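(* Let $R$ be a commutative ring with unity, $G$ a finite group, and let $\mathcal{C}'\subseteq\mathcal{C}$ be two collections of sections of $G$. Let $i:\mathrm{Sect}(G,\mathcal{C}')\to\mathrm{Sect}(G,\mathcal{C})$ be the inclusion of posets and $i_*:\mathcal{D}_G^{\mathcal{C}'}\to\mathcal{D}_G^{\mathcal{C}}$ the induced functor. Suppose that for every $w\in\mathcal{C}$ the poset $w\backslash i=\{w'\in\mathcal{C}' : w\preceq w'\}$ has a contractible realization. Then for every $R\mathcal{D}_G$-module $F$ there is an isomorphism $$\widetilde{H}^*(\mathcal{D}_G^{\mathcal{C}};F)\cong\widetilde{H}^*(\mathcal{D}_G^{\mathcal{C}'};F\circ i_* ).$$ In particular, for a biset functor $F$ for $G$ over $R$, we have $\mathrm{Obs}^{\mathcal{C}}(F(G))\cong\mathrm{Obs}^{\mathcal{C}'}(F(G))$.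
   Context: A section of $G$ is a pair $(U,V)$ with $V\trianglelefteq U\le G$; $(U,V)\preceq(M,L)$ means $L\le V\le U\le M$. A collection is a conjugation-closed set of sections; $\mathrm{Sect}(G,\mathcal{C})$ is $\mathcal{C}$ viewed as a poset under $\preceq$ with conjugation action of $G$. $\mathcal{D}_G^{\mathcal{C}}$ has objects $\mathcal{C}$, morphisms $\mathrm{Hom}((U,V),(M,L))=\{Mg:g\in G,\ {}^g(U,V)\preceq(M,L)\}$, composition $Nh\circ Mg=Nhg$; $\mathcal{D}_G$ uses all sections. An $R\mathcal{D}_G^{\mathcal{C}}$-module is a contravariant functor to $R$-modules; an $R\mathcal{D}_G$-module is restricted to $\mathcal{D}_G^{\mathcal{C}}$ without change of notation. $F(U/V):=F((U,V))$, $F(G):=F((G,1))$; $\mathrm{Defres}^G_{U/V}:F(G)\to F(U/V)$ is induced by $G\cdot1:(U,V)\to(G,1)$. Reduced cohomology: $\widetilde{H}^n(\mathcal{D}_G^{\mathcal{C}};F)=\mathrm{Ext}^n_{R\mathcal{D}_G^{\mathcal{C}}}(\underline{R},F)$ for $n\ge1$ ($\underline{R}$ constant functor); $\widetilde{H}^{-1}$ and $\widetilde{H}^0$ are the kernel and cokernel of $F(G)\to\varprojlim_{(U,V)\in\mathcal{D}_G^{\mathcal{C}}}F(U/V)$, $f\mapsto(\mathrm{Defres}^G_{U/V}f)$ (for $\mathcal{C}'$ and $F\circ i_*$ the source is again $F(G)$). $\mathrm{Obs}^{\mathcal{C}}(F(G))$ denotes this cokernel. A biset functor for $G$ over $R$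 is an $R$-linear functor to $R$-modules from the $R$-biset category (morphisms $H\to K$: $R\otimes B(K,H)$, composition induced by $X\times_HY$) on the quotients $U/V$ indexed by sections of $G$. It is regarded as an $R\mathcal{D}_G$-module by letting $Mg:(U,V)\to(M,L)$ act as restriction from $M/L$ to ${}^gU/L$, deflation to ${}^gU/{}^gV$, then the isomorphism to $U/V$ induced by conjugation by $g^{-1}$. *)

theory Defs
  imports "HOL-Analysis.Analysis" "HOL-Algebra.Module" "HOL-Algebra.AbelCoset"
begin

section \<open>Modules over a commutative ring\<close>

definition lin_map ::
  "('r, 'q) ring_scheme \<Rightarrow> ('r, 'm) module \<Rightarrow> ('r, 'n) module \<Rightarrow> ('m \<Rightarrow> 'n) \<Rightarrow> bool" where
  "lin_map R M N h \<longleftrightarrow>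
     h \<in> carrier M \<rightarrow> carrier N \<and>
     (\<forall>x\<in>carrier M. \<forall>y\<in>carrier M. h (x \<oplus>\<^bsub>M\<^esub> y) = h x \<oplus>\<^bsub>N\<^esub> h y) \<and>
     (\<forall>r\<in>carrier R. \<forall>x\<in>carrier M. h (r \<odot>\<^bsub>M\<^esub> x) = r \<odot>\<^bsub>N\<^esub> h x)"

definition mod_isomorphic ::
  "('r, 'q) ring_scheme \<Rightarrow> ('r, 'm) module \<Rightarrow> ('r, 'n) module \<Rightarrow> bool" where
  "mod_isomorphic R M N \<longleftrightarrow> (\<exists>h. lin_map R M N h \<and> bij_betw h (carrier M) (carrier N))"

text \<open>The record type of modules extends that of rings; the fields \<open>mult\<close> and \<open>one\<close> play no
  role for modules and are filled in arbitrarily below.\<close>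

definition quot_mod :: "('r, 'm) module \<Rightarrow> 'm set \<Rightarrow> ('r, 'm set) module" where
  "quot_mod M N =
     \<lparr>carrier = a_rcosets\<^bsub>M\<^esub> N, mult = (\<lambda>_ _. N), one = N, zero = N,
      add = (\<lambda>A B. A <+>\<^bsub>M\<^esub> B),
      smult = (\<lambda>r A. \<Union>a\<in>A. N +>\<^bsub>M\<^esub> (r \<odot>\<^bsub>M\<^esub> a))\<rparr>"

definition gen_submod :: "('r, 'q) ring_scheme \<Rightarrow> ('r, 'm) module \<Rightarrow> 'm set \<Rightarrow> 'm set" where
  "gen_submod R M A = \<Inter>{N. submodule N R M \<and> A \<subseteq> N}"

definition free_mod :: "('r, 'q) ring_scheme \<Rightarrow> 's set \<Rightarrow> ('r, 's \<Rightarrow> 'r) module" where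
  "free_mod R S =
     \<lparr>carrier = {a. (\<forall>s\<in>S. a s \<in> carrier R) \<and> (\<forall>s. s \<notin> S \<longrightarrow> a s = \<zero>\<^bsub>R\<^esub>) \<and>
                    finite {s. a s \<noteq> \<zero>\<^bsub>R\<^esub>}},
      mult = (\<lambda>_ _ _. \<zero>\<^bsub>R\<^esub>), one = (\<lambda>_. \<zero>\<^bsub>R\<^esub>), zero = (\<lambda>_. \<zero>\<^bsub>R\<^esub>),
      add = (\<lambda>a b s. a s \<oplus>\<^bsub>R\<^esub> b s),
      smult = (\<lambda>r a s. r \<otimes>\<^bsub>R\<^esub> a s)\<rparr>"

definition delta :: "('r, 'q) ring_scheme \<Rightarrow> 's \<Rightarrow> 's \<Rightarrow> 'r" where
  "delta R s = (\<lambda>t. if t = s then \<one>\<^bsub>R\<^esub> else \<zero>\<^bsub>R\<^esub>)"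

section \<open>Categories and functors to modules\<close>

text \<open>\<open>Comp D x y z g f\<close> is the composite of \<open>f \<in> Hom D x y\<close> and \<open>g \<in> Hom D y z\<close>. Hom-sets of
  different pairs of objects may overlap, so a morphism is always used together with its source
  and its target.\<close>

record ('o, 'a) cat =
  Obj :: "'o set"
  Hom :: "'o \<Rightarrow> 'o \<Rightarrow> 'a set"
  Comp :: "'o \<Rightarrow> 'o \<Rightarrow> 'o \<Rightarrow> 'a \<Rightarrow> 'a \<Rightarrow> 'a"
  Idt :: "'o \<Rightarrow> 'a"

text \<open>For \<open>f \<in> Hom D x y\<close>, the map \<open>Act F x y f\<close> goes from \<open>At F y\<close> to \<open>At F x\<close> if \<open>F\<close> is
  contravariant and from \<open>At F x\<close> to \<open>At F y\<close> if \<open>F\<close> is covariant.\<close>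

record ('o, 'a, 'r, 'm) mfunctor =
  At :: "'o \<Rightarrow> ('r, 'm) module"
  Act :: "'o \<Rightarrow> 'o \<Rightarrow> 'a \<Rightarrow> 'm \<Rightarrow> 'm"

definition contra_functor ::
  "('r, 'q) ring_scheme \<Rightarrow> ('o, 'a) cat \<Rightarrow> ('o, 'a, 'r, 'm) mfunctor \<Rightarrow> bool" where
  "contra_functor R D F \<longleftrightarrow>
     (\<forall>x\<in>Obj D. Module.module R (At F x)) \<and>
     (\<forall>x\<in>Obj D. \<forall>y\<in>Obj D. \<forall>f\<in>Hom D x y. lin_map R (At F y) (At F x) (Act F x y f)) \<and>
     (\<forall>x\<in>Obj D. \<forall>m\<in>carrier (At F x). Act F x x (Idt D x) m = m) \<and>
     (\<forall>x\<in>Obj D. \<forall>y\<in>Obj D. \<forall>z\<in>Obj D. \<forall>f\<in>Hom D x y. \<forall>g\<in>Hom D y z. \<forall>m\<in>carrier (At F z).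
        Act F x z (Comp D x y z g f) m = Act F x y f (Act F y z g m))"

definition co_functor ::
  "('r, 'q) ring_scheme \<Rightarrow> ('o, 'a) cat \<Rightarrow> ('o, 'a, 'r, 'm) mfunctor \<Rightarrow> bool" where
  "co_functor R D F \<longleftrightarrow>
     (\<forall>x\<in>Obj D. Module.module R (At F x)) \<and>
     (\<forall>x\<in>Obj D. \<forall>y\<in>Obj D. \<forall>f\<in>Hom D x y. lin_map R (At F x) (At F y) (Act F x y f)) \<and>
     (\<forall>x\<in>Obj D. \<forall>m\<in>carrier (At F x). Act F x x (Idt D x) m = m) \<and>
     (\<forall>x\<in>Obj D. \<forall>y\<in>Obj D. \<forall>z\<in>Obj D. \<forall>f\<in>Hom D x y. \<forall>g\<in>Hom D y z. \<forall>m\<in>carrier (At F x).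
        Act F x z (Comp D x y z g f) m = Act F y z g (Act F x y f m))"

definition const_functor :: "('r, 'q) ring_scheme \<Rightarrow> ('o, 'a, 'r, 'r) mfunctor" where
  "const_functor R =
     \<lparr>At = (\<lambda>_. \<lparr>carrier = carrier R, mult = mult R, one = one R,
                 zero = zero R, add = add R, smult = mult R\<rparr>),
      Act = (\<lambda>_ _ _ m. m)\<rparr>"

text \<open>Natural transformations are extensional (equal to \<open>undefined\<close> off the objects and
  off the carriers), so that equality of functions is equality of natural transformations.\<close>

definition nat_trans ::
  "('r, 'q) ring_scheme \<Rightarrow> ('o, 'a) cat \<Rightarrow> ('o, 'a, 'r, 'm) mfunctor \<Rightarrow>
   ('o, 'a, 'r, 'n) mfunctor \<Rightarrow> ('o \<Rightarrow> 'm \<Rightarrow> 'n) set" where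
  "nat_trans R D P F =
     {\<eta> \<in> (\<Pi>\<^sub>E x\<in>Obj D. carrier (At P x) \<rightarrow>\<^sub>E carrier (At F x)).
        (\<forall>x\<in>Obj D. lin_map R (At P x) (At F x) (\<eta> x)) \<and>
        (\<forall>x\<in>Obj D. \<forall>y\<in>Obj D. \<forall>f\<in>Hom D x y. \<forall>p\<in>carrier (At P y).
           \<eta> x (Act P x y f p) = Act F x y f (\<eta> y p))}"

definition nat_mod ::
  "('r, 'q) ring_scheme \<Rightarrow> ('o, 'a) cat \<Rightarrow> ('o, 'a, 'r, 'm) mfunctor \<Rightarrow>
   ('o, 'a, 'r, 'n) mfunctor \<Rightarrow> ('r, 'o \<Rightarrow> 'm \<Rightarrow> 'n) module" where
  "nat_mod R D P F =
     (let z = (\<lambda>x\<in>Obj D. \<lambda>p\<in>carrier (At P x). \<zero>\<^bsub>At F x\<^esub>) in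
      \<lparr>carrier = nat_trans R D P F, mult = (\<lambda>_ _. z), one = z, zero = z,
       add = (\<lambda>\<eta> \<theta>. \<lambda>x\<in>Obj D. \<lambda>p\<in>carrier (At P x). \<eta> x p \<oplus>\<^bsub>At F x\<^esub> \<theta> x p),
       smult = (\<lambda>r \<eta>. \<lambda>x\<in>Obj D. \<lambda>p\<in>carrier (At P x). r \<odot>\<^bsub>At F x\<^esub> \<eta> x p)\<rparr>)"

definition nat_comp ::
  "('o, 'a) cat \<Rightarrow> ('o, 'a, 'r, 'm) mfunctor \<Rightarrow> ('o \<Rightarrow> 'n \<Rightarrow> 'k) \<Rightarrow> ('o \<Rightarrow> 'm \<Rightarrow> 'n) \<Rightarrow>
   'o \<Rightarrow> 'm \<Rightarrow> 'k" where
  "nat_comp D P \<eta> \<theta> = (\<lambda>x\<in>Obj D. \<lambda>p\<in>carrier (At P x). \<eta> x (\<theta> x p))"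

definition lim_mod ::
  "('o, 'a) cat \<Rightarrow> ('o, 'a, 'r, 'm) mfunctor \<Rightarrow> ('r, 'o \<Rightarrow> 'm) module" where
  "lim_mod D F =
     (let z = (\<lambda>x\<in>Obj D. \<zero>\<^bsub>At F x\<^esub>) in
      \<lparr>carrier = {s \<in> (\<Pi>\<^sub>E x\<in>Obj D. carrier (At F x)).
                   \<forall>x\<in>Obj D. \<forall>y\<in>Obj D. \<forall>f\<in>Hom D x y. Act F x y f (s y) = s x},
       mult = (\<lambda>_ _. z), one = z, zero = z,
       add = (\<lambda>s t. \<lambda>x\<in>Obj D. s x \<oplus>\<^bsub>At F x\<^esub> t x),
       smult = (\<lambda>r s. \<lambda>x\<in>Obj D. r \<odot>\<^bsub>At F x\<^esub> s x)\<rparr>)"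

section \<open>Ext groups\<close>

text \<open>Lifting property against epimorphisms (pointwise surjections) \<open>q : A \<rightarrow> B\<close>. In HOL the
  types of the test objects have to be fixed. The types chosen here lose nothing: a free
  cover of \<open>P\<close> (a direct sum of representable functors with one basis element for each element
  of each \<open>At P y\<close>) consists of finitely supported functions on triples
  \<open>(y, f \<in> Hom D x y, p \<in> At P y)\<close>, so it is among the \<open>A\<close>, and \<open>P\<close> is among the \<open>B\<close>.\<close>

definition projective ::
  "('r, 'q) ring_scheme \<Rightarrow> ('o, 'a) cat \<Rightarrow> ('o, 'a, 'r, 'p) mfunctor \<Rightarrow> bool" where
  "projective R D P \<longleftrightarrow>
     contra_functor R D P \<and>
     (\<forall>(A :: ('o, 'a, 'r, 'o \<times> 'a \<times> 'p \<Rightarrow> 'r) mfunctor) (B :: ('o, 'a, 'r, 'p) mfunctor).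
        contra_functor R D A \<and> contra_functor R D B \<longrightarrow>
        (\<forall>q\<in>nat_trans R D A B. \<forall>f\<in>nat_trans R D P B.
           (\<forall>x\<in>Obj D. q x ` carrier (At A x) = carrier (At B x)) \<longrightarrow>
           (\<exists>h\<in>nat_trans R D P A. nat_comp D P q h = f)))"

definition projective_resolution ::
  "('r, 'q) ring_scheme \<Rightarrow> ('o, 'a) cat \<Rightarrow> ('o, 'a, 'r, 'm) mfunctor \<Rightarrow>
   (nat \<Rightarrow> ('o, 'a, 'r, 'p) mfunctor) \<Rightarrow> (nat \<Rightarrow> 'o \<Rightarrow> 'p \<Rightarrow> 'p) \<Rightarrow> ('o \<Rightarrow> 'p \<Rightarrow> 'm) \<Rightarrow> bool" where
  "projective_resolution R D M P d e \<longleftrightarrow>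
     (\<forall>n. projective R D (P n)) \<and>
     (\<forall>n. d n \<in> nat_trans R D (P (Suc n)) (P n)) \<and>
     e \<in> nat_trans R D (P 0) M \<and>
     (\<forall>x\<in>Obj D. e x ` carrier (At (P 0) x) = carrier (At M x)) \<and>
     (\<forall>x\<in>Obj D. d 0 x ` carrier (At (P 1) x) =
                  {p \<in> carrier (At (P 0) x). e x p = \<zero>\<^bsub>At M x\<^esub>}) \<and>
     (\<forall>n. \<forall>x\<in>Obj D. d (Suc n) x ` carrier (At (P (Suc (Suc n))) x) =
                  {p \<in> carrier (At (P (Suc n)) x). d n x p = \<zero>\<^bsub>At (P n) x\<^esub>})"

text \<open>\<open>H\<^sup>n\<close> of the cochain complex \<open>Hom(P\<^sub>0, F) \<rightarrow> Hom(P\<^sub>1, F) \<rightarrow> \<dots>\<close>\<close>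

definition cohomology_of_resolution ::
  "('r, 'q) ring_scheme \<Rightarrow> ('o, 'a) cat \<Rightarrow> (nat \<Rightarrow> ('o, 'a, 'r, 'p) mfunctor) \<Rightarrow>
   (nat \<Rightarrow> 'o \<Rightarrow> 'p \<Rightarrow> 'p) \<Rightarrow> nat \<Rightarrow> ('o, 'a, 'r, 'm) mfunctor \<Rightarrow>
   ('r, ('o \<Rightarrow> 'p \<Rightarrow> 'm) set) module" where
  "cohomology_of_resolution R D P d n F =
     (let cobd = (\<lambda>k \<eta>. nat_comp D (P (Suc k)) \<eta> (d k));
          Z = {\<eta> \<in> nat_trans R D (P n) F. cobd n \<eta> = \<zero>\<^bsub>nat_mod R D (P (Suc n)) F\<^esub>};
          B = (case n of 0 \<Rightarrow> {\<zero>\<^bsub>nat_mod R D (P 0) F\<^esub>}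
                       | Suc k \<Rightarrow> cobd k ` nat_trans R D (P k) F)
      in quot_mod ((nat_mod R D (P n) F)\<lparr>carrier := Z\<rparr>) B)"

text \<open>\<open>Ext\<^sup>n(M, F)\<close> is computed by an arbitrary but fixed projective resolution \<open>P\<close> of \<open>M\<close>; up to
  isomorphism it does not matter which one. The carrier type of \<open>P\<close> is large enough: it contains
  the indicator functions of lists, and there are at least as many lists as elements in each
  term of the standard free resolution of \<open>M\<close> (over the zero ring all modules are trivial). If \<open>M\<close>
  is the constant functor, then the bar resolution, whose basis elements are chains of
  morphisms, fits directly.\<close>

definition Ext ::
  "('r, 'q) ring_scheme \<Rightarrow> ('o, 'a) cat \<Rightarrow> nat \<Rightarrow> ('o, 'a, 'r, 'k) mfunctor \<Rightarrow>
   ('o, 'a, 'r, 'm) mfunctor \<Rightarrow> ('r, ('o \<Rightarrow> (('o \<times> 'a \<times> 'k \<times> 'r) list \<Rightarrow> 'r) \<Rightarrow> 'm) set) module" where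
  "Ext R D n M F =
     (let (P, d) = (SOME (P, d). \<exists>e. projective_resolution R D M P d e)
      in cohomology_of_resolution R D P d n F)"

section \<open>Sections of a group\<close>

type_synonym 'g sect = "'g set \<times> 'g set"

definition sections :: "('g, 'h) monoid_scheme \<Rightarrow> 'g sect set" where
  "sections G = {(U, V). subgroup U G \<and> V \<lhd> (G\<lparr>carrier := U\<rparr>)}"

definition sect_le :: "'g sect \<Rightarrow> 'g sect \<Rightarrow> bool" where
  "sect_le s t \<longleftrightarrow> snd t \<subseteq> snd s \<and> snd s \<subseteq> fst s \<and> fst s \<subseteq> fst t"

definition conj_set :: "('g, 'h) monoid_scheme \<Rightarrow> 'g \<Rightarrow> 'g set \<Rightarrow> 'g set" where
  "conj_set G g A = (\<lambda>a. g \<otimes>\<^bsub>G\<^esub> a \<otimes>\<^bsub>G\<^esub> inv\<^bsub>G\<^esub> g) ` A"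

definition conj_sect :: "('g, 'h) monoid_scheme \<Rightarrow> 'g \<Rightarrow> 'g sect \<Rightarrow> 'g sect" where
  "conj_sect G g s = (conj_set G g (fst s), conj_set G g (snd s))"

definition collection :: "('g, 'h) monoid_scheme \<Rightarrow> 'g sect set \<Rightarrow> bool" where
  "collection G C \<longleftrightarrow>
     C \<subseteq> sections G \<and> (\<forall>g\<in>carrier G. \<forall>s\<in>C. conj_sect G g s \<in> C)"

text \<open>If \<open>Mg : (U,V) \<rightarrow> (M,L)\<close> and \<open>Nh : (M,L) \<rightarrow> (N,K)\<close>, then \<open>hMh\<inverse> \<subseteq> N\<close>, so the composite \<open>Nhg\<close>
  is the product of the sets \<open>Nh\<close> and \<open>Mg\<close>.\<close>

definition sect_cat :: "('g, 'h) monoid_scheme \<Rightarrow> 'g sect set \<Rightarrow> ('g sect, 'g set) cat" where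
  "sect_cat G C =
     \<lparr>Obj = C,
      Hom = (\<lambda>s t. {fst t #>\<^bsub>G\<^esub> g | g. g \<in> carrier G \<and> sect_le (conj_sect G g s) t}),
      Comp = (\<lambda>_ _ _ b a. b <#>\<^bsub>G\<^esub> a),
      Idt = (\<lambda>s. fst s)\<rparr>"

section \<open>Reduced cohomology\<close>

abbreviation top_sect :: "('g, 'h) monoid_scheme \<Rightarrow> 'g sect" where
  "top_sect G \<equiv> (carrier G, {\<one>\<^bsub>G\<^esub>})"

definition Defres ::
  "('g, 'h) monoid_scheme \<Rightarrow> ('g sect, 'g set, 'r, 'm) mfunctor \<Rightarrow> 'g sect \<Rightarrow> 'm \<Rightarrow> 'm" where
  "Defres G F s = Act F s (top_sect G) (carrier G #>\<^bsub>G\<^esub> \<one>\<^bsub>G\<^esub>)"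

definition to_lim ::
  "('g, 'h) monoid_scheme \<Rightarrow> 'g sect set \<Rightarrow> ('g sect, 'g set, 'r, 'm) mfunctor \<Rightarrow>
   'm \<Rightarrow> 'g sect \<Rightarrow> 'm" where
  "to_lim G C F m = (\<lambda>s\<in>C. Defres G F s m)"

text \<open>In the following definitions \<open>F\<close> is an \<open>RD\<^sub>G\<close>-module. Since \<open>sect_cat G C\<close> is a full
  subcategory of \<open>sect_cat G (sections G)\<close>, its restriction to \<open>sect_cat G C\<close> is given by the same
  record; likewise \<open>F \<circ> i\<^sub>*\<close> for the inclusion functor \<open>i\<^sub>*\<close> of a smaller collection, which is the
  identity on objects and on morphisms.\<close>

definition red_cohom_neg1 ::
  "('g, 'h) monoid_scheme \<Rightarrow> 'g sect set \<Rightarrow> ('g sect, 'g set, 'r, 'm) mfunctor \<Rightarrow>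
   ('r, 'm) module" where
  "red_cohom_neg1 G C F =
     (At F (top_sect G))\<lparr>carrier := {m \<in> carrier (At F (top_sect G)).
        to_lim G C F m = \<zero>\<^bsub>lim_mod (sect_cat G C) F\<^esub>}\<rparr>"

definition Obs ::
  "('g, 'h) monoid_scheme \<Rightarrow> 'g sect set \<Rightarrow> ('g sect, 'g set, 'r, 'm) mfunctor \<Rightarrow>
   ('r, ('g sect \<Rightarrow> 'm) set) module" where
  "Obs G C F =
     quot_mod (lim_mod (sect_cat G C) F) (to_lim G C F ` carrier (At F (top_sect G)))"

abbreviation red_cohom_0 ::
  "('g, 'h) monoid_scheme \<Rightarrow> 'g sect set \<Rightarrow> ('g sect, 'g set, 'r, 'm) mfunctor \<Rightarrow>
   ('r, ('g sect \<Rightarrow> 'm) set) module" where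
  "red_cohom_0 \<equiv> Obs"

text \<open>This is the reduced cohomology in degrees \<open>n \<ge> 1\<close> only.\<close>

definition red_cohom_pos ::
  "('r, 'q) ring_scheme \<Rightarrow> ('g, 'h) monoid_scheme \<Rightarrow> 'g sect set \<Rightarrow> nat \<Rightarrow>
   ('g sect, 'g set, 'r, 'm) mfunctor \<Rightarrow>
   ('r, ('g sect \<Rightarrow> (('g sect \<times> 'g set \<times> 'r \<times> 'r) list \<Rightarrow> 'r) \<Rightarrow> 'm) set) module" where
  "red_cohom_pos R G C n F = Ext R (sect_cat G C) n (const_functor R) F"

section \<open>Realization of a finite poset\<close>

text \<open>Barycentric coordinates on the order complex. For finite \<open>X\<close> the subspace topology of the
  product topology is the topology of the realization. The library counts the empty space as
  contractible, hence the extra conjunct in \<open>contractible_realization\<close>.\<close>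

definition realization :: "'x set \<Rightarrow> ('x \<Rightarrow> 'x \<Rightarrow> bool) \<Rightarrow> ('x \<Rightarrow> real) topology" where
  "realization X leq =
     subtopology (powertop_real X)
       {t \<in> X \<rightarrow>\<^sub>E {0..}. (\<Sum>x\<in>X. t x) = 1 \<and>
          (\<forall>x\<in>X. \<forall>y\<in>X. t x > 0 \<and> t y > 0 \<longrightarrow> leq x y \<or> leq y x)}"

definition contractible_realization :: "'x set \<Rightarrow> ('x \<Rightarrow> 'x \<Rightarrow> bool) \<Rightarrow> bool" where
  "contractible_realization X leq \<longleftrightarrow>
     topspace (realization X leq) \<noteq> {} \<and> contractible_space (realization X leq)"

section \<open>Bisets and the biset category\<close>

record ('k, 'h, 'x) biset =
  pts :: "'x set"
  lact :: "'k \<Rightarrow> 'x \<Rightarrow> 'x"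
  ract :: "'x \<Rightarrow> 'h \<Rightarrow> 'x"

definition is_biset :: "'k monoid \<Rightarrow> 'h monoid \<Rightarrow> ('k, 'h, 'x) biset \<Rightarrow> bool" where
  "is_biset K H X \<longleftrightarrow>
     finite (pts X) \<and>
     (\<forall>k\<in>carrier K. \<forall>x\<in>pts X. lact X k x \<in> pts X) \<and>
     (\<forall>x\<in>pts X. lact X \<one>\<^bsub>K\<^esub> x = x) \<and>
     (\<forall>k\<in>carrier K. \<forall>l\<in>carrier K. \<forall>x\<in>pts X. lact X (k \<otimes>\<^bsub>K\<^esub> l) x = lact X k (lact X l x)) \<and>
     (\<forall>h\<in>carrier H. \<forall>x\<in>pts X. ract X x h \<in> pts X) \<and>
     (\<forall>x\<in>pts X. ract X x \<one>\<^bsub>H\<^esub> = x) \<and>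
     (\<forall>h\<in>carrier H. \<forall>l\<in>carrier H. \<forall>x\<in>pts X. ract X x (h \<otimes>\<^bsub>H\<^esub> l) = ract X (ract X x h) l) \<and>
     (\<forall>k\<in>carrier K. \<forall>h\<in>carrier H. \<forall>x\<in>pts X. ract X (lact X k x) h = lact X k (ract X x h))"

definition biset_iso ::
  "'k monoid \<Rightarrow> 'h monoid \<Rightarrow> ('k, 'h, 'x) biset \<Rightarrow> ('k, 'h, 'y) biset \<Rightarrow> bool" where
  "biset_iso K H X Y \<longleftrightarrow>
     (\<exists>\<phi>. bij_betw \<phi> (pts X) (pts Y) \<and>
        (\<forall>k\<in>carrier K. \<forall>x\<in>pts X. \<phi> (lact X k x) = lact Y k (\<phi> x)) \<and>
        (\<forall>h\<in>carrier H. \<forall>x\<in>pts X. \<phi> (ract X x h) = ract Y (\<phi> x) h))"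

definition biset_sum ::
  "('k, 'h, 'x) biset \<Rightarrow> ('k, 'h, 'y) biset \<Rightarrow> ('k, 'h, 'x + 'y) biset" where
  "biset_sum X Y =
     \<lparr>pts = pts X <+> pts Y,
      lact = (\<lambda>k. map_sum (lact X k) (lact Y k)),
      ract = (\<lambda>p h. map_sum (\<lambda>x. ract X x h) (\<lambda>y. ract Y y h) p)\<rparr>"

text \<open>\<open>X \<times>\<^sub>H Y\<close>: the pairs in \<open>X \<times> Y\<close> modulo \<open>(xh, y) \<sim> (x, hy)\<close>\<close>

definition biset_prod ::
  "'h monoid \<Rightarrow> ('k, 'h, 'x) biset \<Rightarrow> ('h, 'l, 'y) biset \<Rightarrow> ('k, 'l, ('x \<times> 'y) set) biset" where
  "biset_prod H X Y =
     \<lparr>pts = (pts X \<times> pts Y) //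
         {((ract X x h, y), (x, lact Y h y)) | x y h. x \<in> pts X \<and> y \<in> pts Y \<and> h \<in> carrier H},
      lact = (\<lambda>k. image (\<lambda>(x, y). (lact X k x, y))),
      ract = (\<lambda>c l. (\<lambda>(x, y). (x, ract Y y l)) ` c)\<rparr>"

text \<open>Every finite biset is isomorphic to one whose underlying set consists of natural numbers, so
  these bisets suffice to form the Burnside group.\<close>

definition bisets :: "'k monoid \<Rightarrow> 'h monoid \<Rightarrow> ('k, 'h, nat) biset set" where
  "bisets K H = {X. is_biset K H X}"

definition nat_copy :: "'k monoid \<Rightarrow> 'h monoid \<Rightarrow> ('k, 'h, 'x) biset \<Rightarrow> ('k, 'h, nat) biset" where
  "nat_copy K H X = (SOME Y. Y \<in> bisets K H \<and> biset_iso K H X Y)"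

text \<open>\<open>R \<otimes> B(K,H)\<close> is the free \<open>R\<close>-module on the finite \<open>(K,H)\<close>-bisets modulo \<open>[X] = [Y]\<close> for
  \<open>X \<cong> Y\<close> and \<open>[Z] = [X] + [Y]\<close> for \<open>Z \<cong> X \<squnion> Y\<close>.\<close>

definition burnside_rels ::
  "('r, 'q) ring_scheme \<Rightarrow> 'k monoid \<Rightarrow> 'h monoid \<Rightarrow> (('k, 'h, nat) biset \<Rightarrow> 'r) set" where
  "burnside_rels R K H =
     (let M = free_mod R (bisets K H) in
      gen_submod R M
        ({delta R X \<ominus>\<^bsub>M\<^esub> delta R Y | X Y.
            X \<in> bisets K H \<and> Y \<in> bisets K H \<and> biset_iso K H X Y} \<union>
         {delta R Z \<ominus>\<^bsub>M\<^esub> (delta R X \<oplus>\<^bsub>M\<^esub> delta R Y) | X Y Z.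
            X \<in> bisets K H \<and> Y \<in> bisets K H \<and> Z \<in> bisets K H \<and>
            biset_iso K H Z (biset_sum X Y)}))"

definition burnside_mod ::
  "('r, 'q) ring_scheme \<Rightarrow> 'k monoid \<Rightarrow> 'h monoid \<Rightarrow>
   ('r, (('k, 'h, nat) biset \<Rightarrow> 'r) set) module" where
  "burnside_mod R K H = quot_mod (free_mod R (bisets K H)) (burnside_rels R K H)"

definition burnside_class ::
  "('r, 'q) ring_scheme \<Rightarrow> 'k monoid \<Rightarrow> 'h monoid \<Rightarrow> ('k, 'h, 'x) biset \<Rightarrow>
   (('k, 'h, nat) biset \<Rightarrow> 'r) set" where
  "burnside_class R K H X =
     burnside_rels R K H +>\<^bsub>free_mod R (bisets K H)\<^esub> delta R (nat_copy K H X)"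

text \<open>Bilinear extension of \<open>(X, Y) \<mapsto> X \<times>\<^sub>H Y\<close>, first to formal linear combinations and then to
  cosets. The union below is over representatives of the cosets; all of them give the same
  coset.\<close>

definition burnside_comp_rep ::
  "('r, 'q) ring_scheme \<Rightarrow> 'k monoid \<Rightarrow> 'h monoid \<Rightarrow> 'l monoid \<Rightarrow>
   (('k, 'h, nat) biset \<Rightarrow> 'r) \<Rightarrow> (('h, 'l, nat) biset \<Rightarrow> 'r) \<Rightarrow> ('k, 'l, nat) biset \<Rightarrow> 'r" where
  "burnside_comp_rep R K H L a b =
     (let M = free_mod R (bisets K L) in
      \<Oplus>\<^bsub>M\<^esub>p \<in> {X. a X \<noteq> \<zero>\<^bsub>R\<^esub>} \<times> {Y. b Y \<noteq> \<zero>\<^bsub>R\<^esub>}.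
        (a (fst p) \<otimes>\<^bsub>R\<^esub> b (snd p)) \<odot>\<^bsub>M\<^esub>
          delta R (nat_copy K L (biset_prod H (fst p) (snd p))))"

definition burnside_comp ::
  "('r, 'q) ring_scheme \<Rightarrow> 'k monoid \<Rightarrow> 'h monoid \<Rightarrow> 'l monoid \<Rightarrow>
   (('k, 'h, nat) biset \<Rightarrow> 'r) set \<Rightarrow> (('h, 'l, nat) biset \<Rightarrow> 'r) set \<Rightarrow>
   (('k, 'l, nat) biset \<Rightarrow> 'r) set" where
  "burnside_comp R K H L A B =
     (\<Union>a\<in>A. \<Union>b\<in>B.
        burnside_rels R K L +>\<^bsub>free_mod R (bisets K L)\<^esub> burnside_comp_rep R K H L a b)"

definition sect_quot :: "('g, 'h) monoid_scheme \<Rightarrow> 'g sect \<Rightarrow> 'g set monoid" where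
  "sect_quot G s = (G\<lparr>carrier := fst s\<rparr>) Mod (snd s)"

definition regular_biset :: "'k monoid \<Rightarrow> ('k, 'k, 'k) biset" where
  "regular_biset K = \<lparr>pts = carrier K, lact = (\<lambda>k x. k \<otimes>\<^bsub>K\<^esub> x), ract = (\<lambda>x k. x \<otimes>\<^bsub>K\<^esub> k)\<rparr>"

type_synonym ('g, 'r) burnside_elt = "(('g set, 'g set, nat) biset \<Rightarrow> 'r) set"

definition biset_cat ::
  "('r, 'q) ring_scheme \<Rightarrow> ('g, 'h) monoid_scheme \<Rightarrow> ('g sect, ('g, 'r) burnside_elt) cat" where
  "biset_cat R G =
     \<lparr>Obj = sections G,
      Hom = (\<lambda>s t. carrier (burnside_mod R (sect_quot G t) (sect_quot G s))),
      Comp = (\<lambda>s t u b a. burnside_comp R (sect_quot G u) (sect_quot G t) (sect_quot G s) b a),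
      Idt = (\<lambda>s. burnside_class R (sect_quot G s) (sect_quot G s) (regular_biset (sect_quot G s)))\<rparr>"

definition biset_functor ::
  "('r, 'q) ring_scheme \<Rightarrow> ('g, 'h) monoid_scheme \<Rightarrow>
   ('g sect, ('g, 'r) burnside_elt, 'r, 'm) mfunctor \<Rightarrow> bool" where
  "biset_functor R G F \<longleftrightarrow>
     co_functor R (biset_cat R G) F \<and>
     (\<forall>s\<in>sections G. \<forall>t\<in>sections G.
        let M = burnside_mod R (sect_quot G t) (sect_quot G s) in
        \<forall>m\<in>carrier (At F s). \<forall>a\<in>carrier M.
          (\<forall>b\<in>carrier M. Act F s t (a \<oplus>\<^bsub>M\<^esub> b) m = Act F s t a m \<oplus>\<^bsub>At F t\<^esub> Act F s t b m) \<and>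
          (\<forall>r\<in>carrier R. Act F s t (r \<odot>\<^bsub>M\<^esub> a) m = r \<odot>\<^bsub>At F t\<^esub> Act F s t a m))"

text \<open>Restriction from \<open>M/L\<close> to \<open>W/L\<close> for \<open>W \<le> M\<close> is the \<open>(W/L, M/L)\<close>-biset \<open>M/L\<close>.\<close>

definition res_biset ::
  "('g, 'h) monoid_scheme \<Rightarrow> 'g sect \<Rightarrow> ('g set, 'g set, 'g set) biset" where
  "res_biset G t = regular_biset (sect_quot G t)"

text \<open>Deflation from \<open>W/L\<close> to \<open>W/Z\<close>, where \<open>s = (W,Z)\<close> and \<open>L \<le> Z\<close>, is the \<open>(W/Z, W/L)\<close>-biset
  \<open>W/Z\<close>, on which \<open>W/L\<close> acts through \<open>Zx \<cdot> Ly = Zxy\<close>, the product of sets.\<close>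

definition def_biset ::
  "('g, 'h) monoid_scheme \<Rightarrow> 'g sect \<Rightarrow> ('g set, 'g set, 'g set) biset" where
  "def_biset G s =
     \<lparr>pts = carrier (sect_quot G s),
      lact = (\<lambda>k x. k \<otimes>\<^bsub>sect_quot G s\<^esub> x),
      ract = (\<lambda>x h. x <#>\<^bsub>G\<^esub> h)\<rparr>"

text \<open>The isomorphism to \<open>s = (U,V)\<close> from its conjugate by \<open>g\<close> that is induced by conjugation by
  \<open>g\<inverse>\<close>, as a biset with underlying set \<open>U/V\<close>\<close>

definition conj_biset ::
  "('g, 'h) monoid_scheme \<Rightarrow> 'g \<Rightarrow> 'g sect \<Rightarrow> ('g set, 'g set, 'g set) biset" where
  "conj_biset G g s =
     \<lparr>pts = carrier (sect_quot G s),
      lact = (\<lambda>k x. k \<otimes>\<^bsub>sect_quot G s\<^esub> x),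
      ract = (\<lambda>x h. x \<otimes>\<^bsub>sect_quot G s\<^esub> conj_set G (inv\<^bsub>G\<^esub> g) h)\<rparr>"

definition act_biset ::
  "('r, 'q) ring_scheme \<Rightarrow> ('g, 'h) monoid_scheme \<Rightarrow>
   ('g sect, ('g, 'r) burnside_elt, 'r, 'm) mfunctor \<Rightarrow> 'g sect \<Rightarrow> 'g sect \<Rightarrow>
   ('g set, 'g set, 'g set) biset \<Rightarrow> 'm \<Rightarrow> 'm" where
  "act_biset R G F s t X = Act F s t (burnside_class R (sect_quot G t) (sect_quot G s) X)"

text \<open>The result does not depend on the representative \<open>g\<close> of the coset \<open>c = Mg\<close>.\<close>

definition biset_to_DG ::
  "('r, 'q) ring_scheme \<Rightarrow> ('g, 'h) monoid_scheme \<Rightarrow>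
   ('g sect, ('g, 'r) burnside_elt, 'r, 'm) mfunctor \<Rightarrow> ('g sect, 'g set, 'r, 'm) mfunctor" where
  "biset_to_DG R G F =
     \<lparr>At = At F,
      Act = (\<lambda>s t c m.
        let g = (SOME g. g \<in> c);
            s' = conj_sect G g s;
            r = (fst s', snd t)
        in act_biset R G F s' s (conj_biset G g s)
             (act_biset R G F r s' (def_biset G s')
               (act_biset R G F t r (res_biset G t) m)))\<rparr>"

end

theory Submission
  imports Defs "HOL-Library.Poly_Mapping"
begin

text \<open>The idea is to compute the positive cohomology of both categories from one and the same complex.

Let \<open>x\<close> be a section. Call a morphism \<open>Mg : x \<rightarrow> t\<close> with \<open>t \<in> C'\<close> a vertex over \<open>x\<close>. It lies over
the section \<open>g\<inverse>tg\<close>, which is above \<open>x\<close>, and vertices are compared through these sections. Let \<open>Q n x\<close>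
be the free module on the lists of \<open>n + 1\<close> pairwise comparable vertices over \<open>x\<close>. Composition of
morphisms makes \<open>Q n\<close> a contravariant functor, and deletion of entries makes \<open>Q\<close> a complex.

\<^item> \<open>Q n\<close> is a direct sum of representable functors. Every list has a first minimal entry
  \<open>Mg : x \<rightarrow> c\<close>, and it arises in exactly one way from a list over \<open>c\<close> whose first minimal entry is
  the identity, namely by composition with \<open>Mg\<close> (\<open>flag_presheaf_basis\<close>). All the representing
  objects \<open>c\<close> lie in \<open>C'\<close>. So \<open>Q n\<close> is projective over the category of \<open>C\<close> and over that of \<open>C'\<close>,
  and a transformation from \<open>Q n\<close> to \<open>F\<close> is the same thing over both: restriction identifies the
  two cochain complexes (\<open>cohomology_free_restrict\<close>).

\<^item> \<open>Q\<close> is a resolution of the constant functor. Up to repetition of equivalent vertices, \<open>Q\<close> at \<open>x\<close>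
  is the complex of the order complex of \<open>{w \<in> C'. x \<preceq> w}\<close>, which is exact for contractible
  realizations (\<open>contractible_realization_acyclic\<close>). This is proved without singular homology: a
  cycle is moved to lists of nearby points of the realization, contracted there along the homotopy
  in small steps, and brought back by sending a point to a vertex at which its coordinate is large.

Any two projective resolutions have the same cohomology (\<open>cohomology_of_resolution_independent\<close>), so
\<open>Q\<close> computes \<open>Ext\<close> in both categories. In degrees \<open>0\<close> and \<open>-1\<close> it suffices that
\<open>{w \<in> C'. x \<preceq> w}\<close> is nonempty and connected: then compatible families on \<open>C'\<close> extend uniquely to \<open>C\<close>
(\<open>lim_extend\<close>, \<open>lim_determined\<close>).

For a biset functor the only question is whether it is a module over the category of sections. The
composite of restriction, deflation and conjugation attached to \<open>Mg : (U,V) \<rightarrow> (M,L)\<close> is the biset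
\<open>gVg\<inverse> \ M\<close>, and the product of two such bisets is the biset of the composite morphism
(\<open>morphism_biset_prod\<close>); hence functoriality (\<open>biset_to_DG_functor\<close>).\<close>

section \<open>Chains of lists\<close>

abbreviation supp :: "('a \<Rightarrow>\<^sub>0 int) \<Rightarrow> 'a set" where
  "supp \<equiv> Poly_Mapping.keys"

text \<open>Chains have integer coefficients and lists of points as basis. A list of length \<open>n + 1\<close> is an ordered
simplex of dimension \<open>n\<close>, with repetitions allowed, and the empty list is the simplex of dimension
\<open>-1\<close>: all complexes are augmented. Prepending a point is the cone construction.\<close>

definition prepend :: "'a \<Rightarrow> ('a list \<Rightarrow>\<^sub>0 int) \<Rightarrow> ('a list \<Rightarrow>\<^sub>0 int)" where
  "prepend x = frag_extend (\<lambda>ys. frag_of (x # ys))"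

text \<open>The alternating sum of the lists with one entry deleted.\<close>

fun bd :: "'a list \<Rightarrow> ('a list \<Rightarrow>\<^sub>0 int)" where
  "bd [] = 0"
| "bd (x # xs) = frag_of xs - prepend x (bd xs)"

definition bdry :: "('a list \<Rightarrow>\<^sub>0 int) \<Rightarrow> ('a list \<Rightarrow>\<^sub>0 int)" where
  "bdry = frag_extend bd"

definition push :: "('a \<Rightarrow> 'b) \<Rightarrow> ('a list \<Rightarrow>\<^sub>0 int) \<Rightarrow> ('b list \<Rightarrow>\<^sub>0 int)" where
  "push f = frag_extend (\<lambda>xs. frag_of (map f xs))"

lemma frag_map_simps [simp]:
  "prepend x 0 = 0" "prepend x (frag_of ys) = frag_of (x # ys)"
  "prepend x (a - b) = prepend x a - prepend x b" "prepend x (a + b) = prepend x a + prepend x b"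
  "bdry 0 = 0" "bdry (frag_of xs) = bd xs"
  "bdry (a - b) = bdry a - bdry b" "bdry (a + b) = bdry a + bdry b"
  "push f 0 = 0" "push f (frag_of xs) = frag_of (map f xs)"
  "push f (a - b) = push f a - push f b" "push f (a + b) = push f a + push f b"
  by (simp_all add: prepend_def bdry_def push_def frag_extend_diff frag_extend_add)

lemma frag_additive_eqI:
  assumes "\<And>a b. f (a - b) = f a - f b" "\<And>a b. g (a - b) = g a - g b"
    and "\<And>x. x \<in> supp c \<Longrightarrow> f (frag_of x) = g (frag_of x)"
  shows "f c = (g c :: 'b \<Rightarrow>\<^sub>0 int)"
proof -
  have 0: "f 0 = 0" "g 0 = 0"
    using assms(1)[of 0 0] assms(2)[of 0 0] by simp_all
  show ?thesis
    by (rule frag_induction[OF subset_refl[of "supp c"]]) (simp_all add: assms 0)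
qed

lemma bdry_prepend: "bdry (prepend x c) = c - prepend x (bdry c)"
  by (rule frag_additive_eqI[of "\<lambda>c. bdry (prepend x c)"]) (auto simp: algebra_simps)

lemma bdry_bd [simp]: "bdry (bd xs) = 0"
  by (induction xs) (simp_all add: bdry_prepend)

lemma bdry_bdry [simp]: "bdry (bdry c) = 0"
  by (rule frag_additive_eqI[of "\<lambda>c. bdry (bdry c)" "\<lambda>_. 0"]) auto

lemma push_prepend: "push f (prepend x c) = prepend (f x) (push f c)"
  by (rule frag_additive_eqI[of "\<lambda>c. push f (prepend x c)"]) auto

lemma push_bd: "push f (bd xs) = bd (map f xs)"
  by (induction xs) (simp_all add: push_prepend)

lemma push_bdry: "push f (bdry c) = bdry (push f c)"
  by (rule frag_additive_eqI[of "\<lambda>c. push f (bdry c)"]) (auto simp: push_bd)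

lemma push_push: "push f (push g c) = push (f \<circ> g) c"
  by (rule frag_additive_eqI[of "\<lambda>c. push f (push g c)"]) (auto simp: comp_def)

lemma push_ident:
  assumes "\<And>xs x. xs \<in> supp c \<Longrightarrow> x \<in> set xs \<Longrightarrow> f x = x"
  shows "push f c = c"
  by (rule frag_additive_eqI[of "push f" "\<lambda>c. c"]) (use assms in \<open>auto intro!: arg_cong[where f = frag_of] map_idI\<close>)

lemma keys_frag_extend_subset:
  assumes "supp c \<subseteq> S" "\<And>x. x \<in> S \<Longrightarrow> supp (f x) \<subseteq> T"
  shows "supp (frag_extend f c) \<subseteq> T"
  using keys_frag_extend[of f c] assms by blast

lemma keys_diff_subset:
  "supp a \<subseteq> S \<Longrightarrow> supp b \<subseteq> S \<Longrightarrow> supp (a - b :: 'a \<Rightarrow>\<^sub>0 int) \<subseteq> S"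
  using keys_diff[of a b] by blast

lemma keys_add_subset:
  "supp a \<subseteq> S \<Longrightarrow> supp b \<subseteq> S \<Longrightarrow> supp (a + b :: 'a \<Rightarrow>\<^sub>0 int) \<subseteq> S"
  using Poly_Mapping.keys_add[of a b] by blast

lemma keys_prepend: "supp c \<subseteq> S \<Longrightarrow> supp (prepend x c) \<subseteq> (#) x ` S"
  unfolding prepend_def by (rule keys_frag_extend_subset) (auto simp: keys_frag_of)

lemma keys_push: "supp c \<subseteq> S \<Longrightarrow> supp (push f c) \<subseteq> map f ` S"
  unfolding push_def by (rule keys_frag_extend_subset) (auto simp: keys_frag_of)

lemma keys_bd: "supp (bd xs) \<subseteq> {ys. Suc (length ys) = length xs \<and> set ys \<subseteq> set xs}"
proof (induction xs)
  case (Cons x xs)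
  show ?case
    unfolding bd.simps
    by (rule keys_diff_subset) (use keys_prepend[OF Cons.IH, of x] in \<open>fastforce simp: keys_frag_of\<close>)+
qed simp

text \<open>The chain homotopy \<open>[x\<^sub>0,\<dots>,x\<^sub>n] \<mapsto> \<Sum>\<^sub>i (-1)\<^sup>i [f x\<^sub>0,\<dots>,f x\<^sub>i,g x\<^sub>i,\<dots>,g x\<^sub>n]\<close> from the usual
decomposition of a prism into simplices.\<close>

fun prism :: "('a \<Rightarrow> 'b) \<Rightarrow> ('a \<Rightarrow> 'b) \<Rightarrow> 'a list \<Rightarrow> ('b list \<Rightarrow>\<^sub>0 int)" where
  "prism f g [] = 0"
| "prism f g (x # xs) = frag_of (f x # g x # map g xs) - prepend (f x) (prism f g xs)"

lemma prism_prepend: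
  "frag_extend (prism f g) (prepend x c) = prepend (f x) (prepend (g x) (push g c)) - prepend (f x) (frag_extend (prism f g) c)"
  by (rule frag_additive_eqI[of "\<lambda>c. frag_extend (prism f g) (prepend x c)"])
     (auto simp: frag_extend_diff)

lemma bdry_prism_list:
  "bdry (prism f g xs) + frag_extend (prism f g) (bd xs) = frag_of (map g xs) - frag_of (map f xs)"
proof (induction xs)
  case (Cons x xs)
  have *: "prepend (f x) (bdry (prism f g xs)) + prepend (f x) (frag_extend (prism f g) (bd xs))
     = frag_of (f x # map g xs) - frag_of (f x # map f xs)"
    using arg_cong[OF Cons.IH, of "prepend (f x)"] by simp
  show ?case
    using * by (simp add: frag_extend_diff bdry_prepend prism_prepend push_bd) (simp add: algebra_simps)
qed simp

lemma bdry_prism: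
  "bdry (frag_extend (prism f g) c) + frag_extend (prism f g) (bdry c) = push g c - push f c"
  by (rule frag_additive_eqI[of "\<lambda>c. bdry (frag_extend (prism f g) c) + frag_extend (prism f g) (bdry c)"])
     (auto simp: frag_extend_diff bdry_prism_list)

lemma keys_prism: "supp (prism f g xs) \<subseteq> {ys. set ys \<subseteq> f ` set xs \<union> g ` set xs}"
proof (induction xs)
  case (Cons x xs)
  show ?case
    unfolding prism.simps
    by (rule keys_diff_subset) (use keys_prepend[OF Cons.IH, of "f x"] in \<open>fastforce simp: keys_frag_of\<close>)+
qed simp

text \<open>The prism of a list consists of lists with entries in \<open>f ` set xs \<union> g ` set xs\<close>. If those are all
admissible, that is, if \<open>f\<close> and \<open>g\<close> are contiguous, then \<open>f\<close> and \<open>g\<close> map a cycle to homologous cycles.\<close>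

lemma contiguous_homologous:
  assumes "supp z \<subseteq> S" "bdry z = 0"
    and "\<And>xs ys. xs \<in> S \<Longrightarrow> set ys \<subseteq> f ` set xs \<union> g ` set xs \<Longrightarrow> ys \<in> T"
  shows "\<exists>w. supp w \<subseteq> T \<and> bdry w = push g z - push f z"
proof (intro exI conjI)
  show "bdry (frag_extend (prism f g) z) = push g z - push f z"
    using bdry_prism[of f g z] assms(2) by simp
  show "supp (frag_extend (prism f g) z) \<subseteq> T"
    by (rule keys_frag_extend_subset[OF assms(1)]) (use keys_prism assms(3) in blast)
qed

text \<open>A sequence of contiguous maps that ends in a constant map deforms the image of a cycle into the cycles
on one point, and these bound by the cone construction.\<close>

lemma contiguous_contraction:
  fixes H :: "nat \<Rightarrow> 'a \<Rightarrow> 'b"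
  assumes z: "supp z \<subseteq> S" "bdry z = 0"
    and H: "\<And>k xs ys. k < Suc N \<Longrightarrow> xs \<in> S \<Longrightarrow> set ys \<subseteq> H k ` set xs \<union> H (Suc k) ` set xs \<Longrightarrow> ys \<in> T"
    and p: "\<And>xs x. xs \<in> S \<Longrightarrow> x \<in> set xs \<Longrightarrow> H (Suc N) x = p"
    and T: "\<And>ys. set ys \<subseteq> {p} \<Longrightarrow> ys \<in> T"
  shows "\<exists>w. supp w \<subseteq> T \<and> bdry w = push (H 0) z"
proof -
  have *: "n \<le> Suc N \<Longrightarrow> \<exists>w. supp w \<subseteq> T \<and> bdry w = push (H n) z - push (H 0) z" for n
  proof (induction n)
    case 0
    show ?case by (rule exI[of _ 0]) simp
  next
    case (Suc n)
    then obtain w where w: "supp w \<subseteq> T" "bdry w = push (H n) z - push (H 0) z" by auto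
    obtain v where v: "supp v \<subseteq> T" "bdry v = push (H (Suc n)) z - push (H n) z"
      using contiguous_homologous[OF z, of "H n" "H (Suc n)" T] H[of n] Suc.prems by auto
    show ?case
      by (rule exI[of _ "v + w"]) (use v w keys_add_subset[of v T w] in auto)
  qed
  obtain w where w: "supp w \<subseteq> T" "bdry w = push (H (Suc N)) z - push (H 0) z"
    using *[of "Suc N"] by auto
  define c where "c = push (H (Suc N)) z"
  have "map (H (Suc N)) xs \<in> {ys. set ys \<subseteq> {p}}" if "xs \<in> S" for xs
    using p[OF that] by auto
  then have kc: "supp c \<subseteq> {ys. set ys \<subseteq> {p}}"
    unfolding c_def using keys_push[OF z(1), of "H (Suc N)"] by blast
  have bc: "bdry (prepend p c) = c"
    by (simp add: bdry_prepend c_def push_bdry[symmetric] z(2))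
  have "supp (prepend p c) \<subseteq> T"
    using keys_prepend[OF kc, of p] T by (auto 4 3)
  then show ?thesis
    by (intro exI[of _ "prepend p c - w"]) (use w bc keys_diff_subset[of "prepend p c" T w] in \<open>auto simp: c_def\<close>)
qed

text \<open>The method of acyclic carriers: \<open>D\<close> is built by induction on the length, where \<open>D xs\<close> fills the cycle
\<open>g xs - D (bd xs)\<close> inside \<open>B xs\<close>. If \<open>g\<close> is a difference of two chain maps, \<open>D\<close> is a homotopy between
them; if \<open>g\<close> is the identity, \<open>D\<close> is a contraction; and \<open>g = 0\<close> with a nonzero start \<open>w0\<close> yields a
chain map, since \<open>bd D + D bd = 0\<close> says that \<open>D\<close> commutes with the boundary up to sign.\<close>

lemma acyclic_carrier_homotopy:
  fixes g :: "'a list \<Rightarrow> ('b list \<Rightarrow>\<^sub>0 int)" and A B :: "'a list \<Rightarrow> 'b list set"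
  assumes closed: "\<And>xs ys. xs \<in> S \<Longrightarrow> ys \<in> supp (bd xs) \<Longrightarrow> ys \<in> S \<and> B ys \<subseteq> A xs"
    and g: "\<And>xs. xs \<in> S \<Longrightarrow> xs \<noteq> [] \<Longrightarrow> supp (g xs) \<subseteq> A xs"
    and chain: "\<And>xs. xs \<in> S \<Longrightarrow> bdry (g xs) = frag_extend g (bd xs)"
    and acyclic: "\<And>xs z. xs \<in> S \<Longrightarrow> xs \<noteq> [] \<Longrightarrow> supp z \<subseteq> A xs \<Longrightarrow> bdry z = 0 \<Longrightarrow>
                    \<exists>w. supp w \<subseteq> B xs \<and> bdry w = z"
    and w0: "supp w0 \<subseteq> B []" "bdry w0 = g []"
  obtains D where "D [] = w0" "\<And>xs. xs \<in> S \<Longrightarrow> supp (D xs) \<subseteq> B xs"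
    "\<And>xs. xs \<in> S \<Longrightarrow> bdry (D xs) + frag_extend D (bd xs) = g xs"
proof -
  define E where "E = rec_nat (\<lambda>_. w0) (\<lambda>n e xs. SOME w. supp w \<subseteq> B xs \<and>
     bdry w = g xs - frag_extend e (bd xs))"
  have E_Suc: "E (Suc n) xs = (SOME w. supp w \<subseteq> B xs \<and> bdry w = g xs - frag_extend (E n) (bd xs))"
    for n xs by (simp add: E_def)
  define D where "D xs = E (length xs) xs" for xs
  have DE: "frag_extend (E n) (bd xs) = frag_extend D (bd xs)" if "length xs = Suc n" for n xs
    by (rule frag_extend_eq) (use keys_bd[of xs] that in \<open>auto simp: D_def\<close>)
  have "xs \<in> S \<Longrightarrow> supp (D xs) \<subseteq> B xs \<and> bdry (D xs) + frag_extend D (bd xs) = g xs" for xs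
  proof (induction "length xs" arbitrary: xs)
    case 0
    then show ?case using w0 by (simp add: D_def E_def)
  next
    case (Suc n)
    have IH: "supp (D ys) \<subseteq> A xs" "bdry (D ys) + frag_extend D (bd ys) = g ys"
      if "ys \<in> supp (bd xs)" for ys
      using Suc.hyps(1)[of ys] closed[OF \<open>xs \<in> S\<close> that] subsetD[OF keys_bd that] Suc.hyps(2) by auto
    have ne: "xs \<noteq> []" using Suc.hyps(2) by auto
    define z where "z = g xs - frag_extend D (bd xs)"
    have kz: "supp z \<subseteq> A xs"
      unfolding z_def
      by (intro keys_diff_subset g[OF \<open>xs \<in> S\<close> ne] keys_frag_extend_subset[OF subset_refl] IH(1))
    have "bdry (frag_extend D (bd xs)) = frag_extend g (bd xs) - frag_extend D (bdry (bd xs))"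
      by (rule frag_additive_eqI[of "\<lambda>c. bdry (frag_extend D c)" "\<lambda>c. frag_extend g c - frag_extend D (bdry c)"])
         (use IH(2) in \<open>auto simp: frag_extend_diff algebra_simps\<close>)
    then have "bdry z = 0"
      unfolding z_def using chain[OF \<open>xs \<in> S\<close>] by simp
    then have "\<exists>w. supp w \<subseteq> B xs \<and> bdry w = z"
      using acyclic[OF \<open>xs \<in> S\<close> ne kz] by simp
    moreover have "D xs = (SOME w. supp w \<subseteq> B xs \<and> bdry w = z)"
      unfolding z_def D_def[of xs] Suc.hyps(2)[symmetric] E_Suc DE[OF Suc.hyps(2)[symmetric]] ..
    ultimately have "supp (D xs) \<subseteq> B xs \<and> bdry (D xs) = z"
      by (metis (mono_tags, lifting) someI_ex)
    then show ?case by (simp add: z_def)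
  qed
  moreover have "D [] = w0" by (simp add: D_def E_def)
  ultimately show ?thesis using that by blast
qed

lemma acyclic_carrier_chain_map:
  fixes B :: "'a list \<Rightarrow> 'b list set"
  assumes closed: "\<And>xs ys. xs \<in> S \<Longrightarrow> ys \<in> supp (bd xs) \<Longrightarrow> ys \<in> S \<and> B ys \<subseteq> B xs"
    and acyclic: "\<And>xs z. xs \<in> S \<Longrightarrow> xs \<noteq> [] \<Longrightarrow> supp z \<subseteq> B xs \<Longrightarrow> bdry z = 0 \<Longrightarrow>
                    \<exists>w. supp w \<subseteq> B xs \<and> bdry w = z"
    and nil: "[] \<in> B []"
  obtains \<phi> where "\<phi> [] = frag_of []" "\<And>xs. xs \<in> S \<Longrightarrow> supp (\<phi> xs) \<subseteq> B xs"
    "\<And>xs. xs \<in> S \<Longrightarrow> bdry (\<phi> xs) = frag_extend \<phi> (bd xs)"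
proof -
  obtain D where D: "D [] = frag_of []" "\<And>xs. xs \<in> S \<Longrightarrow> supp (D xs) \<subseteq> B xs"
    "\<And>xs. xs \<in> S \<Longrightarrow> bdry (D xs) + frag_extend D (bd xs) = 0"
    by (rule acyclic_carrier_homotopy[where A = B and B = B and S = S and g = "\<lambda>_. 0" and ?w0.0 = "frag_of []"])
       (use assms in \<open>auto simp: frag_extend_eq_0 keys_frag_of\<close>)
  define \<phi> where "\<phi> xs = frag_cmul ((-1) ^ length xs) (D xs)" for xs
  have "frag_extend \<phi> (bd xs) = frag_cmul ((-1) ^ (length xs - 1)) (frag_extend D (bd xs))" for xs
  proof -
    have "frag_extend \<phi> (bd xs) = frag_extend (\<lambda>ys. frag_cmul ((-1) ^ (length xs - 1)) (D ys)) (bd xs)"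
    proof (rule frag_extend_eq)
      fix ys assume "ys \<in> supp (bd xs)"
      then have "length ys = length xs - 1" using keys_bd[of xs] by auto
      then show "\<phi> ys = frag_cmul ((-1) ^ (length xs - 1)) (D ys)" by (simp add: \<phi>_def)
    qed
    then show ?thesis
      by (simp add: frag_extend_def frag_cmul_sum mult.commute)
  qed
  moreover have "bdry (\<phi> xs) = frag_cmul ((-1) ^ length xs) (- frag_extend D (bd xs))" if "xs \<in> S" for xs
  proof -
    have "bdry (D xs) = - frag_extend D (bd xs)"
      using D(3)[OF that] by (simp add: eq_neg_iff_add_eq_0)
    then show ?thesis
      unfolding \<phi>_def by (metis bdry_def frag_extend_cmul)
  qed
  ultimately have "bdry (\<phi> xs) = frag_extend \<phi> (bd xs)" if "xs \<in> S" for xs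
    using that by (cases "length xs") (auto simp: frag_cmul_minus_one[symmetric] simp del: frag_cmul_minus_one minus_frag_cmul)
  then show ?thesis
    using that[of \<phi>] D by (auto simp: \<phi>_def keys_cmul)
qed

text \<open>The boundary lowers the length by exactly one. So of a chain that bounds a cycle of length \<open>n\<close> only the
part of length \<open>n + 1\<close> matters.\<close>

lemma bdry_homogeneous_part:
  assumes "\<And>xs. xs \<in> supp (bdry w) \<Longrightarrow> length xs = n"
  shows "bdry (frag_extend (\<lambda>xs. if length xs = Suc n then frag_of xs else 0) w) = bdry w"
proof -
  have "bdry (frag_extend (\<lambda>xs. if length xs = Suc n then frag_of xs else 0) w)
      = frag_extend (\<lambda>xs. if length xs = n then frag_of xs else 0) (bdry w)"
  proof (rule frag_additive_eqI[of "\<lambda>w. bdry (frag_extend (\<lambda>xs. if length xs = Suc n then frag_of xs else 0) w)"])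
    fix xs :: "'a list"
    have "frag_extend (\<lambda>xs. if length xs = n then frag_of xs else 0) (bd xs) = (if length xs = Suc n then bd xs else 0)"
    proof (cases "length xs = Suc n")
      case True
      then have "frag_extend (\<lambda>xs. if length xs = n then frag_of xs else 0) (bd xs) = frag_extend frag_of (bd xs)"
        by (intro frag_extend_eq) (use keys_bd[of xs] in auto)
      then show ?thesis using True by (simp flip: frag_expansion)
    next
      case False
      then show ?thesis by (auto intro!: frag_extend_eq_0 dest!: subsetD[OF keys_bd])
    qed
    then show "bdry (frag_extend (\<lambda>xs. if length xs = Suc n then frag_of xs else 0) (frag_of xs))
      = frag_extend (\<lambda>xs. if length xs = n then frag_of xs else 0) (bdry (frag_of xs))"
      by simp
  qed (auto simp: frag_extend_diff)
  also have "\<dots> = frag_extend frag_of (bdry w)"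
    by (rule frag_extend_eq) (use assms in auto)
  finally show ?thesis by (simp flip: frag_expansion)
qed

section \<open>Contractible realizations are acyclic\<close>

lemma closedin_all_preimage:
  assumes "\<And>i. i \<in> J \<Longrightarrow> continuous_map T euclideanreal (f i)" "\<And>i. i \<in> J \<Longrightarrow> closed (A i)"
  shows "closedin T {t \<in> topspace T. \<forall>i\<in>J. f i t \<in> A i}"
proof -
  have "closedin T (\<Inter>(insert (topspace T) ((\<lambda>i. {t \<in> topspace T. f i t \<in> A i}) ` J)))"
    by (rule closedin_Inter) (use assms in \<open>auto intro!: closedin_continuous_map_preimage\<close>)
  moreover have "\<Inter>(insert (topspace T) ((\<lambda>i. {t \<in> topspace T. f i t \<in> A i}) ` J)) = {t \<in> topspace T. \<forall>i\<in>J. f i t \<in> A i}"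
    by auto
  ultimately show ?thesis by simp
qed

lemma topspace_realization:
  "topspace (realization X leq) = {t \<in> X \<rightarrow>\<^sub>E {0..}. (\<Sum>x\<in>X. t x) = 1 \<and>
          (\<forall>x\<in>X. \<forall>y\<in>X. t x > 0 \<and> t y > 0 \<longrightarrow> leq x y \<or> leq y x)}"
  by (auto simp: realization_def)

text \<open>The realization is cut out of the cube \<open>[0,1]\<^sup>X\<close> by closed conditions; two incomparable points cannot both
have a positive coordinate, which is the closed condition \<open>t x * t y \<le> 0\<close>.\<close>

lemma compact_space_realization:
  assumes "finite X"
  shows "compact_space (realization X leq)"
proof -
  let ?T = "powertop_real X"
  let ?Y = "{t \<in> X \<rightarrow>\<^sub>E {0::real..}. (\<Sum>x\<in>X. t x) = 1 \<and>
          (\<forall>x\<in>X. \<forall>y\<in>X. t x > 0 \<and> t y > 0 \<longrightarrow> leq x y \<or> leq y x)}"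
  have "closedin ?T {t \<in> topspace ?T. \<forall>x\<in>X. t x \<in> {0..}}"
    by (rule closedin_all_preimage) (auto intro: continuous_map_product_projection)
  moreover have "closedin ?T {t \<in> topspace ?T. \<forall>i\<in>{()}. (\<Sum>x\<in>X. t x) \<in> {1}}"
    by (rule closedin_all_preimage) (auto intro!: continuous_map_sum continuous_map_product_projection assms)
  moreover have "closedin ?T {t \<in> topspace ?T. \<forall>(x, y)\<in>{p \<in> X \<times> X. \<not> (leq (fst p) (snd p) \<or> leq (snd p) (fst p))}. t x * t y \<in> {..0}}"
    unfolding case_prod_beta
    by (rule closedin_all_preimage) (auto intro!: continuous_map_real_mult continuous_map_product_projection)
  ultimately have "closedin ?T ({t \<in> topspace ?T. \<forall>x\<in>X. t x \<in> {0..}} \<inter> {t \<in> topspace ?T. \<forall>i\<in>{()}. (\<Sum>x\<in>X. t x) \<in> {1}} \<inter>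
     {t \<in> topspace ?T. \<forall>(x, y)\<in>{p \<in> X \<times> X. \<not> (leq (fst p) (snd p) \<or> leq (snd p) (fst p))}. t x * t y \<in> {..0}})"
    by (intro closedin_Int)
  also have "\<dots> = ?Y"
    by (auto simp: PiE_iff mult_le_0_iff) force+
  finally have "closedin ?T ?Y" .
  moreover have "compactin ?T (X \<rightarrow>\<^sub>E {0..1})"
    by (simp add: compactin_PiE)
  moreover have "?Y \<subseteq> X \<rightarrow>\<^sub>E {0..1}"
  proof
    fix t assume t: "t \<in> ?Y"
    have "t x \<le> 1" if "x \<in> X" for x
      using member_le_sum[of x X t] t that assms by (auto simp: PiE_iff)
    then show "t \<in> X \<rightarrow>\<^sub>E {0..1}" using t by (auto simp: PiE_iff)
  qed
  ultimately have "compactin ?T ?Y"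
    using closed_compactin[of ?T "X \<rightarrow>\<^sub>E {0..1}" ?Y] by blast
  then show ?thesis
    by (simp add: realization_def compact_space_subtopology)
qed

lemma realization_coordinate_continuous:
  assumes "x \<in> X"
  shows "continuous_map (realization X leq) euclideanreal (\<lambda>t. t x)"
  unfolding realization_def
  by (rule continuous_map_from_subtopology) (rule continuous_map_product_projection[OF assms])

text \<open>Uniform continuity with respect to the sum of the coordinate distances, which is \<open>m\<close> below: the
pairs of points whose images have distance at least \<open>\<epsilon>\<close> form a compact set. If it is empty, any \<open>\<delta>\<close>
works; otherwise \<open>m\<close> has a positive minimum \<open>c\<close> on it.\<close>

lemma realization_homotopy_uniformly_continuous:
  assumes X: "finite X"
    and h: "continuous_map (prod_topology (top_of_set {0..1::real}) (realization X leq)) (realization X leq) h"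
    and "\<epsilon> > (0::real)"
  obtains \<delta> where "\<delta> > 0"
    "\<And>s t y y' x. s \<in> {0..1} \<Longrightarrow> t \<in> {0..1} \<Longrightarrow> y \<in> topspace (realization X leq) \<Longrightarrow>
       y' \<in> topspace (realization X leq) \<Longrightarrow> \<bar>s - t\<bar> < \<delta> \<Longrightarrow> (\<And>x. x \<in> X \<Longrightarrow> \<bar>y x - y' x\<bar> < \<delta>) \<Longrightarrow>
       x \<in> X \<Longrightarrow> \<bar>h (s, y) x - h (t, y') x\<bar> < \<epsilon>"
proof -
  let ?Y = "realization X leq" and ?K = "prod_topology (top_of_set {0..1::real}) (realization X leq)"
  define m where "m p = \<bar>fst (fst p) - fst (snd p)\<bar> + (\<Sum>x\<in>X. \<bar>snd (fst p) x - snd (snd p) x\<bar>)"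
    for p :: "(real \<times> ('a \<Rightarrow> real)) \<times> (real \<times> ('a \<Rightarrow> real))"
  define M where "M p = (\<Sum>x\<in>X. \<bar>h (fst p) x - h (snd p) x\<bar>)" for p
  have coord: "continuous_map Z euclideanreal (\<lambda>p. f p x)" if "continuous_map Z ?Y f" "x \<in> X"
    for Z :: "'z topology" and f x
    using continuous_map_compose[OF that(1) realization_coordinate_continuous[OF that(2)]] by (simp add: comp_def)
  have fs: "continuous_map ?K euclideanreal fst"
    using continuous_map_fst[of "top_of_set {0..1::real}" ?Y] continuous_map_into_fulltopology by blast
  have f1: "continuous_map (prod_topology ?K ?K) euclideanreal (\<lambda>p. fst (fst p))"
      "continuous_map (prod_topology ?K ?K) euclideanreal (\<lambda>p. fst (snd p))"
    using continuous_map_compose[OF continuous_map_fst fs] continuous_map_compose[OF continuous_map_snd fs]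
    by (simp_all add: comp_def)
  have f2: "continuous_map (prod_topology ?K ?K) ?Y (\<lambda>p. snd (fst p))"
      "continuous_map (prod_topology ?K ?K) ?Y (\<lambda>p. snd (snd p))"
    using continuous_map_compose[OF continuous_map_fst continuous_map_snd]
      continuous_map_compose[OF continuous_map_snd continuous_map_snd]
    by (fastforce simp: comp_def)+
  have f3: "continuous_map (prod_topology ?K ?K) ?Y (\<lambda>p. h (fst p))"
      "continuous_map (prod_topology ?K ?K) ?Y (\<lambda>p. h (snd p))"
    using continuous_map_compose[OF continuous_map_fst h] continuous_map_compose[OF continuous_map_snd h]
    by (fastforce simp: comp_def)+
  have m: "continuous_map (prod_topology ?K ?K) euclideanreal m"
    unfolding m_def by (intro continuous_map_add continuous_map_real_abs continuous_map_diff continuous_map_sum f1 coord f2 X)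
  have "continuous_map (prod_topology ?K ?K) euclideanreal M"
    unfolding M_def by (intro continuous_map_add continuous_map_real_abs continuous_map_diff continuous_map_sum coord f3 X)
  then have "closedin (prod_topology ?K ?K) {p \<in> topspace (prod_topology ?K ?K). M p \<in> {\<epsilon>..}}"
    by (rule closedin_continuous_map_preimage) simp
  moreover have "compact_space (prod_topology ?K ?K)"
    using compact_space_realization[OF X, of leq]
    by (simp add: compact_space_prod_topology compact_space_subtopology)
  ultimately have "compactin (prod_topology ?K ?K) {p \<in> topspace (prod_topology ?K ?K). M p \<in> {\<epsilon>..}}" (is "compactin _ ?B")
    by (rule closedin_compact_space[rotated])
  then have cB: "compact (m ` ?B)"
    using image_compactin[OF _ m] by auto
  have small: "M ((s, y), (t, y')) < \<epsilon> \<Longrightarrow> x \<in> X \<Longrightarrow> \<bar>h (s, y) x - h (t, y') x\<bar> < \<epsilon>" for s t y y' x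
    using member_le_sum[of x X "\<lambda>x. \<bar>h (s, y) x - h (t, y') x\<bar>"] X by (simp add: M_def)
  show ?thesis
  proof (cases "?B = {}")
    case True
    have "\<bar>h (s, y) x - h (t, y') x\<bar> < \<epsilon>" if "s \<in> {0..1}" "t \<in> {0..1}" "y \<in> topspace ?Y" "y' \<in> topspace ?Y" "x \<in> X"
      for s t y y' x
    proof -
      have "((s, y), (t, y')) \<notin> ?B" using True by blast
      then show ?thesis using that by (intro small) (auto)
    qed
    then show ?thesis using that[of 1] by simp
  next
    case False
    then have "\<exists>c\<in>m ` ?B. \<forall>c'\<in>m ` ?B. c \<le> c'"
      by (intro compact_attains_inf[OF cB]) blast
    then obtain c where c: "c \<in> m ` ?B" "\<And>c'. c' \<in> m ` ?B \<Longrightarrow> c \<le> c'"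
      by blast
    have "c > 0"
    proof (rule ccontr)
      assume "\<not> c > 0"
      obtain s y t y' where p: "((s, y), (t, y')) \<in> ?B" "c = m ((s, y), (t, y'))" using c(1) by auto
      have "(\<Sum>x\<in>X. \<bar>y x - y' x\<bar>) \<ge> 0" by (simp add: sum_nonneg)
      moreover have "\<bar>s - t\<bar> + (\<Sum>x\<in>X. \<bar>y x - y' x\<bar>) \<le> 0"
        using \<open>\<not> c > 0\<close> p(2) by (simp add: m_def)
      ultimately have "s = t" "(\<Sum>x\<in>X. \<bar>y x - y' x\<bar>) = 0" by linarith+
      then have "\<And>x. x \<in> X \<Longrightarrow> y x = y' x" using X by (subst (asm) sum_nonneg_eq_0_iff) auto
      moreover have "y \<in> extensional X" "y' \<in> extensional X"
        using p(1) by (auto simp: topspace_realization PiE_iff)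
      ultimately have "y = y'" by (auto intro: extensionalityI)
      then show False using p(1) \<open>s = t\<close> \<open>\<epsilon> > 0\<close> by (simp add: M_def)
    qed
    \<comment> \<open>one summand of \<open>m\<close> for the time and one for each coordinate\<close>
    define \<delta> where "\<delta> = c / (1 + card X)"
    have d: "\<delta> > 0" using \<open>c > 0\<close> by (simp add: \<delta>_def)
    show ?thesis
    proof (rule that[OF d])
      fix s t y y' x
      assume *: "s \<in> {0..1}" "t \<in> {0..1}" "y \<in> topspace ?Y" "y' \<in> topspace ?Y" "\<bar>s - t\<bar> < \<delta>"
        "\<And>x. x \<in> X \<Longrightarrow> \<bar>y x - y' x\<bar> < \<delta>" "x \<in> X"
      have "(\<Sum>x\<in>X. \<bar>y x - y' x\<bar>) \<le> of_nat (card X) * \<delta>"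
        by (rule sum_bounded_above) (use *(6) in \<open>auto intro: less_imp_le\<close>)
      moreover have "c = \<delta> + of_nat (card X) * \<delta>"
      proof -
        have "\<delta> * (1 + of_nat (card X)) = c" by (simp add: \<delta>_def add_pos_nonneg[THEN less_imp_neq, symmetric])
        then show ?thesis by (simp add: algebra_simps)
      qed
      ultimately have "m ((s, y), (t, y')) < c"
        using *(5) by (simp add: m_def)
      then have "((s, y), (t, y')) \<notin> ?B" using c(2)[of "m ((s, y), (t, y'))"] by force
      then show "\<bar>h (s, y) x - h (t, y') x\<bar> < \<epsilon>" using * by (intro small) auto
    qed
  qed
qed

definition acyclic_lists :: "'a list set \<Rightarrow> bool" where
  "acyclic_lists S \<longleftrightarrow> (\<forall>z. supp z \<subseteq> S \<longrightarrow> bdry z = 0 \<longrightarrow> (\<exists>w. supp w \<subseteq> S \<and> bdry w = z))"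

definition comparable_lists :: "'a set \<Rightarrow> ('a \<Rightarrow> 'a \<Rightarrow> bool) \<Rightarrow> 'a list set" where
  "comparable_lists X leq = {xs. set xs \<subseteq> X \<and> (\<forall>x\<in>set xs. \<forall>y\<in>set xs. leq x y \<or> leq y x)}"

text \<open>Ordered simplices of diameter less than \<open>\<delta>\<close>. Their vertices need not lie in a common simplex of the
realization; that freedom is what allows them to follow a homotopy.\<close>

definition near_lists :: "('x \<Rightarrow> real) set \<Rightarrow> 'x set \<Rightarrow> real \<Rightarrow> ('x \<Rightarrow> real) list set" where
  "near_lists A X \<delta> = {ys. set ys \<subseteq> A \<and> (\<forall>y\<in>set ys. \<forall>y'\<in>set ys. \<forall>x\<in>X. \<bar>y x - y' x\<bar> < \<delta>)}"

lemma near_lists_mono: "A \<subseteq> B \<Longrightarrow> near_lists A X \<delta> \<subseteq> near_lists B X \<delta>"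
  unfolding near_lists_def by blast

text \<open>The straight-line contraction to \<open>p\<close>, in \<open>N + 1\<close> equal steps. The finitely many lists of a cycle have
diameter at most some \<open>d < \<delta>\<close>, so consecutive stages are contiguous at scale \<open>\<delta>\<close> as soon as the steps
are shorter than \<open>\<delta> - d\<close>.\<close>

lemma near_lists_star_shaped_acyclic:
  assumes X: "finite X" and "\<delta> > 0" and A: "A \<subseteq> X \<rightarrow>\<^sub>E {0..1}" and p: "p \<in> A"
    and star: "\<And>y u. y \<in> A \<Longrightarrow> u \<in> {0..1} \<Longrightarrow> (\<lambda>x\<in>X. (1 - u) * y x + u * p x) \<in> A"
  shows "acyclic_lists (near_lists A X \<delta>)"
  unfolding acyclic_lists_def
proof (intro allI impI)
  fix z assume z: "supp z \<subseteq> near_lists A X \<delta>" "bdry z = 0"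
  define Q where "Q = insert 0 ((\<lambda>(y, y', x). \<bar>y x - y' x\<bar>) ` (\<Union>ys\<in>supp z. set ys \<times> set ys \<times> X))"
  define d where "d = Max Q"
  have Q: "finite Q" "Q \<noteq> {}" by (auto simp: Q_def X)
  have "d < \<delta>"
    unfolding d_def using Q z(1) \<open>\<delta> > 0\<close> by (subst Max_less_iff) (fastforce simp: Q_def near_lists_def)+
  have d: "\<bar>y x - y' x\<bar> \<le> d" if "ys \<in> supp z" "y \<in> set ys" "y' \<in> set ys" "x \<in> X" for ys y y' x
    unfolding d_def by (rule Max_ge[OF Q(1)]) (use that in \<open>force simp: Q_def\<close>)
  obtain N where N: "1 / real (Suc N) < \<delta> - d"
    using nat_approx_posE[of "\<delta> - d"] \<open>d < \<delta>\<close> by auto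
  define u where "u k = real k / real (Suc N)" for k
  define H where "H k y = (\<lambda>x\<in>X. (1 - u k) * y x + u k * p x)" for k y
  have u01: "u k \<in> {0..1}" if "k \<le> Suc N" for k using that by (simp add: u_def)
  have keysA: "y \<in> A" if "ys \<in> supp z" "y \<in> set ys" for ys y
    using that z(1) by (auto simp: near_lists_def)
  have "\<exists>w. supp w \<subseteq> near_lists A X \<delta> \<and> bdry w = push (H 0) z"
  proof (rule contiguous_contraction[OF subset_refl z(2), of N])
    fix k xs ys assume k: "k < Suc N" and xs: "xs \<in> supp z"
      and ys: "set ys \<subseteq> H k ` set xs \<union> H (Suc k) ` set xs"
    have rep: "\<exists>j\<in>{k, Suc k}. \<exists>y'\<in>set xs. y = H j y'" if "y \<in> set ys" for y
      using ys that by auto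
    show "ys \<in> near_lists A X \<delta>"
      unfolding near_lists_def
    proof (intro CollectI conjI ballI subsetI)
      fix y assume "y \<in> set ys"
      then show "y \<in> A"
        using rep[of y] star[OF keysA[OF xs] u01] k by (auto simp: H_def)
    next
      fix y y' x assume *: "y \<in> set ys" "y' \<in> set ys" "x \<in> X"
      obtain i a where i: "i \<in> {k, Suc k}" "a \<in> set xs" "y = H i a" using rep[OF *(1)] by auto
      obtain j b where j: "j \<in> {k, Suc k}" "b \<in> set xs" "y' = H j b" using rep[OF *(2)] by auto
      have "y x - y' x = (1 - u i) * (a x - b x) + (u i - u j) * (p x - b x)"
        using *(3) by (simp add: i(3) j(3) H_def algebra_simps)
      moreover have "\<bar>(1 - u i) * (a x - b x)\<bar> \<le> 1 * d"
        unfolding abs_mult by (rule mult_mono) (use u01[of i] i k d[OF xs i(2) j(2) *(3)] in auto)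
      moreover have "\<bar>(u i - u j) * (p x - b x)\<bar> \<le> 1 / real (Suc N) * 1"
        unfolding abs_mult
      proof (rule mult_mono)
        show "\<bar>u i - u j\<bar> \<le> 1 / real (Suc N)"
          using i(1) j(1) by (auto simp: u_def diff_divide_distrib[symmetric])
        have "p x \<in> {0..1}" "b x \<in> {0..1}"
          using A p keysA[OF xs j(2)] *(3) by blast+
        then show "\<bar>p x - b x\<bar> \<le> 1" by auto
      qed auto
      ultimately show "\<bar>y x - y' x\<bar> < \<delta>" using N by linarith
    qed
  next
    fix xs y assume "xs \<in> supp z" "y \<in> set xs"
    show "H (Suc N) y = p"
      using A p by (intro extensionalityI[of _ X]) (auto simp: H_def u_def PiE_iff)
  next
    fix ys assume "set ys \<subseteq> {p}"
    then have "\<forall>y\<in>set ys. y = p" by auto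
    then show "ys \<in> near_lists A X \<delta>"
      using p \<open>\<delta> > 0\<close> by (auto simp: near_lists_def) (metis abs_zero diff_self)
  qed
  moreover have "push (H 0) z = z"
  proof (rule push_ident)
    fix xs y assume "xs \<in> supp z" "y \<in> set xs"
    then have "y \<in> A" by (rule keysA)
    then show "H 0 y = y"
      using A by (intro extensionalityI[of _ X]) (auto simp: H_def u_def PiE_iff)
  qed
  ultimately show "\<exists>w. supp w \<subseteq> near_lists A X \<delta> \<and> bdry w = z" by simp
qed

text \<open>Write \<open>|X|\<close> for the realization. With \<open>\<epsilon> = 1 / card X\<close>, choose \<open>\<delta>\<close> such that the contracting homotopy
moves lists of diameter below \<open>\<delta>\<close> through lists of diameter below \<open>\<epsilon>\<close>. Send comparable
lists in \<open>X\<close> by a chain map \<open>\<phi>\<close> to lists of diameter below \<open>\<delta>\<close> in \<open>|X|\<close>, regard those as lists of diameter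
below \<open>\<epsilon>\<close>, and return to comparable lists by a vertex map \<open>v\<close>. By acyclic carriers the composite is homotopic
to the identity, while the step in the middle turns cycles into boundaries.\<close>

theorem contractible_realization_acyclic:
  assumes X: "finite X" and "contractible_realization X leq"
  shows "acyclic_lists (comparable_lists X leq)"
proof -
  let ?Y = "topspace (realization X leq)" and ?I = "top_of_set {0..1::real}"
  let ?S = "comparable_lists X leq"
  obtain p h where h: "continuous_map (prod_topology ?I (realization X leq)) (realization X leq) h"
    "\<And>y. h (0, y) = y" "\<And>y. h (1, y) = p" and "?Y \<noteq> {}"
    using assms(2) unfolding contractible_realization_def contractible_space_def homotopic_with_def
    by auto
  define \<epsilon> where "\<epsilon> = 1 / real (card X)"
  have Y01: "?Y \<subseteq> X \<rightarrow>\<^sub>E {0..1}"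
  proof
    fix t assume t: "t \<in> ?Y"
    have "t x \<le> 1" if "x \<in> X" for x
      using member_le_sum[of x X t] t that X by (auto simp: PiE_iff topspace_realization)
    then show "t \<in> X \<rightarrow>\<^sub>E {0..1}" using t by (auto simp: PiE_iff topspace_realization)
  qed
  have "X \<noteq> {}" using \<open>?Y \<noteq> {}\<close> by (auto simp: topspace_realization)
  then have "\<epsilon> > 0" using X by (simp add: \<epsilon>_def card_gt_0_iff)
  \<comment> \<open>the coordinates of \<open>y\<close> have sum \<open>1\<close>\<close>
  have "\<exists>x\<in>X. y x \<ge> \<epsilon>" if "y \<in> ?Y" for y
  proof (rule ccontr)
    assume "\<not> (\<exists>x\<in>X. y x \<ge> \<epsilon>)"
    then have "(\<Sum>x\<in>X. y x) < (\<Sum>x\<in>X. \<epsilon>)"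
      using \<open>X \<noteq> {}\<close> X by (intro sum_strict_mono) auto
    then show False using that \<open>X \<noteq> {}\<close> X by (simp add: \<epsilon>_def topspace_realization)
  qed
  then obtain v where v: "\<And>y. y \<in> ?Y \<Longrightarrow> v y \<in> X" "\<And>y. y \<in> ?Y \<Longrightarrow> y (v y) \<ge> \<epsilon>"
    by metis
  obtain \<delta> where \<delta>: "\<delta> > 0" "\<And>s t y y' x. s \<in> {0..1} \<Longrightarrow> t \<in> {0..1} \<Longrightarrow> y \<in> ?Y \<Longrightarrow>
       y' \<in> ?Y \<Longrightarrow> \<bar>s - t\<bar> < \<delta> \<Longrightarrow> (\<And>x. x \<in> X \<Longrightarrow> \<bar>y x - y' x\<bar> < \<delta>) \<Longrightarrow>
       x \<in> X \<Longrightarrow> \<bar>h (s, y) x - h (t, y') x\<bar> < \<epsilon>"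
    using realization_homotopy_uniformly_continuous[OF X h(1) \<open>\<epsilon> > 0\<close>] by metis
  \<comment> \<open>the closed simplex spanned by a list; it is star-shaped, so it can carry \<open>\<phi>\<close>\<close>
  define face where "face xs = {y \<in> ?Y. \<forall>x\<in>X. y x \<noteq> 0 \<longrightarrow> x \<in> set xs}" for xs
  have sub: "ys \<in> ?S \<and> set ys \<subseteq> set xs" if "xs \<in> ?S" "ys \<in> supp (bd xs)" for xs ys
    using that(1) subsetD[OF keys_bd that(2)] by (auto simp: comparable_lists_def)
  have face_sub: "face xs \<subseteq> ?Y" for xs by (auto simp: face_def)
  have face_acyclic: "acyclic_lists (near_lists (face xs) X \<delta>)" if xs: "xs \<in> ?S" "xs \<noteq> []" for xs
  proof (rule near_lists_star_shaped_acyclic[OF X \<delta>(1)])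
    show "face xs \<subseteq> X \<rightarrow>\<^sub>E {0..1}" using Y01 by (auto simp: face_def)
    let ?p = "\<lambda>x\<in>X. if x = hd xs then 1 else (0::real)"
    have hd: "hd xs \<in> set xs" "hd xs \<in> X" "leq (hd xs) (hd xs)"
      using xs hd_in_set[OF xs(2)] unfolding comparable_lists_def by blast+
    show "?p \<in> face xs"
      using hd X by (auto simp: face_def topspace_realization sum.delta)
    fix y u assume yu: "y \<in> face xs" "u \<in> {0..1::real}"
    let ?c = "\<lambda>x\<in>X. (1 - u) * y x + u * ?p x"
    have "y \<in> ?Y" using yu(1) by (simp add: face_def)
    then have "(\<Sum>x\<in>X. y x) = 1" "\<And>x. x \<in> X \<Longrightarrow> 0 \<le> y x" by (auto simp: topspace_realization)
    have s: "(\<Sum>x\<in>X. ?c x) = 1"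
      using hd X \<open>(\<Sum>x\<in>X. y x) = 1\<close>
      by (simp add: sum.distrib sum_distrib_left[symmetric] sum.delta)
    have supp: "x \<in> set xs" if "?c x \<noteq> 0" "x \<in> X" for x
      using that yu(1) hd(1) by (auto simp: face_def split: if_splits)
    show "?c \<in> face xs"
      unfolding face_def topspace_realization
    proof (intro CollectI conjI ballI impI)
      show "?c \<in> X \<rightarrow>\<^sub>E {0..}" using yu(2) \<open>\<And>x. x \<in> X \<Longrightarrow> 0 \<le> y x\<close> by auto
      show "(\<Sum>x\<in>X. ?c x) = 1" by (rule s)
      show "leq x x' \<or> leq x' x" if "x \<in> X" "x' \<in> X" "?c x > 0 \<and> ?c x' > 0" for x x'
      proof -
        have "x \<in> set xs" "x' \<in> set xs"
          using supp[of x] supp[of x'] that by (metis less_irrefl)+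
        then show ?thesis using xs(1) by (simp add: comparable_lists_def)
      qed
      show "x \<in> set xs" if "x \<in> X" "?c x \<noteq> 0" for x using supp that by blast
    qed
  qed
  obtain \<phi> where \<phi>: "\<phi> [] = frag_of []" "\<And>xs. xs \<in> ?S \<Longrightarrow> supp (\<phi> xs) \<subseteq> near_lists (face xs) X \<delta>"
    "\<And>xs. xs \<in> ?S \<Longrightarrow> bdry (\<phi> xs) = frag_extend \<phi> (bd xs)"
  proof (rule acyclic_carrier_chain_map[where S = ?S and B = "\<lambda>xs. near_lists (face xs) X \<delta>"])
    fix xs ys assume "xs \<in> ?S" "ys \<in> supp (bd xs)"
    from sub[OF this] show "ys \<in> ?S \<and> near_lists (face ys) X \<delta> \<subseteq> near_lists (face xs) X \<delta>"
      by (fastforce simp: near_lists_def face_def)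
  qed (use face_acyclic in \<open>auto simp: acyclic_lists_def near_lists_def\<close>)
  have v_face: "set ys \<subseteq> face xs \<Longrightarrow> v ` set ys \<subseteq> set xs" for xs ys
    using v \<open>\<epsilon> > 0\<close> by (force simp: face_def)
  \<comment> \<open>Both the identity and \<open>v \<circ> \<phi>\<close> send \<open>xs\<close> to chains of lists with entries in \<open>xs\<close>, and those form a cone.\<close>
  define g where "g xs = frag_of xs - push v (\<phi> xs)" for xs
  have mono: "zs \<in> ?S" if "xs \<in> ?S" "set zs \<subseteq> set xs" for xs zs
    using that by (auto simp: comparable_lists_def)
  obtain D where D: "D [] = 0" "\<And>xs. xs \<in> ?S \<Longrightarrow> supp (D xs) \<subseteq> {ys. set ys \<subseteq> set xs}"
    "\<And>xs. xs \<in> ?S \<Longrightarrow> bdry (D xs) + frag_extend D (bd xs) = g xs"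
  proof (rule acyclic_carrier_homotopy[where S = ?S and A = "\<lambda>xs. {ys. set ys \<subseteq> set xs}" and B = "\<lambda>xs. {ys. set ys \<subseteq> set xs}"
        and g = g and ?w0.0 = 0])
    fix xs ys assume "xs \<in> ?S" "ys \<in> supp (bd xs)"
    from sub[OF this] show "ys \<in> ?S \<and> {zs. set zs \<subseteq> set ys} \<subseteq> {zs. set zs \<subseteq> set xs}" by auto
  next
    fix xs assume xs: "xs \<in> ?S"
    have "supp (push v (\<phi> xs)) \<subseteq> map v ` near_lists (face xs) X \<delta>"
      by (rule keys_push[OF \<phi>(2)[OF xs]])
    also have "\<dots> \<subseteq> {ys. set ys \<subseteq> set xs}" by (rule image_subsetI) (use v_face in \<open>simp add: near_lists_def\<close>)
    finally show "supp (g xs) \<subseteq> {ys. set ys \<subseteq> set xs}"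
      unfolding g_def by (intro keys_diff_subset) (auto simp: keys_frag_of)
    show "bdry (g xs) = frag_extend g (bd xs)"
    proof -
      have "frag_extend g c = c - push v (frag_extend \<phi> c)" for c
        by (rule frag_additive_eqI[of "frag_extend g" "\<lambda>c. c - push v (frag_extend \<phi> c)"])
           (auto simp: g_def frag_extend_diff)
      then show ?thesis by (simp add: g_def push_bdry[symmetric] \<phi>(3)[OF xs])
    qed
  next
    fix xs :: "'a list" and z assume xs: "xs \<noteq> []" and z: "supp z \<subseteq> {ys. set ys \<subseteq> set xs}" "bdry z = 0"
    show "\<exists>w. supp w \<subseteq> {ys. set ys \<subseteq> set xs} \<and> bdry w = z"
    proof (intro exI conjI)
      have "(#) (hd xs) ` {ys. set ys \<subseteq> set xs} \<subseteq> {ys. set ys \<subseteq> set xs}"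
        using hd_in_set[OF xs] by auto
      then show "supp (prepend (hd xs) z) \<subseteq> {ys. set ys \<subseteq> set xs}"
        using keys_prepend[OF z(1), of "hd xs"] by blast
      show "bdry (prepend (hd xs) z) = z" by (simp add: bdry_prepend z(2))
    qed
  qed (auto simp: g_def \<phi>(1))
  show ?thesis
    unfolding acyclic_lists_def
  proof (intro allI impI)
    fix z assume z: "supp z \<subseteq> ?S" "bdry z = 0"
    define z' where "z' = frag_extend \<phi> z"
    have kz': "supp z' \<subseteq> near_lists ?Y X \<delta>"
      unfolding z'_def
      by (rule keys_frag_extend_subset[OF z(1)]) (use \<phi>(2) near_lists_mono[OF face_sub] in blast)
    have "bdry z' = frag_extend \<phi> (bdry z)"
      unfolding z'_def
      by (rule frag_additive_eqI[of "\<lambda>c. bdry (frag_extend \<phi> c)" "\<lambda>c. frag_extend \<phi> (bdry c)"])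
         (use z(1) \<phi>(3) in \<open>auto simp: frag_extend_diff\<close>)
    then have bz': "bdry z' = 0" using z(2) by simp
    obtain N where N: "1 / real (Suc N) < \<delta>" using nat_approx_posE[OF \<delta>(1)] by auto
    define u where "u k = real k / real (Suc N)" for k
    define H where "H k y = h (u k, y)" for k y
    have "\<exists>w. supp w \<subseteq> near_lists ?Y X \<epsilon> \<and> bdry w = push (H 0) z'"
    proof (rule contiguous_contraction[OF kz' bz', of N])
      fix k xs ys assume k: "k < Suc N" and xs: "xs \<in> near_lists ?Y X \<delta>"
        and ys: "set ys \<subseteq> H k ` set xs \<union> H (Suc k) ` set xs"
      have rep: "\<exists>j\<in>{k, Suc k}. \<exists>y'\<in>set xs. y = H j y'" if "y \<in> set ys" for y
        using ys that by auto
      have u01: "u j \<in> {0..1}" if "j \<in> {k, Suc k}" for j using that k by (auto simp: u_def)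
      show "ys \<in> near_lists ?Y X \<epsilon>"
        unfolding near_lists_def
      proof (intro CollectI conjI ballI subsetI)
        fix y assume "y \<in> set ys"
        then obtain j a where "j \<in> {k, Suc k}" "a \<in> set xs" "y = h (u j, a)"
          using rep[of y] by (auto simp: H_def)
        moreover have "a \<in> ?Y" using \<open>a \<in> set xs\<close> xs by (auto simp: near_lists_def)
        ultimately show "y \<in> ?Y"
          using continuous_map_image_subset_topspace[OF h(1)] u01[of j] by auto
      next
        fix y y' x assume *: "y \<in> set ys" "y' \<in> set ys" "x \<in> X"
        obtain i a where i: "i \<in> {k, Suc k}" "a \<in> set xs" "y = H i a" using rep[OF *(1)] by auto
        obtain j b where j: "j \<in> {k, Suc k}" "b \<in> set xs" "y' = H j b" using rep[OF *(2)] by auto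
        have "\<bar>u i - u j\<bar> \<le> 1 / real (Suc N)"
          using i(1) j(1) by (auto simp: u_def diff_divide_distrib[symmetric])
        then have "\<bar>u i - u j\<bar> < \<delta>" using N by linarith
        then show "\<bar>y x - y' x\<bar> < \<epsilon>"
          unfolding i(3) j(3) H_def
          by (intro \<delta>(2) u01 i(1) j(1) *(3)) (use i(2) j(2) xs in \<open>auto simp: near_lists_def\<close>)
      qed
    next
      show "H (Suc N) y = p" for y by (simp add: H_def u_def h(3))
      obtain y where "y \<in> ?Y" using \<open>?Y \<noteq> {}\<close> by blast
      then have "p \<in> ?Y"
        using continuous_map_image_subset_topspace[OF h(1)] h(3)[of y] by force
      fix ys assume "set ys \<subseteq> {p}"
      then have "\<forall>y\<in>set ys. y = p" by auto
      then show "ys \<in> near_lists ?Y X \<epsilon>" using \<open>p \<in> ?Y\<close> \<open>\<epsilon> > 0\<close>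
        by (auto simp: near_lists_def) (metis abs_zero diff_self)
    qed
    moreover have "push (H 0) z' = z'"
      by (rule push_ident) (simp add: H_def u_def h(2))
    ultimately obtain w where w: "supp w \<subseteq> near_lists ?Y X \<epsilon>" "bdry w = z'"
      by auto
    \<comment> \<open>If \<open>y\<close> and \<open>y'\<close> have distance less than \<open>\<epsilon>\<close>, the vertices \<open>v y\<close> and \<open>v y'\<close> both lie in the support of \<open>y\<close>.\<close>
    have "map v ` near_lists ?Y X \<epsilon> \<subseteq> ?S"
    proof (rule image_subsetI)
      fix ys assume ys: "ys \<in> near_lists ?Y X \<epsilon>"
      have pos: "y (v y') > 0" if "y \<in> set ys" "y' \<in> set ys" for y y'
      proof -
        have "y' \<in> ?Y" using ys that by (auto simp: near_lists_def)
        then have "\<bar>y (v y') - y' (v y')\<bar> < \<epsilon>" "y' (v y') \<ge> \<epsilon>"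
          using ys that v by (auto simp: near_lists_def)
        then show ?thesis by linarith
      qed
      have "leq (v y) (v y') \<or> leq (v y') (v y)" if "y \<in> set ys" "y' \<in> set ys" for y y'
      proof -
        have "y \<in> ?Y" "y' \<in> ?Y" using ys that by (auto simp: near_lists_def)
        then show ?thesis
          using pos[OF that(1,1)] pos[OF that] v(1)[of y] v(1)[of y'] unfolding topspace_realization by blast
      qed
      then show "map v ys \<in> ?S"
        using ys v(1) by (auto simp: comparable_lists_def near_lists_def)
    qed
    then have kw: "supp (push v w) \<subseteq> ?S"
      using keys_push[OF w(1), of v] by blast
    have kD: "supp (frag_extend D z) \<subseteq> ?S"
      by (rule keys_frag_extend_subset[OF z(1)]) (use D(2) mono in blast)
    have "bdry (frag_extend D z) + frag_extend D (bdry z) = z - push v z'"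
      unfolding z'_def
      by (rule frag_additive_eqI[of "\<lambda>z. bdry (frag_extend D z) + frag_extend D (bdry z)" "\<lambda>z. z - push v (frag_extend \<phi> z)"])
         (use z(1) D(3) in \<open>auto simp: frag_extend_diff g_def\<close>)
    then have "bdry (push v w + frag_extend D z) = z"
      using z(2) by (simp add: push_bdry[symmetric] w(2))
    then show "\<exists>w. supp w \<subseteq> ?S \<and> bdry w = z"
      using keys_add_subset[OF kw kD] by blast
  qed
qed

section \<open>Linear maps, free modules and quotients\<close>

lemma lin_mapI:
  assumes "\<And>x. x \<in> carrier M \<Longrightarrow> h x \<in> carrier N"
    and "\<And>x y. x \<in> carrier M \<Longrightarrow> y \<in> carrier M \<Longrightarrow> h (x \<oplus>\<^bsub>M\<^esub> y) = h x \<oplus>\<^bsub>N\<^esub> h y"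
    and "\<And>r x. r \<in> carrier R \<Longrightarrow> x \<in> carrier M \<Longrightarrow> h (r \<odot>\<^bsub>M\<^esub> x) = r \<odot>\<^bsub>N\<^esub> h x"
  shows "lin_map R M N h"
  using assms by (auto simp: lin_map_def)

lemma lin_mapD:
  assumes "lin_map R M N h"
  shows "x \<in> carrier M \<Longrightarrow> h x \<in> carrier N"
    and "x \<in> carrier M \<Longrightarrow> y \<in> carrier M \<Longrightarrow> h (x \<oplus>\<^bsub>M\<^esub> y) = h x \<oplus>\<^bsub>N\<^esub> h y"
    and "r \<in> carrier R \<Longrightarrow> x \<in> carrier M \<Longrightarrow> h (r \<odot>\<^bsub>M\<^esub> x) = r \<odot>\<^bsub>N\<^esub> h x"
  using assms by (auto simp: lin_map_def)

lemma lin_map_zero: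
  assumes "Module.module R M" "Module.module R N" "lin_map R M N h"
  shows "h \<zero>\<^bsub>M\<^esub> = \<zero>\<^bsub>N\<^esub>"
proof -
  interpret M: Module.module R M by fact
  interpret N: Module.module R N by fact
  have "h (\<zero>\<^bsub>R\<^esub> \<odot>\<^bsub>M\<^esub> \<zero>\<^bsub>M\<^esub>) = \<zero>\<^bsub>R\<^esub> \<odot>\<^bsub>N\<^esub> h \<zero>\<^bsub>M\<^esub>"
    by (rule lin_mapD(3)[OF assms(3)]) auto
  then show ?thesis using lin_mapD(1)[OF assms(3) M.zero_closed] by simp
qed

lemma lin_map_minus:
  assumes "Module.module R M" "Module.module R N" "lin_map R M N h"
  shows "x \<in> carrier M \<Longrightarrow> h (\<ominus>\<^bsub>M\<^esub> x) = \<ominus>\<^bsub>N\<^esub> h x"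
    and "x \<in> carrier M \<Longrightarrow> y \<in> carrier M \<Longrightarrow> h (x \<ominus>\<^bsub>M\<^esub> y) = h x \<ominus>\<^bsub>N\<^esub> h y"
proof -
  interpret M: Module.module R M by fact
  interpret N: Module.module R N by fact
  have *: "h (\<ominus>\<^bsub>M\<^esub> x) = \<ominus>\<^bsub>N\<^esub> h x" if "x \<in> carrier M" for x
  proof -
    have "h (\<ominus>\<^bsub>M\<^esub> x) \<oplus>\<^bsub>N\<^esub> h x = \<zero>\<^bsub>N\<^esub>"
      using lin_mapD(2)[OF assms(3), of "\<ominus>\<^bsub>M\<^esub> x" x] that lin_map_zero[OF assms(1-3)] by (simp add: M.M.l_neg)
    then show ?thesis
      using lin_mapD(1)[OF assms(3)] that by (intro N.M.minus_equality[symmetric]) auto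
  qed
  show "x \<in> carrier M \<Longrightarrow> h (\<ominus>\<^bsub>M\<^esub> x) = \<ominus>\<^bsub>N\<^esub> h x" by (rule *)
  show "h (x \<ominus>\<^bsub>M\<^esub> y) = h x \<ominus>\<^bsub>N\<^esub> h y" if "x \<in> carrier M" "y \<in> carrier M"
    using lin_mapD(2)[OF assms(3), of x "\<ominus>\<^bsub>M\<^esub> y"] that * by (simp add: a_minus_def)
qed

lemma lin_map_compose:
  assumes "lin_map R M N f" "lin_map R N K g"
  shows "lin_map R M K (\<lambda>x. g (f x))"
  using assms by (auto simp: lin_map_def Pi_iff)

lemma lin_map_cong:
  assumes "Module.module R M" "\<And>x. x \<in> carrier M \<Longrightarrow> f x = g x"
  shows "lin_map R M N f \<longleftrightarrow> lin_map R M N g"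
proof -
  interpret M: Module.module R M by fact
  show ?thesis using assms(2) by (auto simp: lin_map_def Pi_iff)
qed

lemma mod_isomorphic_trans:
  assumes "mod_isomorphic R M N" "mod_isomorphic R N K"
  shows "mod_isomorphic R M K"
proof -
  obtain f g where "lin_map R M N f" "bij_betw f (carrier M) (carrier N)"
    "lin_map R N K g" "bij_betw g (carrier N) (carrier K)"
    using assms by (auto simp: mod_isomorphic_def)
  then show ?thesis
    unfolding mod_isomorphic_def
    by (intro exI[of _ "\<lambda>x. g (f x)"]) (auto intro: lin_map_compose bij_betw_trans[unfolded comp_def])
qed

lemma submodule_abelian_subgroup:
  assumes "Module.module R M" "submodule N R M"
  shows "abelian_subgroup N M"
proof -
  interpret M: Module.module R M by fact
  show ?thesis
    by (rule abelian_subgroupI3) (auto intro: additive_subgroup.intro submodule.axioms(1)[OF assms(2)] M.abelian_group_axioms)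
qed

lemma
  assumes "Module.module R M" "submodule N R M"
  shows submodule_carrier: "x \<in> N \<Longrightarrow> x \<in> carrier M"
    and submodule_zero: "\<zero>\<^bsub>M\<^esub> \<in> N"
    and submodule_add: "x \<in> N \<Longrightarrow> y \<in> N \<Longrightarrow> x \<oplus>\<^bsub>M\<^esub> y \<in> N"
    and submodule_minus: "x \<in> N \<Longrightarrow> \<ominus>\<^bsub>M\<^esub> x \<in> N"
    and submodule_smult: "r \<in> carrier R \<Longrightarrow> x \<in> N \<Longrightarrow> r \<odot>\<^bsub>M\<^esub> x \<in> N"
proof -
  interpret M: Module.module R M by fact
  interpret N: abelian_subgroup N M by (rule submodule_abelian_subgroup[OF assms])
  show "x \<in> N \<Longrightarrow> x \<in> carrier M" by simp
  show "\<zero>\<^bsub>M\<^esub> \<in> N" by simp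
  show "x \<in> N \<Longrightarrow> y \<in> N \<Longrightarrow> x \<oplus>\<^bsub>M\<^esub> y \<in> N" by simp
  show "x \<in> N \<Longrightarrow> \<ominus>\<^bsub>M\<^esub> x \<in> N" by simp
  show "r \<in> carrier R \<Longrightarrow> x \<in> N \<Longrightarrow> r \<odot>\<^bsub>M\<^esub> x \<in> N" by (rule submodule.smult_closed[OF assms(2)])
qed

lemma
  assumes M: "Module.module R M" and N: "submodule N R M" and x: "x \<in> carrier M"
  shows coset_self: "x \<in> N +>\<^bsub>M\<^esub> x"
    and coset_carrier: "y \<in> N +>\<^bsub>M\<^esub> x \<Longrightarrow> y \<in> carrier M"
    and coset_eq_iff: "y \<in> carrier M \<Longrightarrow> N +>\<^bsub>M\<^esub> x = N +>\<^bsub>M\<^esub> y \<longleftrightarrow> x \<ominus>\<^bsub>M\<^esub> y \<in> N"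
    and coset_mem_eq: "y \<in> N +>\<^bsub>M\<^esub> x \<Longrightarrow> N +>\<^bsub>M\<^esub> y = N +>\<^bsub>M\<^esub> x"
    and coset_add: "y \<in> carrier M \<Longrightarrow> (N +>\<^bsub>M\<^esub> x) <+>\<^bsub>M\<^esub> (N +>\<^bsub>M\<^esub> y) = N +>\<^bsub>M\<^esub> (x \<oplus>\<^bsub>M\<^esub> y)"
    and coset_smult: "r \<in> carrier R \<Longrightarrow> (\<Union>a\<in>N +>\<^bsub>M\<^esub> x. N +>\<^bsub>M\<^esub> (r \<odot>\<^bsub>M\<^esub> a)) = N +>\<^bsub>M\<^esub> (r \<odot>\<^bsub>M\<^esub> x)"
proof -
  interpret M: Module.module R M by fact
  interpret N: abelian_subgroup N M by (rule submodule_abelian_subgroup[OF M N])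
  show self: "x \<in> N +>\<^bsub>M\<^esub> x" by (rule N.a_rcos_self[OF x])
  show carr: "y \<in> carrier M" if "y \<in> N +>\<^bsub>M\<^esub> x" for y by (rule N.a_elemrcos_carrier[OF x that])
  show eq: "N +>\<^bsub>M\<^esub> x = N +>\<^bsub>M\<^esub> y \<longleftrightarrow> x \<ominus>\<^bsub>M\<^esub> y \<in> N" if "y \<in> carrier M" for y
    using N.a_rcos_module[OF that x] N.a_repr_independence'[of x y] that self by (auto simp: a_minus_def)
  show meq: "N +>\<^bsub>M\<^esub> y = N +>\<^bsub>M\<^esub> x" if "y \<in> N +>\<^bsub>M\<^esub> x" for y
    using N.a_repr_independence'[OF that x] by simp
  show "y \<in> carrier M \<Longrightarrow> (N +>\<^bsub>M\<^esub> x) <+>\<^bsub>M\<^esub> (N +>\<^bsub>M\<^esub> y) = N +>\<^bsub>M\<^esub> (x \<oplus>\<^bsub>M\<^esub> y)"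
    by (rule N.a_rcos_sum[OF x])
  show "(\<Union>a\<in>N +>\<^bsub>M\<^esub> x. N +>\<^bsub>M\<^esub> (r \<odot>\<^bsub>M\<^esub> a)) = N +>\<^bsub>M\<^esub> (r \<odot>\<^bsub>M\<^esub> x)" if r: "r \<in> carrier R"
  proof -
    have "N +>\<^bsub>M\<^esub> (r \<odot>\<^bsub>M\<^esub> a) = N +>\<^bsub>M\<^esub> (r \<odot>\<^bsub>M\<^esub> x)" if a: "a \<in> N +>\<^bsub>M\<^esub> x" for a
    proof -
      have "a \<oplus>\<^bsub>M\<^esub> \<ominus>\<^bsub>M\<^esub> x \<in> N" by (rule N.a_rcos_module_imp[OF x a])
      then have "r \<odot>\<^bsub>M\<^esub> (a \<oplus>\<^bsub>M\<^esub> \<ominus>\<^bsub>M\<^esub> x) \<in> N" by (rule submodule_smult[OF M N r])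
      then have "r \<odot>\<^bsub>M\<^esub> a \<oplus>\<^bsub>M\<^esub> \<ominus>\<^bsub>M\<^esub> (r \<odot>\<^bsub>M\<^esub> x) \<in> N"
        using r x carr[OF a] by (simp add: M.smult_r_distr M.smult_r_minus)
      then have "r \<odot>\<^bsub>M\<^esub> a \<in> N +>\<^bsub>M\<^esub> (r \<odot>\<^bsub>M\<^esub> x)"
        using r x carr[OF a] by (intro N.a_rcos_module_rev) auto
      then show ?thesis using N.a_repr_independence'[of "r \<odot>\<^bsub>M\<^esub> a"] r x by auto
    qed
    then show ?thesis using self by blast
  qed
qed

lemma quot_mod_sel:
  "carrier (quot_mod M N) = a_rcosets\<^bsub>M\<^esub> N" "add (quot_mod M N) = (<+>\<^bsub>M\<^esub>)"
  "smult (quot_mod M N) = (\<lambda>r A. \<Union>a\<in>A. N +>\<^bsub>M\<^esub> (r \<odot>\<^bsub>M\<^esub> a))"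
  by (simp_all add: quot_mod_def)

lemma
  assumes "Module.module R M" "submodule N R M" "x \<in> carrier M"
  shows quot_mod_add: "y \<in> carrier M \<Longrightarrow>
      (N +>\<^bsub>M\<^esub> x) \<oplus>\<^bsub>quot_mod M N\<^esub> (N +>\<^bsub>M\<^esub> y) = N +>\<^bsub>M\<^esub> (x \<oplus>\<^bsub>M\<^esub> y)"
    and quot_mod_smult: "r \<in> carrier R \<Longrightarrow> r \<odot>\<^bsub>quot_mod M N\<^esub> (N +>\<^bsub>M\<^esub> x) = N +>\<^bsub>M\<^esub> (r \<odot>\<^bsub>M\<^esub> x)"
  by (simp_all add: quot_mod_sel coset_add[OF assms] coset_smult[OF assms])

lemma quot_mod_carrier_iff: "A \<in> carrier (quot_mod M N) \<longleftrightarrow> (\<exists>x\<in>carrier M. A = N +>\<^bsub>M\<^esub> x)"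
  by (auto simp: quot_mod_sel A_RCOSETS_def')

lemma quot_mod_isomorphic:
  assumes Z: "Module.module R Z" and Z': "Module.module R Z'"
    and B: "submodule B R Z" and B': "submodule B' R Z'"
    and h: "lin_map R Z Z' h"
    and hB: "\<And>z. z \<in> carrier Z \<Longrightarrow> h z \<in> B' \<longleftrightarrow> z \<in> B"
    and surj: "\<And>z'. z' \<in> carrier Z' \<Longrightarrow> \<exists>z\<in>carrier Z. z' \<ominus>\<^bsub>Z'\<^esub> h z \<in> B'"
  shows "mod_isomorphic R (quot_mod Z B) (quot_mod Z' B')"
proof -
  interpret Z: Module.module R Z by fact
  interpret Z': Module.module R Z' by fact
  note hc = lin_mapD(1)[OF h]
  have eq: "B' +>\<^bsub>Z'\<^esub> h x = B' +>\<^bsub>Z'\<^esub> h y \<longleftrightarrow> B +>\<^bsub>Z\<^esub> x = B +>\<^bsub>Z\<^esub> y" if "x \<in> carrier Z" "y \<in> carrier Z" for x y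
    using that hB[of "x \<ominus>\<^bsub>Z\<^esub> y"]
    by (simp add: coset_eq_iff[OF Z B] coset_eq_iff[OF Z' B'] hc lin_map_minus(2)[OF Z Z' h])
  define H where "H A = (\<Union>a\<in>A. B' +>\<^bsub>Z'\<^esub> h a)" for A
  have H: "H (B +>\<^bsub>Z\<^esub> x) = B' +>\<^bsub>Z'\<^esub> h x" if x: "x \<in> carrier Z" for x
  proof -
    have "B' +>\<^bsub>Z'\<^esub> h a = B' +>\<^bsub>Z'\<^esub> h x" if "a \<in> B +>\<^bsub>Z\<^esub> x" for a
      using eq[OF coset_carrier[OF Z B x that] x] coset_mem_eq[OF Z B x that] by simp
    then show ?thesis using coset_self[OF Z B x] unfolding H_def by blast
  qed
  show ?thesis
    unfolding mod_isomorphic_def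
  proof (intro exI conjI)
    show "lin_map R (quot_mod Z B) (quot_mod Z' B') H"
      by (rule lin_mapI)
         (auto simp: quot_mod_carrier_iff H quot_mod_add[OF Z B] quot_mod_add[OF Z' B']
            quot_mod_smult[OF Z B] quot_mod_smult[OF Z' B'] hc lin_mapD(2,3)[OF h])
    show "bij_betw H (carrier (quot_mod Z B)) (carrier (quot_mod Z' B'))"
    proof (rule bij_betw_imageI)
      show "inj_on H (carrier (quot_mod Z B))"
        by (rule inj_onI) (auto simp: quot_mod_carrier_iff H eq)
      have "\<exists>z\<in>carrier Z. B' +>\<^bsub>Z'\<^esub> z' = B' +>\<^bsub>Z'\<^esub> h z" if z': "z' \<in> carrier Z'" for z'
        using surj[OF z'] coset_eq_iff[OF Z' B' z'] hc by blast
      then show "H ` carrier (quot_mod Z B) = carrier (quot_mod Z' B')"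
        using H hc by (fastforce simp: quot_mod_carrier_iff image_iff)
    qed
  qed
qed

section \<open>Free modules\<close>

lemma free_mod_sel:
  "carrier (free_mod R S) = {a. (\<forall>s\<in>S. a s \<in> carrier R) \<and> (\<forall>s. s \<notin> S \<longrightarrow> a s = \<zero>\<^bsub>R\<^esub>) \<and> finite {s. a s \<noteq> \<zero>\<^bsub>R\<^esub>}}"
  "zero (free_mod R S) = (\<lambda>_. \<zero>\<^bsub>R\<^esub>)" "add (free_mod R S) = (\<lambda>a b s. a s \<oplus>\<^bsub>R\<^esub> b s)"
  "smult (free_mod R S) = (\<lambda>r a s. r \<otimes>\<^bsub>R\<^esub> a s)"
  by (simp_all add: free_mod_def)

definition lin_ext :: "('r, 'q) ring_scheme \<Rightarrow> ('r, 'm) module \<Rightarrow> ('s \<Rightarrow> 'm) \<Rightarrow> ('s \<Rightarrow> 'r) \<Rightarrow> 'm" where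
  "lin_ext R N \<tau> a = (\<Oplus>\<^bsub>N\<^esub>s\<in>{s. a s \<noteq> \<zero>\<^bsub>R\<^esub>}. a s \<odot>\<^bsub>N\<^esub> \<tau> s)"

context cring
begin

lemma free_mod_coeff: "a \<in> carrier (free_mod R S) \<Longrightarrow> a s \<in> carrier R"
  by (cases "s \<in> S") (auto simp: free_mod_sel)

lemma free_mod_supp: "a \<in> carrier (free_mod R S) \<Longrightarrow> finite {s. a s \<noteq> \<zero>}"
  "a \<in> carrier (free_mod R S) \<Longrightarrow> {s. a s \<noteq> \<zero>} \<subseteq> S"
  by (auto simp: free_mod_sel)

lemma free_mod_memI:
  assumes "\<And>s. s \<in> S \<Longrightarrow> a s \<in> carrier R" "finite A" "A \<subseteq> S" "\<And>s. s \<notin> A \<Longrightarrow> a s = \<zero>"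
  shows "a \<in> carrier (free_mod R S)"
proof -
  have "{s. a s \<noteq> \<zero>} \<subseteq> A" using assms(4) by auto
  then show ?thesis using assms finite_subset by (auto simp: free_mod_sel)
qed

lemma free_mod_module: "Module.module R (free_mod R S)"
proof (rule moduleI)
  have add: "(\<lambda>s. a s \<oplus> b s) \<in> carrier (free_mod R S)"
    if "a \<in> carrier (free_mod R S)" "b \<in> carrier (free_mod R S)" for a b
    using that by (intro free_mod_memI[where A = "{s. a s \<noteq> \<zero>} \<union> {s. b s \<noteq> \<zero>}"]) (auto simp: free_mod_sel)
  have smult: "(\<lambda>s. r \<otimes> a s) \<in> carrier (free_mod R S)" if "r \<in> carrier R" "a \<in> carrier (free_mod R S)" for a r
    using that by (intro free_mod_memI[where A = "{s. a s \<noteq> \<zero>}"]) (auto simp: free_mod_sel)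
  show "cring R" by (rule is_cring)
  show "abelian_group (free_mod R S)"
  proof (rule abelian_groupI)
    fix a assume a: "a \<in> carrier (free_mod R S)"
    have "(\<lambda>s. \<ominus> a s) \<in> carrier (free_mod R S)"
      using a by (intro free_mod_memI[where A = "{s. a s \<noteq> \<zero>}"]) (auto simp: free_mod_sel)
    then show "\<exists>b\<in>carrier (free_mod R S). b \<oplus>\<^bsub>free_mod R S\<^esub> a = \<zero>\<^bsub>free_mod R S\<^esub>"
      by (rule bexI[rotated]) (use free_mod_coeff[OF a] in \<open>simp add: free_mod_sel(2,3) l_neg\<close>)
  qed (use add free_mod_coeff[where S = S] in \<open>auto simp: free_mod_sel(2-4) a_ac intro!: ext free_mod_memI[where A = "{}"]\<close>)
  show "r \<odot>\<^bsub>free_mod R S\<^esub> a \<in> carrier (free_mod R S)" if "r \<in> carrier R" "a \<in> carrier (free_mod R S)" for r a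
    using smult[OF that] by (simp add: free_mod_sel(4))
qed (use free_mod_coeff[where S = S] in \<open>auto simp: free_mod_sel(2-4) l_distr r_distr m_assoc intro!: ext\<close>)

lemma delta_in_free_mod: "s \<in> S \<Longrightarrow> delta R s \<in> carrier (free_mod R S)"
  by (rule free_mod_memI[where A = "{s}"]) (auto simp: delta_def)

text \<open>By induction on the size of the support.\<close>

lemma free_mod_induct [consumes 1, case_names zero delta add smult]:
  assumes a: "a \<in> carrier (free_mod R S)" and zero: "P \<zero>\<^bsub>free_mod R S\<^esub>"
    and delta: "\<And>s. s \<in> S \<Longrightarrow> P (delta R s)"
    and add: "\<And>a b. a \<in> carrier (free_mod R S) \<Longrightarrow> b \<in> carrier (free_mod R S) \<Longrightarrow> P a \<Longrightarrow> P b \<Longrightarrow>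
                 P (a \<oplus>\<^bsub>free_mod R S\<^esub> b)"
    and smult: "\<And>r a. r \<in> carrier R \<Longrightarrow> a \<in> carrier (free_mod R S) \<Longrightarrow> P a \<Longrightarrow> P (r \<odot>\<^bsub>free_mod R S\<^esub> a)"
  shows "P a"
proof -
  have "finite A \<Longrightarrow> A \<subseteq> S \<Longrightarrow> a \<in> carrier (free_mod R S) \<Longrightarrow> (\<forall>s. s \<notin> A \<longrightarrow> a s = \<zero>) \<Longrightarrow> P a" for A
  proof (induction A arbitrary: a rule: finite_induct)
    case empty
    then have "a = \<zero>\<^bsub>free_mod R S\<^esub>" by (auto simp: free_mod_sel)
    then show ?case using zero by simp
  next
    case (insert s A)
    let ?b = "\<lambda>t. if t = s then \<zero> else a t"
    have b: "?b \<in> carrier (free_mod R S)"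
      using insert.prems insert.hyps by (intro free_mod_memI[where A = A]) (auto simp: free_mod_sel)
    have "P ?b" using insert.prems by (intro insert.IH b) auto
    moreover have "P (a s \<odot>\<^bsub>free_mod R S\<^esub> delta R s)"
      using insert.prems by (intro smult delta delta_in_free_mod free_mod_coeff) auto
    moreover have "a s \<odot>\<^bsub>free_mod R S\<^esub> delta R s \<in> carrier (free_mod R S)"
      using insert.prems by (intro Module.module.smult_closed[OF free_mod_module] delta_in_free_mod free_mod_coeff) auto
    moreover have "a = (a s \<odot>\<^bsub>free_mod R S\<^esub> delta R s) \<oplus>\<^bsub>free_mod R S\<^esub> ?b"
      using free_mod_coeff[OF insert.prems(2)] by (auto simp: free_mod_sel delta_def)
    ultimately show ?case using add[OF _ b] by metis
  qed
  then show ?thesis using a free_mod_supp[OF a] by blast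
qed

lemma lin_ext_superset:
  assumes N: "Module.module R N" and a: "a \<in> carrier (free_mod R S)" and \<tau>: "\<And>s. s \<in> S \<Longrightarrow> \<tau> s \<in> carrier N"
    and A: "finite A" "{s. a s \<noteq> \<zero>} \<subseteq> A" "A \<subseteq> S"
  shows "lin_ext R N \<tau> a = (\<Oplus>\<^bsub>N\<^esub>s\<in>A. a s \<odot>\<^bsub>N\<^esub> \<tau> s)"
proof -
  interpret N: Module.module R N by fact
  show ?thesis
    unfolding lin_ext_def
    by (rule N.add.finprod_mono_neutral_cong_left)
       (use assms free_mod_coeff[OF a] in \<open>auto\<close>)
qed

lemma lin_ext_lin_map:
  assumes N: "Module.module R N" and \<tau>: "\<And>s. s \<in> S \<Longrightarrow> \<tau> s \<in> carrier N"
  shows "lin_map R (free_mod R S) N (lin_ext R N \<tau>)"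
proof -
  interpret N: Module.module R N by fact
  interpret F: Module.module R "free_mod R S" by (rule free_mod_module)
  have *: "finite A \<Longrightarrow> A \<subseteq> S \<Longrightarrow> (\<lambda>s. a s \<odot>\<^bsub>N\<^esub> \<tau> s) \<in> A \<rightarrow> carrier N" if "a \<in> carrier (free_mod R S)" for a A
    using free_mod_coeff[OF that] \<tau> by auto
  show ?thesis
  proof (rule lin_mapI)
    fix a assume a: "a \<in> carrier (free_mod R S)"
    then show "lin_ext R N \<tau> a \<in> carrier N"
      unfolding lin_ext_def by (intro N.M.finsum_closed * free_mod_supp)
    fix r assume r: "r \<in> carrier R"
    let ?A = "{s. a s \<noteq> \<zero>}"
    have "{s. r \<otimes> a s \<noteq> \<zero>} \<subseteq> ?A" using r by auto
    then have "lin_ext R N \<tau> (r \<odot>\<^bsub>free_mod R S\<^esub> a) = (\<Oplus>\<^bsub>N\<^esub>s\<in>?A. (r \<otimes> a s) \<odot>\<^bsub>N\<^esub> \<tau> s)"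
      using lin_ext_superset[where \<tau> = \<tau> and A = ?A, OF N F.smult_closed[OF r a] \<tau> free_mod_supp(1)[OF a] _ free_mod_supp(2)[OF a]]
      by (simp add: free_mod_sel(4))
    also have "\<dots> = (\<Oplus>\<^bsub>N\<^esub>s\<in>?A. r \<odot>\<^bsub>N\<^esub> (a s \<odot>\<^bsub>N\<^esub> \<tau> s))"
      using free_mod_coeff[OF a] free_mod_supp(2)[OF a] \<tau> r
      by (intro N.M.finsum_cong') (auto simp: N.smult_assoc1)
    also have "\<dots> = r \<odot>\<^bsub>N\<^esub> lin_ext R N \<tau> a"
      unfolding lin_ext_def using N.finsum_smult_ldistr[OF free_mod_supp(1)[OF a] r *[OF a]] free_mod_supp[OF a] by simp
    finally show "lin_ext R N \<tau> (r \<odot>\<^bsub>free_mod R S\<^esub> a) = r \<odot>\<^bsub>N\<^esub> lin_ext R N \<tau> a" .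
  next
    fix a b assume a: "a \<in> carrier (free_mod R S)" and b: "b \<in> carrier (free_mod R S)"
    let ?A = "{s. a s \<noteq> \<zero>} \<union> {s. b s \<noteq> \<zero>}"
    have A: "finite ?A" "?A \<subseteq> S" using free_mod_supp[OF a] free_mod_supp[OF b] by auto
    have "{s. a s \<oplus> b s \<noteq> \<zero>} \<subseteq> ?A" by auto
    then have "lin_ext R N \<tau> (a \<oplus>\<^bsub>free_mod R S\<^esub> b) = (\<Oplus>\<^bsub>N\<^esub>s\<in>?A. (a s \<oplus> b s) \<odot>\<^bsub>N\<^esub> \<tau> s)"
      using lin_ext_superset[where \<tau> = \<tau> and A = ?A, OF N F.M.a_closed[OF a b] \<tau> A(1) _ A(2)] by (simp add: free_mod_sel(3))
    also have "\<dots> = (\<Oplus>\<^bsub>N\<^esub>s\<in>?A. a s \<odot>\<^bsub>N\<^esub> \<tau> s \<oplus>\<^bsub>N\<^esub> b s \<odot>\<^bsub>N\<^esub> \<tau> s)"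
      using free_mod_coeff[OF a] free_mod_coeff[OF b] A(2) \<tau>
      by (intro N.M.finsum_cong') (auto simp: N.smult_l_distr)
    also have "\<dots> = (\<Oplus>\<^bsub>N\<^esub>s\<in>?A. a s \<odot>\<^bsub>N\<^esub> \<tau> s) \<oplus>\<^bsub>N\<^esub> (\<Oplus>\<^bsub>N\<^esub>s\<in>?A. b s \<odot>\<^bsub>N\<^esub> \<tau> s)"
      by (intro N.M.finsum_addf * a b A)
    also have "\<dots> = lin_ext R N \<tau> a \<oplus>\<^bsub>N\<^esub> lin_ext R N \<tau> b"
      using lin_ext_superset[where \<tau> = \<tau> and A = ?A, OF N a \<tau> A(1) _ A(2)]
        lin_ext_superset[where \<tau> = \<tau> and A = ?A, OF N b \<tau> A(1) _ A(2)] by auto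
    finally show "lin_ext R N \<tau> (a \<oplus>\<^bsub>free_mod R S\<^esub> b) = lin_ext R N \<tau> a \<oplus>\<^bsub>N\<^esub> lin_ext R N \<tau> b" .
  qed
qed

lemma lin_ext_delta:
  assumes N: "Module.module R N" and "\<tau> s \<in> carrier N"
  shows "lin_ext R N \<tau> (delta R s) = \<tau> s"
proof -
  interpret N: Module.module R N by fact
  have "lin_ext R N \<tau> (delta R s) = (\<Oplus>\<^bsub>N\<^esub>t\<in>{s}. delta R s t \<odot>\<^bsub>N\<^esub> \<tau> t)"
    by (rule lin_ext_superset[OF N delta_in_free_mod[of s "{s}"]]) (use assms(2) in \<open>auto simp: delta_def\<close>)
  also have "\<dots> = \<tau> s" using assms(2) by (simp add: delta_def)
  finally show ?thesis .
qed

lemma lin_map_eqI: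
  assumes N: "Module.module R N" and f: "lin_map R (free_mod R S) N f" and g: "lin_map R (free_mod R S) N g"
    and eq: "\<And>s. s \<in> S \<Longrightarrow> f (delta R s) = g (delta R s)" and a: "a \<in> carrier (free_mod R S)"
  shows "f a = g a"
  using a
proof (induction rule: free_mod_induct)
  case zero
  show ?case using lin_map_zero[OF free_mod_module N f] lin_map_zero[OF free_mod_module N g] by simp
qed (simp_all add: eq lin_mapD(2,3)[OF f] lin_mapD(2,3)[OF g])

lemma lin_map_free_in_submodule:
  assumes N: "Module.module R N" and f: "lin_map R (free_mod R S) N f" and K: "submodule K R N"
    and "\<And>s. s \<in> S \<Longrightarrow> f (delta R s) \<in> K" and a: "a \<in> carrier (free_mod R S)"
  shows "f a \<in> K"
  using a
proof (induction rule: free_mod_induct)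
  case zero
  show ?case using lin_map_zero[OF free_mod_module N f] submodule_zero[OF N K] by simp
qed (simp_all add: assms(4) lin_mapD(2,3)[OF f] submodule_add[OF N K] submodule_smult[OF N K])

text \<open>The map \<open>\<int>[S] \<rightarrow> R[S]\<close>. Chain homotopies are constructed over the integers, where the additive maps
between free groups are given by their values on the basis, and then transported to \<open>R\<close> along it.\<close>

definition base_change :: "('s \<Rightarrow>\<^sub>0 int) \<Rightarrow> 's \<Rightarrow> 'a" where
  "base_change c s = add_pow R (Poly_Mapping.lookup c s) \<one>"

lemma add_pow_int_01: "add_pow R (0::int) a = \<zero>" "a \<in> carrier R \<Longrightarrow> add_pow R (1::int) a = a"
proof -
  have "add_pow R (0::nat) a = \<zero>" "a \<in> carrier R \<Longrightarrow> add_pow R (1::nat) a = a"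
    by (simp_all add: add_pow_def nat_pow_def)
  then show "add_pow R (0::int) a = \<zero>" "a \<in> carrier R \<Longrightarrow> add_pow R (1::int) a = a"
    by (simp_all add: add_pow_int_ge)
qed

lemma base_change_closed:
  "supp c \<subseteq> S \<Longrightarrow> base_change c \<in> carrier (free_mod R S)"
  by (rule free_mod_memI[where A = "supp c"]) (auto simp: base_change_def in_keys_iff add_pow_int_01)

lemma base_change_frag_of: "base_change (frag_of s) = delta R s"
  by (rule ext) (simp add: base_change_def delta_def add_pow_int_01)

lemma base_change_zero: "base_change 0 = \<zero>\<^bsub>free_mod R S\<^esub>"
  by (rule ext) (simp add: base_change_def free_mod_sel add_pow_int_01)

lemma base_change_add: "base_change (c + d) = base_change c \<oplus>\<^bsub>free_mod R S\<^esub> base_change d"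
  by (auto simp: base_change_def free_mod_sel lookup_add add.int_pow_mult)

lemma base_change_diff:
  assumes "supp c \<subseteq> S" "supp d \<subseteq> S"
  shows "base_change (c - d) = base_change c \<ominus>\<^bsub>free_mod R S\<^esub> base_change d"
proof -
  interpret F: Module.module R "free_mod R S" by (rule free_mod_module)
  have "base_change (c - d) \<oplus>\<^bsub>free_mod R S\<^esub> base_change d = base_change c"
    by (simp flip: base_change_add)
  moreover have "base_change (c - d) \<in> carrier (free_mod R S)"
    by (intro base_change_closed keys_diff_subset assms)
  ultimately show ?thesis
    using base_change_closed[OF assms(2)]
    by (metis F.M.add.inv_closed F.M.add.m_assoc F.M.r_neg F.M.r_zero a_minus_def)
qed

lemma lin_ext_base_change:
  assumes c: "supp c \<subseteq> S" and F: "\<And>s. s \<in> S \<Longrightarrow> supp (F s) \<subseteq> T"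
  shows "lin_ext R (free_mod R T) (\<lambda>s. base_change (F s)) (base_change c) = base_change (frag_extend F c)"
proof -
  let ?L = "lin_ext R (free_mod R T) (\<lambda>s. base_change (F s))"
  have lin: "lin_map R (free_mod R S) (free_mod R T) ?L"
    by (rule lin_ext_lin_map[OF free_mod_module]) (rule base_change_closed[OF F])
  have "supp c \<subseteq> S \<and> ?L (base_change c) = base_change (frag_extend F c)"
    using c
  proof (induction c rule: frag_induction)
    case zero
    show ?case
      using lin_map_zero[OF free_mod_module free_mod_module lin] by (simp add: base_change_zero[of S] base_change_zero[of T])
  next
    case (one s)
    then show ?case
      by (simp add: base_change_frag_of lin_ext_delta[OF free_mod_module] base_change_closed[OF F] keys_frag_of)
  next
    case (diff c d)
    have k: "supp (frag_extend F c) \<subseteq> T" "supp (frag_extend F d) \<subseteq> T"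
      using diff keys_frag_extend_subset F by metis+
    show ?case
      using diff k by (simp add: keys_diff_subset frag_extend_diff base_change_diff[of _ S] base_change_diff[of _ T]
          lin_map_minus(2)[OF free_mod_module free_mod_module lin] base_change_closed)
  qed
  then show ?thesis by simp
qed

end

section \<open>Modules over a category\<close>

definition category :: "('o, 'a) cat \<Rightarrow> bool" where
  "category D \<longleftrightarrow>
     (\<forall>x\<in>Obj D. Idt D x \<in> Hom D x x) \<and>
     (\<forall>x\<in>Obj D. \<forall>y\<in>Obj D. \<forall>z\<in>Obj D. \<forall>f\<in>Hom D x y. \<forall>g\<in>Hom D y z. Comp D x y z g f \<in> Hom D x z) \<and>
     (\<forall>x\<in>Obj D. \<forall>y\<in>Obj D. \<forall>f\<in>Hom D x y. Comp D x x y f (Idt D x) = f \<and> Comp D x y y (Idt D y) f = f) \<and>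
     (\<forall>x\<in>Obj D. \<forall>y\<in>Obj D. \<forall>z\<in>Obj D. \<forall>w\<in>Obj D. \<forall>f\<in>Hom D x y. \<forall>g\<in>Hom D y z. \<forall>h\<in>Hom D z w.
        Comp D x y w (Comp D y z w h g) f = Comp D x z w h (Comp D x y z g f))"

lemma categoryD:
  assumes "category D"
  shows "x \<in> Obj D \<Longrightarrow> Idt D x \<in> Hom D x x"
    and "x \<in> Obj D \<Longrightarrow> y \<in> Obj D \<Longrightarrow> z \<in> Obj D \<Longrightarrow> f \<in> Hom D x y \<Longrightarrow> g \<in> Hom D y z \<Longrightarrow>
           Comp D x y z g f \<in> Hom D x z"
    and "x \<in> Obj D \<Longrightarrow> y \<in> Obj D \<Longrightarrow> f \<in> Hom D x y \<Longrightarrow> Comp D x x y f (Idt D x) = f"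
    and "x \<in> Obj D \<Longrightarrow> y \<in> Obj D \<Longrightarrow> f \<in> Hom D x y \<Longrightarrow> Comp D x y y (Idt D y) f = f"
    and "x \<in> Obj D \<Longrightarrow> y \<in> Obj D \<Longrightarrow> z \<in> Obj D \<Longrightarrow> w \<in> Obj D \<Longrightarrow> f \<in> Hom D x y \<Longrightarrow> g \<in> Hom D y z \<Longrightarrow> h \<in> Hom D z w \<Longrightarrow>
           Comp D x y w (Comp D y z w h g) f = Comp D x z w h (Comp D x y z g f)"
  using assms unfolding category_def by blast+

lemma contra_functorD:
  assumes "contra_functor R D F"
  shows "x \<in> Obj D \<Longrightarrow> Module.module R (At F x)"
    and "x \<in> Obj D \<Longrightarrow> y \<in> Obj D \<Longrightarrow> f \<in> Hom D x y \<Longrightarrow> lin_map R (At F y) (At F x) (Act F x y f)"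
    and "x \<in> Obj D \<Longrightarrow> m \<in> carrier (At F x) \<Longrightarrow> Act F x x (Idt D x) m = m"
    and "x \<in> Obj D \<Longrightarrow> y \<in> Obj D \<Longrightarrow> z \<in> Obj D \<Longrightarrow> f \<in> Hom D x y \<Longrightarrow> g \<in> Hom D y z \<Longrightarrow> m \<in> carrier (At F z) \<Longrightarrow>
           Act F x z (Comp D x y z g f) m = Act F x y f (Act F y z g m)"
  using assms unfolding contra_functor_def by blast+

lemma contra_functor_closed:
  assumes "contra_functor R D F" "x \<in> Obj D" "y \<in> Obj D" "f \<in> Hom D x y" "m \<in> carrier (At F y)"
  shows "Act F x y f m \<in> carrier (At F x)"
  by (rule lin_mapD(1)[OF contra_functorD(2)[OF assms(1-4)] assms(5)])

lemma nat_transD: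
  assumes "\<eta> \<in> nat_trans R D P F"
  shows "x \<in> Obj D \<Longrightarrow> lin_map R (At P x) (At F x) (\<eta> x)"
    and "x \<in> Obj D \<Longrightarrow> p \<in> carrier (At P x) \<Longrightarrow> \<eta> x p \<in> carrier (At F x)"
    and "x \<in> Obj D \<Longrightarrow> y \<in> Obj D \<Longrightarrow> f \<in> Hom D x y \<Longrightarrow> p \<in> carrier (At P y) \<Longrightarrow> \<eta> x (Act P x y f p) = Act F x y f (\<eta> y p)"
  using assms by (auto simp: nat_trans_def lin_map_def)

lemma nat_trans_eqI:
  assumes "\<eta> \<in> nat_trans R D P F" "\<theta> \<in> nat_trans R D P F"
    and "\<And>x p. x \<in> Obj D \<Longrightarrow> p \<in> carrier (At P x) \<Longrightarrow> \<eta> x p = \<theta> x p"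
  shows "\<eta> = \<theta>"
proof (rule ext)
  fix x
  show "\<eta> x = \<theta> x"
  proof (cases "x \<in> Obj D")
    case True
    then have "\<eta> x \<in> carrier (At P x) \<rightarrow>\<^sub>E carrier (At F x)" "\<theta> x \<in> carrier (At P x) \<rightarrow>\<^sub>E carrier (At F x)"
      using assms(1,2) by (auto simp: nat_trans_def)
    then show ?thesis using assms(3)[OF True] by (rule PiE_ext)
  next
    case False
    then show ?thesis using assms(1,2) by (auto simp: nat_trans_def PiE_def extensional_def)
  qed
qed

text \<open>Natural transformations are stored as functions that are undefined outside the carriers; \<open>mk_nat\<close>
brings given components into that form, so that equality can be tested pointwise.\<close>

definition mk_nat :: "('o, 'a) cat \<Rightarrow> ('o, 'a, 'r, 'm) mfunctor \<Rightarrow> ('o \<Rightarrow> 'm \<Rightarrow> 'n) \<Rightarrow> 'o \<Rightarrow> 'm \<Rightarrow> 'n" where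
  "mk_nat D P \<theta> = (\<lambda>x\<in>Obj D. \<lambda>p\<in>carrier (At P x). \<theta> x p)"

lemma mk_nat_apply [simp]: "x \<in> Obj D \<Longrightarrow> p \<in> carrier (At P x) \<Longrightarrow> mk_nat D P \<theta> x p = \<theta> x p"
  by (simp add: mk_nat_def)

lemma mk_nat_in_nat_trans:
  assumes P: "contra_functor R D P"
    and lin: "\<And>x. x \<in> Obj D \<Longrightarrow> lin_map R (At P x) (At F x) (\<theta> x)"
    and nat: "\<And>x y f p. x \<in> Obj D \<Longrightarrow> y \<in> Obj D \<Longrightarrow> f \<in> Hom D x y \<Longrightarrow> p \<in> carrier (At P y) \<Longrightarrow>
                \<theta> x (Act P x y f p) = Act F x y f (\<theta> y p)"
  shows "mk_nat D P \<theta> \<in> nat_trans R D P F"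
proof -
  have "lin_map R (At P x) (At F x) (mk_nat D P \<theta> x)" if "x \<in> Obj D" for x
    using lin_map_cong[OF contra_functorD(1)[OF P that], of "\<theta> x" "mk_nat D P \<theta> x" "At F x"] that lin by simp
  moreover have "mk_nat D P \<theta> x (Act P x y f p) = Act F x y f (mk_nat D P \<theta> y p)"
    if "x \<in> Obj D" "y \<in> Obj D" "f \<in> Hom D x y" "p \<in> carrier (At P y)" for x y f p
    using nat[OF that] that contra_functor_closed[OF P that] by simp
  moreover have "mk_nat D P \<theta> \<in> (\<Pi>\<^sub>E x\<in>Obj D. carrier (At P x) \<rightarrow>\<^sub>E carrier (At F x))"
    using lin_mapD(1)[OF lin] by (auto simp: mk_nat_def)
  ultimately show ?thesis by (simp add: nat_trans_def)
qed

lemma nat_comp_mk_nat: "nat_comp D P \<eta> \<theta> = mk_nat D P (\<lambda>x p. \<eta> x (\<theta> x p))"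
  by (simp add: nat_comp_def mk_nat_def)

lemma nat_comp_in_nat_trans:
  assumes "contra_functor R D P" "\<theta> \<in> nat_trans R D P Q" "\<eta> \<in> nat_trans R D Q F"
  shows "nat_comp D P \<eta> \<theta> \<in> nat_trans R D P F"
  unfolding nat_comp_mk_nat
  by (rule mk_nat_in_nat_trans[OF assms(1)])
     (simp_all add: nat_transD(2,3)[OF assms(2)] nat_transD(2,3)[OF assms(3)]
        lin_map_compose[OF nat_transD(1)[OF assms(2)] nat_transD(1)[OF assms(3)]])

lemma nat_comp_apply: "x \<in> Obj D \<Longrightarrow> p \<in> carrier (At P x) \<Longrightarrow> nat_comp D P \<eta> \<theta> x p = \<eta> x (\<theta> x p)"
  by (simp add: nat_comp_mk_nat)

lemma nat_mod_sel:
  "carrier (nat_mod R D P F) = nat_trans R D P F"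
  "zero (nat_mod R D P F) = mk_nat D P (\<lambda>x p. \<zero>\<^bsub>At F x\<^esub>)"
  "add (nat_mod R D P F) = (\<lambda>\<eta> \<theta>. mk_nat D P (\<lambda>x p. \<eta> x p \<oplus>\<^bsub>At F x\<^esub> \<theta> x p))"
  "smult (nat_mod R D P F) = (\<lambda>r \<eta>. mk_nat D P (\<lambda>x p. r \<odot>\<^bsub>At F x\<^esub> \<eta> x p))"
  by (simp_all add: nat_mod_def mk_nat_def Let_def)

lemma lin_map_zero_fun:
  assumes "Module.module R M" "Module.module R N"
  shows "lin_map R M N (\<lambda>_. \<zero>\<^bsub>N\<^esub>)"
proof -
  interpret N: Module.module R N by fact
  show ?thesis by (rule lin_mapI) auto
qed

lemma lin_map_add_fun:
  assumes "Module.module R M" "Module.module R N" "lin_map R M N f" "lin_map R M N g"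
  shows "lin_map R M N (\<lambda>x. f x \<oplus>\<^bsub>N\<^esub> g x)"
proof -
  interpret N: Module.module R N by fact
  show ?thesis
    by (rule lin_mapI)
       (auto simp: lin_mapD[OF assms(3)] lin_mapD[OF assms(4)] N.smult_r_distr N.M.a_ac)
qed

lemma lin_map_smult_fun:
  assumes "Module.module R M" "Module.module R N" "r \<in> carrier R" "lin_map R M N f"
  shows "lin_map R M N (\<lambda>x. r \<odot>\<^bsub>N\<^esub> f x)"
proof -
  interpret N: Module.module R N by fact
  show ?thesis
  proof (rule lin_mapI)
    fix s x assume "s \<in> carrier R" "x \<in> carrier M"
    then show "r \<odot>\<^bsub>N\<^esub> f (s \<odot>\<^bsub>M\<^esub> x) = s \<odot>\<^bsub>N\<^esub> (r \<odot>\<^bsub>N\<^esub> f x)"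
      using assms(3) lin_mapD(1)[OF assms(4)]
      by (simp add: lin_mapD(3)[OF assms(4)] N.smult_assoc1[symmetric] N.R.m_comm)
  qed (use assms(3) in \<open>auto simp: lin_mapD[OF assms(4)] N.smult_r_distr\<close>)
qed

lemma lin_map_minus_fun:
  assumes "Module.module R M" "Module.module R N" "lin_map R M N f"
  shows "lin_map R M N (\<lambda>x. \<ominus>\<^bsub>N\<^esub> f x)"
proof -
  interpret N: Module.module R N by fact
  show ?thesis
    by (rule lin_mapI) (auto simp: lin_mapD[OF assms(3)] N.smult_r_minus N.M.minus_add)
qed

lemma nat_mod_zero:
  assumes P: "contra_functor R D P" and F: "contra_functor R D F"
  shows "\<zero>\<^bsub>nat_mod R D P F\<^esub> \<in> nat_trans R D P F"
  unfolding nat_mod_sel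
  by (rule mk_nat_in_nat_trans[OF P])
     (auto intro: lin_map_zero_fun contra_functorD(1)[OF P] contra_functorD(1)[OF F] simp:
        lin_map_zero[OF contra_functorD(1)[OF F] contra_functorD(1)[OF F] contra_functorD(2)[OF F]])

lemma
  assumes P: "contra_functor R D P" and F: "contra_functor R D F" and \<eta>: "\<eta> \<in> nat_trans R D P F"
  shows nat_mod_add: "\<theta> \<in> nat_trans R D P F \<Longrightarrow> \<eta> \<oplus>\<^bsub>nat_mod R D P F\<^esub> \<theta> \<in> nat_trans R D P F"
    and nat_mod_smult: "r \<in> carrier R \<Longrightarrow> r \<odot>\<^bsub>nat_mod R D P F\<^esub> \<eta> \<in> nat_trans R D P F"
    and nat_mod_uminus: "mk_nat D P (\<lambda>x p. \<ominus>\<^bsub>At F x\<^esub> \<eta> x p) \<in> nat_trans R D P F"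
proof -
  note mod = contra_functorD(1)[OF P] contra_functorD(1)[OF F] and e = nat_transD[OF \<eta>] and lin = contra_functorD(2)[OF F]
  show "\<eta> \<oplus>\<^bsub>nat_mod R D P F\<^esub> \<theta> \<in> nat_trans R D P F" if "\<theta> \<in> nat_trans R D P F"
    unfolding nat_mod_sel
    by (rule mk_nat_in_nat_trans[OF P])
       (auto intro!: lin_map_add_fun mod e(1) nat_transD(1)[OF that] simp: e(2,3) nat_transD(2,3)[OF that] lin_mapD(2)[OF lin])
  show "r \<odot>\<^bsub>nat_mod R D P F\<^esub> \<eta> \<in> nat_trans R D P F" if "r \<in> carrier R"
    unfolding nat_mod_sel
    by (rule mk_nat_in_nat_trans[OF P]) (auto intro!: lin_map_smult_fun mod e(1) that simp: e(2,3) lin_mapD(3)[OF lin that])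
  show "mk_nat D P (\<lambda>x p. \<ominus>\<^bsub>At F x\<^esub> \<eta> x p) \<in> nat_trans R D P F"
    by (rule mk_nat_in_nat_trans[OF P])
       (auto intro!: lin_map_minus_fun mod e(1) simp: e(2,3) lin_map_minus(1)[OF mod(2) mod(2) lin])
qed

lemma nat_mod_module:
  assumes R: "cring R" and P: "contra_functor R D P" and F: "contra_functor R D F"
  shows "Module.module R (nat_mod R D P F)"
proof -
  interpret R: cring R by fact
  note mod = contra_functorD(1)[OF F]
  have ag: "abelian_group (At F x)" if "x \<in> Obj D" for x using mod[OF that] by (simp add: Module.module_def)
  have am: "abelian_monoid (At F x)" if "x \<in> Obj D" for x using ag[OF that] by (simp add: abelian_group_def)
  note val = nat_transD(2)
  note z = nat_mod_zero[OF P F] and add = nat_mod_add[OF P F] and sm = nat_mod_smult[OF P F]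
  show ?thesis
  proof (rule moduleI)
    show "abelian_group (nat_mod R D P F)"
    proof (rule abelian_groupI, unfold nat_mod_sel(1))
      fix \<eta> \<theta> \<kappa> assume *: "\<eta> \<in> nat_trans R D P F" "\<theta> \<in> nat_trans R D P F" "\<kappa> \<in> nat_trans R D P F"
      show "\<eta> \<oplus>\<^bsub>nat_mod R D P F\<^esub> \<theta> \<in> nat_trans R D P F" by (rule add[OF *(1,2)])
      show "\<eta> \<oplus>\<^bsub>nat_mod R D P F\<^esub> \<theta> \<oplus>\<^bsub>nat_mod R D P F\<^esub> \<kappa> = \<eta> \<oplus>\<^bsub>nat_mod R D P F\<^esub> (\<theta> \<oplus>\<^bsub>nat_mod R D P F\<^esub> \<kappa>)"
        by (rule nat_trans_eqI[OF add[OF add[OF *(1,2)] *(3)] add[OF *(1) add[OF *(2,3)]]])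
           (simp add: nat_mod_sel(3) abelian_monoid.a_assoc[OF am] val[OF *(1)] val[OF *(2)] val[OF *(3)])
      show "\<eta> \<oplus>\<^bsub>nat_mod R D P F\<^esub> \<theta> = \<theta> \<oplus>\<^bsub>nat_mod R D P F\<^esub> \<eta>"
        by (rule nat_trans_eqI[OF add[OF *(1,2)] add[OF *(2,1)]])
           (simp add: nat_mod_sel(3) abelian_monoid.a_comm[OF am] val[OF *(1)] val[OF *(2)])
      show "\<zero>\<^bsub>nat_mod R D P F\<^esub> \<oplus>\<^bsub>nat_mod R D P F\<^esub> \<eta> = \<eta>"
        by (rule nat_trans_eqI[OF add[OF z *(1)] *(1)])
           (simp add: nat_mod_sel(2,3) abelian_monoid.l_zero[OF am] val[OF *(1)])
      note m = nat_mod_uminus[OF P F *(1)]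
      show "\<exists>\<theta>\<in>nat_trans R D P F. \<theta> \<oplus>\<^bsub>nat_mod R D P F\<^esub> \<eta> = \<zero>\<^bsub>nat_mod R D P F\<^esub>"
        by (rule bexI[OF _ m], rule nat_trans_eqI[OF add[OF m *(1)] z])
           (simp add: nat_mod_sel(2,3) abelian_group.l_neg[OF ag] val[OF *(1)])
    qed (rule z)
  next
    fix r \<eta> assume *: "r \<in> carrier R" "\<eta> \<in> carrier (nat_mod R D P F)"
    note e = *(2)[unfolded nat_mod_sel(1)]
    show "r \<odot>\<^bsub>nat_mod R D P F\<^esub> \<eta> \<in> carrier (nat_mod R D P F)"
      using sm[OF e *(1)] by (simp add: nat_mod_sel(1))
    fix s assume s: "s \<in> carrier R"
    show "(r \<oplus>\<^bsub>R\<^esub> s) \<odot>\<^bsub>nat_mod R D P F\<^esub> \<eta> = r \<odot>\<^bsub>nat_mod R D P F\<^esub> \<eta> \<oplus>\<^bsub>nat_mod R D P F\<^esub> s \<odot>\<^bsub>nat_mod R D P F\<^esub> \<eta>"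
      by (rule nat_trans_eqI[OF sm[OF e R.a_closed[OF *(1) s]] add[OF sm[OF e *(1)] sm[OF e s]]])
         (simp add: nat_mod_sel(3,4) Module.module.smult_l_distr[OF mod] *(1) s val[OF e])
    show "(r \<otimes>\<^bsub>R\<^esub> s) \<odot>\<^bsub>nat_mod R D P F\<^esub> \<eta> = r \<odot>\<^bsub>nat_mod R D P F\<^esub> (s \<odot>\<^bsub>nat_mod R D P F\<^esub> \<eta>)"
      by (rule nat_trans_eqI[OF sm[OF e R.m_closed[OF *(1) s]] sm[OF sm[OF e s] *(1)]])
         (simp add: nat_mod_sel(4) Module.module.smult_assoc1[OF mod] *(1) s val[OF e])
  next
    fix r \<eta> \<theta> assume *: "r \<in> carrier R" "\<eta> \<in> carrier (nat_mod R D P F)" "\<theta> \<in> carrier (nat_mod R D P F)"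
    note e = *(2,3)[unfolded nat_mod_sel(1)]
    show "r \<odot>\<^bsub>nat_mod R D P F\<^esub> (\<eta> \<oplus>\<^bsub>nat_mod R D P F\<^esub> \<theta>) = r \<odot>\<^bsub>nat_mod R D P F\<^esub> \<eta> \<oplus>\<^bsub>nat_mod R D P F\<^esub> r \<odot>\<^bsub>nat_mod R D P F\<^esub> \<theta>"
      by (rule nat_trans_eqI[OF sm[OF add[OF e] *(1)] add[OF sm[OF e(1) *(1)] sm[OF e(2) *(1)]]])
         (simp add: nat_mod_sel(3,4) Module.module.smult_r_distr[OF mod] *(1) val[OF e(1)] val[OF e(2)])
  next
    fix \<eta> assume "\<eta> \<in> carrier (nat_mod R D P F)"
    note e = this[unfolded nat_mod_sel(1)]
    show "\<one>\<^bsub>R\<^esub> \<odot>\<^bsub>nat_mod R D P F\<^esub> \<eta> = \<eta>"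
      by (rule nat_trans_eqI[OF sm[OF e R.one_closed] e])
         (simp add: nat_mod_sel(4) Module.module.smult_one[OF mod] val[OF e])
  qed (rule R)
qed

lemma nat_mod_minus_apply:
  assumes R: "cring R" and P: "contra_functor R D P" and F: "contra_functor R D F"
    and \<eta>: "\<eta> \<in> nat_trans R D P F" and \<theta>: "\<theta> \<in> nat_trans R D P F" and x: "x \<in> Obj D" "p \<in> carrier (At P x)"
  shows "(\<eta> \<ominus>\<^bsub>nat_mod R D P F\<^esub> \<theta>) x p = \<eta> x p \<ominus>\<^bsub>At F x\<^esub> \<theta> x p"
proof -
  interpret R: cring R by fact
  interpret N: Module.module R "nat_mod R D P F" by (rule nat_mod_module[OF R P F])
  interpret Fx: Module.module R "At F x" by (rule contra_functorD(1)[OF F x(1)])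
  let ?m = "mk_nat D P (\<lambda>x p. \<ominus>\<^bsub>At F x\<^esub> \<theta> x p)"
  have m: "?m \<in> nat_trans R D P F" by (rule nat_mod_uminus[OF P F \<theta>])
  have "abelian_group (At F x)" if "x \<in> Obj D" for x
    using contra_functorD(1)[OF F that] by (simp add: Module.module_def)
  then have "?m \<oplus>\<^bsub>nat_mod R D P F\<^esub> \<theta> = \<zero>\<^bsub>nat_mod R D P F\<^esub>"
    by (intro nat_trans_eqI[OF nat_mod_add[OF P F m \<theta>] nat_mod_zero[OF P F]])
       (simp add: nat_mod_sel(2,3) abelian_group.l_neg nat_transD(2)[OF \<theta>])
  then have "\<ominus>\<^bsub>nat_mod R D P F\<^esub> \<theta> = ?m"
    using m \<theta> by (intro N.M.minus_equality) (auto simp: nat_mod_sel(1))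
  then show ?thesis using x by (simp add: a_minus_def nat_mod_sel(3))
qed

section \<open>Free functors and projective functors\<close>

definition presheaf :: "('o, 'a) cat \<Rightarrow> ('o \<Rightarrow> 's set) \<Rightarrow> ('o \<Rightarrow> 'o \<Rightarrow> 'a \<Rightarrow> 's \<Rightarrow> 's) \<Rightarrow> bool" where
  "presheaf D S act \<longleftrightarrow>
     (\<forall>x\<in>Obj D. \<forall>y\<in>Obj D. \<forall>f\<in>Hom D x y. \<forall>s\<in>S y. act x y f s \<in> S x) \<and>
     (\<forall>x\<in>Obj D. \<forall>s\<in>S x. act x x (Idt D x) s = s) \<and>
     (\<forall>x\<in>Obj D. \<forall>y\<in>Obj D. \<forall>z\<in>Obj D. \<forall>f\<in>Hom D x y. \<forall>g\<in>Hom D y z. \<forall>s\<in>S z.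
        act x z (Comp D x y z g f) s = act x y f (act y z g s))"

lemma presheafD:
  assumes "presheaf D S act"
  shows "x \<in> Obj D \<Longrightarrow> y \<in> Obj D \<Longrightarrow> f \<in> Hom D x y \<Longrightarrow> s \<in> S y \<Longrightarrow> act x y f s \<in> S x"
    and "x \<in> Obj D \<Longrightarrow> s \<in> S x \<Longrightarrow> act x x (Idt D x) s = s"
    and "x \<in> Obj D \<Longrightarrow> y \<in> Obj D \<Longrightarrow> z \<in> Obj D \<Longrightarrow> f \<in> Hom D x y \<Longrightarrow> g \<in> Hom D y z \<Longrightarrow> s \<in> S z \<Longrightarrow>
        act x z (Comp D x y z g f) s = act x y f (act y z g s)"
  using assms unfolding presheaf_def by blast+

text \<open>A pair \<open>(c, b)\<close> in a basis contributes a copy of the representable presheaf \<open>Hom(-, c)\<close>, embedded by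
\<open>f \<mapsto> b \<cdot> f\<close>; the condition says that the presheaf is the disjoint union of these copies.\<close>

definition presheaf_basis ::
  "('o, 'a) cat \<Rightarrow> ('o \<Rightarrow> 's set) \<Rightarrow> ('o \<Rightarrow> 'o \<Rightarrow> 'a \<Rightarrow> 's \<Rightarrow> 's) \<Rightarrow> ('o \<times> 's) set \<Rightarrow> bool" where
  "presheaf_basis D S act Bs \<longleftrightarrow>
     (\<forall>(c, b)\<in>Bs. c \<in> Obj D \<and> b \<in> S c) \<and>
     (\<forall>x\<in>Obj D. \<forall>s\<in>S x. \<exists>!(c, b, f). (c, b) \<in> Bs \<and> f \<in> Hom D x c \<and> act x c f b = s)"

definition free_functor ::
  "('r, 'q) ring_scheme \<Rightarrow> ('o \<Rightarrow> 's set) \<Rightarrow> ('o \<Rightarrow> 'o \<Rightarrow> 'a \<Rightarrow> 's \<Rightarrow> 's) \<Rightarrow> ('o, 'a, 'r, 's \<Rightarrow> 'r) mfunctor" where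
  "free_functor R S act =
     \<lparr>At = (\<lambda>x. free_mod R (S x)),
      Act = (\<lambda>x y f. lin_ext R (free_mod R (S x)) (\<lambda>s. delta R (act x y f s)))\<rparr>"

context cring
begin

lemma free_functor_lin_map:
  assumes "presheaf D S act" "x \<in> Obj D" "y \<in> Obj D" "f \<in> Hom D x y"
  shows "lin_map R (free_mod R (S y)) (free_mod R (S x)) (Act (free_functor R S act) x y f)"
  unfolding free_functor_def mfunctor.simps
  by (rule lin_ext_lin_map[OF free_mod_module]) (use presheafD(1)[OF assms] in \<open>auto intro: delta_in_free_mod\<close>)

lemma free_functor_Act_delta:
  assumes "presheaf D S act" "x \<in> Obj D" "y \<in> Obj D" "f \<in> Hom D x y" "s \<in> S y"
  shows "Act (free_functor R S act) x y f (delta R s) = delta R (act x y f s)"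
  unfolding free_functor_def mfunctor.simps
  by (rule lin_ext_delta[OF free_mod_module]) (use presheafD(1)[OF assms] in \<open>auto intro: delta_in_free_mod\<close>)

lemma free_functor_contra_functor:
  assumes D: "category D" and S: "presheaf D S act"
  shows "contra_functor R D (free_functor R S act)"
proof -
  let ?P = "free_functor R S act"
  have At: "At ?P x = free_mod R (S x)" for x by (simp add: free_functor_def)
  have id: "Act ?P x x (Idt D x) m = m" if x: "x \<in> Obj D" and m: "m \<in> carrier (free_mod R (S x))" for x m
  proof (rule lin_map_eqI[where S = "S x" and g = "\<lambda>m. m", OF free_mod_module free_functor_lin_map[OF S x x] _ _ m])
    show "lin_map R (free_mod R (S x)) (free_mod R (S x)) (\<lambda>m. m)" by (rule lin_mapI) auto
  qed (auto simp: x categoryD(1)[OF D] free_functor_Act_delta[OF S] presheafD(2)[OF S])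
  have comp: "Act ?P x z (Comp D x y z g f) m = Act ?P x y f (Act ?P y z g m)"
    if x: "x \<in> Obj D" "y \<in> Obj D" "z \<in> Obj D" and fg: "f \<in> Hom D x y" "g \<in> Hom D y z" and m: "m \<in> carrier (free_mod R (S z))"
    for x y z f g m
  proof (rule lin_map_eqI[where S = "S z" and g = "\<lambda>m. Act ?P x y f (Act ?P y z g m)", OF free_mod_module free_functor_lin_map[OF S] _ _ m])
    show "lin_map R (free_mod R (S z)) (free_mod R (S x)) (\<lambda>m. Act ?P x y f (Act ?P y z g m))"
      by (rule lin_map_compose[OF free_functor_lin_map[OF S] free_functor_lin_map[OF S]]) (use x fg in auto)
  qed (use x fg categoryD(2)[OF D x fg] in \<open>auto simp: free_functor_Act_delta[OF S] presheafD(1,3)[OF S]\<close>)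
  show ?thesis
    unfolding contra_functor_def At
    using free_functor_lin_map[OF S] id comp by (simp add: At free_mod_module)
qed

text \<open>The Yoneda lemma, applied to each representable summand.\<close>

lemma free_functor_extend:
  fixes F :: "('o, 'c, 'a, 'm) mfunctor" and S :: "'o \<Rightarrow> 's set" and m :: "'o \<Rightarrow> 's \<Rightarrow> 'm"
  assumes D: "category D" and S: "presheaf D S act" and Bs: "presheaf_basis D S act Bs"
    and F: "contra_functor R D F" and m: "\<And>c b. (c, b) \<in> Bs \<Longrightarrow> m c b \<in> carrier (At F c)"
  obtains \<eta> where "\<eta> \<in> nat_trans R D (free_functor R S act) F" "\<And>c b. (c, b) \<in> Bs \<Longrightarrow> \<eta> c (delta R b) = m c b"
proof -
  let ?P = "free_functor R S act"
  have At: "At ?P x = free_mod R (S x)" for x by (simp add: free_functor_def)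
  have BsD: "c \<in> Obj D" "b \<in> S c" if "(c, b) \<in> Bs" for c b
    using Bs that by (auto simp: presheaf_basis_def)
  define Q where "Q x s t \<longleftrightarrow> (\<exists>c b f. t = (c, b, f) \<and> (c, b) \<in> Bs \<and> f \<in> Hom D x c \<and> act x c f b = s)" for x s t
  \<comment> \<open>\<open>Q x s t\<close> restates the basis condition with a single variable \<open>t\<close> for the triple.\<close>
  have ex1: "\<exists>!t. Q x s t" if "x \<in> Obj D" "s \<in> S x" for x s
  proof -
    have "Q x s = (\<lambda>(c, b, f). (c, b) \<in> Bs \<and> f \<in> Hom D x c \<and> act x c f b = s)"
      by (auto simp: Q_def fun_eq_iff)
    then show ?thesis using Bs that unfolding presheaf_basis_def by simp
  qed
  define \<tau> where "\<tau> x s = (case THE t. Q x s t of (c, b, f) \<Rightarrow> Act F x c f (m c b))" for x s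
  have \<tau>: "\<tau> x (act x c f b) = Act F x c f (m c b)"
    if "x \<in> Obj D" "(c, b) \<in> Bs" "f \<in> Hom D x c" for x c b f
  proof -
    have "Q x (act x c f b) (c, b, f)" using that by (auto simp: Q_def)
    moreover have "act x c f b \<in> S x" using that BsD by (intro presheafD(1)[OF S]) auto
    ultimately have "(THE t. Q x (act x c f b) t) = (c, b, f)" using ex1[OF that(1)] by (metis the1_equality)
    then show ?thesis by (simp add: \<tau>_def)
  qed
  have rep: "\<exists>c b f. (c, b) \<in> Bs \<and> f \<in> Hom D x c \<and> s = act x c f b" if "x \<in> Obj D" "s \<in> S x" for x s
    using ex1[OF that] unfolding Q_def by metis
  have \<tau>_closed: "\<tau> x s \<in> carrier (At F x)" if x: "x \<in> Obj D" "s \<in> S x" for x s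
    using rep[OF x] \<tau>[OF x(1)] x(1) BsD(1) m contra_functor_closed[OF F] by metis
  have \<tau>_nat: "\<tau> x (act x y f s) = Act F x y f (\<tau> y s)"
    if x: "x \<in> Obj D" "y \<in> Obj D" "f \<in> Hom D x y" "s \<in> S y" for x y f s
  proof -
    obtain c b g where c: "(c, b) \<in> Bs" "g \<in> Hom D y c" "s = act y c g b" using rep[OF x(2,4)] by blast
    note co = BsD[OF c(1)]
    have "\<tau> x (act x y f s) = \<tau> x (act x c (Comp D x y c g f) b)"
      using x c co by (simp add: presheafD(3)[OF S])
    also have "\<dots> = Act F x c (Comp D x y c g f) (m c b)"
      using x c co by (intro \<tau> categoryD(2)[OF D]) auto
    also have "\<dots> = Act F x y f (Act F y c g (m c b))"
      using x c co m by (intro contra_functorD(4)[OF F]) auto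
    finally show ?thesis using \<tau>[OF x(2) c(1,2)] c(3) by simp
  qed
  let ?\<theta> = "\<lambda>x. lin_ext R (At F x) (\<tau> x)"
  have lin: "lin_map R (free_mod R (S x)) (At F x) (?\<theta> x)" if "x \<in> Obj D" for x
    by (rule lin_ext_lin_map[OF contra_functorD(1)[OF F that]]) (rule \<tau>_closed[OF that])
  have dl: "?\<theta> x (delta R s) = \<tau> x s" if "x \<in> Obj D" "s \<in> S x" for x s
    by (rule lin_ext_delta[OF contra_functorD(1)[OF F that(1)]]) (rule \<tau>_closed[OF that])
  show ?thesis
  proof (rule that)
    show "mk_nat D ?P ?\<theta> \<in> nat_trans R D ?P F"
    proof (rule mk_nat_in_nat_trans[OF free_functor_contra_functor[OF D S]], unfold At)
      show "lin_map R (free_mod R (S x)) (At F x) (?\<theta> x)" if "x \<in> Obj D" for x using lin[OF that] .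
      fix x y f p assume x: "x \<in> Obj D" "y \<in> Obj D" "f \<in> Hom D x y" and p: "p \<in> carrier (free_mod R (S y))"
      show "?\<theta> x (Act ?P x y f p) = Act F x y f (?\<theta> y p)"
      proof (rule lin_map_eqI[where S = "S y" and f = "\<lambda>p. ?\<theta> x (Act ?P x y f p)" and g = "\<lambda>p. Act F x y f (?\<theta> y p)", OF contra_functorD(1)[OF F x(1)] _ _ _ p])
        show "lin_map R (free_mod R (S y)) (At F x) (\<lambda>p. ?\<theta> x (Act ?P x y f p))"
          by (rule lin_map_compose[OF free_functor_lin_map[OF S x] lin[OF x(1)]])
        show "lin_map R (free_mod R (S y)) (At F x) (\<lambda>p. Act F x y f (?\<theta> y p))"
          by (rule lin_map_compose[OF lin[OF x(2)] contra_functorD(2)[OF F x]])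
      qed (simp add: free_functor_Act_delta[OF S x] dl x presheafD(1)[OF S x] \<tau>_nat)
    qed
    fix c b assume cb: "(c, b) \<in> Bs"
    note co = BsD[OF cb]
    have "\<tau> c b = Act F c c (Idt D c) (m c b)"
      using \<tau>[OF co(1) cb categoryD(1)[OF D co(1)]] presheafD(2)[OF S co] by simp
    then show "mk_nat D ?P ?\<theta> c (delta R b) = m c b"
      using co m[OF cb] by (simp add: At delta_in_free_mod dl contra_functorD(3)[OF F])
  qed
qed

lemma free_functor_nat_trans_eqI:
  assumes D: "category D" and S: "presheaf D S act" and Bs: "presheaf_basis D S act Bs"
    and F: "contra_functor R D F"
    and \<eta>: "\<eta> \<in> nat_trans R D (free_functor R S act) F" and \<theta>: "\<theta> \<in> nat_trans R D (free_functor R S act) F"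
    and eq: "\<And>c b. (c, b) \<in> Bs \<Longrightarrow> \<eta> c (delta R b) = \<theta> c (delta R b)"
  shows "\<eta> = \<theta>"
proof (rule nat_trans_eqI[OF \<eta> \<theta>])
  let ?P = "free_functor R S act"
  have At: "At ?P x = free_mod R (S x)" for x by (simp add: free_functor_def)
  fix x p assume x: "x \<in> Obj D" and p: "p \<in> carrier (At ?P x)"
  show "\<eta> x p = \<theta> x p"
  proof (rule lin_map_eqI[OF contra_functorD(1)[OF F x] nat_transD(1)[OF \<eta> x, unfolded At] nat_transD(1)[OF \<theta> x, unfolded At] _ p[unfolded At]])
    fix s assume s: "s \<in> S x"
    have "\<exists>c b f. (c, b) \<in> Bs \<and> f \<in> Hom D x c \<and> s = act x c f b"
      using Bs x s unfolding presheaf_basis_def by blast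
    then obtain c b f where c: "(c, b) \<in> Bs" "f \<in> Hom D x c" "s = act x c f b" by blast
    have co: "c \<in> Obj D" "b \<in> S c" using Bs c(1) by (auto simp: presheaf_basis_def)
    have "delta R s = Act ?P x c f (delta R b)"
      by (simp add: free_functor_Act_delta[OF S x co(1) c(2) co(2)] c(3))
    then show "\<eta> x (delta R s) = \<theta> x (delta R s)"
      using nat_transD(3)[OF \<eta> x co(1) c(2)] nat_transD(3)[OF \<theta> x co(1) c(2)] eq[OF c(1)]
        delta_in_free_mod[OF co(2)] by (simp add: At)
  qed
qed

text \<open>Choose preimages of the images of the basis elements, and extend.\<close>

lemma free_functor_lift:
  assumes D: "category D" and S: "presheaf D S act" and Bs: "presheaf_basis D S act Bs"
    and A: "contra_functor R D A" and B: "contra_functor R D B"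
    and q: "q \<in> nat_trans R D A B" and f: "f \<in> nat_trans R D (free_functor R S act) B"
    and im: "\<And>x p. x \<in> Obj D \<Longrightarrow> p \<in> carrier (At (free_functor R S act) x) \<Longrightarrow> f x p \<in> q x ` carrier (At A x)"
  obtains h where "h \<in> nat_trans R D (free_functor R S act) A" "nat_comp D (free_functor R S act) q h = f"
proof -
  let ?P = "free_functor R S act"
  have At: "At ?P x = free_mod R (S x)" for x by (simp add: free_functor_def)
  have BsD: "c \<in> Obj D" "b \<in> S c" if "(c, b) \<in> Bs" for c b
    using Bs that by (auto simp: presheaf_basis_def)
  have "\<exists>m. m \<in> carrier (At A c) \<and> q c m = f c (delta R b)" if "(c, b) \<in> Bs" for c b
    using im[of c "delta R b"] BsD[OF that] delta_in_free_mod[of b "S c"] by (force simp: At)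
  then obtain m where m: "\<And>c b. (c, b) \<in> Bs \<Longrightarrow> m c b \<in> carrier (At A c) \<and> q c (m c b) = f c (delta R b)"
    by metis
  obtain h where h: "h \<in> nat_trans R D ?P A" "\<And>c b. (c, b) \<in> Bs \<Longrightarrow> h c (delta R b) = m c b"
    using free_functor_extend[OF D S Bs A, of m] m by blast
  have "nat_comp D ?P q h = f"
  proof (rule free_functor_nat_trans_eqI[OF D S Bs B nat_comp_in_nat_trans[OF free_functor_contra_functor[OF D S] h(1) q] f])
    fix c b assume cb: "(c, b) \<in> Bs"
    show "nat_comp D ?P q h c (delta R b) = f c (delta R b)"
      using m[OF cb] h(2)[OF cb] BsD[OF cb] delta_in_free_mod[of b "S c"] by (simp add: nat_comp_apply At)
  qed
  then show ?thesis using that h(1) by blast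
qed

lemma free_functor_projective:
  fixes D :: "('o, 'c) cat" and S :: "'o \<Rightarrow> 's set"
  assumes D: "category D" and S: "presheaf D S act" and Bs: "presheaf_basis D S act Bs"
  shows "projective R D (free_functor R S act)"
  unfolding projective_def
proof (intro conjI allI impI ballI)
  show "contra_functor R D (free_functor R S act)" by (rule free_functor_contra_functor[OF D S])
next
  fix A :: "('o, 'c, 'a, 'o \<times> 'c \<times> ('s \<Rightarrow> 'a) \<Rightarrow> 'a) mfunctor" and B :: "('o, 'c, 'a, 's \<Rightarrow> 'a) mfunctor" and q f
  assume AB: "contra_functor R D A \<and> contra_functor R D B" and qf: "q \<in> nat_trans R D A B" "f \<in> nat_trans R D (free_functor R S act) B"
    and surj: "\<forall>x\<in>Obj D. q x ` carrier (At A x) = carrier (At B x)"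
  show "\<exists>h\<in>nat_trans R D (free_functor R S act) A. nat_comp D (free_functor R S act) q h = f"
  proof (rule free_functor_lift[OF D S Bs conjunct1[OF AB] conjunct2[OF AB] qf])
    show "f x p \<in> q x ` carrier (At A x)" if "x \<in> Obj D" "p \<in> carrier (At (free_functor R S act) x)" for x p
      using surj nat_transD(2)[OF qf(2) that] that(1) by simp
  qed blast
qed

text \<open>The definition of projectivity tests the lifting property only against functors with values in certain
types. The free functor on all elements of \<open>P\<close> has values in such a type. So the identity of \<open>P\<close> lifts to
it, and \<open>P\<close> is a retract of a free functor.\<close>

lemma projective_retract:
  fixes P :: "('o, 'c, 'a, 'p) mfunctor"
  assumes D: "category D" and P: "projective R D P"
  obtains S :: "'o \<Rightarrow> ('o \<times> 'c \<times> 'p) set" and act Bs q i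
  where "presheaf D S act" "presheaf_basis D S act Bs"
    "q \<in> nat_trans R D (free_functor R S act) P" "i \<in> nat_trans R D P (free_functor R S act)"
    "\<And>x p. x \<in> Obj D \<Longrightarrow> p \<in> carrier (At P x) \<Longrightarrow> q x (i x p) = p"
proof -
  define S where "S x = {(y, f, p). y \<in> Obj D \<and> f \<in> Hom D x y \<and> p \<in> carrier (At P y)}" for x
  define act :: "'o \<Rightarrow> 'o \<Rightarrow> 'c \<Rightarrow> 'o \<times> 'c \<times> 'p \<Rightarrow> 'o \<times> 'c \<times> 'p"
    where "act x x' a = (\<lambda>(y, f, p). (y, Comp D x x' y f a, p))" for x x' a
  define Bs where "Bs = {(y, (y, Idt D y, p)) | y p. y \<in> Obj D \<and> p \<in> carrier (At P y)}"
  have Pc: "contra_functor R D P" using P by (simp add: projective_def)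
  have S: "presheaf D S act"
    unfolding presheaf_def S_def act_def by (auto simp: categoryD[OF D])
  have Bs: "presheaf_basis D S act Bs"
    unfolding presheaf_basis_def
  proof (intro conjI ballI)
    fix x s assume x: "x \<in> Obj D" and s: "s \<in> S x"
    obtain y f p where yfp: "s = (y, f, p)" "y \<in> Obj D" "f \<in> Hom D x y" "p \<in> carrier (At P y)"
      using s by (auto simp: S_def)
    show "\<exists>!(c, b, f). (c, b) \<in> Bs \<and> f \<in> Hom D x c \<and> act x c f b = s"
    proof (rule ex1I[of _ "(y, (y, Idt D y, p), f)"])
      show "case (y, (y, Idt D y, p), f) of (c, b, f) \<Rightarrow> (c, b) \<in> Bs \<and> f \<in> Hom D x c \<and> act x c f b = s"
        using yfp x by (auto simp: Bs_def act_def categoryD[OF D])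
      fix t assume "case t of (c, b, f) \<Rightarrow> (c, b) \<in> Bs \<and> f \<in> Hom D x c \<and> act x c f b = s"
      then show "t = (y, (y, Idt D y, p), f)"
        using yfp x by (auto simp: Bs_def act_def categoryD[OF D])
    qed
  qed (auto simp: Bs_def S_def categoryD[OF D])
  let ?A = "free_functor R S act"
  have A: "contra_functor R D ?A" by (rule free_functor_contra_functor[OF D S])
  obtain q where q: "q \<in> nat_trans R D ?A P" "\<And>c b. (c, b) \<in> Bs \<Longrightarrow> q c (delta R b) = snd (snd b)"
    by (rule free_functor_extend[OF D S Bs Pc, of "\<lambda>c b. snd (snd b)"]) (auto simp: Bs_def)
  have surj: "q x ` carrier (At ?A x) = carrier (At P x)" if x: "x \<in> Obj D" for x
  proof
    show "q x ` carrier (At ?A x) \<subseteq> carrier (At P x)" using nat_transD(2)[OF q(1) x] by auto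
    show "carrier (At P x) \<subseteq> q x ` carrier (At ?A x)"
    proof
      fix p assume p: "p \<in> carrier (At P x)"
      have "q x (delta R (x, Idt D x, p)) = p" using q(2)[of x "(x, Idt D x, p)"] x p by (auto simp: Bs_def)
      moreover have "delta R (x, Idt D x, p) \<in> carrier (At ?A x)"
        using x p by (auto simp: free_functor_def S_def categoryD[OF D] intro!: delta_in_free_mod)
      ultimately show "p \<in> q x ` carrier (At ?A x)" by (metis imageI)
    qed
  qed
  have "mk_nat D P (\<lambda>x p. p) \<in> nat_trans R D P P"
    by (rule mk_nat_in_nat_trans[OF Pc]) (auto intro: lin_mapI)
  then have "\<exists>i\<in>nat_trans R D P ?A. nat_comp D P q i = mk_nat D P (\<lambda>x p. p)"
    using P A Pc q(1) surj unfolding projective_def by blast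
  then obtain i where i: "i \<in> nat_trans R D P ?A" "nat_comp D P q i = mk_nat D P (\<lambda>x p. p)" by blast
  have "q x (i x p) = p" if "x \<in> Obj D" "p \<in> carrier (At P x)" for x p
    using fun_cong[OF fun_cong[OF i(2), of x], of p] that by (simp add: nat_comp_apply)
  then show ?thesis using that S Bs q(1) i(1) by blast
qed

text \<open>Being a retract of a free functor, \<open>P\<close> inherits the lifting property for functors with values in
arbitrary types. This is what makes resolutions of different types comparable.\<close>

lemma projective_lift:
  fixes D :: "('o, 'c) cat" and P :: "('o, 'c, 'a, 'p) mfunctor"
  assumes D: "category D" and P: "projective R D P"
    and A: "contra_functor R D A" and B: "contra_functor R D B"
    and q: "q \<in> nat_trans R D A B" and f: "f \<in> nat_trans R D P B"
    and im: "\<And>x p. x \<in> Obj D \<Longrightarrow> p \<in> carrier (At P x) \<Longrightarrow> f x p \<in> q x ` carrier (At A x)"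
  obtains h where "h \<in> nat_trans R D P A" "\<And>x p. x \<in> Obj D \<Longrightarrow> p \<in> carrier (At P x) \<Longrightarrow> q x (h x p) = f x p"
proof -
  have Pc: "contra_functor R D P" using P by (simp add: projective_def)
  obtain S :: "'o \<Rightarrow> ('o \<times> 'c \<times> 'p) set" and act Bs r i where S: "presheaf D S act" "presheaf_basis D S act Bs"
    and r: "r \<in> nat_trans R D (free_functor R S act) P" and i: "i \<in> nat_trans R D P (free_functor R S act)"
    and ri: "\<And>x p. x \<in> Obj D \<Longrightarrow> p \<in> carrier (At P x) \<Longrightarrow> r x (i x p) = p"
    using projective_retract[OF D P] by metis
  let ?A = "free_functor R S act"
  have Ac: "contra_functor R D ?A" by (rule free_functor_contra_functor[OF D S(1)])
  obtain h where h: "h \<in> nat_trans R D ?A A" "nat_comp D ?A q h = nat_comp D ?A f r"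
  proof (rule free_functor_lift[OF D S A B q nat_comp_in_nat_trans[OF Ac r f]])
    show "nat_comp D ?A f r x p \<in> q x ` carrier (At A x)" if "x \<in> Obj D" "p \<in> carrier (At ?A x)" for x p
      using im[OF that(1) nat_transD(2)[OF r that]] that by (simp add: nat_comp_apply)
  qed
  have "q x (nat_comp D P h i x p) = f x p" if x: "x \<in> Obj D" "p \<in> carrier (At P x)" for x p
  proof -
    note ip = nat_transD(2)[OF i x]
    have "q x (h x (i x p)) = f x (r x (i x p))"
      using fun_cong[OF fun_cong[OF h(2), of x], of "i x p"] x ip by (simp add: nat_comp_apply)
    then show ?thesis using x ri[OF x] by (simp add: nat_comp_apply)
  qed
  then show ?thesis using that nat_comp_in_nat_trans[OF Pc i h(1)] by blast
qed

end

section \<open>Independence of the projective resolution\<close>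

lemma projective_resolution_unfold:
  assumes "projective_resolution R D M P d e"
  shows "projective R D (P n)" "d n \<in> nat_trans R D (P (Suc n)) (P n)" "e \<in> nat_trans R D (P 0) M"
    "x \<in> Obj D \<Longrightarrow> e x ` carrier (At (P 0) x) = carrier (At M x)"
    "x \<in> Obj D \<Longrightarrow> d 0 x ` carrier (At (P (Suc 0)) x) = {p \<in> carrier (At (P 0) x). e x p = \<zero>\<^bsub>At M x\<^esub>}"
    "x \<in> Obj D \<Longrightarrow> d (Suc n) x ` carrier (At (P (Suc (Suc n))) x) =
                  {p \<in> carrier (At (P (Suc n)) x). d n x p = \<zero>\<^bsub>At (P n) x\<^esub>}"
  using assms unfolding projective_resolution_def by simp_all

lemma projective_resolutionD:
  assumes "projective_resolution R D M P d e"
  shows "projective R D (P n)" and "contra_functor R D (P n)"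
    and "d n \<in> nat_trans R D (P (Suc n)) (P n)" and "e \<in> nat_trans R D (P 0) M"
    and "x \<in> Obj D \<Longrightarrow> e x ` carrier (At (P 0) x) = carrier (At M x)"
    and "x \<in> Obj D \<Longrightarrow> p \<in> carrier (At (P (Suc 0)) x) \<Longrightarrow> e x (d 0 x p) = \<zero>\<^bsub>At M x\<^esub>"
    and "x \<in> Obj D \<Longrightarrow> q \<in> carrier (At (P 0) x) \<Longrightarrow> e x q = \<zero>\<^bsub>At M x\<^esub> \<Longrightarrow> q \<in> d 0 x ` carrier (At (P (Suc 0)) x)"
    and "x \<in> Obj D \<Longrightarrow> r \<in> carrier (At (P (Suc (Suc n))) x) \<Longrightarrow> d n x (d (Suc n) x r) = \<zero>\<^bsub>At (P n) x\<^esub>"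
    and "x \<in> Obj D \<Longrightarrow> s \<in> carrier (At (P (Suc n)) x) \<Longrightarrow> d n x s = \<zero>\<^bsub>At (P n) x\<^esub> \<Longrightarrow>
           s \<in> d (Suc n) x ` carrier (At (P (Suc (Suc n))) x)"
proof -
  note u = projective_resolution_unfold[OF assms]
  show "projective R D (P n)" "d n \<in> nat_trans R D (P (Suc n)) (P n)" "e \<in> nat_trans R D (P 0) M" by (rule u)+
  show "contra_functor R D (P n)" using u(1)[of n] by (simp add: projective_def)
  show "x \<in> Obj D \<Longrightarrow> e x ` carrier (At (P 0) x) = carrier (At M x)" by (rule u(4))
  show "x \<in> Obj D \<Longrightarrow> p \<in> carrier (At (P (Suc 0)) x) \<Longrightarrow> e x (d 0 x p) = \<zero>\<^bsub>At M x\<^esub>"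
    using imageI[of p "carrier (At (P (Suc 0)) x)" "d 0 x"] by (simp add: u(5))
  show "x \<in> Obj D \<Longrightarrow> q \<in> carrier (At (P 0) x) \<Longrightarrow> e x q = \<zero>\<^bsub>At M x\<^esub> \<Longrightarrow> q \<in> d 0 x ` carrier (At (P (Suc 0)) x)"
    by (simp add: u(5))
  show "x \<in> Obj D \<Longrightarrow> r \<in> carrier (At (P (Suc (Suc n))) x) \<Longrightarrow> d n x (d (Suc n) x r) = \<zero>\<^bsub>At (P n) x\<^esub>"
    using imageI[of r "carrier (At (P (Suc (Suc n))) x)" "d (Suc n) x"] by (simp add: u(6))
  show "x \<in> Obj D \<Longrightarrow> s \<in> carrier (At (P (Suc n)) x) \<Longrightarrow> d n x s = \<zero>\<^bsub>At (P n) x\<^esub> \<Longrightarrow>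
           s \<in> d (Suc n) x ` carrier (At (P (Suc (Suc n))) x)"
    by (simp add: u(6))
qed

lemma nat_trans_zero:
  assumes "contra_functor R D P" "contra_functor R D F" "\<eta> \<in> nat_trans R D P F" "x \<in> Obj D"
  shows "\<eta> x \<zero>\<^bsub>At P x\<^esub> = \<zero>\<^bsub>At F x\<^esub>"
  by (rule lin_map_zero[OF contra_functorD(1)[OF assms(1,4)] contra_functorD(1)[OF assms(2,4)] nat_transD(1)[OF assms(3,4)]])

lemma nat_trans_diff:
  assumes "contra_functor R D P" "contra_functor R D F" "\<eta> \<in> nat_trans R D P F" "x \<in> Obj D"
    "p \<in> carrier (At P x)" "q \<in> carrier (At P x)"
  shows "\<eta> x (p \<ominus>\<^bsub>At P x\<^esub> q) = \<eta> x p \<ominus>\<^bsub>At F x\<^esub> \<eta> x q"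
  by (rule lin_map_minus(2)[OF contra_functorD(1)[OF assms(1,4)] contra_functorD(1)[OF assms(2,4)] nat_transD(1)[OF assms(3,4)] assms(5,6)])

context cring
begin

lemma mk_nat_diff_in_nat_trans:
  assumes P: "contra_functor R D P" and F: "contra_functor R D F"
    and \<eta>: "\<eta> \<in> nat_trans R D P F" and \<theta>: "\<theta> \<in> nat_trans R D P F"
  shows "mk_nat D P (\<lambda>x p. \<eta> x p \<ominus>\<^bsub>At F x\<^esub> \<theta> x p) \<in> nat_trans R D P F"
proof -
  interpret N: Module.module R "nat_mod R D P F" by (rule nat_mod_module[OF is_cring P F])
  have in': "\<eta> \<ominus>\<^bsub>nat_mod R D P F\<^esub> \<theta> \<in> nat_trans R D P F"
    using N.M.minus_closed[of \<eta> \<theta>] \<eta> \<theta> by (simp add: nat_mod_sel(1))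
  have "mk_nat D P (\<lambda>x p. \<eta> x p \<ominus>\<^bsub>At F x\<^esub> \<theta> x p) = mk_nat D P (\<eta> \<ominus>\<^bsub>nat_mod R D P F\<^esub> \<theta>)"
    unfolding mk_nat_def using nat_mod_minus_apply[OF is_cring P F \<eta> \<theta>] by (intro restrict_ext) (simp cong: restrict_cong)
  also have "\<dots> \<in> nat_trans R D P F"
    by (rule mk_nat_in_nat_trans[OF P]) (use nat_transD[OF in'] in auto)
  finally show ?thesis .
qed

text \<open>Lift degree by degree. The condition that is carried along is that the next lift exists: \<open>f \<circ> d\<close> takes
values in the image of \<open>d'\<close>, by exactness of \<open>Q\<close>.\<close>

lemma chain_map_lift:
  fixes D :: "('o, 'c) cat" and P :: "nat \<Rightarrow> ('o, 'c, 'a, 'p) mfunctor" and Q :: "nat \<Rightarrow> ('o, 'c, 'a, 'q) mfunctor"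
  assumes D: "category D" and M: "contra_functor R D M"
    and resP: "projective_resolution R D M P d e" and resQ: "projective_resolution R D M Q d' e'"
  obtains \<phi> where "\<And>n. \<phi> n \<in> nat_trans R D (P n) (Q n)"
    "\<And>x p. x \<in> Obj D \<Longrightarrow> p \<in> carrier (At (P 0) x) \<Longrightarrow> e' x (\<phi> 0 x p) = e x p"
    "\<And>n x p. x \<in> Obj D \<Longrightarrow> p \<in> carrier (At (P (Suc n)) x) \<Longrightarrow> d' n x (\<phi> (Suc n) x p) = \<phi> n x (d n x p)"
proof -
  note p = projective_resolutionD[OF resP] and q = projective_resolutionD[OF resQ]
  define ok where "ok n f \<longleftrightarrow> f \<in> nat_trans R D (P n) (Q n) \<and>
      (\<forall>x\<in>Obj D. \<forall>p\<in>carrier (At (P (Suc n)) x). f x (d n x p) \<in> d' n x ` carrier (At (Q (Suc n)) x)) \<and>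
      (n = 0 \<longrightarrow> (\<forall>x\<in>Obj D. \<forall>p\<in>carrier (At (P 0) x). e' x (f x p) = e x p))" for n f
  define next_ok where "next_ok n f g \<longleftrightarrow> (\<forall>x\<in>Obj D. \<forall>p\<in>carrier (At (P (Suc n)) x). d' n x (g x p) = f x (d n x p))" for n f g
  have "\<exists>\<phi>. \<forall>n. ok n (\<phi> n) \<and> next_ok n (\<phi> n) (\<phi> (Suc n))"
  proof (rule dependent_nat_choice)
    obtain f where f: "f \<in> nat_trans R D (P 0) (Q 0)"
      "\<And>x p. x \<in> Obj D \<Longrightarrow> p \<in> carrier (At (P 0) x) \<Longrightarrow> e' x (f x p) = e x p"
      by (rule projective_lift[OF D p(1) q(2) M q(4) p(4)]) (use q(5) nat_transD(2)[OF p(4)] in auto)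
    have "f x (d 0 x r) \<in> d' 0 x ` carrier (At (Q (Suc 0)) x)" if "x \<in> Obj D" "r \<in> carrier (At (P (Suc 0)) x)" for x r
      using nat_transD(2)[OF p(3) that] that p(6)[OF that] f by (intro q(7)) (auto intro: nat_transD(2))
    then show "\<exists>f. ok 0 f" using f by (auto simp: ok_def)
  next
    fix f n assume "ok n f"
    then have f: "f \<in> nat_trans R D (P n) (Q n)"
      "\<And>x p. x \<in> Obj D \<Longrightarrow> p \<in> carrier (At (P (Suc n)) x) \<Longrightarrow> f x (d n x p) \<in> d' n x ` carrier (At (Q (Suc n)) x)"
      by (auto simp: ok_def)
    obtain g where g: "g \<in> nat_trans R D (P (Suc n)) (Q (Suc n))"
      "\<And>x p. x \<in> Obj D \<Longrightarrow> p \<in> carrier (At (P (Suc n)) x) \<Longrightarrow> d' n x (g x p) = nat_comp D (P (Suc n)) f (d n) x p"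
      by (rule projective_lift[OF D p(1) q(2) q(2) q(3) nat_comp_in_nat_trans[OF p(2) p(3) f(1)]])
         (use f(2) in \<open>auto simp: nat_comp_apply\<close>)
    have g2: "d' n x (g x p) = f x (d n x p)" if "x \<in> Obj D" "p \<in> carrier (At (P (Suc n)) x)" for x p
      using g(2)[OF that] that by (simp add: nat_comp_apply)
    have "g x (d (Suc n) x r) \<in> d' (Suc n) x ` carrier (At (Q (Suc (Suc n))) x)"
      if x: "x \<in> Obj D" "r \<in> carrier (At (P (Suc (Suc n))) x)" for x r
    proof (rule q(9)[OF x(1)])
      note dr = nat_transD(2)[OF p(3) x]
      show "g x (d (Suc n) x r) \<in> carrier (At (Q (Suc n)) x)" by (rule nat_transD(2)[OF g(1) x(1) dr])
      show "d' n x (g x (d (Suc n) x r)) = \<zero>\<^bsub>At (Q n) x\<^esub>"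
        using g2[OF x(1) dr] p(8)[OF x] nat_trans_zero[OF p(2) q(2) f(1) x(1)] by simp
    qed
    then show "\<exists>g. ok (Suc n) g \<and> next_ok n f g" using g(1) g2 by (auto simp: ok_def next_ok_def)
  qed
  then obtain \<phi> where \<phi>: "\<And>n. ok n (\<phi> n)" "\<And>n. next_ok n (\<phi> n) (\<phi> (Suc n))" by blast
  show ?thesis
    by (rule that[of \<phi>]) (use \<phi>(1) \<phi>(1)[of 0] \<phi>(2) in \<open>auto simp: ok_def next_ok_def\<close>)
qed

text \<open>An endomorphism \<open>\<phi>\<close> of a projective resolution that lifts the identity is homotopic to the identity, by
some \<open>s\<close> with \<open>d s + s d = \<phi> - 1\<close>. For a cocycle \<open>\<eta>\<close> this gives \<open>\<eta> \<phi> - \<eta> = \<eta> s d\<close>, a coboundary.\<close>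

lemma chain_endomap_cohomologous:
  fixes D :: "('o, 'c) cat" and P :: "nat \<Rightarrow> ('o, 'c, 'a, 'p) mfunctor"
  assumes D: "category D" and M: "contra_functor R D M" and F: "contra_functor R D F"
    and res: "projective_resolution R D M P d e"
    and \<phi>: "\<And>n. \<phi> n \<in> nat_trans R D (P n) (P n)"
      "\<And>x p. x \<in> Obj D \<Longrightarrow> p \<in> carrier (At (P 0) x) \<Longrightarrow> e x (\<phi> 0 x p) = e x p"
      "\<And>n x p. x \<in> Obj D \<Longrightarrow> p \<in> carrier (At (P (Suc n)) x) \<Longrightarrow> d n x (\<phi> (Suc n) x p) = \<phi> n x (d n x p)"
    and \<eta>: "\<eta> \<in> nat_trans R D (P (Suc k)) F"
      "\<And>x p. x \<in> Obj D \<Longrightarrow> p \<in> carrier (At (P (Suc (Suc k))) x) \<Longrightarrow> \<eta> x (d (Suc k) x p) = \<zero>\<^bsub>At F x\<^esub>"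
  obtains \<zeta> where "\<zeta> \<in> nat_trans R D (P k) F"
    "\<And>x p. x \<in> Obj D \<Longrightarrow> p \<in> carrier (At (P (Suc k)) x) \<Longrightarrow>
       \<eta> x (\<phi> (Suc k) x p) \<ominus>\<^bsub>At F x\<^esub> \<eta> x p = \<zeta> x (d k x p)"
proof -
  note p = projective_resolutionD[OF res]
  have mod: "Module.module R (At (P n) x)" if "x \<in> Obj D" for n x by (rule contra_functorD(1)[OF p(2) that])
  have ag: "abelian_group (At (P n) x)" if "x \<in> Obj D" for n x using mod[OF that] by (simp add: Module.module_def)
  note cl = abelian_group.minus_closed[OF ag]
  have cancel: "a \<ominus>\<^bsub>At (P n) x\<^esub> a = \<zero>\<^bsub>At (P n) x\<^esub>" if "x \<in> Obj D" "a \<in> carrier (At (P n) x)" for n x a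
    using abelian_group.r_neg[OF ag that(2)] that(1) by (simp add: a_minus_def)
  let ?id = "\<lambda>n. mk_nat D (P n) (\<lambda>x p. p)"
  have id: "?id n \<in> nat_trans R D (P n) (P n)" for n
    by (rule mk_nat_in_nat_trans[OF p(2)]) (auto intro: lin_mapI)
  define \<delta> where "\<delta> n = mk_nat D (P n) (\<lambda>x p. \<phi> n x p \<ominus>\<^bsub>At (P n) x\<^esub> ?id n x p)" for n
  have \<delta>: "\<delta> n \<in> nat_trans R D (P n) (P n)" for n
    unfolding \<delta>_def by (rule mk_nat_diff_in_nat_trans[OF p(2) p(2) \<phi>(1) id])
  have \<delta>_apply: "\<delta> n x r = \<phi> n x r \<ominus>\<^bsub>At (P n) x\<^esub> r" if "x \<in> Obj D" "r \<in> carrier (At (P n) x)" for n x r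
    using that by (simp add: \<delta>_def)
  have \<delta>_d: "d n x (\<delta> (Suc n) x r) = \<delta> n x (d n x r)" if "x \<in> Obj D" "r \<in> carrier (At (P (Suc n)) x)" for n x r
    using that nat_transD(2)[OF p(3) that] nat_trans_diff[OF p(2) p(2) p(3)] nat_transD(2)[OF \<phi>(1)] \<phi>(3)[OF that]
    by (simp add: \<delta>_apply)
  define ok where "ok n s \<longleftrightarrow> s \<in> nat_trans R D (P n) (P (Suc n)) \<and>
     (\<forall>x\<in>Obj D. \<forall>r\<in>carrier (At (P (Suc n)) x).
        \<delta> (Suc n) x r \<ominus>\<^bsub>At (P (Suc n)) x\<^esub> s x (d n x r) \<in> d (Suc n) x ` carrier (At (P (Suc (Suc n))) x))" for n s
  define next_ok where "next_ok n s t \<longleftrightarrow> (\<forall>x\<in>Obj D. \<forall>r\<in>carrier (At (P (Suc n)) x).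
      d (Suc n) x (t x r) = \<delta> (Suc n) x r \<ominus>\<^bsub>At (P (Suc n)) x\<^esub> s x (d n x r))" for n s t
  have "\<exists>s. \<forall>n. ok n (s n) \<and> next_ok n (s n) (s (Suc n))"
  proof (rule dependent_nat_choice)
    obtain s where s: "s \<in> nat_trans R D (P 0) (P (Suc 0))"
      "\<And>x r. x \<in> Obj D \<Longrightarrow> r \<in> carrier (At (P 0) x) \<Longrightarrow> d 0 x (s x r) = \<delta> 0 x r"
    proof (rule projective_lift[OF D p(1) p(2) p(2) p(3) \<delta>[of 0]])
      fix x r assume x: "x \<in> Obj D" "r \<in> carrier (At (P 0) x)"
      note mM = contra_functorD(1)[OF M x(1)]
      have "e x (\<delta> 0 x r) = \<zero>\<^bsub>At M x\<^esub>"
        using nat_trans_diff[OF p(2) M p(4) x(1) nat_transD(2)[OF \<phi>(1) x] x(2)] nat_transD(2)[OF p(4) x] \<phi>(2)[OF x]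
          abelian_group.r_neg[of "At M x" "e x r"] mM
        by (simp add: \<delta>_apply x) (simp add: a_minus_def Module.module_def)
      then show "\<delta> 0 x r \<in> d 0 x ` carrier (At (P (Suc 0)) x)"
        by (intro p(7)[OF x(1) nat_transD(2)[OF \<delta> x]])
    qed blast
    have "\<delta> (Suc 0) x r \<ominus>\<^bsub>At (P (Suc 0)) x\<^esub> s x (d 0 x r) \<in> d (Suc 0) x ` carrier (At (P (Suc (Suc 0))) x)"
      if x: "x \<in> Obj D" "r \<in> carrier (At (P (Suc 0)) x)" for x r
    proof (rule p(9)[OF x(1)])
      note c1 = nat_transD(2)[OF \<delta> x] and dr = nat_transD(2)[OF p(3) x]
      note c2 = nat_transD(2)[OF s(1) x(1) dr]
      show "\<delta> (Suc 0) x r \<ominus>\<^bsub>At (P (Suc 0)) x\<^esub> s x (d 0 x r) \<in> carrier (At (P (Suc 0)) x)"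
        by (rule cl[OF x(1) c1 c2])
      show "d 0 x (\<delta> (Suc 0) x r \<ominus>\<^bsub>At (P (Suc 0)) x\<^esub> s x (d 0 x r)) = \<zero>\<^bsub>At (P 0) x\<^esub>"
        using nat_trans_diff[OF p(2) p(2) p(3) x(1) c1 c2] s(2)[OF x(1) dr] \<delta>_d[OF x] cancel[OF x(1) nat_transD(2)[OF \<delta> x(1) dr]]
        by simp
    qed
    then show "\<exists>s. ok 0 s" using s(1) by (auto simp: ok_def)
  next
    fix s n assume "ok n s"
    then have s: "s \<in> nat_trans R D (P n) (P (Suc n))"
      "\<And>x r. x \<in> Obj D \<Longrightarrow> r \<in> carrier (At (P (Suc n)) x) \<Longrightarrow>
        \<delta> (Suc n) x r \<ominus>\<^bsub>At (P (Suc n)) x\<^esub> s x (d n x r) \<in> d (Suc n) x ` carrier (At (P (Suc (Suc n))) x)"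
      by (auto simp: ok_def)
    note sd = nat_comp_in_nat_trans[OF p(2) p(3) s(1)]
    define \<kappa> where "\<kappa> = mk_nat D (P (Suc n)) (\<lambda>x r. \<delta> (Suc n) x r \<ominus>\<^bsub>At (P (Suc n)) x\<^esub> nat_comp D (P (Suc n)) s (d n) x r)"
    have \<kappa>: "\<kappa> \<in> nat_trans R D (P (Suc n)) (P (Suc n))"
      unfolding \<kappa>_def by (rule mk_nat_diff_in_nat_trans[OF p(2) p(2) \<delta> sd])
    have \<kappa>_apply: "\<kappa> x r = \<delta> (Suc n) x r \<ominus>\<^bsub>At (P (Suc n)) x\<^esub> s x (d n x r)"
      if "x \<in> Obj D" "r \<in> carrier (At (P (Suc n)) x)" for x r
      using that by (simp add: \<kappa>_def nat_comp_apply)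
    obtain t where t: "t \<in> nat_trans R D (P (Suc n)) (P (Suc (Suc n)))"
      "\<And>x r. x \<in> Obj D \<Longrightarrow> r \<in> carrier (At (P (Suc n)) x) \<Longrightarrow> d (Suc n) x (t x r) = \<kappa> x r"
      by (rule projective_lift[OF D p(1) p(2) p(2) p(3) \<kappa>]) (use s(2) in \<open>auto simp: \<kappa>_apply\<close>)
    have "\<delta> (Suc (Suc n)) x r \<ominus>\<^bsub>At (P (Suc (Suc n))) x\<^esub> t x (d (Suc n) x r) \<in> d (Suc (Suc n)) x ` carrier (At (P (Suc (Suc (Suc n)))) x)"
      if x: "x \<in> Obj D" "r \<in> carrier (At (P (Suc (Suc n))) x)" for x r
    proof (rule p(9)[OF x(1)])
      note c1 = nat_transD(2)[OF \<delta> x] and dr = nat_transD(2)[OF p(3) x]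
      note c2 = nat_transD(2)[OF t(1) x(1) dr]
      show "\<delta> (Suc (Suc n)) x r \<ominus>\<^bsub>At (P (Suc (Suc n))) x\<^esub> t x (d (Suc n) x r) \<in> carrier (At (P (Suc (Suc n))) x)"
        by (rule cl[OF x(1) c1 c2])
      note cd = nat_transD(2)[OF \<delta> x(1) dr]
      have "\<kappa> x (d (Suc n) x r) = \<delta> (Suc n) x (d (Suc n) x r)"
        using \<kappa>_apply[OF x(1) dr] p(8)[OF x] nat_trans_zero[OF p(2) p(2) s(1) x(1)] cd
          abelian_group.r_neg[OF ag[OF x(1)]] abelian_monoid.r_zero[of "At (P (Suc n)) x"] ag[OF x(1), of "Suc n"]
        by (simp add: a_minus_def abelian_group_def)
           (metis abelian_group.a_inv_closed abelian_group.r_neg ag abelian_group.axioms(1) abelian_monoid.zero_closed abelian_monoid.l_zero x(1))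
      then show "d (Suc n) x (\<delta> (Suc (Suc n)) x r \<ominus>\<^bsub>At (P (Suc (Suc n))) x\<^esub> t x (d (Suc n) x r)) = \<zero>\<^bsub>At (P (Suc n)) x\<^esub>"
        using nat_trans_diff[OF p(2) p(2) p(3) x(1) c1 c2] t(2)[OF x(1) dr] \<delta>_d[OF x] cancel[OF x(1) cd]
        by simp
    qed
    then show "\<exists>t. ok (Suc n) t \<and> next_ok n s t"
      using t by (auto simp: ok_def next_ok_def \<kappa>_apply)
  qed
  then obtain s where s: "\<And>n. ok n (s n)" "\<And>n. next_ok n (s n) (s (Suc n))" by blast
  have sk: "s k \<in> nat_trans R D (P k) (P (Suc k))" "s (Suc k) \<in> nat_trans R D (P (Suc k)) (P (Suc (Suc k)))"
    using s(1) by (auto simp: ok_def)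
  show ?thesis
  proof (rule that)
    show "nat_comp D (P k) \<eta> (s k) \<in> nat_trans R D (P k) F" by (rule nat_comp_in_nat_trans[OF p(2) sk(1) \<eta>(1)])
    fix x r assume x: "x \<in> Obj D" "r \<in> carrier (At (P (Suc k)) x)"
    interpret Fx: Module.module R "At F x" by (rule contra_functorD(1)[OF F x(1)])
    note dr = nat_transD(2)[OF p(3) x]
    note c1 = nat_transD(2)[OF \<delta> x] and c2 = nat_transD(2)[OF sk(1) x(1) dr]
    have "d (Suc k) x (s (Suc k) x r) = \<delta> (Suc k) x r \<ominus>\<^bsub>At (P (Suc k)) x\<^esub> s k x (d k x r)"
      using s(2)[of k] x by (auto simp: next_ok_def)
    then have "\<zero>\<^bsub>At F x\<^esub> = \<eta> x (\<delta> (Suc k) x r) \<ominus>\<^bsub>At F x\<^esub> \<eta> x (s k x (d k x r))"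
      using \<eta>(2)[OF x(1) nat_transD(2)[OF sk(2) x]] nat_trans_diff[OF p(2) F \<eta>(1) x(1) c1 c2] by simp
    then have "\<eta> x (\<delta> (Suc k) x r) = \<eta> x (s k x (d k x r))"
      using nat_transD(2)[OF \<eta>(1) x(1) c1] nat_transD(2)[OF \<eta>(1) x(1) c2]
        Fx.M.minus_equality[of "\<eta> x (\<delta> (Suc k) x r)" "\<ominus>\<^bsub>At F x\<^esub> \<eta> x (s k x (d k x r))"]
      by (simp add: a_minus_def)
    then show "\<eta> x (\<phi> (Suc k) x r) \<ominus>\<^bsub>At F x\<^esub> \<eta> x r = nat_comp D (P k) \<eta> (s k) x (d k x r)"
      using x dr nat_trans_diff[OF p(2) F \<eta>(1) x(1) nat_transD(2)[OF \<phi>(1) x] x(2)]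
      by (simp add: \<delta>_apply nat_comp_apply)
  qed
qed

definition cocycles where
  "cocycles D P d k F = {\<eta> \<in> nat_trans R D (P (Suc k)) F.
     \<forall>x\<in>Obj D. \<forall>p\<in>carrier (At (P (Suc (Suc k))) x). \<eta> x (d (Suc k) x p) = \<zero>\<^bsub>At F x\<^esub>}"

definition coboundaries where
  "coboundaries D P d k F = {\<eta> \<in> nat_trans R D (P (Suc k)) F.
     \<exists>\<zeta>\<in>nat_trans R D (P k) F. \<forall>x\<in>Obj D. \<forall>p\<in>carrier (At (P (Suc k)) x). \<eta> x p = \<zeta> x (d k x p)}"

lemma cohomology_of_resolution_Suc:
  assumes P: "\<And>n. contra_functor R D (P n)" and d: "\<And>n. d n \<in> nat_trans R D (P (Suc n)) (P n)"
    and F: "contra_functor R D F"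
  shows "cohomology_of_resolution R D P d (Suc k) F =
    quot_mod ((nat_mod R D (P (Suc k)) F)\<lparr>carrier := cocycles D P d k F\<rparr>) (coboundaries D P d k F)"
proof -
  have z: "\<zero>\<^bsub>nat_mod R D (P (Suc (Suc k))) F\<^esub> \<in> nat_trans R D (P (Suc (Suc k))) F"
    by (rule nat_mod_zero[OF P F])
  have "(nat_comp D (P (Suc (Suc k))) \<eta> (d (Suc k)) = \<zero>\<^bsub>nat_mod R D (P (Suc (Suc k))) F\<^esub>) \<longleftrightarrow>
     (\<forall>x\<in>Obj D. \<forall>p\<in>carrier (At (P (Suc (Suc k))) x). \<eta> x (d (Suc k) x p) = \<zero>\<^bsub>At F x\<^esub>)"
    if "\<eta> \<in> nat_trans R D (P (Suc k)) F" for \<eta>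
  proof
    assume "nat_comp D (P (Suc (Suc k))) \<eta> (d (Suc k)) = \<zero>\<^bsub>nat_mod R D (P (Suc (Suc k))) F\<^esub>"
    then show "\<forall>x\<in>Obj D. \<forall>p\<in>carrier (At (P (Suc (Suc k))) x). \<eta> x (d (Suc k) x p) = \<zero>\<^bsub>At F x\<^esub>"
      by (metis nat_comp_apply nat_mod_sel(2) mk_nat_apply)
  qed (intro nat_trans_eqI[OF nat_comp_in_nat_trans[OF P d that] z], simp add: nat_comp_apply nat_mod_sel(2))
  then have Z: "{\<eta> \<in> nat_trans R D (P (Suc k)) F. nat_comp D (P (Suc (Suc k))) \<eta> (d (Suc k)) = \<zero>\<^bsub>nat_mod R D (P (Suc (Suc k))) F\<^esub>}
     = cocycles D P d k F"
    unfolding cocycles_def by blast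
  have B: "(\<lambda>\<eta>. nat_comp D (P (Suc k)) \<eta> (d k)) ` nat_trans R D (P k) F = coboundaries D P d k F"
  proof (intro equalityI subsetI)
    fix \<eta> assume "\<eta> \<in> (\<lambda>\<eta>. nat_comp D (P (Suc k)) \<eta> (d k)) ` nat_trans R D (P k) F"
    then show "\<eta> \<in> coboundaries D P d k F"
      using nat_comp_in_nat_trans[OF P d] by (auto simp: coboundaries_def nat_comp_apply)
  next
    fix \<eta> assume "\<eta> \<in> coboundaries D P d k F"
    then obtain \<zeta> where e: "\<eta> \<in> nat_trans R D (P (Suc k)) F" "\<zeta> \<in> nat_trans R D (P k) F"
      "\<And>x p. x \<in> Obj D \<Longrightarrow> p \<in> carrier (At (P (Suc k)) x) \<Longrightarrow> \<eta> x p = \<zeta> x (d k x p)"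
      by (auto simp: coboundaries_def)
    have "\<eta> = nat_comp D (P (Suc k)) \<zeta> (d k)"
      by (rule nat_trans_eqI[OF e(1) nat_comp_in_nat_trans[OF P d e(2)]]) (simp add: e(3) nat_comp_apply)
    then show "\<eta> \<in> (\<lambda>\<eta>. nat_comp D (P (Suc k)) \<eta> (d k)) ` nat_trans R D (P k) F" using e(2) by blast
  qed
  show ?thesis
    unfolding cohomology_of_resolution_def Let_def using Z B by simp
qed

lemma minus_eq_smult:
  assumes "Module.module R M" "y \<in> carrier M"
  shows "x \<ominus>\<^bsub>M\<^esub> y = x \<oplus>\<^bsub>M\<^esub> ((\<ominus> \<one>) \<odot>\<^bsub>M\<^esub> y)"
proof -
  interpret M: Module.module R M by fact
  show ?thesis using assms(2) by (simp add: a_minus_def M.smult_l_minus)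
qed

text \<open>Closure under negation is multiplication by \<open>-1\<close>.\<close>

lemma submoduleI_smult:
  assumes M: "Module.module R M" and "H \<subseteq> carrier M" "\<zero>\<^bsub>M\<^esub> \<in> H"
    and "\<And>a b. a \<in> H \<Longrightarrow> b \<in> H \<Longrightarrow> a \<oplus>\<^bsub>M\<^esub> b \<in> H"
    and smult: "\<And>r a. r \<in> carrier R \<Longrightarrow> a \<in> H \<Longrightarrow> r \<odot>\<^bsub>M\<^esub> a \<in> H"
  shows "submodule H R M"
proof -
  interpret M: Module.module R M by fact
  show ?thesis
  proof (rule M.submoduleI)
    show "\<ominus>\<^bsub>M\<^esub> a \<in> H" if "a \<in> H" for a
      using smult[OF _ that, of "\<ominus> \<one>"] that assms(2) by (simp add: M.smult_l_minus subset_iff)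
  qed (use assms in auto)
qed

lemma cocycles_submodule:
  assumes P: "\<And>n. contra_functor R D (P n)" and d: "\<And>n. d n \<in> nat_trans R D (P (Suc n)) (P n)"
    and F: "contra_functor R D F"
  shows "submodule (cocycles D P d k F) R (nat_mod R D (P (Suc k)) F)"
proof -
  interpret N: Module.module R "nat_mod R D (P (Suc k)) F" by (rule nat_mod_module[OF is_cring P F])
  have [simp]: "d (Suc k) x p \<in> carrier (At (P (Suc k)) x)" if "x \<in> Obj D" "p \<in> carrier (At (P (Suc (Suc k))) x)" for x p
    using nat_transD(2)[OF d that] .
  have mod: "Module.module R (At F x)" if "x \<in> Obj D" for x by (rule contra_functorD(1)[OF F that])
  have am: "abelian_monoid (At F x)" if "x \<in> Obj D" for x using mod[OF that] by (simp add: Module.module_def abelian_group_def)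
  have l0: "\<zero>\<^bsub>At F x\<^esub> \<oplus>\<^bsub>At F x\<^esub> \<zero>\<^bsub>At F x\<^esub> = \<zero>\<^bsub>At F x\<^esub>" if "x \<in> Obj D" for x
    using abelian_monoid.l_zero[OF am[OF that] abelian_monoid.zero_closed[OF am[OF that]]] .
  show ?thesis
  proof (rule submoduleI_smult[OF N.module_axioms])
    show "\<zero>\<^bsub>nat_mod R D (P (Suc k)) F\<^esub> \<in> cocycles D P d k F"
      using N.M.zero_closed by (auto simp: cocycles_def nat_mod_sel(1)) (simp add: nat_mod_sel(2))
    fix \<eta> assume e: "\<eta> \<in> cocycles D P d k F"
    show "r \<odot>\<^bsub>nat_mod R D (P (Suc k)) F\<^esub> \<eta> \<in> cocycles D P d k F" if "r \<in> carrier R" for r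
      using e N.smult_closed[OF that, of \<eta>]
      by (auto simp: cocycles_def nat_mod_sel(1)) (simp add: nat_mod_sel(4) Module.module.smult_r_null[OF mod] that)
    show "\<eta> \<oplus>\<^bsub>nat_mod R D (P (Suc k)) F\<^esub> \<theta> \<in> cocycles D P d k F" if "\<theta> \<in> cocycles D P d k F" for \<theta>
      using e that N.M.a_closed[of \<eta> \<theta>]
      by (auto simp: cocycles_def nat_mod_sel(1)) (simp add: nat_mod_sel(3) l0)
  qed (auto simp: cocycles_def nat_mod_sel(1))
qed

lemma coboundaries_submodule:
  assumes P: "\<And>n. contra_functor R D (P n)" and d: "\<And>n. d n \<in> nat_trans R D (P (Suc n)) (P n)"
    and F: "contra_functor R D F"
    and dd: "\<And>n x r. x \<in> Obj D \<Longrightarrow> r \<in> carrier (At (P (Suc (Suc n))) x) \<Longrightarrow> d n x (d (Suc n) x r) = \<zero>\<^bsub>At (P n) x\<^esub>"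
  shows "submodule (coboundaries D P d k F) R ((nat_mod R D (P (Suc k)) F)\<lparr>carrier := cocycles D P d k F\<rparr>)"
proof -
  interpret N: Module.module R "nat_mod R D (P (Suc k)) F" by (rule nat_mod_module[OF is_cring P F])
  interpret N0: Module.module R "nat_mod R D (P k) F" by (rule nat_mod_module[OF is_cring P F])
  have Z: "Module.module R ((nat_mod R D (P (Suc k)) F)\<lparr>carrier := cocycles D P d k F\<rparr>)"
    by (rule submodule.submodule_is_module[OF cocycles_submodule[where P = P and d = d, OF P d F] N.module_axioms])
  have [simp]: "d k x p \<in> carrier (At (P k) x)" if "x \<in> Obj D" "p \<in> carrier (At (P (Suc k)) x)" for x p
    using nat_transD(2)[OF d that] .
  show ?thesis
  proof (rule submoduleI_smult[OF Z])
    show "coboundaries D P d k F \<subseteq> carrier ((nat_mod R D (P (Suc k)) F)\<lparr>carrier := cocycles D P d k F\<rparr>)"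
    proof
      fix \<eta> assume "\<eta> \<in> coboundaries D P d k F"
      then obtain \<zeta> where e: "\<eta> \<in> nat_trans R D (P (Suc k)) F" "\<zeta> \<in> nat_trans R D (P k) F"
        "\<And>x p. x \<in> Obj D \<Longrightarrow> p \<in> carrier (At (P (Suc k)) x) \<Longrightarrow> \<eta> x p = \<zeta> x (d k x p)"
        by (auto simp: coboundaries_def)
      have "\<eta> x (d (Suc k) x p) = \<zero>\<^bsub>At F x\<^esub>" if "x \<in> Obj D" "p \<in> carrier (At (P (Suc (Suc k))) x)" for x p
        using e(3)[OF that(1) nat_transD(2)[OF d that]] dd[OF that] nat_trans_zero[OF P F e(2) that(1)] by simp
      then show "\<eta> \<in> carrier ((nat_mod R D (P (Suc k)) F)\<lparr>carrier := cocycles D P d k F\<rparr>)"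
        using e(1) by (simp add: cocycles_def)
    qed
    show "\<zero>\<^bsub>(nat_mod R D (P (Suc k)) F)\<lparr>carrier := cocycles D P d k F\<rparr>\<^esub> \<in> coboundaries D P d k F"
      using N.M.zero_closed N0.M.zero_closed unfolding coboundaries_def
      by (auto simp: nat_mod_sel(1) intro!: bexI[of _ "\<zero>\<^bsub>nat_mod R D (P k) F\<^esub>"]) (simp add: nat_mod_sel(2))
    fix \<eta> assume "\<eta> \<in> coboundaries D P d k F"
    then obtain \<zeta> where e: "\<eta> \<in> nat_trans R D (P (Suc k)) F" "\<zeta> \<in> nat_trans R D (P k) F"
        "\<And>x p. x \<in> Obj D \<Longrightarrow> p \<in> carrier (At (P (Suc k)) x) \<Longrightarrow> \<eta> x p = \<zeta> x (d k x p)"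
      by (auto simp: coboundaries_def)
    show "r \<odot>\<^bsub>(nat_mod R D (P (Suc k)) F)\<lparr>carrier := cocycles D P d k F\<rparr>\<^esub> \<eta> \<in> coboundaries D P d k F" if "r \<in> carrier R" for r
    proof -
      have "r \<odot>\<^bsub>nat_mod R D (P (Suc k)) F\<^esub> \<eta> \<in> nat_trans R D (P (Suc k)) F" "r \<odot>\<^bsub>nat_mod R D (P k) F\<^esub> \<zeta> \<in> nat_trans R D (P k) F"
        using N.smult_closed[OF that] N0.smult_closed[OF that] e(1,2) by (auto simp: nat_mod_sel(1))
      then show ?thesis
        unfolding coboundaries_def by (auto intro!: bexI[of _ "r \<odot>\<^bsub>nat_mod R D (P k) F\<^esub> \<zeta>"]) (simp add: nat_mod_sel(4) e(3))
    qed
    fix \<theta> assume "\<theta> \<in> coboundaries D P d k F"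
    then obtain \<xi> where t: "\<theta> \<in> nat_trans R D (P (Suc k)) F" "\<xi> \<in> nat_trans R D (P k) F"
        "\<And>x p. x \<in> Obj D \<Longrightarrow> p \<in> carrier (At (P (Suc k)) x) \<Longrightarrow> \<theta> x p = \<xi> x (d k x p)"
      by (auto simp: coboundaries_def)
    have "\<eta> \<oplus>\<^bsub>nat_mod R D (P (Suc k)) F\<^esub> \<theta> \<in> nat_trans R D (P (Suc k)) F" "\<zeta> \<oplus>\<^bsub>nat_mod R D (P k) F\<^esub> \<xi> \<in> nat_trans R D (P k) F"
      using N.M.a_closed N0.M.a_closed e(1,2) t(1,2) by (auto simp: nat_mod_sel(1))
    then show "\<eta> \<oplus>\<^bsub>(nat_mod R D (P (Suc k)) F)\<lparr>carrier := cocycles D P d k F\<rparr>\<^esub> \<theta> \<in> coboundaries D P d k F"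
      unfolding coboundaries_def
      by (auto intro!: bexI[of _ "\<zeta> \<oplus>\<^bsub>nat_mod R D (P k) F\<^esub> \<xi>"]) (simp add: nat_mod_sel(3) e(3) t(3))
  qed
qed

lemma coboundaryI:
  assumes "\<eta> \<in> nat_trans R D (P (Suc k)) F" "\<zeta> \<in> nat_trans R D (P k) F"
    "\<And>x p. x \<in> Obj D \<Longrightarrow> p \<in> carrier (At (P (Suc k)) x) \<Longrightarrow> \<eta> x p = \<zeta> x (d k x p)"
  shows "\<eta> \<in> coboundaries D P d k F"
  using assms by (auto simp: coboundaries_def)

text \<open>Lifts of the identity in both directions, \<open>\<phi> : P \<rightarrow> Q\<close> and \<open>\<psi> : Q \<rightarrow> P\<close>, exist by projectivity. Their
composites are endomorphisms that lift the identity, so they act as the identity on cohomology.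
Hence precomposition with \<open>\<psi>\<close> is injective and surjective on classes.\<close>

theorem cohomology_of_resolution_independent:
  fixes D :: "('o, 'c) cat" and P :: "nat \<Rightarrow> ('o, 'c, 'a, 'p) mfunctor" and Q :: "nat \<Rightarrow> ('o, 'c, 'a, 'q) mfunctor"
  assumes D: "category D" and M: "contra_functor R D M" and F: "contra_functor R D F"
    and resP: "projective_resolution R D M P d e" and resQ: "projective_resolution R D M Q d' e'"
  shows "mod_isomorphic R (cohomology_of_resolution R D P d (Suc k) F) (cohomology_of_resolution R D Q d' (Suc k) F)"
proof -
  note p = projective_resolutionD[OF resP] and q = projective_resolutionD[OF resQ]
  obtain \<phi> where \<phi>: "\<And>n. \<phi> n \<in> nat_trans R D (P n) (Q n)"
    "\<And>x p. x \<in> Obj D \<Longrightarrow> p \<in> carrier (At (P 0) x) \<Longrightarrow> e' x (\<phi> 0 x p) = e x p"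
    "\<And>n x p. x \<in> Obj D \<Longrightarrow> p \<in> carrier (At (P (Suc n)) x) \<Longrightarrow> d' n x (\<phi> (Suc n) x p) = \<phi> n x (d n x p)"
    using chain_map_lift[OF D M resP resQ] by metis
  obtain \<psi> where \<psi>: "\<And>n. \<psi> n \<in> nat_trans R D (Q n) (P n)"
    "\<And>x p. x \<in> Obj D \<Longrightarrow> p \<in> carrier (At (Q 0) x) \<Longrightarrow> e x (\<psi> 0 x p) = e' x p"
    "\<And>n x p. x \<in> Obj D \<Longrightarrow> p \<in> carrier (At (Q (Suc n)) x) \<Longrightarrow> d n x (\<psi> (Suc n) x p) = \<psi> n x (d' n x p)"
    using chain_map_lift[OF D M resQ resP] by metis
  define \<theta> where "\<theta> n = nat_comp D (P n) (\<psi> n) (\<phi> n)" for n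
  define \<theta>' where "\<theta>' n = nat_comp D (Q n) (\<phi> n) (\<psi> n)" for n
  note \<phi>c = nat_transD(2)[OF \<phi>(1)] and \<psi>c = nat_transD(2)[OF \<psi>(1)] and dc = nat_transD(2)[OF p(3)] and d'c = nat_transD(2)[OF q(3)]
  have \<theta>: "\<And>n. \<theta> n \<in> nat_trans R D (P n) (P n)"
      "\<And>x p. x \<in> Obj D \<Longrightarrow> p \<in> carrier (At (P 0) x) \<Longrightarrow> e x (\<theta> 0 x p) = e x p"
      "\<And>n x p. x \<in> Obj D \<Longrightarrow> p \<in> carrier (At (P (Suc n)) x) \<Longrightarrow> d n x (\<theta> (Suc n) x p) = \<theta> n x (d n x p)"
    unfolding \<theta>_def using nat_comp_in_nat_trans[OF p(2) \<phi>(1) \<psi>(1)]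
    by (simp_all add: nat_comp_apply \<phi> \<psi> \<phi>c dc)
  have \<theta>': "\<And>n. \<theta>' n \<in> nat_trans R D (Q n) (Q n)"
      "\<And>x p. x \<in> Obj D \<Longrightarrow> p \<in> carrier (At (Q 0) x) \<Longrightarrow> e' x (\<theta>' 0 x p) = e' x p"
      "\<And>n x p. x \<in> Obj D \<Longrightarrow> p \<in> carrier (At (Q (Suc n)) x) \<Longrightarrow> d' n x (\<theta>' (Suc n) x p) = \<theta>' n x (d' n x p)"
    unfolding \<theta>'_def using nat_comp_in_nat_trans[OF q(2) \<psi>(1) \<phi>(1)]
    by (simp_all add: nat_comp_apply \<phi> \<psi> \<psi>c d'c)
  let ?NP = "nat_mod R D (P (Suc k)) F" and ?NQ = "nat_mod R D (Q (Suc k)) F"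
  let ?ZP = "?NP\<lparr>carrier := cocycles D P d k F\<rparr>" and ?ZQ = "?NQ\<lparr>carrier := cocycles D Q d' k F\<rparr>"
  have NP: "Module.module R ?NP" and NQ: "Module.module R ?NQ"
    by (rule nat_mod_module[OF is_cring p(2) F], rule nat_mod_module[OF is_cring q(2) F])
  have ZP: "Module.module R ?ZP" and ZQ: "Module.module R ?ZQ"
    using submodule.submodule_is_module[OF cocycles_submodule[where P = P and d = d, OF p(2) p(3) F] NP]
      submodule.submodule_is_module[OF cocycles_submodule[where P = Q and d = d', OF q(2) q(3) F] NQ] by auto
  have BP: "submodule (coboundaries D P d k F) R ?ZP" and BQ: "submodule (coboundaries D Q d' k F) R ?ZQ"
    by (rule coboundaries_submodule[where P = P and d = d, OF p(2) p(3) F p(8)], assumption+,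
        rule coboundaries_submodule[where P = Q and d = d', OF q(2) q(3) F q(8)], assumption+)
  have zP: "\<eta> \<in> nat_trans R D (P (Suc k)) F" "\<And>x r. x \<in> Obj D \<Longrightarrow> r \<in> carrier (At (P (Suc (Suc k))) x) \<Longrightarrow> \<eta> x (d (Suc k) x r) = \<zero>\<^bsub>At F x\<^esub>"
    if "\<eta> \<in> carrier ?ZP" for \<eta> using that by (auto simp: cocycles_def)
  have zQ: "\<eta> \<in> nat_trans R D (Q (Suc k)) F" "\<And>x r. x \<in> Obj D \<Longrightarrow> r \<in> carrier (At (Q (Suc (Suc k))) x) \<Longrightarrow> \<eta> x (d' (Suc k) x r) = \<zero>\<^bsub>At F x\<^esub>"
    if "\<eta> \<in> carrier ?ZQ" for \<eta> using that by (auto simp: cocycles_def)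
  define h where "h \<eta> = nat_comp D (Q (Suc k)) \<eta> (\<psi> (Suc k))" for \<eta> :: "'o \<Rightarrow> 'p \<Rightarrow> 'e"
  have hz: "h \<eta> \<in> carrier ?ZQ" if "\<eta> \<in> carrier ?ZP" for \<eta>
    using nat_comp_in_nat_trans[OF q(2) \<psi>(1) zP(1)[OF that]] zP(2)[OF that]
    by (auto simp: cocycles_def h_def nat_comp_apply d'c \<psi>(3)[symmetric] \<psi>c)
  have lin: "lin_map R ?ZP ?ZQ h"
  proof (rule lin_mapI[OF hz])
    fix \<eta> \<kappa> assume e: "\<eta> \<in> carrier ?ZP" "\<kappa> \<in> carrier ?ZP"
    have s: "\<eta> \<oplus>\<^bsub>?ZP\<^esub> \<kappa> \<in> carrier ?ZP" "h \<eta> \<oplus>\<^bsub>?ZQ\<^esub> h \<kappa> \<in> carrier ?ZQ"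
      using e hz ZP ZQ by (meson Module.module.axioms(2) abelian_group.axioms(1) abelian_monoid.a_closed)+
    show "h (\<eta> \<oplus>\<^bsub>?ZP\<^esub> \<kappa>) = h \<eta> \<oplus>\<^bsub>?ZQ\<^esub> h \<kappa>"
      by (rule nat_trans_eqI[OF zQ(1)[OF hz[OF s(1)]] zQ(1)[OF s(2)]])
         (simp add: h_def nat_comp_apply nat_mod_sel(3) \<psi>c)
  next
    fix r \<eta> assume e: "r \<in> carrier R" "\<eta> \<in> carrier ?ZP"
    have s: "r \<odot>\<^bsub>?ZP\<^esub> \<eta> \<in> carrier ?ZP" "r \<odot>\<^bsub>?ZQ\<^esub> h \<eta> \<in> carrier ?ZQ"
      using e hz Module.module.smult_closed[OF ZP] Module.module.smult_closed[OF ZQ] by blast+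
    show "h (r \<odot>\<^bsub>?ZP\<^esub> \<eta>) = r \<odot>\<^bsub>?ZQ\<^esub> h \<eta>"
      by (rule nat_trans_eqI[OF zQ(1)[OF hz[OF s(1)]] zQ(1)[OF s(2)]])
         (simp add: h_def nat_comp_apply nat_mod_sel(4) \<psi>c)
  qed
  have minus_apply': "(\<eta> \<ominus>\<^bsub>?ZQ\<^esub> \<kappa>) x r = \<eta> x r \<ominus>\<^bsub>At F x\<^esub> \<kappa> x r"
    if "\<eta> \<in> carrier ?ZQ" "\<kappa> \<in> carrier ?ZQ" "x \<in> Obj D" "r \<in> carrier (At (Q (Suc k)) x)" for \<eta> \<kappa> x r
    using that nat_transD(2)[OF zQ(1)[OF that(2)] that(3,4)]
    by (simp add: minus_eq_smult[OF ZQ] minus_eq_smult[OF contra_functorD(1)[OF F]] nat_mod_sel(3,4))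
  have minusQ: "\<eta> \<ominus>\<^bsub>?ZQ\<^esub> \<kappa> \<in> carrier ?ZQ" if "\<eta> \<in> carrier ?ZQ" "\<kappa> \<in> carrier ?ZQ" for \<eta> \<kappa>
    using abelian_group.minus_closed[OF Module.module.axioms(2)[OF ZQ] that] .
  show ?thesis
    unfolding cohomology_of_resolution_Suc[where P = P and d = d, OF p(2) p(3) F]
      cohomology_of_resolution_Suc[where P = Q and d = d', OF q(2) q(3) F]
  proof (rule quot_mod_isomorphic[OF ZP ZQ BP BQ lin])
    fix \<eta> assume e: "\<eta> \<in> carrier ?ZP"
    note zp = zP[OF e] and zh = zQ[OF hz[OF e]]
    show "h \<eta> \<in> coboundaries D Q d' k F \<longleftrightarrow> \<eta> \<in> coboundaries D P d k F"
    proof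
      assume "\<eta> \<in> coboundaries D P d k F"
      then obtain \<zeta> where z: "\<zeta> \<in> nat_trans R D (P k) F"
        "\<And>x p. x \<in> Obj D \<Longrightarrow> p \<in> carrier (At (P (Suc k)) x) \<Longrightarrow> \<eta> x p = \<zeta> x (d k x p)"
        by (auto simp: coboundaries_def)
      show "h \<eta> \<in> coboundaries D Q d' k F"
        by (rule coboundaryI[where P = Q and d = d' and k = k, OF zh(1) nat_comp_in_nat_trans[OF q(2) \<psi>(1) z(1)]])
           (simp add: h_def nat_comp_apply z(2) \<psi>c \<psi>(3) d'c)
    next
      assume "h \<eta> \<in> coboundaries D Q d' k F"
      then obtain \<zeta> where z: "\<zeta> \<in> nat_trans R D (Q k) F"
        "\<And>x p. x \<in> Obj D \<Longrightarrow> p \<in> carrier (At (Q (Suc k)) x) \<Longrightarrow> h \<eta> x p = \<zeta> x (d' k x p)"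
        by (auto simp: coboundaries_def)
      obtain \<xi> where xi: "\<xi> \<in> nat_trans R D (P k) F" "\<And>x p. x \<in> Obj D \<Longrightarrow> p \<in> carrier (At (P (Suc k)) x) \<Longrightarrow>
         \<eta> x (\<theta> (Suc k) x p) \<ominus>\<^bsub>At F x\<^esub> \<eta> x p = \<xi> x (d k x p)"
        by (rule chain_endomap_cohomologous[where \<phi> = \<theta> and k = k and \<eta> = \<eta>, OF D M F resP])
           (assumption | rule \<theta> zp that)+
      note z\<phi> = nat_comp_in_nat_trans[OF p(2) \<phi>(1)[of k] z(1)]
      show "\<eta> \<in> coboundaries D P d k F"
      proof (rule coboundaryI[where P = P and d = d and k = k, OF zp(1) mk_nat_diff_in_nat_trans[OF p(2) F z\<phi> xi(1)]])
        fix x r assume x: "x \<in> Obj D" "r \<in> carrier (At (P (Suc k)) x)"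
        interpret Fx: Module.module R "At F x" by (rule contra_functorD(1)[OF F x(1)])
        have a: "\<eta> x (\<theta> (Suc k) x r) \<in> carrier (At F x)" "\<eta> x r \<in> carrier (At F x)"
          using nat_transD(2)[OF zp(1) x(1)] nat_transD(2)[OF \<theta>(1) x] x by auto
        have "\<eta> x (\<theta> (Suc k) x r) = \<zeta> x (\<phi> k x (d k x r))"
          using z(2)[OF x(1) \<phi>c[OF x]] x by (simp add: h_def \<theta>_def nat_comp_apply \<phi>c \<phi>(3))
        moreover have "\<eta> x r = \<eta> x (\<theta> (Suc k) x r) \<ominus>\<^bsub>At F x\<^esub> (\<eta> x (\<theta> (Suc k) x r) \<ominus>\<^bsub>At F x\<^esub> \<eta> x r)"
          using a by (simp add: a_minus_def Fx.M.minus_add Fx.M.a_assoc[symmetric] Fx.M.r_neg)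
        ultimately show "\<eta> x r = mk_nat D (P k) (\<lambda>x p. nat_comp D (P k) \<zeta> (\<phi> k) x p \<ominus>\<^bsub>At F x\<^esub> \<xi> x p) x (d k x r)"
          using xi(2)[OF x] x dc[OF x] by (simp add: nat_comp_apply)
      qed
    qed
  next
    fix \<eta> assume e: "\<eta> \<in> carrier ?ZQ"
    note zq = zQ[OF e]
    let ?\<kappa> = "nat_comp D (P (Suc k)) \<eta> (\<phi> (Suc k))"
    have \<kappa>: "?\<kappa> \<in> carrier ?ZP"
      using nat_comp_in_nat_trans[OF p(2) \<phi>(1) zq(1)] zq(2)
      by (auto simp: cocycles_def nat_comp_apply dc \<phi>(3)[symmetric] \<phi>c)
    obtain \<xi> where xi: "\<xi> \<in> nat_trans R D (Q k) F" "\<And>x p. x \<in> Obj D \<Longrightarrow> p \<in> carrier (At (Q (Suc k)) x) \<Longrightarrow>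
         \<eta> x (\<theta>' (Suc k) x p) \<ominus>\<^bsub>At F x\<^esub> \<eta> x p = \<xi> x (d' k x p)"
      by (rule chain_endomap_cohomologous[where \<phi> = \<theta>' and k = k and \<eta> = \<eta>, OF D M F resQ])
         (assumption | rule \<theta>' zq that)+
    have "h ?\<kappa> \<ominus>\<^bsub>?ZQ\<^esub> \<eta> \<in> coboundaries D Q d' k F"
    proof (rule coboundaryI[where P = Q and d = d' and k = k, OF zQ(1)[OF minusQ[OF hz[OF \<kappa>] e]] xi(1)])
      fix x r assume x: "x \<in> Obj D" "r \<in> carrier (At (Q (Suc k)) x)"
      show "(h ?\<kappa> \<ominus>\<^bsub>?ZQ\<^esub> \<eta>) x r = \<xi> x (d' k x r)"
        using minus_apply'[OF hz[OF \<kappa>] e x] xi(2)[OF x] x by (simp add: h_def \<theta>'_def nat_comp_apply \<psi>c)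
    qed
    then have "\<ominus>\<^bsub>?ZQ\<^esub> (h ?\<kappa> \<ominus>\<^bsub>?ZQ\<^esub> \<eta>) \<in> coboundaries D Q d' k F"
      by (rule submodule_minus[OF ZQ BQ])
    moreover have "\<ominus>\<^bsub>?ZQ\<^esub> (h ?\<kappa> \<ominus>\<^bsub>?ZQ\<^esub> \<eta>) = \<eta> \<ominus>\<^bsub>?ZQ\<^esub> h ?\<kappa>"
    proof -
      interpret Z: Module.module R ?ZQ by (rule ZQ)
      show ?thesis using e hz[OF \<kappa>] Z.M.minus_add[of "h ?\<kappa>" "\<ominus>\<^bsub>?ZQ\<^esub> \<eta>"] Z.M.minus_minus[OF e]
        by (simp only: a_minus_def Z.M.a_inv_closed Z.M.a_comm)
    qed
    ultimately show "\<exists>z\<in>carrier ?ZP. \<eta> \<ominus>\<^bsub>?ZQ\<^esub> h z \<in> coboundaries D Q d' k F"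
      using \<kappa> by auto
  qed
qed

end

section \<open>The complex of comparable lists over a ring\<close>

lemma comparable_lists_subset: "xs \<in> comparable_lists X leq \<Longrightarrow> set ys \<subseteq> set xs \<Longrightarrow> ys \<in> comparable_lists X leq"
  unfolding comparable_lists_def by blast

lemma keys_bd_comparable:
  "xs \<in> comparable_lists X leq \<Longrightarrow> length xs = Suc n \<Longrightarrow>
     supp (bd xs) \<subseteq> {ys \<in> comparable_lists X leq. length ys = n}"
  using keys_bd[of xs] comparable_lists_subset by fastforce

text \<open>Several points of \<open>V\<close> may lie over the same point of \<open>X\<close>. This does not change homology: \<open>s \<circ> p\<close> moves
each point of \<open>V\<close> to an equivalent one, so it is contiguous to the identity.\<close>

lemma acyclic_comparable_lists_pullback:
  assumes acyclic: "acyclic_lists (comparable_lists X leq)"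
    and p: "\<And>v. v \<in> V \<Longrightarrow> p v \<in> X" and s: "\<And>x. x \<in> X \<Longrightarrow> s x \<in> V" "\<And>x. x \<in> X \<Longrightarrow> p (s x) = x"
  shows "acyclic_lists (comparable_lists V (\<lambda>v w. leq (p v) (p w)))"
  unfolding acyclic_lists_def
proof (intro allI impI)
  let ?S = "comparable_lists X leq" and ?T = "comparable_lists V (\<lambda>v w. leq (p v) (p w))"
  fix z assume z: "supp z \<subseteq> ?T" "bdry z = 0"
  have "map p ` ?T \<subseteq> ?S"
  proof (rule image_subsetI)
    fix vs assume "vs \<in> ?T"
    then have "set vs \<subseteq> V" "\<forall>v\<in>set vs. \<forall>w\<in>set vs. leq (p v) (p w) \<or> leq (p w) (p v)" by (auto simp: comparable_lists_def)
    then show "map p vs \<in> ?S" using p by (auto simp: comparable_lists_def subset_iff)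
  qed
  then have "supp (push p z) \<subseteq> ?S" using keys_push[OF z(1), of p] by blast
  moreover have "bdry (push p z) = 0" by (simp add: push_bdry[symmetric] z(2))
  ultimately obtain w where w: "supp w \<subseteq> ?S" "bdry w = push p z"
    using acyclic unfolding acyclic_lists_def by blast
  have "map s ` ?S \<subseteq> ?T"
  proof (rule image_subsetI)
    fix xs assume "xs \<in> ?S"
    then have "set xs \<subseteq> X" "\<forall>x\<in>set xs. \<forall>y\<in>set xs. leq x y \<or> leq y x" by (auto simp: comparable_lists_def)
    then show "map s xs \<in> ?T" using s by (auto simp: comparable_lists_def subset_iff)
  qed
  then have sw: "supp (push s w) \<subseteq> ?T" using keys_push[OF w(1), of s] by blast
  have bsw: "bdry (push s w) = push (s \<circ> p) z" by (simp add: push_bdry[symmetric] w(2) push_push)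
  have "\<exists>u. supp u \<subseteq> ?T \<and> bdry u = push id z - push (s \<circ> p) z"
  proof (rule contiguous_homologous[OF z])
    fix xs ys assume xs: "xs \<in> ?T" and ys: "set ys \<subseteq> (s \<circ> p) ` set xs \<union> id ` set xs"
    have xsV: "set xs \<subseteq> V" "\<forall>v\<in>set xs. \<forall>w\<in>set xs. leq (p v) (p w) \<or> leq (p w) (p v)"
      using xs by (auto simp: comparable_lists_def)
    have rep: "y \<in> V \<and> (\<exists>x\<in>set xs. p y = p x)" if "y \<in> set ys" for y
      using that ys xsV(1) s p by (auto 4 3 simp: subset_iff)
    show "ys \<in> ?T"
      unfolding comparable_lists_def
    proof (intro CollectI conjI subsetI ballI)
      show "y \<in> V" if "y \<in> set ys" for y using rep[OF that] by blast
      show "leq (p y) (p y') \<or> leq (p y') (p y)" if "y \<in> set ys" "y' \<in> set ys" for y y'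
        using rep[OF that(1)] rep[OF that(2)] xsV(2) by metis
    qed
  qed
  then obtain u where u: "supp u \<subseteq> ?T" "bdry u = push id z - push (s \<circ> p) z" by blast
  have "push id z = z" by (rule push_ident) simp
  then have "bdry (u + push s w) = z" using u bsw by simp
  then show "\<exists>w. supp w \<subseteq> ?T \<and> bdry w = z" using keys_add_subset[OF u(1) sw] by blast
qed

text \<open>Over the integers, exactness of a complex of free modules that is bounded below gives a contraction. A
contraction is preserved by every change of coefficients, whereas exactness alone need not be.\<close>

lemma acyclic_comparable_lists_contraction:
  assumes acyclic: "acyclic_lists (comparable_lists V leq)"
  obtains D where
    "\<And>xs. xs \<in> comparable_lists V leq \<Longrightarrow> supp (D xs) \<subseteq> {ys \<in> comparable_lists V leq. length ys = Suc (length xs)}"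
    "\<And>xs. xs \<in> comparable_lists V leq \<Longrightarrow> bdry (D xs) + frag_extend D (bd xs) = frag_of xs"
proof -
  let ?T = "comparable_lists V leq"
  have fill: "\<exists>w. supp w \<subseteq> {ys \<in> ?T. length ys = Suc n} \<and> bdry w = z"
    if z: "supp z \<subseteq> {ys \<in> ?T. length ys = n}" "bdry z = 0" for z n
  proof -
    obtain w where w: "supp w \<subseteq> ?T" "bdry w = z"
      using acyclic z unfolding acyclic_lists_def by blast
    let ?w = "frag_extend (\<lambda>xs. if length xs = Suc n then frag_of xs else 0) w"
    have "bdry ?w = z" using bdry_homogeneous_part[of w n] z(1) w(2) by blast
    moreover have "supp ?w \<subseteq> {ys \<in> ?T. length ys = Suc n}"
      by (rule keys_frag_extend_subset[OF w(1)]) (auto simp: keys_frag_of)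
    ultimately show ?thesis by blast
  qed
  have nil: "[] \<in> ?T" by (simp add: comparable_lists_def)
  obtain w0 where w0: "supp w0 \<subseteq> {ys \<in> ?T. length ys = Suc 0}" "bdry w0 = frag_of []"
    using fill[of "frag_of []" 0] nil by (auto simp: keys_frag_of)
  obtain D where "\<And>xs. xs \<in> ?T \<Longrightarrow> supp (D xs) \<subseteq> {ys \<in> ?T. length ys = Suc (length xs)}"
    "\<And>xs. xs \<in> ?T \<Longrightarrow> bdry (D xs) + frag_extend D (bd xs) = frag_of xs"
  proof (rule acyclic_carrier_homotopy[where S = ?T and g = frag_of and ?w0.0 = w0 and
        A = "\<lambda>xs. {ys \<in> ?T. length ys = length xs}" and B = "\<lambda>xs. {ys \<in> ?T. length ys = Suc (length xs)}"])
    fix xs ys assume "xs \<in> ?T" and ys: "ys \<in> supp (bd xs)"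
    then show "ys \<in> ?T \<and> {zs \<in> ?T. length zs = Suc (length ys)} \<subseteq> {zs \<in> ?T. length zs = length xs}"
      using subsetD[OF keys_bd ys] comparable_lists_subset by auto
  next
    show "bdry (frag_of xs) = frag_extend frag_of (bd xs)" for xs :: "'a list" by (simp flip: frag_expansion)
  qed (use fill w0 in \<open>auto simp: keys_frag_of\<close>)
  then show ?thesis using that by blast
qed

text \<open>The differential of the complex with coefficients in \<open>R\<close>, from degree \<open>n + 1\<close> to degree \<open>n\<close>, where
the degree is the length of the lists. The empty list makes up degree \<open>0\<close>.\<close>

definition list_diff :: "('r, 'q) ring_scheme \<Rightarrow> 'v list set \<Rightarrow> nat \<Rightarrow> ('v list \<Rightarrow> 'r) \<Rightarrow> 'v list \<Rightarrow> 'r" where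
  "list_diff R T n = lin_ext R (free_mod R {xs \<in> T. length xs = n}) (\<lambda>s. cring.base_change R (bd s))"

context cring
begin

lemma list_diff_lin_map:
  "lin_map R (free_mod R {xs \<in> comparable_lists V leq. length xs = Suc n}) (free_mod R {xs \<in> comparable_lists V leq. length xs = n})
     (list_diff R (comparable_lists V leq) n)"
  unfolding list_diff_def
  by (rule lin_ext_lin_map[OF free_mod_module]) (rule base_change_closed, rule keys_bd_comparable, auto)

lemma list_diff_base_change:
  "supp c \<subseteq> {xs \<in> comparable_lists V leq. length xs = Suc n} \<Longrightarrow>
   list_diff R (comparable_lists V leq) n (base_change c) = base_change (bdry c)"
  unfolding list_diff_def bdry_def
  by (rule lin_ext_base_change) (auto dest: keys_bd_comparable)

lemma list_diff_delta:
  "s \<in> comparable_lists V leq \<Longrightarrow> length s = Suc n \<Longrightarrow> list_diff R (comparable_lists V leq) n (delta R s) = base_change (bd s)"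
  using list_diff_base_change[of "frag_of s" V leq n] by (simp add: keys_frag_of base_change_frag_of)

lemma list_diff_list_diff:
  assumes "a \<in> carrier (free_mod R {xs \<in> comparable_lists V leq. length xs = Suc (Suc n)})"
  shows "list_diff R (comparable_lists V leq) n (list_diff R (comparable_lists V leq) (Suc n) a) = (\<lambda>_. \<zero>)"
proof -
  let ?T = "\<lambda>n. {xs \<in> comparable_lists V leq. length xs = n}"
  have "list_diff R (comparable_lists V leq) n (list_diff R (comparable_lists V leq) (Suc n) a) = \<zero>\<^bsub>free_mod R (?T n)\<^esub>"
  proof (rule lin_map_eqI[where S = "?T (Suc (Suc n))", OF free_mod_module lin_map_compose[OF list_diff_lin_map list_diff_lin_map]
        lin_map_zero_fun[OF free_mod_module free_mod_module] _ assms])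
    fix s assume s: "s \<in> ?T (Suc (Suc n))"
    have "supp (bd s) \<subseteq> ?T (Suc n)" using s by (intro keys_bd_comparable) auto
    then show "list_diff R (comparable_lists V leq) n (list_diff R (comparable_lists V leq) (Suc n) (delta R s)) = \<zero>\<^bsub>free_mod R (?T n)\<^esub>"
      using s by (simp add: list_diff_delta list_diff_base_change base_change_zero[symmetric])
  qed
  then show ?thesis by (simp add: free_mod_sel)
qed

lemma list_diff_exact:
  assumes acyclic: "acyclic_lists (comparable_lists V leq)"
    and a: "a \<in> carrier (free_mod R {xs \<in> comparable_lists V leq. length xs = Suc n})"
    and da: "list_diff R (comparable_lists V leq) n a = (\<lambda>_. \<zero>)"
  shows "a \<in> list_diff R (comparable_lists V leq) (Suc n) ` carrier (free_mod R {xs \<in> comparable_lists V leq. length xs = Suc (Suc n)})"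
proof -
  let ?T = "\<lambda>n. {xs \<in> comparable_lists V leq. length xs = n}"
  let ?d = "list_diff R (comparable_lists V leq)"
  obtain D where D: "\<And>xs. xs \<in> comparable_lists V leq \<Longrightarrow> supp (D xs) \<subseteq> ?T (Suc (length xs))"
    "\<And>xs. xs \<in> comparable_lists V leq \<Longrightarrow> bdry (D xs) + frag_extend D (bd xs) = frag_of xs"
    by (rule acyclic_comparable_lists_contraction[OF acyclic]) (rule that)
  define h where "h n = lin_ext R (free_mod R (?T (Suc n))) (\<lambda>s. base_change (D s))" for n
  have kD: "supp (D s) \<subseteq> ?T (Suc n)" if "s \<in> ?T n" for s n using D(1) that by blast
  have h: "lin_map R (free_mod R (?T n)) (free_mod R (?T (Suc n))) (h n)" for n
    unfolding h_def by (rule lin_ext_lin_map[OF free_mod_module]) (rule base_change_closed[OF kD])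
  have hb: "h n (base_change c) = base_change (frag_extend D c)" if "supp c \<subseteq> ?T n" for c n
    unfolding h_def by (rule lin_ext_base_change[OF that]) (rule kD)
  interpret F: Module.module R "free_mod R (?T (Suc n))" by (rule free_mod_module)
  have "?d (Suc n) (h (Suc n) a) \<oplus>\<^bsub>free_mod R (?T (Suc n))\<^esub> h n (?d n a) = a"
  proof (rule lin_map_eqI[where S = "?T (Suc n)" and g = "\<lambda>a. a", OF free_mod_module lin_map_add_fun[OF free_mod_module free_mod_module
          lin_map_compose[OF h list_diff_lin_map] lin_map_compose[OF list_diff_lin_map h]] _ _ a])
    show "lin_map R (free_mod R (?T (Suc n))) (free_mod R (?T (Suc n))) (\<lambda>a. a)" by (rule lin_mapI) auto
    fix s assume s: "s \<in> ?T (Suc n)"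
    have kb: "supp (bd s) \<subseteq> ?T n" using s by (intro keys_bd_comparable) auto
    have "h (Suc n) (delta R s) = base_change (D s)"
      using hb[of "frag_of s" "Suc n"] s by (simp add: keys_frag_of base_change_frag_of)
    then have "?d (Suc n) (h (Suc n) (delta R s)) \<oplus>\<^bsub>free_mod R (?T (Suc n))\<^esub> h n (?d n (delta R s)) =
      base_change (bdry (D s)) \<oplus>\<^bsub>free_mod R (?T (Suc n))\<^esub> base_change (frag_extend D (bd s))"
      using s by (simp add: list_diff_delta hb[OF kb] list_diff_base_change[OF kD[OF s]])
    also have "\<dots> = delta R s"
      using D(2)[of s] s by (simp add: base_change_frag_of flip: base_change_add)
    finally show "?d (Suc n) (h (Suc n) (delta R s)) \<oplus>\<^bsub>free_mod R (?T (Suc n))\<^esub> h n (?d n (delta R s)) = delta R s" .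
  qed
  moreover have "h n (?d n a) = \<zero>\<^bsub>free_mod R (?T (Suc n))\<^esub>"
    using lin_map_zero[OF free_mod_module free_mod_module h] da by (simp add: free_mod_sel)
  moreover have ha: "h (Suc n) a \<in> carrier (free_mod R (?T (Suc (Suc n))))" by (rule lin_mapD(1)[OF h a])
  ultimately have "?d (Suc n) (h (Suc n) a) = a"
    using lin_mapD(1)[OF list_diff_lin_map ha] by simp
  then show ?thesis using imageI[OF ha, of "?d (Suc n)"] by simp
qed

lemma list_diff_0_surj:
  assumes acyclic: "acyclic_lists (comparable_lists V leq)" and r: "r \<in> carrier R"
  shows "\<exists>a\<in>carrier (free_mod R {xs \<in> comparable_lists V leq. length xs = Suc 0}). list_diff R (comparable_lists V leq) 0 a [] = r"
proof -
  obtain D where D: "\<And>xs. xs \<in> comparable_lists V leq \<Longrightarrow> supp (D xs) \<subseteq> {ys \<in> comparable_lists V leq. length ys = Suc (length xs)}"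
    "\<And>xs. xs \<in> comparable_lists V leq \<Longrightarrow> bdry (D xs) + frag_extend D (bd xs) = frag_of xs"
    by (rule acyclic_comparable_lists_contraction[OF acyclic]) (rule that)
  have nil: "[] \<in> comparable_lists V leq" by (simp add: comparable_lists_def)
  let ?F = "free_mod R {xs \<in> comparable_lists V leq. length xs = Suc 0}"
  have k: "supp (D []) \<subseteq> {ys \<in> comparable_lists V leq. length ys = Suc 0}" using D(1)[OF nil] by simp
  have bc: "base_change (D []) \<in> carrier ?F" by (rule base_change_closed[OF k])
  have "list_diff R (comparable_lists V leq) 0 (r \<odot>\<^bsub>?F\<^esub> base_change (D [])) [] = r \<otimes> base_change (bdry (D [])) []"
    using lin_mapD(3)[OF list_diff_lin_map r bc] list_diff_base_change[OF k] by (simp add: free_mod_sel)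
  also have "bdry (D []) = frag_of []" using D(2)[OF nil] by simp
  finally have "list_diff R (comparable_lists V leq) 0 (r \<odot>\<^bsub>?F\<^esub> base_change (D [])) [] = r"
    using r by (simp add: base_change_frag_of delta_def)
  then show ?thesis using Module.module.smult_closed[OF free_mod_module r bc] by blast
qed

section \<open>Restriction to a full subcategory\<close>

lemma nat_trans_restrict:
  assumes "\<eta> \<in> nat_trans R D P F" "O' \<subseteq> Obj D"
  shows "restrict \<eta> O' \<in> nat_trans R (D\<lparr>Obj := O'\<rparr>) P F"
  using assms unfolding nat_trans_def by (auto simp: subset_iff PiE_iff)

lemma contra_functor_restrict:
  assumes "contra_functor R D F" "O' \<subseteq> Obj D"
  shows "contra_functor R (D\<lparr>Obj := O'\<rparr>) F"
  using assms unfolding contra_functor_def by (auto simp: subset_iff)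

lemma category_restrict: "category D \<Longrightarrow> O' \<subseteq> Obj D \<Longrightarrow> category (D\<lparr>Obj := O'\<rparr>)"
  unfolding category_def by (auto simp: subset_iff)

lemma presheaf_restrict: "presheaf D S act \<Longrightarrow> O' \<subseteq> Obj D \<Longrightarrow> presheaf (D\<lparr>Obj := O'\<rparr>) S act"
  unfolding presheaf_def by (auto simp: subset_iff)

lemma presheaf_basis_restrict:
  "presheaf_basis D S act Bs \<Longrightarrow> O' \<subseteq> Obj D \<Longrightarrow> fst ` Bs \<subseteq> O' \<Longrightarrow> presheaf_basis (D\<lparr>Obj := O'\<rparr>) S act Bs"
  unfolding presheaf_basis_def by (auto simp: subset_iff image_iff)

text \<open>If the basis lies over the objects in \<open>O'\<close>, a natural transformation on \<open>O'\<close> already has values on the whole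
basis, and these determine its extension to all objects.\<close>

lemma free_functor_nat_trans_extend:
  assumes D: "category D" and S: "presheaf D S act" and Bs: "presheaf_basis D S act Bs"
    and F: "contra_functor R D F" and O': "O' \<subseteq> Obj D" "fst ` Bs \<subseteq> O'"
    and \<eta>: "\<eta> \<in> nat_trans R (D\<lparr>Obj := O'\<rparr>) (free_functor R S act) F"
  obtains \<theta> where "\<theta> \<in> nat_trans R D (free_functor R S act) F" "restrict \<theta> O' = \<eta>"
proof -
  let ?P = "free_functor R S act" and ?D = "D\<lparr>Obj := O'\<rparr>"
  have At: "At ?P x = free_mod R (S x)" for x by (simp add: free_functor_def)
  have bs: "c \<in> O'" "b \<in> S c" if "(c, b) \<in> Bs" for c b
    using that O'(2) Bs by (auto simp: presheaf_basis_def)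
  have "\<eta> c (delta R b) \<in> carrier (At F c)" if "(c, b) \<in> Bs" for c b
    using nat_transD(2)[OF \<eta>, of c "delta R b"] bs[OF that] delta_in_free_mod[of b "S c"] by (simp add: At)
  then obtain \<theta> where \<theta>: "\<theta> \<in> nat_trans R D ?P F" "\<And>c b. (c, b) \<in> Bs \<Longrightarrow> \<theta> c (delta R b) = \<eta> c (delta R b)"
    using free_functor_extend[OF D S Bs F, of "\<lambda>c b. \<eta> c (delta R b)"] by blast
  have "restrict \<theta> O' = \<eta>"
    by (rule free_functor_nat_trans_eqI[OF category_restrict[OF D O'(1)] presheaf_restrict[OF S O'(1)]
          presheaf_basis_restrict[OF Bs O'] contra_functor_restrict[OF F O'(1)] nat_trans_restrict[OF \<theta>(1) O'(1)] \<eta>])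
       (simp add: bs(1) \<theta>(2))
  then show ?thesis using that \<theta>(1) by blast
qed

theorem cohomology_free_restrict:
  fixes D :: "('o, 'c) cat" and S :: "nat \<Rightarrow> 'o \<Rightarrow> 's set"
  assumes D: "category D" and S: "\<And>n. presheaf D (S n) (act n)" and Bs: "\<And>n. presheaf_basis D (S n) (act n) (Bs n)"
    and F: "contra_functor R D F" and O': "O' \<subseteq> Obj D" "\<And>n. fst ` Bs n \<subseteq> O'"
    and P: "\<And>n. P n = free_functor R (S n) (act n)"
    and d: "\<And>n. d n \<in> nat_trans R D (P (Suc n)) (P n)"
    and dd: "\<And>n x r. x \<in> Obj D \<Longrightarrow> r \<in> carrier (At (P (Suc (Suc n))) x) \<Longrightarrow> d n x (d (Suc n) x r) = \<zero>\<^bsub>At (P n) x\<^esub>"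
  shows "mod_isomorphic R (cohomology_of_resolution R D P d (Suc k) F)
     (cohomology_of_resolution R (D\<lparr>Obj := O'\<rparr>) P (\<lambda>n. restrict (d n) O') (Suc k) F)"
proof -
  let ?D = "D\<lparr>Obj := O'\<rparr>" and ?d = "\<lambda>n. restrict (d n) O'"
  have Pc: "contra_functor R D (P n)" for n unfolding P by (rule free_functor_contra_functor[OF D S])
  note F' = contra_functor_restrict[OF F O'(1)] and Pc' = contra_functor_restrict[OF Pc O'(1)]
  have d': "?d n \<in> nat_trans R ?D (P (Suc n)) (P n)" for n by (rule nat_trans_restrict[OF d O'(1)])
  have dd': "?d n x (?d (Suc n) x r) = \<zero>\<^bsub>At (P n) x\<^esub>" if "x \<in> Obj ?D" "r \<in> carrier (At (P (Suc (Suc n))) x)" for n x r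
    using dd[of x r n] that O'(1) by auto
  have eqI: "\<eta> = \<theta>" if "\<eta> \<in> nat_trans R D (P n) F" "\<theta> \<in> nat_trans R D (P n) F"
    "\<And>x p. x \<in> O' \<Longrightarrow> p \<in> carrier (At (P n) x) \<Longrightarrow> \<eta> x p = \<theta> x p" for \<eta> \<theta> n
  proof (rule free_functor_nat_trans_eqI[OF D S Bs F that(1)[unfolded P] that(2)[unfolded P]])
    fix c b assume cb: "(c, b) \<in> Bs n"
    have "c \<in> O'" using subsetD[OF O'(2) imageI[OF cb, of fst]] by simp
    moreover have "b \<in> S n c" using Bs[of n] cb unfolding presheaf_basis_def by blast
    ultimately show "\<eta> c (delta R b) = \<theta> c (delta R b)"
      using delta_in_free_mod[of b "S n c"] by (intro that(3)) (auto simp: P free_functor_def)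
  qed
  let ?N = "nat_mod R D (P (Suc k)) F" and ?N' = "nat_mod R ?D (P (Suc k)) F"
  let ?Z = "?N\<lparr>carrier := cocycles D P d k F\<rparr>" and ?Z' = "?N'\<lparr>carrier := cocycles ?D P ?d k F\<rparr>"
  have N: "Module.module R ?N" and N': "Module.module R ?N'"
    by (rule nat_mod_module[OF is_cring Pc F], rule nat_mod_module[OF is_cring Pc' F'])
  have Z: "Module.module R ?Z" and Z': "Module.module R ?Z'"
    using submodule.submodule_is_module[OF cocycles_submodule[where P = P and d = d, OF Pc d F] N]
      submodule.submodule_is_module[OF cocycles_submodule[where P = P and d = ?d, OF Pc' d' F'] N'] by auto
  have B: "submodule (coboundaries D P d k F) R ?Z"
    by (rule coboundaries_submodule[where P = P and d = d, OF Pc d F dd])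
  have B': "submodule (coboundaries ?D P ?d k F) R ?Z'"
    by (rule coboundaries_submodule[where P = P and d = ?d, OF Pc' d' F' dd'])
  let ?h = "\<lambda>\<eta>. restrict \<eta> O'"
  have zt: "\<eta> \<in> nat_trans R D (P (Suc k)) F" if "\<eta> \<in> carrier ?Z" for \<eta> using that by (simp add: cocycles_def)
  have hz: "?h \<eta> \<in> carrier ?Z'" if "\<eta> \<in> carrier ?Z" for \<eta>
    using nat_trans_restrict[OF zt[OF that] O'(1)] that O'(1) by (auto simp: cocycles_def subset_iff)
  have lin: "lin_map R ?Z ?Z' ?h"
    by (rule lin_mapI[OF hz]) (use O'(1) in \<open>auto simp: nat_mod_sel mk_nat_def fun_eq_iff restrict_def\<close>)
  show ?thesis
    unfolding cohomology_of_resolution_Suc[where P = P and d = d, OF Pc d F]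
      cohomology_of_resolution_Suc[where P = P and d = ?d, OF Pc' d' F']
  proof (rule quot_mod_isomorphic[OF Z Z' B B' lin])
    fix \<eta> assume e: "\<eta> \<in> carrier ?Z"
    show "?h \<eta> \<in> coboundaries ?D P ?d k F \<longleftrightarrow> \<eta> \<in> coboundaries D P d k F"
    proof
      assume "\<eta> \<in> coboundaries D P d k F"
      then obtain \<zeta> where z: "\<zeta> \<in> nat_trans R D (P k) F"
        "\<And>x p. x \<in> Obj D \<Longrightarrow> p \<in> carrier (At (P (Suc k)) x) \<Longrightarrow> \<eta> x p = \<zeta> x (d k x p)"
        by (auto simp: coboundaries_def)
      show "?h \<eta> \<in> coboundaries ?D P ?d k F"
        by (rule coboundaryI[OF nat_trans_restrict[OF zt[OF e] O'(1)] nat_trans_restrict[OF z(1) O'(1)]])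
           (use z(2) O'(1) in auto)
    next
      assume "?h \<eta> \<in> coboundaries ?D P ?d k F"
      then obtain \<zeta>' where z: "\<zeta>' \<in> nat_trans R ?D (P k) F"
        "\<And>x p. x \<in> O' \<Longrightarrow> p \<in> carrier (At (P (Suc k)) x) \<Longrightarrow> \<eta> x p = \<zeta>' x (d k x p)"
        by (auto simp: coboundaries_def)
      obtain \<zeta> where zz: "\<zeta> \<in> nat_trans R D (P k) F" "restrict \<zeta> O' = \<zeta>'"
        using free_functor_nat_trans_extend[OF D S Bs F O'(1) O'(2) z(1)[unfolded P]] P by metis
      have "\<eta> = nat_comp D (P (Suc k)) \<zeta> (d k)"
      proof (rule eqI[OF zt[OF e] nat_comp_in_nat_trans[OF Pc d zz(1)]])
        fix x p assume "x \<in> O'" "p \<in> carrier (At (P (Suc k)) x)"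
        then show "\<eta> x p = nat_comp D (P (Suc k)) \<zeta> (d k) x p"
          using z(2) zz(2) O'(1) by (auto simp: nat_comp_apply)
      qed
      then have "\<eta> x p = \<zeta> x (d k x p)" if "x \<in> Obj D" "p \<in> carrier (At (P (Suc k)) x)" for x p
        using that by (simp add: nat_comp_apply)
      then show "\<eta> \<in> coboundaries D P d k F"
        by (rule coboundaryI[OF zt[OF e] zz(1)])
    qed
  next
    fix \<eta>' assume e: "\<eta>' \<in> carrier ?Z'"
    then have e': "\<eta>' \<in> nat_trans R ?D (P (Suc k)) F"
      "\<And>x p. x \<in> O' \<Longrightarrow> p \<in> carrier (At (P (Suc (Suc k))) x) \<Longrightarrow> \<eta>' x (d (Suc k) x p) = \<zero>\<^bsub>At F x\<^esub>"
      by (auto simp: cocycles_def)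
    obtain \<eta> where n: "\<eta> \<in> nat_trans R D (P (Suc k)) F" "restrict \<eta> O' = \<eta>'"
      using free_functor_nat_trans_extend[OF D S Bs F O'(1) O'(2) e'(1)[unfolded P]] P by metis
    have zero: "\<zero>\<^bsub>nat_mod R D (P (Suc (Suc k))) F\<^esub> \<in> nat_trans R D (P (Suc (Suc k))) F"
      by (rule nat_mod_zero[OF Pc F])
    have "nat_comp D (P (Suc (Suc k))) \<eta> (d (Suc k)) = \<zero>\<^bsub>nat_mod R D (P (Suc (Suc k))) F\<^esub>"
    proof (rule eqI[OF nat_comp_in_nat_trans[OF Pc d n(1)] zero])
      fix x p assume x: "x \<in> O'" "p \<in> carrier (At (P (Suc (Suc k))) x)"
      have "\<eta> x (d (Suc k) x p) = \<eta>' x (d (Suc k) x p)" using n(2) x(1) by auto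
      then show "nat_comp D (P (Suc (Suc k))) \<eta> (d (Suc k)) x p = \<zero>\<^bsub>nat_mod R D (P (Suc (Suc k))) F\<^esub> x p"
        using e'(2)[OF x] x O'(1) by (auto simp: nat_comp_apply nat_mod_sel(2))
    qed
    then have "\<eta> x (d (Suc k) x p) = \<zero>\<^bsub>At F x\<^esub>" if "x \<in> Obj D" "p \<in> carrier (At (P (Suc (Suc k))) x)" for x p
      using that by (metis nat_comp_apply nat_mod_sel(2) mk_nat_apply)
    then have "\<eta> \<in> carrier ?Z" using n(1) by (simp add: cocycles_def)
    moreover have "\<eta>' \<ominus>\<^bsub>?Z'\<^esub> \<eta>' = \<zero>\<^bsub>?Z'\<^esub>"
      using abelian_group.r_neg[OF Module.module.axioms(2)[OF Z'] e] by (simp add: a_minus_def)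
    ultimately show "\<exists>\<eta>\<in>carrier ?Z. \<eta>' \<ominus>\<^bsub>?Z'\<^esub> restrict \<eta> O' \<in> coboundaries ?D P ?d k F"
      using submodule_zero[OF Z' B'] n(2) by (auto intro!: bexI[of _ \<eta>])
  qed
qed

end

section \<open>Sections of a group\<close>

context group
begin

lemma conj_set_one: "A \<subseteq> carrier G \<Longrightarrow> conj_set G \<one> A = A"
  unfolding conj_set_def by (auto simp: subset_iff image_iff)

lemma conj_set_mult:
  assumes "g \<in> carrier G" "h \<in> carrier G" "A \<subseteq> carrier G"
  shows "conj_set G (g \<otimes> h) A = conj_set G g (conj_set G h A)"
  unfolding conj_set_def image_image
  by (rule image_cong[OF refl]) (use assms in \<open>auto simp: inv_mult_group m_assoc subset_iff\<close>)

lemma conj_set_closed: "g \<in> carrier G \<Longrightarrow> A \<subseteq> carrier G \<Longrightarrow> conj_set G g A \<subseteq> carrier G"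
  unfolding conj_set_def by auto

lemma conj_set_mono: "A \<subseteq> B \<Longrightarrow> conj_set G g A \<subseteq> conj_set G g B"
  unfolding conj_set_def by blast

lemma conj_set_subset_iff:
  assumes "g \<in> carrier G" "A \<subseteq> carrier G" "B \<subseteq> carrier G"
  shows "conj_set G g A \<subseteq> conj_set G g B \<longleftrightarrow> A \<subseteq> B"
proof
  assume "conj_set G g A \<subseteq> conj_set G g B"
  then have "conj_set G (inv g) (conj_set G g A) \<subseteq> conj_set G (inv g) (conj_set G g B)" by (rule conj_set_mono)
  then show "A \<subseteq> B" using assms by (simp add: conj_set_mult[symmetric] conj_set_one)
qed (rule conj_set_mono)

lemma sections_facts:
  assumes "s \<in> sections G"
  shows sections_subgroup: "subgroup (fst s) G" and sections_snd_subgroup: "subgroup (snd s) G"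
    and sections_snd_fst: "snd s \<subseteq> fst s"
    and sections_fst_carrier: "fst s \<subseteq> carrier G" and sections_snd_carrier: "snd s \<subseteq> carrier G"
    and sections_one: "\<one> \<in> fst s" "\<one> \<in> snd s"
    and sections_conj_closed: "x \<in> fst s \<Longrightarrow> v \<in> snd s \<Longrightarrow> x \<otimes> v \<otimes> inv x \<in> snd s"
    and sections_normal: "snd s \<lhd> G\<lparr>carrier := fst s\<rparr>"
proof -
  show U: "subgroup (fst s) G" and V: "snd s \<lhd> G\<lparr>carrier := fst s\<rparr>" using assms by (auto simp: sections_def)
  have VU: "subgroup (snd s) (G\<lparr>carrier := fst s\<rparr>)" by (rule normal_imp_subgroup[OF V])
  show "subgroup (snd s) G" by (rule incl_subgroup[OF U VU])
  show "snd s \<subseteq> fst s" using subgroup.subset[OF VU] by simp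
  then show "fst s \<subseteq> carrier G" "snd s \<subseteq> carrier G" using subgroup.subset[OF U] by auto
  show "\<one> \<in> fst s" "\<one> \<in> snd s" using subgroup.one_closed[OF U] subgroup.one_closed[OF \<open>subgroup (snd s) G\<close>] by auto
  show "x \<otimes> v \<otimes> inv x \<in> snd s" if "x \<in> fst s" "v \<in> snd s"
    using normal.inv_op_closed2[OF V, of x v] that m_inv_consistent[OF U, of x] by simp
qed

lemma conj_sect_one: "s \<in> sections G \<Longrightarrow> conj_sect G \<one> s = s"
  by (simp add: conj_sect_def conj_set_one sections_fst_carrier sections_snd_carrier)

lemma conj_sect_mult:
  "g \<in> carrier G \<Longrightarrow> h \<in> carrier G \<Longrightarrow> s \<in> sections G \<Longrightarrow> conj_sect G (g \<otimes> h) s = conj_sect G g (conj_sect G h s)"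
  by (simp add: conj_sect_def conj_set_mult sections_fst_carrier sections_snd_carrier)

lemma sect_le_refl: "s \<in> sections G \<Longrightarrow> sect_le s s"
  by (simp add: sect_le_def sections_snd_fst)

lemma sect_le_trans: "sect_le s t \<Longrightarrow> sect_le t u \<Longrightarrow> sect_le s u"
  unfolding sect_le_def by blast

lemma sect_le_conj_iff:
  assumes "g \<in> carrier G" "s \<in> sections G" "t \<in> sections G"
  shows "sect_le (conj_sect G g s) (conj_sect G g t) \<longleftrightarrow> sect_le s t"
  unfolding sect_le_def conj_sect_def fst_conv snd_conv
  using conj_set_subset_iff[OF assms(1)] sections_fst_carrier[OF assms(2)] sections_snd_carrier[OF assms(2)]
    sections_fst_carrier[OF assms(3)] sections_snd_carrier[OF assms(3)] by simp

lemma conj_set_self: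
  assumes "x \<in> carrier G" "A \<subseteq> carrier G" "conj_set G x A \<subseteq> A" "conj_set G (inv x) A \<subseteq> A"
  shows "conj_set G x A = A"
proof
  have "conj_set G x (conj_set G (inv x) A) \<subseteq> conj_set G x A" using assms(4) by (rule conj_set_mono)
  then show "A \<subseteq> conj_set G x A" using assms by (simp add: conj_set_mult[symmetric] conj_set_one)
qed (rule assms(3))

lemma conj_sect_self:
  assumes s: "s \<in> sections G" and x: "x \<in> fst s"
  shows "conj_sect G x s = s"
proof -
  note f = sections_facts[OF s]
  have c: "conj_set G y (fst s) \<subseteq> fst s" "conj_set G y (snd s) \<subseteq> snd s" if "y \<in> fst s" for y
    using that f(8) subgroup.m_closed[OF f(1)] subgroup.m_inv_closed[OF f(1)] by (auto simp: conj_set_def)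
  have "x \<in> carrier G" "inv x \<in> fst s" using x f(4) subgroup.m_inv_closed[OF f(1)] by auto
  then have "conj_set G x (fst s) = fst s" "conj_set G x (snd s) = snd s"
    by (intro conj_set_self c x f(4,5); simp)+
  then show ?thesis by (simp add: conj_sect_def)
qed

lemma conj_set_subgroup:
  assumes "subgroup H G" "g \<in> carrier G"
  shows "subgroup (conj_set G g H) G"
proof (rule subgroupI)
  note H = subgroup.subset[OF assms(1)]
  show "conj_set G g H \<subseteq> carrier G" by (rule conj_set_closed[OF assms(2) H])
  show "conj_set G g H \<noteq> {}" using subgroup.one_closed[OF assms(1)] by (auto simp: conj_set_def)
  show "inv a \<in> conj_set G g H" if "a \<in> conj_set G g H" for a
  proof -
    obtain x where x: "x \<in> H" "a = g \<otimes> x \<otimes> inv g" using \<open>a \<in> conj_set G g H\<close> by (auto simp: conj_set_def)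
    have "inv a = g \<otimes> inv x \<otimes> inv g" using x H assms(2) by (simp add: inv_mult_group m_assoc subset_iff)
    then show ?thesis using subgroup.m_inv_closed[OF assms(1) x(1)] by (auto simp: conj_set_def)
  qed
  show "a \<otimes> b \<in> conj_set G g H" if ab: "a \<in> conj_set G g H" "b \<in> conj_set G g H" for a b
  proof -
    obtain x where x1: "x \<in> H" "a = g \<otimes> x \<otimes> inv g" using ab(1) by (auto simp: conj_set_def)
    obtain y where x2: "y \<in> H" "b = g \<otimes> y \<otimes> inv g" using ab(2) by (auto simp: conj_set_def)
    note x = x1 x2
    have xy: "x \<in> carrier G" "y \<in> carrier G" using x H by auto
    have "inv g \<otimes> (g \<otimes> (y \<otimes> inv g)) = y \<otimes> inv g"
      using xy assms(2) by (simp add: m_assoc[symmetric])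
    then have "a \<otimes> b = g \<otimes> (x \<otimes> y) \<otimes> inv g" using x(2,4) xy assms(2) by (simp add: m_assoc)
    then show ?thesis using subgroup.m_closed[OF assms(1) x(1,3)] by (auto simp: conj_set_def)
  qed
qed

lemma sectionsI:
  assumes "subgroup U G" "subgroup V G" "V \<subseteq> U" "\<And>x v. x \<in> U \<Longrightarrow> v \<in> V \<Longrightarrow> x \<otimes> v \<otimes> inv x \<in> V"
  shows "(U, V) \<in> sections G"
proof -
  interpret U: group "G\<lparr>carrier := U\<rparr>" by (rule subgroup_imp_group[OF assms(1)])
  have "subgroup V (G\<lparr>carrier := U\<rparr>)" by (rule subgroup_incl[OF assms(2,1,3)])
  then have "V \<lhd> G\<lparr>carrier := U\<rparr>"
    unfolding U.normal_inv_iff using assms(4) m_inv_consistent[OF assms(1)] by simp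
  then show ?thesis using assms(1) by (simp add: sections_def)
qed

lemma conj_sect_sections:
  assumes s: "s \<in> sections G" and g: "g \<in> carrier G"
  shows "conj_sect G g s \<in> sections G"
  unfolding conj_sect_def
proof (rule sectionsI)
  note f = sections_facts[OF s]
  show "subgroup (conj_set G g (fst s)) G" "subgroup (conj_set G g (snd s)) G" "conj_set G g (snd s) \<subseteq> conj_set G g (fst s)"
    using conj_set_subgroup[OF f(1) g] conj_set_subgroup[OF f(2) g] conj_set_mono[OF f(3)] by auto
  fix x v assume "x \<in> conj_set G g (fst s)" "v \<in> conj_set G g (snd s)"
  then obtain a b where ab: "a \<in> fst s" "x = g \<otimes> a \<otimes> inv g" "b \<in> snd s" "v = g \<otimes> b \<otimes> inv g" by (auto simp: conj_set_def)
  have c: "a \<in> carrier G" "b \<in> carrier G" using ab f(4,5) by auto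
  have "x \<otimes> v \<otimes> inv x = g \<otimes> (a \<otimes> b \<otimes> inv a) \<otimes> inv g"
  proof -
    have k: "inv g \<otimes> (g \<otimes> z) = z" if "z \<in> carrier G" for z using that g by (simp add: m_assoc[symmetric])
    show ?thesis using c g by (simp add: ab(2,4) inv_mult_group m_assoc k)
  qed
  then show "x \<otimes> v \<otimes> inv x \<in> conj_set G g (snd s)" using f(8)[OF ab(1,3)] by (auto simp: conj_set_def)
qed

lemma sect_le_conj_left:
  assumes "g \<in> carrier G" "s \<in> sections G" "t \<in> sections G"
  shows "sect_le (conj_sect G g s) t \<longleftrightarrow> sect_le s (conj_sect G (inv g) t)"
  using sect_le_conj_iff[OF assms(1) assms(2) conj_sect_sections[OF assms(3) inv_closed[OF assms(1)]]] assms
  by (simp add: conj_sect_mult[symmetric] conj_sect_one)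

text \<open>The formula behind every composition in this development: the product of two cosets is again a coset
if \<open>h\<close> conjugates \<open>M\<close> into \<open>N\<close>.\<close>

lemma coset_mult_morphism:
  assumes N: "subgroup N G" and M: "M \<subseteq> carrier G" "\<one> \<in> M" and gh: "g \<in> carrier G" "h \<in> carrier G"
    and le: "conj_set G h M \<subseteq> N"
  shows "(N #> h) <#> (M #> g) = N #> (h \<otimes> g)"
proof (intro equalityI subsetI)
  note Nc = subgroup.subset[OF N]
  fix x assume "x \<in> (N #> h) <#> (M #> g)"
  then obtain n m where nm: "n \<in> N" "m \<in> M" "x = n \<otimes> h \<otimes> (m \<otimes> g)" by (auto simp: set_mult_def r_coset_def)
  have c: "n \<in> carrier G" "m \<in> carrier G" using nm Nc M by auto
  have "x = n \<otimes> (h \<otimes> m \<otimes> inv h) \<otimes> (h \<otimes> g)"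
  proof -
    have k: "inv h \<otimes> (h \<otimes> z) = z" if "z \<in> carrier G" for z using that gh by (simp add: m_assoc[symmetric])
    show ?thesis using c gh by (simp add: nm(3) m_assoc k)
  qed
  moreover have "n \<otimes> (h \<otimes> m \<otimes> inv h) \<in> N"
    using nm le by (intro subgroup.m_closed[OF N nm(1)]) (auto simp: conj_set_def)
  ultimately show "x \<in> N #> (h \<otimes> g)" by (auto simp: r_coset_def)
next
  note Nc = subgroup.subset[OF N]
  fix x assume "x \<in> N #> (h \<otimes> g)"
  then obtain n where n: "n \<in> N" "x = n \<otimes> (h \<otimes> g)" by (auto simp: r_coset_def)
  then have "x = (n \<otimes> h) \<otimes> (\<one> \<otimes> g)" using gh Nc by (auto simp: m_assoc)
  then show "x \<in> (N #> h) <#> (M #> g)" using n(1) M(2) by (auto simp: set_mult_def r_coset_def)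
qed

lemma sect_cat_sel:
  "Obj (sect_cat G C) = C" "Comp (sect_cat G C) x y z b a = b <#> a" "Idt (sect_cat G C) s = fst s"
  "f \<in> Hom (sect_cat G C) s t \<longleftrightarrow> (\<exists>g\<in>carrier G. f = fst t #> g \<and> sect_le (conj_sect G g s) t)"
  by (auto simp: sect_cat_def)

lemma sect_cat_restrict: "sect_cat G C' = (sect_cat G C)\<lparr>Obj := C'\<rparr>"
  by (simp add: sect_cat_def)

lemma sect_comp:
  assumes "s \<in> sections G" "t \<in> sections G" "u \<in> sections G" "g \<in> carrier G" "h \<in> carrier G"
    "sect_le (conj_sect G h t) u"
  shows "(fst u #> h) <#> (fst t #> g) = fst u #> (h \<otimes> g)"
  using assms by (intro coset_mult_morphism sections_facts(1,4,6)) (auto simp: sect_le_def conj_sect_def)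

lemma sect_le_comp:
  assumes "s \<in> sections G" "t \<in> sections G" "g \<in> carrier G" "h \<in> carrier G"
    "sect_le (conj_sect G g s) t" "sect_le (conj_sect G h t) u"
  shows "sect_le (conj_sect G (h \<otimes> g) s) u"
proof -
  have "sect_le (conj_sect G h (conj_sect G g s)) (conj_sect G h t)"
    using assms by (simp add: sect_le_conj_iff conj_sect_sections)
  then show ?thesis using assms sect_le_trans by (simp add: conj_sect_mult) blast
qed

lemma sect_cat_category:
  assumes C: "C \<subseteq> sections G"
  shows "category (sect_cat G C)"
  unfolding category_def sect_cat_sel
proof (intro conjI ballI)
  fix x assume "x \<in> C"
  then have x: "x \<in> sections G" using C by auto
  show "\<exists>g\<in>carrier G. fst x = fst x #> g \<and> sect_le (conj_sect G g x) x"
    using x by (intro bexI[of _ \<one>]) (auto simp: conj_sect_one sect_le_refl coset_mult_one sections_fst_carrier)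
next
  fix x y z f g assume xyz: "x \<in> C" "y \<in> C" "z \<in> C" and f: "f \<in> Hom (sect_cat G C) x y" and g: "g \<in> Hom (sect_cat G C) y z"
  have s: "x \<in> sections G" "y \<in> sections G" "z \<in> sections G" using xyz C by auto
  obtain a b where a: "a \<in> carrier G" "f = fst y #> a" "sect_le (conj_sect G a x) y"
    and b: "b \<in> carrier G" "g = fst z #> b" "sect_le (conj_sect G b y) z" using f g by (auto simp: sect_cat_sel(4))
  show "\<exists>c\<in>carrier G. g <#> f = fst z #> c \<and> sect_le (conj_sect G c x) z"
    using sect_comp[OF s a(1) b(1,3)] sect_le_comp[OF s(1,2) a(1) b(1) a(3) b(3)] a b by (intro bexI[of _ "b \<otimes> a"]) auto
next
  fix x y f assume xy: "x \<in> C" "y \<in> C" and f: "f \<in> Hom (sect_cat G C) x y"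
  have s: "x \<in> sections G" "y \<in> sections G" using xy C by auto
  obtain a where a: "a \<in> carrier G" "f = fst y #> a" "sect_le (conj_sect G a x) y" using f by (auto simp: sect_cat_sel(4))
  have "fst x = fst x #> \<one>" "fst y = fst y #> \<one>" using s by (auto simp: coset_mult_one sections_fst_carrier)
  moreover have "(fst y #> a) <#> (fst x #> \<one>) = fst y #> (a \<otimes> \<one>)"
    by (rule sect_comp[OF s(1) s(1) s(2)]) (use a in auto)
  moreover have "(fst y #> \<one>) <#> (fst y #> a) = fst y #> (\<one> \<otimes> a)"
    by (rule sect_comp[OF s(2) s(2) s(2)]) (use a s in \<open>auto simp: conj_sect_one sect_le_refl\<close>)
  ultimately show "f <#> fst x = f" "fst y <#> f = f" using a by (metis r_one, metis l_one)
next
  fix x y z w f g h assume "x \<in> C" and yzw: "y \<in> C" "z \<in> C" "w \<in> C"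
    and f: "f \<in> Hom (sect_cat G C) x y" and g: "g \<in> Hom (sect_cat G C) y z" and h: "h \<in> Hom (sect_cat G C) z w"
  have "k \<subseteq> carrier G" if "k \<in> Hom (sect_cat G C) s t" "t \<in> C" for k s t
  proof -
    have "t \<in> sections G" using that(2) C by auto
    then show ?thesis
      using that(1) r_coset_subset_G[OF sections_fst_carrier] by (metis sect_cat_sel(4))
  qed
  then have "f \<subseteq> carrier G" "g \<subseteq> carrier G" "h \<subseteq> carrier G"
    using f g h yzw by blast+
  then show "h <#> g <#> f = h <#> (g <#> f)" by (simp add: set_mult_assoc)
qed

section \<open>Flags of morphisms into a collection\<close>

text \<open>For a morphism \<open>f = Mg : s \<rightarrow> t\<close> this is \<open>g\<inverse>tg\<close>, a section above \<open>s\<close>. The choice of \<open>g\<close> in the coset does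
not matter because the elements of \<open>M\<close> normalise \<open>t\<close>.\<close>

definition pullback_sect :: "'a sect \<Rightarrow> 'a set \<Rightarrow> 'a sect" where
  "pullback_sect t f = conj_sect G (inv (SOME g. g \<in> f)) t"

lemma pullback_sect:
  assumes t: "t \<in> sections G" and g: "g \<in> carrier G"
  shows "pullback_sect t (fst t #> g) = conj_sect G (inv g) t"
proof -
  have "g \<in> fst t #> g" using sections_one(1)[OF t] g by (force simp: r_coset_def)
  then have "(SOME h. h \<in> fst t #> g) \<in> fst t #> g" by (rule someI)
  then obtain m where m: "m \<in> fst t" "(SOME h. h \<in> fst t #> g) = m \<otimes> g" by (auto simp: r_coset_def)
  have mc: "m \<in> carrier G" "inv m \<in> fst t" using m(1) sections_fst_carrier[OF t] subgroup.m_inv_closed[OF sections_subgroup[OF t]] by auto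
  then show ?thesis
    using m(2) g t conj_sect_self[OF t mc(2)] by (simp add: pullback_sect_def inv_mult_group conj_sect_mult)
qed

text \<open>The morphisms from \<open>x\<close> to members of \<open>C\<close>, each with its target. The two zeros carry no information: they
put the vertices into the type \<open>'o \<times> 'a \<times> 'k \<times> 'r\<close> from which the basis elements of the resolution
that defines \<open>Ext\<close> are built.\<close>

definition vertices :: "('r, 'q) ring_scheme \<Rightarrow> 'a sect set \<Rightarrow> 'a sect \<Rightarrow> ('a sect \<times> 'a set \<times> 'r \<times> 'r) set" where
  "vertices R C x = {(t, f, \<zero>\<^bsub>R\<^esub>, \<zero>\<^bsub>R\<^esub>) | t f. t \<in> C \<and> f \<in> Hom (sect_cat G C) x t}"

definition vertex_sect :: "'a sect \<times> 'a set \<times> 'r \<times> 'r \<Rightarrow> 'a sect" where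
  "vertex_sect v = pullback_sect (fst v) (fst (snd v))"

definition vertex_act :: "'a set \<Rightarrow> 'a sect \<times> 'a set \<times> 'r \<times> 'r \<Rightarrow> 'a sect \<times> 'a set \<times> 'r \<times> 'r" where
  "vertex_act a = (\<lambda>(t, f, r). (t, f <#> a, r))"

abbreviation vertex_le :: "'a sect \<times> 'a set \<times> 'r \<times> 'r \<Rightarrow> 'a sect \<times> 'a set \<times> 'r \<times> 'r \<Rightarrow> bool" where
  "vertex_le v w \<equiv> sect_le (vertex_sect v) (vertex_sect w)"

definition flags :: "('r, 'q) ring_scheme \<Rightarrow> 'a sect set \<Rightarrow> nat \<Rightarrow> 'a sect \<Rightarrow> ('a sect \<times> 'a set \<times> 'r \<times> 'r) list set" where
  "flags R C n x = {vs \<in> comparable_lists (vertices R C x) vertex_le. length vs = n}"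

text \<open>The first minimal entry. Vertices are only preordered, so a flag can have several minimal entries; the
first of them is a choice that is compatible with composition of morphisms.\<close>

definition apex :: "('a sect \<times> 'a set \<times> 'r \<times> 'r) list \<Rightarrow> 'a sect \<times> 'a set \<times> 'r \<times> 'r" where
  "apex vs = the (find (\<lambda>v. \<forall>w\<in>set vs. vertex_le v w) vs)"

text \<open>The flags over \<open>c\<close> whose apex is the identity of \<open>c\<close>. The length is shifted so that \<open>n\<close> is the
dimension.\<close>

definition flag_basis :: "('r, 'q) ring_scheme \<Rightarrow> 'a sect set \<Rightarrow> nat \<Rightarrow> ('a sect \<times> ('a sect \<times> 'a set \<times> 'r \<times> 'r) list) set" where
  "flag_basis R C n = {(c, b). c \<in> C \<and> b \<in> flags R C (Suc n) c \<and> apex b = (c, fst c, \<zero>\<^bsub>R\<^esub>, \<zero>\<^bsub>R\<^esub>)}"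

lemma find_map: "find P (map f xs) = map_option f (find (\<lambda>x. P (f x)) xs)"
  by (induction xs) auto

lemma verticesE:
  assumes "v \<in> vertices R C x" "C \<subseteq> sections G" "x \<in> sections G"
  obtains t g where "v = (t, fst t #> g, \<zero>\<^bsub>R\<^esub>, \<zero>\<^bsub>R\<^esub>)" "t \<in> C" "t \<in> sections G" "g \<in> carrier G"
    "sect_le (conj_sect G g x) t" "vertex_sect v = conj_sect G (inv g) t" "sect_le x (vertex_sect v)"
proof -
  obtain t g where v: "v = (t, fst t #> g, \<zero>\<^bsub>R\<^esub>, \<zero>\<^bsub>R\<^esub>)" "t \<in> C" "g \<in> carrier G" "sect_le (conj_sect G g x) t"
    using assms(1) by (auto simp: vertices_def sect_cat_sel(4))
  have t: "t \<in> sections G" using v(2) assms(2) by auto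
  have vs: "vertex_sect v = conj_sect G (inv g) t" using pullback_sect[OF t v(3)] by (simp add: v(1) vertex_sect_def)
  show ?thesis using that[OF v(1,2) t v(3,4) vs] v(3,4) vs t assms(3) by (simp add: sect_le_conj_left)
qed

lemma vertex_sect_coset:
  "t \<in> sections G \<Longrightarrow> g \<in> carrier G \<Longrightarrow> vertex_sect (t, fst t #> g, r) = conj_sect G (inv g) t"
  by (simp add: vertex_sect_def pullback_sect)

lemma verticesI:
  "t \<in> C \<Longrightarrow> g \<in> carrier G \<Longrightarrow> sect_le (conj_sect G g x) t \<Longrightarrow> (t, fst t #> g, \<zero>\<^bsub>R\<^esub>, \<zero>\<^bsub>R\<^esub>) \<in> vertices R C x"
  unfolding vertices_def using sect_cat_sel(4)[of "fst t #> g" C x t] by blast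

lemma vertex_sect_sections:
  assumes "v \<in> vertices R C x" "C \<subseteq> sections G" "x \<in> sections G"
  shows "vertex_sect v \<in> sections G"
  by (rule verticesE[OF assms]) (simp add: conj_sect_sections)

text \<open>Composition with \<open>k : x \<rightarrow> y\<close> turns vertices over \<open>y\<close> into vertices over \<open>x\<close>. The sections that belong to
them are all conjugated by the same element, so comparability is preserved and reflected.\<close>

lemma vertex_act:
  assumes v: "v \<in> vertices R C y" and C: "C \<subseteq> sections G" and x: "x \<in> sections G" "y \<in> sections G"
    and k: "k \<in> carrier G" "sect_le (conj_sect G k x) y"
  shows "vertex_act (fst y #> k) v \<in> vertices R C x"
    and "vertex_sect (vertex_act (fst y #> k) v) = conj_sect G (inv k) (vertex_sect v)"
proof -
  obtain t g where t: "v = (t, fst t #> g, \<zero>\<^bsub>R\<^esub>, \<zero>\<^bsub>R\<^esub>)" "t \<in> C" "t \<in> sections G" "g \<in> carrier G"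
    "sect_le (conj_sect G g y) t" "vertex_sect v = conj_sect G (inv g) t"
    using verticesE[OF v C x(2)] by metis
  have e: "vertex_act (fst y #> k) v = (t, fst t #> (g \<otimes> k), \<zero>\<^bsub>R\<^esub>, \<zero>\<^bsub>R\<^esub>)"
    using sect_comp[OF x t(3) k(1) t(4,5)] by (simp add: t(1) vertex_act_def)
  show "vertex_act (fst y #> k) v \<in> vertices R C x"
    unfolding e using sect_le_comp[OF x k(1) t(4) k(2) t(5)] t(2,4) k(1) by (intro verticesI) auto
  show "vertex_sect (vertex_act (fst y #> k) v) = conj_sect G (inv k) (vertex_sect v)"
    unfolding e t(6) using t(3,4) k(1) by (simp add: vertex_sect_coset inv_mult_group conj_sect_mult)
qed

lemma vertex_act_le:
  assumes "v \<in> vertices R C y" "w \<in> vertices R C y" and C: "C \<subseteq> sections G" and x: "x \<in> sections G" "y \<in> sections G"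
    and k: "k \<in> carrier G" "sect_le (conj_sect G k x) y"
  shows "vertex_le (vertex_act (fst y #> k) v) (vertex_act (fst y #> k) w) \<longleftrightarrow> vertex_le v w"
  using assms vertex_act(2)[OF assms(1) C x k] vertex_act(2)[OF assms(2) C x k]
  by (simp add: sect_le_conj_iff vertex_sect_sections[OF _ C x(2)])

lemma flagsD: "vs \<in> flags R C n x \<Longrightarrow> v \<in> set vs \<Longrightarrow> v \<in> vertices R C x"
  by (auto simp: flags_def comparable_lists_def)

lemma flags_act:
  assumes "vs \<in> flags R C n y" and C: "C \<subseteq> sections G" and x: "x \<in> sections G" "y \<in> sections G"
    and k: "k \<in> carrier G" "sect_le (conj_sect G k x) y"
  shows "map (vertex_act (fst y #> k)) vs \<in> flags R C n x"
proof -
  let ?a = "vertex_act (fst y #> k)"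
  have "\<forall>v\<in>set vs. \<forall>w\<in>set vs. vertex_le v w \<or> vertex_le w v" "length vs = n"
    using assms(1) by (simp_all add: flags_def comparable_lists_def)
  then have "\<forall>v\<in>set vs. \<forall>w\<in>set vs. vertex_le (?a v) (?a w) \<or> vertex_le (?a w) (?a v)"
    using vertex_act_le[OF flagsD[OF assms(1)] flagsD[OF assms(1)] C x k] by blast
  moreover have "?a ` set vs \<subseteq> vertices R C x" using vertex_act(1)[OF flagsD[OF assms(1)] C x k] by blast
  ultimately show ?thesis using \<open>length vs = n\<close> unfolding flags_def comparable_lists_def by simp
qed

lemma apex_map:
  assumes "\<And>v w. v \<in> set vs \<Longrightarrow> w \<in> set vs \<Longrightarrow> vertex_le (f v) (f w) \<longleftrightarrow> vertex_le v w"
    and "find (\<lambda>v. \<forall>w\<in>set vs. vertex_le v w) vs \<noteq> None"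
  shows "apex (map f vs) = f (apex vs)"
proof -
  have "find (\<lambda>v. \<forall>w\<in>set vs. vertex_le (f v) (f w)) vs = find (\<lambda>v. \<forall>w\<in>set vs. vertex_le v w) vs"
    by (rule find_cong) (use assms(1) in auto)
  then show ?thesis using assms(2) by (auto simp: apex_def find_map)
qed

lemma flag_has_apex:
  assumes vs: "vs \<in> flags R C (Suc n) x" and C: "C \<subseteq> sections G" and x: "x \<in> sections G"
  shows "find (\<lambda>v. \<forall>w\<in>set vs. vertex_le v w) vs \<noteq> None"
    and "apex vs \<in> set vs" and "\<And>w. w \<in> set vs \<Longrightarrow> vertex_le (apex vs) w"
proof -
  have min: "us \<noteq> [] \<Longrightarrow> set us \<subseteq> set vs \<Longrightarrow> \<exists>v\<in>set us. \<forall>w\<in>set us. vertex_le v w" for us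
  proof (induction us)
    case (Cons u us)
    have u: "u \<in> set vs" using Cons.prems by auto
    have refl: "vertex_le u u" using sect_le_refl[OF vertex_sect_sections[OF flagsD[OF vs u] C x]] .
    show ?case
    proof (cases "us = []")
      case False
      then obtain v where v: "v \<in> set us" "\<forall>w\<in>set us. vertex_le v w" using Cons by auto
      have "vertex_le u v \<or> vertex_le v u"
        using vs u v(1) Cons.prems(2) unfolding flags_def comparable_lists_def by auto
      then show ?thesis
      proof
        assume "vertex_le u v"
        then have "\<forall>w\<in>set (u # us). vertex_le u w" using v refl sect_le_trans by (metis set_ConsD)
        then show ?thesis by (intro bexI[of _ u]) simp_all
      next
        assume "vertex_le v u"
        then show ?thesis using v by auto
      qed
    qed (use refl in auto)
  qed simp
  have "vs \<noteq> []" using vs by (auto simp: flags_def)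
  then have "\<exists>v\<in>set vs. \<forall>w\<in>set vs. vertex_le v w" using min by blast
  then show n: "find (\<lambda>v. \<forall>w\<in>set vs. vertex_le v w) vs \<noteq> None" unfolding find_None_iff by blast
  then obtain v where v: "find (\<lambda>v. \<forall>w\<in>set vs. vertex_le v w) vs = Some v" by auto
  then have "apex vs = v" by (simp add: apex_def)
  moreover have "v \<in> set vs" "\<forall>w\<in>set vs. vertex_le v w" using v by (auto simp: find_Some_iff in_set_conv_nth)
  ultimately show "apex vs \<in> set vs" "\<And>w. w \<in> set vs \<Longrightarrow> vertex_le (apex vs) w" by auto
qed

lemma flags_presheaf:
  assumes C: "C \<subseteq> sections G" and O': "O' \<subseteq> sections G"
  shows "presheaf (sect_cat G O') (flags R C n) (\<lambda>x y a. map (vertex_act a))"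
  unfolding presheaf_def
proof (intro conjI ballI)
  let ?D = "sect_cat G (sections G)"
  have cat: "category ?D" by (rule sect_cat_category) simp
  have H: "Hom (sect_cat G C) s t = Hom ?D s t" "Hom (sect_cat G O') s t = Hom ?D s t" for s t by (simp_all add: sect_cat_def)
  {
    fix x y f vs assume xy: "x \<in> Obj (sect_cat G O')" "y \<in> Obj (sect_cat G O')" and f: "f \<in> Hom (sect_cat G O') x y"
      and vs: "vs \<in> flags R C n y"
    have "x \<in> sections G" "y \<in> sections G" using xy O' by (auto simp: sect_cat_sel)
    moreover obtain k where "k \<in> carrier G" "f = fst y #> k" "sect_le (conj_sect G k x) y"
      using f by (auto simp: sect_cat_sel(4))
    ultimately show "map (vertex_act f) vs \<in> flags R C n x"
      using flags_act[OF vs C] by simp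
  next
    fix x vs assume x: "x \<in> Obj (sect_cat G O')" and vs: "vs \<in> flags R C n x"
    have "vertex_act (Idt (sect_cat G O') x) v = v" if v: "v \<in> set vs" for v
    proof -
      obtain t f where tf: "v = (t, f, \<zero>\<^bsub>R\<^esub>, \<zero>\<^bsub>R\<^esub>)" "t \<in> C" "f \<in> Hom ?D x t"
        using flagsD[OF vs v] by (auto simp: vertices_def H)
      have "x \<in> sections G" "t \<in> sections G" using x tf(2) O' C by (auto simp: sect_cat_sel(1))
      then show ?thesis using categoryD(3)[OF cat, of x t f] tf(1,3) by (simp add: vertex_act_def sect_cat_sel(1-3))
    qed
    then show "map (vertex_act (Idt (sect_cat G O') x)) vs = vs" by (simp add: map_idI)
  next
    fix x y z f g vs assume xyz: "x \<in> Obj (sect_cat G O')" "y \<in> Obj (sect_cat G O')" "z \<in> Obj (sect_cat G O')"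
      and fg: "f \<in> Hom (sect_cat G O') x y" "g \<in> Hom (sect_cat G O') y z" and vs: "vs \<in> flags R C n z"
    have "vertex_act (Comp (sect_cat G O') x y z g f) v = vertex_act f (vertex_act g v)" if v: "v \<in> set vs" for v
    proof -
      obtain t h where th: "v = (t, h, \<zero>\<^bsub>R\<^esub>, \<zero>\<^bsub>R\<^esub>)" "t \<in> C" "h \<in> Hom ?D z t"
        using flagsD[OF vs v] by (auto simp: vertices_def H)
      have "x \<in> sections G" "y \<in> sections G" "z \<in> sections G" "t \<in> sections G"
        using xyz th(2) O' C by (auto simp: sect_cat_sel(1))
      then show ?thesis
        using categoryD(5)[OF cat, of x y z t f g h] th(1,3) fg by (simp add: vertex_act_def sect_cat_sel(1-3) H)
    qed
    then show "map (vertex_act (Comp (sect_cat G O') x y z g f)) vs = map (vertex_act f) (map (vertex_act g) vs)" by simp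
  }
qed

text \<open>Let the apex of a flag \<open>s\<close> over \<open>x\<close> be \<open>Mg : x \<rightarrow> c\<close>. All other entries are above the apex, so each of them
factors through \<open>Mg\<close>. The factors form a flag over \<open>c\<close> whose apex is the identity. Conversely, the apex of
the translate of such a flag by \<open>f\<close> is \<open>f\<close>, so \<open>f\<close> and \<open>c\<close> can be recovered.\<close>

lemma flag_presheaf_basis:
  fixes R :: "('r, 'q) ring_scheme"
  assumes C: "C \<subseteq> O'" and O': "O' \<subseteq> sections G"
  shows "presheaf_basis (sect_cat G O') (flags R C (Suc n)) (\<lambda>x y a. map (vertex_act a)) (flag_basis R C n)"
  unfolding presheaf_basis_def
proof (intro conjI ballI)
  show "case cb of (c, b) \<Rightarrow> c \<in> Obj (sect_cat G O') \<and> b \<in> flags R C (Suc n) c" if "cb \<in> flag_basis R C n" for cb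
    using that C by (auto simp: flag_basis_def sect_cat_sel)
next
  have CS: "C \<subseteq> sections G" using C O' by auto
  fix x s assume "x \<in> Obj (sect_cat G O')" and s: "s \<in> flags R C (Suc n) x"
  then have x: "x \<in> sections G" using O' by (auto simp: sect_cat_sel)
  note ap = flag_has_apex[OF s CS x]
  obtain c g where c: "apex s = (c, fst c #> g, \<zero>\<^bsub>R\<^esub>, \<zero>\<^bsub>R\<^esub>)" "c \<in> C" "c \<in> sections G" "g \<in> carrier G"
    "sect_le (conj_sect G g x) c" "vertex_sect (apex s) = conj_sect G (inv g) c"
    using verticesE[OF flagsD[OF s ap(2)] CS x] by metis
  let ?f = "fst c #> g"
  have f: "?f \<in> Hom (sect_cat G O') x c" using c(4,5) by (auto simp: sect_cat_sel(4))
  \<comment> \<open>division by \<open>Mg\<close>\<close>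
  define u :: "'a sect \<times> 'a set \<times> 'r \<times> 'r \<Rightarrow> 'a sect \<times> 'a set \<times> 'r \<times> 'r"
    where "u = (\<lambda>(t, h, r). (t, h #> inv g, r))"
  have u: "u v \<in> vertices R C c" "vertex_act ?f (u v) = v" "vertex_sect (u v) = conj_sect G g (vertex_sect v)" if v: "v \<in> set s" for v
  proof -
    obtain t h where t: "v = (t, fst t #> h, \<zero>\<^bsub>R\<^esub>, \<zero>\<^bsub>R\<^esub>)" "t \<in> C" "t \<in> sections G" "h \<in> carrier G"
      "sect_le (conj_sect G h x) t" "vertex_sect v = conj_sect G (inv h) t"
      using verticesE[OF flagsD[OF s v] CS x] by metis
    have uv: "u v = (t, fst t #> (h \<otimes> inv g), \<zero>\<^bsub>R\<^esub>, \<zero>\<^bsub>R\<^esub>)"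
      using t(3,4) c(4) by (simp add: t(1) u_def coset_mult_assoc sections_fst_carrier)
    have "sect_le (conj_sect G (inv g) c) (conj_sect G (inv h) t)" using ap(3)[OF v] by (simp add: c(6) t(6))
    then have "sect_le (conj_sect G h (conj_sect G (inv g) c)) t"
      using t c by (simp add: sect_le_conj_left conj_sect_sections)
    then have le: "sect_le (conj_sect G (h \<otimes> inv g) c) t" using t c by (simp add: conj_sect_mult)
    show "u v \<in> vertices R C c" unfolding uv using t c le by (intro verticesI) auto
    show "vertex_act ?f (u v) = v"
      unfolding uv vertex_act_def using sect_comp[OF x c(3) t(3) c(4) _ le] t(3,4) c(4) by (simp add: t(1) m_assoc)
    show "vertex_sect (u v) = conj_sect G g (vertex_sect v)"
      unfolding uv t(6) using t c by (simp add: vertex_sect_coset inv_mult_group conj_sect_mult)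
  qed
  have ule: "vertex_le (u v) (u w) \<longleftrightarrow> vertex_le v w" if "v \<in> set s" "w \<in> set s" for v w
    using u(3) that c(4) by (simp add: sect_le_conj_iff vertex_sect_sections[OF flagsD[OF s] CS x])
  have us: "map u s \<in> flags R C (Suc n) c"
  proof -
    have "\<forall>v\<in>set s. \<forall>w\<in>set s. vertex_le v w \<or> vertex_le w v" "length s = Suc n"
      using s by (simp_all add: flags_def comparable_lists_def)
    moreover have "u ` set s \<subseteq> vertices R C c" using u(1) by blast
    ultimately show ?thesis using ule unfolding flags_def comparable_lists_def by simp
  qed
  have "apex (map u s) = u (apex s)" by (rule apex_map[OF ule ap(1)])
  also have "\<dots> = (c, fst c, \<zero>\<^bsub>R\<^esub>, \<zero>\<^bsub>R\<^esub>)"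
    using c(3,4) by (simp add: c(1) u_def coset_mult_assoc sections_fst_carrier coset_mult_one)
  finally have cb: "(c, map u s) \<in> flag_basis R C n" using us c(2) by (simp add: flag_basis_def)
  have act: "map (vertex_act ?f) (map u s) = s" using u(2) by (simp add: map_idI)
  show "\<exists>!(c, b, f). (c, b) \<in> flag_basis R C n \<and> f \<in> Hom (sect_cat G O') x c \<and> map (vertex_act f) b = s"
  proof (rule ex1I[of _ "(c, map u s, ?f)"])
    show "case (c, map u s, ?f) of (c, b, f) \<Rightarrow> (c, b) \<in> flag_basis R C n \<and> f \<in> Hom (sect_cat G O') x c \<and> map (vertex_act f) b = s"
      using cb f act by simp
    fix p assume p: "case p of (c, b, f) \<Rightarrow> (c, b) \<in> flag_basis R C n \<and> f \<in> Hom (sect_cat G O') x c \<and> map (vertex_act f) b = s"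
    obtain c' b' f' where p': "p = (c', b', f')" by (cases p)
    have b': "(c', b') \<in> flag_basis R C n" "f' \<in> Hom (sect_cat G O') x c'" "map (vertex_act f') b' = s"
      using p by (auto simp: p')
    have c': "c' \<in> sections G" "b' \<in> flags R C (Suc n) c'" "apex b' = (c', fst c', \<zero>\<^bsub>R\<^esub>, \<zero>\<^bsub>R\<^esub>)"
      using b'(1) CS by (auto simp: flag_basis_def)
    obtain k where k: "k \<in> carrier G" "f' = fst c' #> k" "sect_le (conj_sect G k x) c'" using b'(2) by (auto simp: sect_cat_sel(4))
    have "apex s = vertex_act f' (apex b')"
      unfolding b'(3)[symmetric] k(2)
      by (rule apex_map[OF vertex_act_le[OF flagsD[OF c'(2)] flagsD[OF c'(2)] CS x c'(1) k(1,3)] flag_has_apex(1)[OF c'(2) CS c'(1)]])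
    also have "\<dots> = (c', f', \<zero>\<^bsub>R\<^esub>, \<zero>\<^bsub>R\<^esub>)"
    proof -
      have "fst c' <#> f' = (fst c' #> \<one>) <#> (fst c' #> k)" using c'(1) k(2) by (simp add: coset_mult_one sections_fst_carrier)
      also have "\<dots> = fst c' #> (\<one> \<otimes> k)"
        by (rule sect_comp[OF x c'(1) c'(1) k(1) one_closed]) (simp add: conj_sect_one c'(1) sect_le_refl)
      finally show ?thesis using k by (simp add: c'(3) vertex_act_def)
    qed
    finally have cf: "c' = c" "f' = ?f" using c(1) by auto
    have "u (vertex_act ?f v) = v" if v: "v \<in> set b'" for v
    proof -
      obtain t h where t: "v = (t, fst t #> h, \<zero>\<^bsub>R\<^esub>, \<zero>\<^bsub>R\<^esub>)" "t \<in> C" "t \<in> sections G" "h \<in> carrier G"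
        "sect_le (conj_sect G h c) t"
        using verticesE[OF flagsD[OF c'(2) v] CS c'(1)] cf(1) by metis
      have "vertex_act ?f v = (t, fst t #> (h \<otimes> g), \<zero>\<^bsub>R\<^esub>, \<zero>\<^bsub>R\<^esub>)"
        using sect_comp[OF x c(3) t(3) c(4) t(4,5)] by (simp add: t(1) vertex_act_def)
      then show ?thesis using t(3,4) c(4) by (simp add: t(1) u_def coset_mult_assoc sections_fst_carrier m_assoc)
    qed
    then have "map u (map (vertex_act ?f) b') = b'" by (simp add: map_idI)
    then have "b' = map u s" unfolding b'(3)[symmetric] cf(2) by (rule sym)
    then show "p = (c, map u s, ?f)" using cf by (simp add: p')
  qed
qed

text \<open>The vertices over \<open>x\<close> map onto the poset \<open>{w \<in> C. x \<preceq> w}\<close>, and \<open>w\<close> has a preimage, the inclusion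
\<open>x \<rightarrow> w\<close>.\<close>

lemma flags_acyclic:
  assumes fin: "finite (carrier G)" and C: "C \<subseteq> sections G" "\<And>g s. g \<in> carrier G \<Longrightarrow> s \<in> C \<Longrightarrow> conj_sect G g s \<in> C"
    and x: "x \<in> sections G" and contr: "contractible_realization {w \<in> C. sect_le x w} sect_le"
  shows "acyclic_lists (comparable_lists (vertices R C x) vertex_le)"
proof (rule acyclic_comparable_lists_pullback)
  let ?X = "{w \<in> C. sect_le x w}"
  have "?X \<subseteq> Pow (carrier G) \<times> Pow (carrier G)"
    using C(1) sections_fst_carrier sections_snd_carrier by (auto simp: subset_iff) (metis fst_conv, metis snd_conv)
  then have "finite ?X" using fin finite_subset by blast
  then show "acyclic_lists (comparable_lists ?X sect_le)" using contr by (rule contractible_realization_acyclic)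
  show "vertex_sect v \<in> ?X" if "v \<in> vertices R C x" for v
    by (rule verticesE[OF that C(1) x]) (simp add: C(2))
  let ?s = "\<lambda>w. (w, fst w, \<zero>\<^bsub>R\<^esub>, \<zero>\<^bsub>R\<^esub>)"
  fix w assume w: "w \<in> ?X"
  have ws: "w \<in> sections G" using w C(1) by auto
  have w1: "fst w #> \<one> = fst w" using ws by (simp add: coset_mult_one sections_fst_carrier)
  show "?s w \<in> vertices R C x" using verticesI[of w C \<one> x R] w x by (simp add: w1 conj_sect_one)
  show "vertex_sect (?s w) = w" using vertex_sect_coset[OF ws one_closed] by (simp add: w1 conj_sect_one ws)
qed

end

lemma (in cring) const_functor_module: "Module.module R (At (const_functor R) x)"
  by (rule moduleI)
     (auto simp: const_functor_def l_distr r_distr m_assoc is_cring a_ac intro!: abelian_groupI intro: l_neg)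

lemma (in cring) const_functor_contra: "contra_functor R D (const_functor R)"
  unfolding contra_functor_def using const_functor_module
  by (auto simp: const_functor_def lin_map_def)

section \<open>The simultaneous resolution\<close>

locale section_resolution = group G + R: cring R for G :: "('g, 'h) monoid_scheme" (structure) and R :: "('r, 'q) ring_scheme" +
  fixes C :: "'g sect set" and C' :: "'g sect set"
  assumes fin: "finite (carrier G)" and C: "collection G C" and C': "collection G C'" and sub: "C' \<subseteq> C"
    and contr: "\<And>x. x \<in> C \<Longrightarrow> contractible_realization {w \<in> C'. sect_le x w} sect_le"
begin

abbreviation const_R :: "('g sect, 'g set, 'r, 'r) mfunctor" where
  "const_R \<equiv> const_functor R"

lemma C_sections: "C \<subseteq> sections G" and C'_sections: "C' \<subseteq> sections G"
  using C C' by (auto simp: collection_def)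

text \<open>\<open>Q\<close> is built from \<open>C'\<close> alone and is defined on all sections. Contractibility at the objects of \<open>C\<close> makes
it a resolution over \<open>C\<close>; over \<open>C'\<close> it is the same construction for the pair \<open>(C', C')\<close>.\<close>

definition Q :: "nat \<Rightarrow> ('g sect, 'g set, 'r, ('g sect \<times> 'g set \<times> 'r \<times> 'r) list \<Rightarrow> 'r) mfunctor" where
  "Q n = free_functor R (flags R C' (Suc n)) (\<lambda>x y a. map (vertex_act a))"

abbreviation (input) lists_over :: "'g sect \<Rightarrow> ('g sect \<times> 'g set \<times> 'r \<times> 'r) list set" where
  "lists_over x \<equiv> comparable_lists (vertices R C' x) vertex_le"

definition Qd where "Qd n = mk_nat (sect_cat G C) (Q (Suc n)) (\<lambda>x. list_diff R (lists_over x) (Suc n))"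

definition Qe where "Qe = mk_nat (sect_cat G C) (Q 0) (\<lambda>x a. list_diff R (lists_over x) 0 a [])"

lemma At_Q: "At (Q n) x = free_mod R {xs \<in> lists_over x. length xs = Suc n}"
  by (simp add: Q_def free_functor_def flags_def)

lemma flags_over_C_acyclic: "x \<in> C \<Longrightarrow> acyclic_lists (lists_over x)"
  using C' C_sections contr by (intro flags_acyclic fin C'_sections) (auto simp: collection_def)

lemma flags_over_C_presheaf: "presheaf (sect_cat G C) (flags R C' n) (\<lambda>x y a. map (vertex_act a))"
  by (rule flags_presheaf[OF C'_sections C_sections])

lemma flags_over_C_basis: "presheaf_basis (sect_cat G C) (flags R C' (Suc n)) (\<lambda>x y a. map (vertex_act a)) (flag_basis R C' n)"
  by (rule flag_presheaf_basis[OF sub C_sections])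

lemma sect_cat_C_category: "category (sect_cat G C)"
  by (rule sect_cat_category[OF C_sections])

lemma Q_contra: "contra_functor R (sect_cat G C) (Q n)"
  unfolding Q_def by (rule R.free_functor_contra_functor[OF sect_cat_C_category flags_over_C_presheaf])

lemma Q_act_lin_map:
  assumes "x \<in> C" "y \<in> C" "f \<in> Hom (sect_cat G C) x y"
  shows "lin_map R (free_mod R {xs \<in> lists_over y. length xs = Suc n}) (free_mod R {xs \<in> lists_over x. length xs = Suc n}) (Act (Q n) x y f)"
  using contra_functorD(2)[OF Q_contra[of n], of x y f] assms by (simp add: At_Q sect_cat_sel(1))

lemma Q_act_base_change:
  assumes xy: "x \<in> C" "y \<in> C" "f \<in> Hom (sect_cat G C) x y" and c: "supp c \<subseteq> {xs \<in> lists_over y. length xs = Suc n}"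
  shows "Act (Q n) x y f (R.base_change c) = R.base_change (push (vertex_act f) c)"
proof -
  have "Act (Q n) x y f = lin_ext R (free_mod R (flags R C' (Suc n) x)) (\<lambda>s. R.base_change (frag_of (map (vertex_act f) s)))"
    by (simp add: Q_def free_functor_def R.base_change_frag_of)
  then show ?thesis
    unfolding push_def using presheafD(1)[OF flags_over_C_presheaf[of "Suc n"], of x y f] xy
    by (simp add: R.lin_ext_base_change[OF c[folded flags_def]] keys_frag_of sect_cat_sel(1))
qed

lemma Q_act_delta:
  assumes xy: "x \<in> C" "y \<in> C" "f \<in> Hom (sect_cat G C) x y" and s: "s \<in> lists_over y" "length s = Suc n"
  shows "Act (Q n) x y f (delta R s) = delta R (map (vertex_act f) s)"
  using Q_act_base_change[OF xy, of "frag_of s" n] s by (simp add: keys_frag_of R.base_change_frag_of)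

lemma map_vertex_act:
  "x \<in> C \<Longrightarrow> y \<in> C \<Longrightarrow> f \<in> Hom (sect_cat G C) x y \<Longrightarrow> s \<in> lists_over y \<Longrightarrow> map (vertex_act f) s \<in> lists_over x"
  using presheafD(1)[OF flags_over_C_presheaf[of "length s"], of x y f s] by (simp add: flags_def sect_cat_sel(1))

lemma Qd_nat: "Qd n \<in> nat_trans R (sect_cat G C) (Q (Suc n)) (Q n)"
  unfolding Qd_def
proof (rule mk_nat_in_nat_trans[OF Q_contra])
  show "lin_map R (At (Q (Suc n)) x) (At (Q n) x) (list_diff R (lists_over x) (Suc n))" for x
    unfolding At_Q by (rule R.list_diff_lin_map)
  fix x y f p assume "x \<in> Obj (sect_cat G C)" "y \<in> Obj (sect_cat G C)" and f: "f \<in> Hom (sect_cat G C) x y" and p: "p \<in> carrier (At (Q (Suc n)) y)"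
  then have xy: "x \<in> C" "y \<in> C" by (auto simp: sect_cat_sel(1))
  show "list_diff R (lists_over x) (Suc n) (Act (Q (Suc n)) x y f p) = Act (Q n) x y f (list_diff R (lists_over y) (Suc n) p)"
  proof (rule R.lin_map_eqI[OF R.free_mod_module lin_map_compose[OF Q_act_lin_map[OF xy f] R.list_diff_lin_map]
        lin_map_compose[OF R.list_diff_lin_map Q_act_lin_map[OF xy f]] _ p[unfolded At_Q]])
    fix s assume s: "s \<in> {xs \<in> lists_over y. length xs = Suc (Suc n)}"
    have "supp (bd s) \<subseteq> {xs \<in> lists_over y. length xs = Suc n}" using s by (intro keys_bd_comparable) auto
    then show "list_diff R (lists_over x) (Suc n) (Act (Q (Suc n)) x y f (delta R s)) = Act (Q n) x y f (list_diff R (lists_over y) (Suc n) (delta R s))"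
      using s xy f by (simp add: Q_act_delta Q_act_base_change R.list_diff_delta map_vertex_act push_bd)
  qed
qed

lemma augmentation_lin_map:
  "lin_map R (At (Q 0) x) (At const_R x) (\<lambda>a. list_diff R (lists_over x) 0 a [])"
proof -
  note l = lin_mapD[OF R.list_diff_lin_map[of "vertices R C' x" vertex_le 0]]
  show ?thesis
    unfolding At_Q
  proof (rule lin_mapI)
    fix a assume a: "a \<in> carrier (free_mod R {xs \<in> lists_over x. length xs = Suc 0})"
    show "list_diff R (lists_over x) 0 a [] \<in> carrier (At const_R x)"
      using R.free_mod_coeff[OF l(1)[OF a]] by (simp add: const_functor_def)
    show "list_diff R (lists_over x) 0 (r \<odot>\<^bsub>free_mod R {xs \<in> lists_over x. length xs = Suc 0}\<^esub> a) [] = r \<odot>\<^bsub>At const_R x\<^esub> list_diff R (lists_over x) 0 a []"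
      if "r \<in> carrier R" for r using l(3)[OF that a] by (simp add: const_functor_def free_mod_sel)
    show "list_diff R (lists_over x) 0 (a \<oplus>\<^bsub>free_mod R {xs \<in> lists_over x. length xs = Suc 0}\<^esub> b) [] =
      list_diff R (lists_over x) 0 a [] \<oplus>\<^bsub>At const_R x\<^esub> list_diff R (lists_over x) 0 b []"
      if "b \<in> carrier (free_mod R {xs \<in> lists_over x. length xs = Suc 0})" for b
      using l(2)[OF a that] by (simp add: const_functor_def free_mod_sel)
  qed
qed

lemma Qe_nat: "Qe \<in> nat_trans R (sect_cat G C) (Q 0) const_R"
  unfolding Qe_def
proof (rule mk_nat_in_nat_trans[OF Q_contra augmentation_lin_map])
  fix x y f p assume "x \<in> Obj (sect_cat G C)" "y \<in> Obj (sect_cat G C)" and f: "f \<in> Hom (sect_cat G C) x y" and p: "p \<in> carrier (At (Q 0) y)"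
  then have xy: "x \<in> C" "y \<in> C" by (auto simp: sect_cat_sel(1))
  have one: "list_diff R (lists_over z) 0 (delta R s) [] = \<one>\<^bsub>R\<^esub>" if s: "s \<in> lists_over z" "length s = Suc 0" for s z
  proof -
    obtain v where "s = [v]" using s(2) by (cases s) auto
    then show ?thesis using R.list_diff_delta[OF s] by (simp add: R.base_change_frag_of delta_def)
  qed
  have At: "At const_R y = At const_R x" by (simp add: const_functor_def)
  have "list_diff R (lists_over x) 0 (Act (Q 0) x y f p) [] = list_diff R (lists_over y) 0 p []"
  proof (rule R.lin_map_eqI[OF R.const_functor_module lin_map_compose[OF Q_act_lin_map[OF xy f] augmentation_lin_map[of x, unfolded At_Q]]
        augmentation_lin_map[of y, unfolded At_Q At] _ p[unfolded At_Q]])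
    fix s assume "s \<in> {xs \<in> lists_over y. length xs = Suc 0}"
    then show "list_diff R (lists_over x) 0 (Act (Q 0) x y f (delta R s)) [] = list_diff R (lists_over y) 0 (delta R s) []"
      using xy f by (simp add: Q_act_delta map_vertex_act one)
  qed
  then show "list_diff R (lists_over x) 0 (Act (Q 0) x y f p) [] = Act const_R x y f (list_diff R (lists_over y) 0 p [])"
    by (simp add: const_functor_def)
qed

lemma Qd_apply: "x \<in> C \<Longrightarrow> p \<in> carrier (At (Q (Suc n)) x) \<Longrightarrow> Qd n x p = list_diff R (lists_over x) (Suc n) p"
  by (simp add: Qd_def sect_cat_sel(1))

lemma Qd_Qd: "x \<in> C \<Longrightarrow> r \<in> carrier (At (Q (Suc (Suc n))) x) \<Longrightarrow> Qd n x (Qd (Suc n) x r) = \<zero>\<^bsub>At (Q n) x\<^esub>"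
  using nat_transD(2)[OF Qd_nat, of x r "Suc n"] R.list_diff_list_diff[of r "vertices R C' x" vertex_le "Suc n"]
  by (simp add: Qd_apply sect_cat_sel(1) At_Q free_mod_sel(2))

lemma Q_resolution: "projective_resolution R (sect_cat G C) const_R Q Qd Qe"
  unfolding projective_resolution_def
proof (intro conjI allI ballI)
  show "projective R (sect_cat G C) (Q n)" for n
    unfolding Q_def by (rule R.free_functor_projective[OF sect_cat_C_category flags_over_C_presheaf flags_over_C_basis])
  show "Qd n \<in> nat_trans R (sect_cat G C) (Q (Suc n)) (Q n)" for n by (rule Qd_nat)
  show "Qe \<in> nat_trans R (sect_cat G C) (Q 0) const_R" by (rule Qe_nat)
  fix x assume "x \<in> Obj (sect_cat G C)"
  then have x: "x \<in> C" by (simp add: sect_cat_sel(1))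
  have ox: "x \<in> Obj (sect_cat G C)" using x by (simp add: sect_cat_sel(1))
  show "Qe x ` carrier (At (Q 0) x) = carrier (At const_R x)"
  proof
    show "Qe x ` carrier (At (Q 0) x) \<subseteq> carrier (At const_R x)" by (rule image_subsetI) (rule nat_transD(2)[OF Qe_nat ox])
    show "carrier (At const_R x) \<subseteq> Qe x ` carrier (At (Q 0) x)"
    proof
      fix r assume "r \<in> carrier (At const_R x)"
      then have r: "r \<in> carrier R" by (simp add: const_functor_def)
      obtain a where a: "a \<in> carrier (At (Q 0) x)" "list_diff R (lists_over x) 0 a [] = r"
        using R.list_diff_0_surj[OF flags_over_C_acyclic[OF x] r] by (auto simp: At_Q)
      then have "Qe x a = r" using ox by (simp add: Qe_def)
      then show "r \<in> Qe x ` carrier (At (Q 0) x)" using a(1) by (metis imageI)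
    qed
  qed
  show "Qd 0 x ` carrier (At (Q 1) x) = {p \<in> carrier (At (Q 0) x). Qe x p = \<zero>\<^bsub>At const_R x\<^esub>}"
  proof (intro equalityI subsetI)
    fix p assume "p \<in> Qd 0 x ` carrier (At (Q 1) x)"
    then obtain r where r: "r \<in> carrier (At (Q (Suc 0)) x)" "p = Qd 0 x r" by auto
    have p: "p \<in> carrier (At (Q 0) x)" using nat_transD(2)[OF Qd_nat ox r(1)] r(2) by simp
    have "list_diff R (lists_over x) 0 p [] = \<zero>\<^bsub>R\<^esub>"
      using R.list_diff_list_diff[of r "vertices R C' x" vertex_le 0] r x by (simp add: Qd_apply At_Q)
    then show "p \<in> {p \<in> carrier (At (Q 0) x). Qe x p = \<zero>\<^bsub>At const_R x\<^esub>}"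
      using p ox by (simp add: Qe_def const_functor_def)
  next
    fix p assume "p \<in> {p \<in> carrier (At (Q 0) x). Qe x p = \<zero>\<^bsub>At const_R x\<^esub>}"
    then have p: "p \<in> carrier (free_mod R {xs \<in> lists_over x. length xs = Suc 0})" "list_diff R (lists_over x) 0 p [] = \<zero>\<^bsub>R\<^esub>"
      using ox by (auto simp: Qe_def const_functor_def At_Q)
    have "list_diff R (lists_over x) 0 p = (\<lambda>_. \<zero>\<^bsub>R\<^esub>)"
    proof
      fix xs
      show "list_diff R (lists_over x) 0 p xs = \<zero>\<^bsub>R\<^esub>"
        using p(2) lin_mapD(1)[OF R.list_diff_lin_map p(1)] by (cases xs) (auto simp: free_mod_sel)
    qed
    from R.list_diff_exact[OF flags_over_C_acyclic[OF x] p(1) this]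
    obtain a where a: "a \<in> carrier (At (Q (Suc 0)) x)" "p = list_diff R (lists_over x) (Suc 0) a" by (auto simp: At_Q)
    then show "p \<in> Qd 0 x ` carrier (At (Q 1) x)"
      using imageI[OF a(1), of "Qd 0 x"] Qd_apply[OF x a(1)] by simp
  qed
  fix n
  show "Qd (Suc n) x ` carrier (At (Q (Suc (Suc n))) x) = {p \<in> carrier (At (Q (Suc n)) x). Qd n x p = \<zero>\<^bsub>At (Q n) x\<^esub>}"
  proof (intro equalityI subsetI)
    fix p assume "p \<in> Qd (Suc n) x ` carrier (At (Q (Suc (Suc n))) x)"
    then obtain r where "r \<in> carrier (At (Q (Suc (Suc n))) x)" "p = Qd (Suc n) x r" by auto
    then show "p \<in> {p \<in> carrier (At (Q (Suc n)) x). Qd n x p = \<zero>\<^bsub>At (Q n) x\<^esub>}"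
      using Qd_Qd[OF x, of r n] nat_transD(2)[OF Qd_nat ox, of r "Suc n"] by simp
  next
    fix p assume "p \<in> {p \<in> carrier (At (Q (Suc n)) x). Qd n x p = \<zero>\<^bsub>At (Q n) x\<^esub>}"
    then have p: "p \<in> carrier (free_mod R {xs \<in> lists_over x. length xs = Suc (Suc n)})" "list_diff R (lists_over x) (Suc n) p = (\<lambda>_. \<zero>\<^bsub>R\<^esub>)"
      using x Qd_apply[of x p n] by (auto simp: At_Q free_mod_sel(2))
    from R.list_diff_exact[OF flags_over_C_acyclic[OF x] p]
    obtain a where a: "a \<in> carrier (At (Q (Suc (Suc n))) x)" "p = list_diff R (lists_over x) (Suc (Suc n)) a" by (auto simp: At_Q)
    then show "p \<in> Qd (Suc n) x ` carrier (At (Q (Suc (Suc n))) x)"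
      using imageI[OF a(1), of "Qd (Suc n) x"] Qd_apply[OF x a(1)] by simp
  qed
qed

text \<open>\<open>Ext\<close> is computed from some chosen resolution, which exists because \<open>Q\<close> is one.\<close>

lemma Ext_const:
  fixes F :: "('g sect, 'g set, 'r, 'm) mfunctor"
  assumes F: "contra_functor R (sect_cat G C) F"
  shows "mod_isomorphic R (red_cohom_pos R G C (Suc k) F) (cohomology_of_resolution R (sect_cat G C) Q Qd (Suc k) F)"
    and "mod_isomorphic R (cohomology_of_resolution R (sect_cat G C) Q Qd (Suc k) F) (red_cohom_pos R G C (Suc k) F)"
proof -
  define X :: "(nat \<Rightarrow> ('g sect, 'g set, 'r, ('g sect \<times> 'g set \<times> 'r \<times> 'r) list \<Rightarrow> 'r) mfunctor) \<times>
      (nat \<Rightarrow> 'g sect \<Rightarrow> (('g sect \<times> 'g set \<times> 'r \<times> 'r) list \<Rightarrow> 'r) \<Rightarrow> (('g sect \<times> 'g set \<times> 'r \<times> 'r) list \<Rightarrow> 'r))"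
    where "X = (SOME (P, d). \<exists>e. projective_resolution R (sect_cat G C) const_R P d e)"
  have "\<exists>e. projective_resolution R (sect_cat G C) const_R (fst X) (snd X) e"
    unfolding X_def by (rule someI2[of _ "(Q, Qd)"]) (use Q_resolution in \<open>auto split: prod.splits\<close>)
  then obtain e where e: "projective_resolution R (sect_cat G C) const_R (fst X) (snd X) e" by blast
  have X: "red_cohom_pos R G C n F = cohomology_of_resolution R (sect_cat G C) (fst X) (snd X) n F" for n
    unfolding red_cohom_pos_def Ext_def X_def[symmetric] by (simp add: case_prod_beta)
  show "mod_isomorphic R (red_cohom_pos R G C (Suc k) F) (cohomology_of_resolution R (sect_cat G C) Q Qd (Suc k) F)"
    unfolding X by (rule R.cohomology_of_resolution_independent[OF sect_cat_C_category R.const_functor_contra F e Q_resolution])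
  show "mod_isomorphic R (cohomology_of_resolution R (sect_cat G C) Q Qd (Suc k) F) (red_cohom_pos R G C (Suc k) F)"
    unfolding X by (rule R.cohomology_of_resolution_independent[OF sect_cat_C_category R.const_functor_contra F Q_resolution e])
qed

text \<open>The basis of \<open>Q\<close> lies over objects of \<open>C'\<close>.\<close>

lemma Q_restrict:
  assumes F: "contra_functor R (sect_cat G C) F"
  shows "mod_isomorphic R (cohomology_of_resolution R (sect_cat G C) Q Qd (Suc k) F)
     (cohomology_of_resolution R (sect_cat G C') Q (\<lambda>n. restrict (Qd n) C') (Suc k) F)"
  unfolding sect_cat_restrict[of C' C]
proof (rule R.cohomology_free_restrict[OF sect_cat_C_category flags_over_C_presheaf flags_over_C_basis F])
  show "Qd n x (Qd (Suc n) x r) = \<zero>\<^bsub>At (Q n) x\<^esub>" if "x \<in> Obj (sect_cat G C)" "r \<in> carrier (At (Q (Suc (Suc n))) x)" for n x r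
    using Qd_Qd that by (simp add: sect_cat_sel(1))
qed (use sub Qd_nat in \<open>auto simp: sect_cat_sel(1) flag_basis_def Q_def\<close>)

end

section \<open>Limits and the degrees 0 and -1\<close>

lemma lim_mod_sel:
  "s \<in> carrier (lim_mod D F) \<longleftrightarrow> s \<in> (\<Pi>\<^sub>E x\<in>Obj D. carrier (At F x)) \<and>
      (\<forall>x\<in>Obj D. \<forall>y\<in>Obj D. \<forall>f\<in>Hom D x y. Act F x y f (s y) = s x)"
  "zero (lim_mod D F) = (\<lambda>x\<in>Obj D. \<zero>\<^bsub>At F x\<^esub>)"
  "add (lim_mod D F) = (\<lambda>s t. \<lambda>x\<in>Obj D. s x \<oplus>\<^bsub>At F x\<^esub> t x)"
  "smult (lim_mod D F) = (\<lambda>r s. \<lambda>x\<in>Obj D. r \<odot>\<^bsub>At F x\<^esub> s x)"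
  by (simp_all add: lim_mod_def Let_def)

lemma lim_modD:
  assumes "s \<in> carrier (lim_mod D F)"
  shows "x \<in> Obj D \<Longrightarrow> s x \<in> carrier (At F x)"
    and "x \<in> Obj D \<Longrightarrow> y \<in> Obj D \<Longrightarrow> f \<in> Hom D x y \<Longrightarrow> Act F x y f (s y) = s x"
    and "s \<in> extensional (Obj D)"
  using assms by (auto simp: lim_mod_sel PiE_iff)

lemma lim_modI:
  assumes "\<And>x. x \<in> Obj D \<Longrightarrow> t x \<in> carrier (At F x)"
    and "\<And>x y f. x \<in> Obj D \<Longrightarrow> y \<in> Obj D \<Longrightarrow> f \<in> Hom D x y \<Longrightarrow> Act F x y f (t y) = t x"
  shows "restrict t (Obj D) \<in> carrier (lim_mod D F)"
  using assms by (auto simp: lim_mod_sel)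

context cring
begin

lemma lim_mod_module:
  assumes F: "contra_functor R D F"
  shows "Module.module R (lim_mod D F)"
proof -
  note mod = contra_functorD(1)[OF F] and lin = contra_functorD(2)[OF F]
  have ag: "abelian_group (At F x)" if "x \<in> Obj D" for x using mod[OF that] by (simp add: Module.module_def)
  have am: "abelian_monoid (At F x)" if "x \<in> Obj D" for x using ag[OF that] by (simp add: abelian_group_def)
  have eqI: "s = t" if "s \<in> carrier (lim_mod D F)" "t \<in> carrier (lim_mod D F)" "\<And>x. x \<in> Obj D \<Longrightarrow> s x = t x" for s t
    using lim_modD(3)[OF that(1)] lim_modD(3)[OF that(2)] that(3) by (rule extensionalityI)
  have z: "\<zero>\<^bsub>lim_mod D F\<^esub> \<in> carrier (lim_mod D F)"
    unfolding lim_mod_sel(2) by (rule lim_modI) (auto simp: abelian_monoid.zero_closed[OF am] lin_map_zero[OF mod mod lin])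
  have a: "s \<oplus>\<^bsub>lim_mod D F\<^esub> t \<in> carrier (lim_mod D F)" if "s \<in> carrier (lim_mod D F)" "t \<in> carrier (lim_mod D F)" for s t
    unfolding lim_mod_sel(3)
    by (rule lim_modI) (use lim_modD[OF that(1)] lim_modD[OF that(2)] in \<open>auto simp: abelian_monoid.a_closed[OF am] lin_mapD(2)[OF lin]\<close>)
  have m: "r \<odot>\<^bsub>lim_mod D F\<^esub> s \<in> carrier (lim_mod D F)" if "r \<in> carrier R" "s \<in> carrier (lim_mod D F)" for r s
    unfolding lim_mod_sel(4)
    by (rule lim_modI) (use lim_modD[OF that(2)] that(1) in \<open>auto simp: Module.module.smult_closed[OF mod] lin_mapD(3)[OF lin]\<close>)
  have n: "(\<lambda>x\<in>Obj D. \<ominus>\<^bsub>At F x\<^esub> s x) \<in> carrier (lim_mod D F)" if "s \<in> carrier (lim_mod D F)" for s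
    by (rule lim_modI) (use lim_modD[OF that] in \<open>auto simp: abelian_group.a_inv_closed[OF ag] lin_map_minus(1)[OF mod mod lin]\<close>)
  show ?thesis
  proof (rule moduleI)
    show "abelian_group (lim_mod D F)"
    proof (rule abelian_groupI)
      fix s t u assume *: "s \<in> carrier (lim_mod D F)" "t \<in> carrier (lim_mod D F)" "u \<in> carrier (lim_mod D F)"
      note v = lim_modD(1)[OF *(1)] lim_modD(1)[OF *(2)] lim_modD(1)[OF *(3)]
      show "s \<oplus>\<^bsub>lim_mod D F\<^esub> t \<in> carrier (lim_mod D F)" by (rule a[OF *(1,2)])
      show "s \<oplus>\<^bsub>lim_mod D F\<^esub> t \<oplus>\<^bsub>lim_mod D F\<^esub> u = s \<oplus>\<^bsub>lim_mod D F\<^esub> (t \<oplus>\<^bsub>lim_mod D F\<^esub> u)"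
        by (rule eqI[OF a[OF a[OF *(1,2)] *(3)] a[OF *(1) a[OF *(2,3)]]]) (simp add: lim_mod_sel(3) abelian_monoid.a_assoc[OF am] v)
      show "s \<oplus>\<^bsub>lim_mod D F\<^esub> t = t \<oplus>\<^bsub>lim_mod D F\<^esub> s"
        by (rule eqI[OF a[OF *(1,2)] a[OF *(2,1)]]) (simp add: lim_mod_sel(3) abelian_monoid.a_comm[OF am] v)
      show "\<zero>\<^bsub>lim_mod D F\<^esub> \<oplus>\<^bsub>lim_mod D F\<^esub> s = s"
        by (rule eqI[OF a[OF z *(1)] *(1)]) (simp add: lim_mod_sel(2,3) abelian_monoid.l_zero[OF am] v)
      show "\<exists>t\<in>carrier (lim_mod D F). t \<oplus>\<^bsub>lim_mod D F\<^esub> s = \<zero>\<^bsub>lim_mod D F\<^esub>"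
        by (rule bexI[OF _ n[OF *(1)]], rule eqI[OF a[OF n[OF *(1)] *(1)] z]) (simp add: lim_mod_sel(2,3) abelian_group.l_neg[OF ag] v)
    qed (rule z)
  next
    fix r q s t assume *: "r \<in> carrier R" "q \<in> carrier R"
    show "r \<odot>\<^bsub>lim_mod D F\<^esub> (s \<oplus>\<^bsub>lim_mod D F\<^esub> t) = r \<odot>\<^bsub>lim_mod D F\<^esub> s \<oplus>\<^bsub>lim_mod D F\<^esub> r \<odot>\<^bsub>lim_mod D F\<^esub> t"
      if s: "s \<in> carrier (lim_mod D F)" "t \<in> carrier (lim_mod D F)"
      by (rule eqI[OF m[OF *(1) a[OF s]] a[OF m[OF *(1) s(1)] m[OF *(1) s(2)]]])
         (simp add: lim_mod_sel(3,4) Module.module.smult_r_distr[OF mod] * lim_modD(1)[OF s(1)] lim_modD(1)[OF s(2)])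
    assume s: "s \<in> carrier (lim_mod D F)"
    note v = lim_modD(1)[OF s]
    show "r \<odot>\<^bsub>lim_mod D F\<^esub> s \<in> carrier (lim_mod D F)" by (rule m[OF *(1) s])
    show "(r \<oplus> q) \<odot>\<^bsub>lim_mod D F\<^esub> s = r \<odot>\<^bsub>lim_mod D F\<^esub> s \<oplus>\<^bsub>lim_mod D F\<^esub> q \<odot>\<^bsub>lim_mod D F\<^esub> s"
      by (rule eqI[OF m[OF a_closed[OF *] s] a[OF m[OF *(1) s] m[OF *(2) s]]])
         (simp add: lim_mod_sel(3,4) Module.module.smult_l_distr[OF mod] * v)
    show "(r \<otimes> q) \<odot>\<^bsub>lim_mod D F\<^esub> s = r \<odot>\<^bsub>lim_mod D F\<^esub> (q \<odot>\<^bsub>lim_mod D F\<^esub> s)"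
      by (rule eqI[OF m[OF m_closed[OF *] s] m[OF *(1) m[OF *(2) s]]])
         (simp add: lim_mod_sel(3,4) Module.module.smult_assoc1[OF mod] * v)
  next
    fix s assume s: "s \<in> carrier (lim_mod D F)"
    show "\<one> \<odot>\<^bsub>lim_mod D F\<^esub> s = s"
      by (rule eqI[OF m[OF one_closed s] s]) (simp add: lim_mod_sel(4) Module.module.smult_one[OF mod] lim_modD(1)[OF s])
  qed (rule is_cring)
qed

lemma lin_map_image_submodule:
  assumes M: "Module.module R M" and N: "Module.module R N" and h: "lin_map R M N h"
  shows "submodule (h ` carrier M) R N"
proof -
  interpret M: Module.module R M by fact
  show ?thesis
  proof (rule submoduleI_smult[OF N])
    show "h ` carrier M \<subseteq> carrier N" using lin_mapD(1)[OF h] by auto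
    show "\<zero>\<^bsub>N\<^esub> \<in> h ` carrier M" using lin_map_zero[OF M N h] M.M.zero_closed by (metis imageI)
    show "a \<oplus>\<^bsub>N\<^esub> b \<in> h ` carrier M" if ab: "a \<in> h ` carrier M" "b \<in> h ` carrier M" for a b
    proof -
      obtain x y where "x \<in> carrier M" "y \<in> carrier M" "a = h x" "b = h y" using ab by blast
      moreover have "x \<oplus>\<^bsub>M\<^esub> y \<in> carrier M" using calculation by simp
      ultimately show ?thesis using imageI[of "x \<oplus>\<^bsub>M\<^esub> y" "carrier M" h] lin_mapD(2)[OF h, of x y] by simp
    qed
    show "r \<odot>\<^bsub>N\<^esub> a \<in> h ` carrier M" if r: "r \<in> carrier R" and a: "a \<in> h ` carrier M" for r a
    proof -
      obtain x where x: "x \<in> carrier M" "a = h x" using a by blast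
      then have "r \<odot>\<^bsub>N\<^esub> a = h (r \<odot>\<^bsub>M\<^esub> x)" using lin_mapD(3)[OF h r] by simp
      then show ?thesis using M.smult_closed[OF r x(1)] by simp
    qed
  qed
qed

end

text \<open>Acyclicity in degree \<open>0\<close> is connectedness. If \<open>g\<close> took different values at \<open>w\<close> and \<open>w'\<close>, counting the
points with value \<open>g w\<close> would be a functional \<open>L\<close> that vanishes on boundaries but not on \<open>[w] - [w']\<close>.\<close>

lemma acyclic_comparable_constant:
  assumes acyclic: "acyclic_lists (comparable_lists X leq)" and refl: "\<And>a. a \<in> X \<Longrightarrow> leq a a"
    and g: "\<And>a b. a \<in> X \<Longrightarrow> b \<in> X \<Longrightarrow> leq a b \<Longrightarrow> g a = g b"
    and w: "w \<in> X" "w' \<in> X"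
  shows "g w = g w'"
proof (rule ccontr)
  assume ne: "g w \<noteq> g w'"
  define L where "L = frag_extend (\<lambda>xs. if \<exists>a. xs = [a] \<and> g a = g w then frag_of () else 0)"
  have L_of: "L (frag_of xs) = (if \<exists>a. xs = [a] \<and> g a = g w then frag_of () else 0)" for xs by (simp add: L_def)
  have L_diff: "L (a - b) = L a - L b" for a b by (simp add: L_def frag_extend_diff)
  let ?z = "frag_of [w] - frag_of [w']"
  have "supp ?z \<subseteq> comparable_lists X leq"
    by (intro keys_diff_subset) (use w refl in \<open>auto simp: comparable_lists_def keys_frag_of\<close>)
  then obtain u where u: "supp u \<subseteq> comparable_lists X leq" "bdry u = ?z"
    using acyclic[unfolded acyclic_lists_def, rule_format, of ?z] by auto
  have "L (bd xs) = 0" if xs: "xs \<in> comparable_lists X leq" for xs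
  proof (cases "length xs = Suc (Suc 0)")
    case True
    then obtain a b where ab: "xs = [a, b]" by (auto simp: length_Suc_conv)
    then have "g a = g b" using xs g[of a b] g[of b a] by (auto simp: comparable_lists_def)
    then show ?thesis by (simp add: ab L_diff L_of)
  next
    case False
    then show ?thesis unfolding L_def
      by (intro frag_extend_eq_0) (use keys_bd[of xs] in auto)
  qed
  then have "L (bdry u) = 0"
    using frag_additive_eqI[of "\<lambda>u. L (bdry u)" "\<lambda>_. 0" u] u(1) by (auto simp: L_diff)
  moreover have "L ?z = frag_of ()" using ne by (simp add: L_diff L_of)
  ultimately show False using u(2) by simp
qed

context section_resolution
begin

lemma sect_incl_hom: "x \<in> sections G \<Longrightarrow> w \<in> sections G \<Longrightarrow> sect_le x w \<Longrightarrow> fst w \<in> Hom (sect_cat G O') x w"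
  by (auto simp: sect_cat_sel(4) conj_sect_one coset_mult_one sections_fst_carrier intro!: bexI[of _ \<one>])

lemma top_sect_sections: "top_sect G \<in> sections G"
  by (rule sectionsI) (auto simp: subgroup_self triv_subgroup)

lemma top_hom: "x \<in> sections G \<Longrightarrow> carrier G #> \<one> \<in> Hom (sect_cat G O') x (top_sect G)"
  by (auto simp: sect_cat_sel(4) conj_sect_one sect_le_def sections_one sections_fst_carrier intro!: bexI[of _ \<one>] dest: subsetD[OF sections_snd_fst] subsetD[OF sections_fst_carrier])

context
  fixes F :: "('g sect, 'g set, 'r, 'm) mfunctor"
  assumes F: "contra_functor R (sect_cat G (sections G)) F"
begin

lemma F_sub: "O' \<subseteq> sections G \<Longrightarrow> contra_functor R (sect_cat G O') F"
  using R.contra_functor_restrict[OF F] by (simp add: sect_cat_restrict[of O' "sections G"] sect_cat_sel(1))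

lemma Act_comp:
  assumes "x \<in> sections G" "y \<in> sections G" "z \<in> sections G" "g \<in> carrier G" "h \<in> carrier G"
    "sect_le (conj_sect G g x) y" "sect_le (conj_sect G h y) z" "m \<in> carrier (At F z)"
  shows "Act F x y (fst y #> g) (Act F y z (fst z #> h) m) = Act F x z (fst z #> (h \<otimes> g)) m"
  using contra_functorD(4)[OF F, of x y z "fst y #> g" "fst z #> h" m] sect_comp[OF assms(1-5,7)] assms
  by (simp add: sect_cat_sel(1,2)) (metis sect_cat_sel(4))

lemma Act_incl_comp:
  assumes "x \<in> sections G" "y \<in> sections G" "z \<in> sections G" "sect_le x y" "sect_le y z" "m \<in> carrier (At F z)"
  shows "Act F x y (fst y) (Act F y z (fst z) m) = Act F x z (fst z) m"
  using Act_comp[OF assms(1-3) one_closed one_closed _ _ assms(6)] assms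
  by (simp add: conj_sect_one coset_mult_one sections_fst_carrier)

lemma Defres_closed: "x \<in> sections G \<Longrightarrow> m \<in> carrier (At F (top_sect G)) \<Longrightarrow> Defres G F x m \<in> carrier (At F x)"
  unfolding Defres_def using contra_functor_closed[OF F, of x "top_sect G"] top_sect_sections top_hom by (simp add: sect_cat_sel(1))

lemma Act_Defres:
  assumes "x \<in> sections G" "y \<in> sections G" "f \<in> Hom (sect_cat G O') x y" "m \<in> carrier (At F (top_sect G))"
  shows "Act F x y f (Defres G F y m) = Defres G F x m"
proof -
  obtain g where g: "g \<in> carrier G" "f = fst y #> g" "sect_le (conj_sect G g x) y" using assms(3) by (auto simp: sect_cat_sel(4))
  have "sect_le y (top_sect G)" using assms(2) by (simp add: sect_le_def sections_one sections_fst_carrier sections_snd_fst)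
  then have "Act F x y f (Defres G F y m) = Act F x (top_sect G) (carrier G #> (\<one> \<otimes> g)) m"
    using Act_comp[OF assms(1,2) top_sect_sections g(1) one_closed g(3) _ assms(4)] assms(2)
    by (simp add: Defres_def g(2) conj_sect_one)
  also have "carrier G #> (\<one> \<otimes> g) = carrier G #> \<one>"
    using g(1) by (simp add: coset_join2 subgroup_self coset_mult_one)
  finally show ?thesis by (simp add: Defres_def)
qed

lemma to_lim_in_lim:
  assumes "O' \<subseteq> sections G" "m \<in> carrier (At F (top_sect G))"
  shows "to_lim G O' F m \<in> carrier (lim_mod (sect_cat G O') F)"
  unfolding to_lim_def
proof (rule lim_modI[of "sect_cat G O'" "\<lambda>s. Defres G F s m" F, unfolded sect_cat_sel(1)])
  show "Defres G F x m \<in> carrier (At F x)" if "x \<in> O'" for x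
    using Defres_closed assms that by blast
  show "Act F x y f (Defres G F y m) = Defres G F x m" if "x \<in> O'" "y \<in> O'" "f \<in> Hom (sect_cat G O') x y" for x y f
    using Act_Defres[OF subsetD[OF assms(1) that(1)] subsetD[OF assms(1) that(2)] that(3) assms(2)] .
qed

lemma to_lim_lin_map:
  assumes O': "O' \<subseteq> sections G"
  shows "lin_map R (At F (top_sect G)) (lim_mod (sect_cat G O') F) (to_lim G O' F)"
proof (rule lin_mapI[OF to_lim_in_lim[OF O']])
  have lin: "lin_map R (At F (top_sect G)) (At F x) (Defres G F x)" if "x \<in> O'" for x
    unfolding Defres_def[abs_def]
    by (rule contra_functorD(2)[OF F, of x "top_sect G", unfolded sect_cat_sel(1)])
       (use that O' top_hom top_sect_sections in blast)+
  show "to_lim G O' F (x \<oplus>\<^bsub>At F (top_sect G)\<^esub> y) = to_lim G O' F x \<oplus>\<^bsub>lim_mod (sect_cat G O') F\<^esub> to_lim G O' F y"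
    if "x \<in> carrier (At F (top_sect G))" "y \<in> carrier (At F (top_sect G))" for x y
    using lin_mapD(2)[OF lin that] by (auto simp: to_lim_def lim_mod_sel(3) sect_cat_sel(1) fun_eq_iff)
  show "to_lim G O' F (r \<odot>\<^bsub>At F (top_sect G)\<^esub> x) = r \<odot>\<^bsub>lim_mod (sect_cat G O') F\<^esub> to_lim G O' F x"
    if "r \<in> carrier R" "x \<in> carrier (At F (top_sect G))" for r x
    using lin_mapD(3)[OF lin that] by (auto simp: to_lim_def lim_mod_sel(4) sect_cat_sel(1) fun_eq_iff)
qed

lemma above_exists: "x \<in> C \<Longrightarrow> \<exists>w\<in>C'. sect_le x w"
proof (rule ccontr)
  assume x: "x \<in> C" and "\<not> (\<exists>w\<in>C'. sect_le x w)"
  then have e: "{w \<in> C'. sect_le x w} = {}" by blast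
  have "topspace (realization {w \<in> C'. sect_le x w} sect_le) = {}"
    unfolding topspace_realization e by simp
  then show False using contr[OF x] unfolding contractible_realization_def by blast
qed

text \<open>A compatible family on \<open>C'\<close> gives a function on \<open>{w \<in> C'. x \<preceq> w}\<close> with values in \<open>F x\<close> that is constant
along comparabilities, hence constant because the poset is connected.\<close>

lemma lim_value_unique:
  assumes s: "s \<in> carrier (lim_mod (sect_cat G C') F)" and x: "x \<in> C"
    and w: "w \<in> C'" "sect_le x w" "w' \<in> C'" "sect_le x w'"
  shows "Act F x w (fst w) (s w) = Act F x w' (fst w') (s w')"
proof -
  let ?X = "{w \<in> C'. sect_le x w}"
  have xs: "x \<in> sections G" using x C_sections by auto
  have ws: "w \<in> sections G" if "w \<in> C'" for w using that C'_sections by auto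
  have "?X \<subseteq> Pow (carrier G) \<times> Pow (carrier G)"
    using ws sections_fst_carrier sections_snd_carrier by (auto simp: subset_iff) (metis fst_conv, metis snd_conv)
  then have "finite ?X" using fin finite_subset by blast
  then have ac: "acyclic_lists (comparable_lists ?X sect_le)" using contr[OF x] by (rule contractible_realization_acyclic)
  show ?thesis
  proof (rule acyclic_comparable_constant[where g = "\<lambda>w. Act F x w (fst w) (s w)", OF ac])
    fix a b assume ab: "a \<in> ?X" "b \<in> ?X" "sect_le a b"
    have "s a = Act F a b (fst b) (s b)"
      using lim_modD(2)[OF s, of a b "fst b"] sect_incl_hom[of a b C'] ab ws by (simp add: sect_cat_sel(1))
    then show "Act F x a (fst a) (s a) = Act F x b (fst b) (s b)"
      using Act_incl_comp[OF xs ws ws, of a b "s b"] ab lim_modD(1)[OF s] by (simp add: sect_cat_sel(1))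
  qed (use w ws sect_le_refl in auto)
qed

lemma lim_restrict:
  assumes "s \<in> carrier (lim_mod (sect_cat G C) F)"
  shows "restrict s C' \<in> carrier (lim_mod (sect_cat G C') F)"
proof -
  have H: "Hom (sect_cat G C') = Hom (sect_cat G C)" by (simp add: sect_cat_def)
  show ?thesis
  proof (rule lim_modI[of "sect_cat G C'" s F, unfolded sect_cat_sel(1)])
    show "s x \<in> carrier (At F x)" if "x \<in> C'" for x
      using lim_modD(1)[OF assms] subsetD[OF sub that] by (simp add: sect_cat_sel(1))
    show "Act F x y f (s y) = s x" if "x \<in> C'" "y \<in> C'" "f \<in> Hom (sect_cat G C') x y" for x y f
      using lim_modD(2)[OF assms] subsetD[OF sub that(1)] subsetD[OF sub that(2)] that(3) by (simp add: sect_cat_sel(1) H)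
  qed
qed

text \<open>The value of the extension at \<open>x\<close> is computed from any \<open>w \<in> C'\<close> above \<open>x\<close>. For compatibility with a morphism
\<open>Mg : x \<rightarrow> y\<close>, take some \<open>v\<close> above \<open>y\<close>; its conjugate \<open>u = g\<inverse>vg\<close> is above \<open>x\<close> and again in \<open>C'\<close>.\<close>

lemma lim_extend:
  assumes s: "s \<in> carrier (lim_mod (sect_cat G C') F)"
  shows "\<exists>t\<in>carrier (lim_mod (sect_cat G C) F). restrict t C' = s"
proof -
  have ws: "w \<in> sections G" if "w \<in> C'" for w using that C'_sections by auto
  have xs: "x \<in> sections G" if "x \<in> C" for x using that C_sections by auto
  obtain w where w: "\<And>x. x \<in> C \<Longrightarrow> w x \<in> C' \<and> sect_le x (w x)" using above_exists by metis
  define t where "t x = Act F x (w x) (fst (w x)) (s (w x))" for x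
  have t: "t x = Act F x v (fst v) (s v)" if "x \<in> C" "v \<in> C'" "sect_le x v" for x v
    unfolding t_def using w[OF that(1)] that by (intro lim_value_unique[OF s]) auto
  have sc: "s v \<in> carrier (At F v)" if "v \<in> C'" for v using lim_modD(1)[OF s] that by (simp add: sect_cat_sel(1))
  have "restrict t C \<in> carrier (lim_mod (sect_cat G C) F)"
  proof (rule lim_modI[of "sect_cat G C" t F, unfolded sect_cat_sel(1)])
    fix x assume x: "x \<in> C"
    show "t x \<in> carrier (At F x)"
      unfolding t_def using w[OF x] contra_functor_closed[OF F, of x "w x" "fst (w x)" "s (w x)"] x xs ws sc sect_incl_hom
      by (simp add: sect_cat_sel(1))
    fix y f assume y: "y \<in> C" and f: "f \<in> Hom (sect_cat G C) x y"
    obtain g where g: "g \<in> carrier G" "f = fst y #> g" "sect_le (conj_sect G g x) y" using f by (auto simp: sect_cat_sel(4))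
    let ?v = "w y" and ?u = "conj_sect G (inv g) (w y)"
    have v: "?v \<in> C'" "?v \<in> sections G" "sect_le y ?v" using w[OF y] ws by auto
    have u: "?u \<in> C'" "?u \<in> sections G" using v g(1) C' ws by (auto simp: collection_def)
    have cu: "conj_sect G g ?u = ?v" using v(2) g(1) by (simp add: conj_sect_mult[symmetric] conj_sect_one)
    have "sect_le (conj_sect G g x) ?v" using g(3) v(3) by (rule sect_le_trans)
    then have xu: "sect_le x ?u" using x xs v(2) g(1) by (simp add: sect_le_conj_left)
    have le: "sect_le (conj_sect G g ?u) ?v" unfolding cu by (rule sect_le_refl[OF v(2)])
    have "Act F x y f (t y) = Act F x ?v (fst ?v #> (\<one> \<otimes> g)) (s ?v)"
      unfolding t[OF y v(1,3)] g(2)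
      using Act_comp[OF xs[OF x] xs[OF y] v(2) g(1) one_closed g(3) _ sc[OF v(1)]] v(3) xs[OF y]
      by (simp add: conj_sect_one coset_mult_one sections_fst_carrier v(2))
    also have "\<dots> = Act F x ?u (fst ?u) (Act F ?u ?v (fst ?v #> g) (s ?v))"
      using Act_comp[OF xs[OF x] u(2) v(2) one_closed g(1) _ le sc[OF v(1)]] xu xs[OF x] g(1)
      by (simp add: conj_sect_one coset_mult_one sections_fst_carrier u(2))
    also have "Act F ?u ?v (fst ?v #> g) (s ?v) = s ?u"
      using lim_modD(2)[OF s, of ?u ?v "fst ?v #> g"] u(1) v(1) g(1) le by (auto simp: sect_cat_sel)
    also have "Act F x ?u (fst ?u) (s ?u) = t x" using t[OF x u(1) xu] by simp
    finally show "Act F x y f (t y) = t x" .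
  qed
  moreover have "restrict (restrict t C) C' = s"
  proof (rule extensionalityI[of _ C'])
    show "s \<in> extensional C'" using lim_modD(3)[OF s] by (simp add: sect_cat_sel(1))
    show "restrict (restrict t C) C' \<in> extensional C'" by (rule restrict_extensional)
    fix v assume v: "v \<in> C'"
    have "t v = Act F v v (fst v) (s v)" using t[of v v] v sub sect_le_refl[OF ws[OF v]] by auto
    also have "\<dots> = s v" using contra_functorD(3)[OF F, of v "s v"] ws[OF v] sc[OF v] by (simp add: sect_cat_sel(1,3))
    finally show "restrict (restrict t C) C' v = s v" using v sub by auto
  qed
  ultimately show ?thesis by blast
qed

lemma lim_determined:
  assumes "s \<in> carrier (lim_mod (sect_cat G C) F)" "t \<in> carrier (lim_mod (sect_cat G C) F)" "restrict s C' = restrict t C'"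
  shows "s = t"
proof (rule extensionalityI[of _ C])
  show "s \<in> extensional C" "t \<in> extensional C" using lim_modD(3)[OF assms(1)] lim_modD(3)[OF assms(2)] by (auto simp: sect_cat_sel(1))
  fix x assume x: "x \<in> C"
  obtain w where w: "w \<in> C'" "sect_le x w" using above_exists[OF x] by blast
  have "w \<in> C" "x \<in> sections G" "w \<in> sections G" using w(1) x sub C_sections by auto
  then have "Act F x w (fst w) (s w) = s x" "Act F x w (fst w) (t w) = t x"
    using lim_modD(2)[OF assms(1), of x w "fst w"] lim_modD(2)[OF assms(2), of x w "fst w"] x w(2) sect_incl_hom
    by (simp_all add: sect_cat_sel(1))
  moreover have "s w = t w" using fun_cong[OF assms(3), of w] w(1) by simp
  ultimately show "s x = t x" by simp
qed

lemma restrict_to_lim: "restrict (to_lim G C F m) C' = to_lim G C' F m"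
  using sub by (auto simp: to_lim_def fun_eq_iff restrict_def)

text \<open>Restriction identifies the limits over \<open>C\<close> and \<open>C'\<close>, and it commutes with the maps from \<open>F(G)\<close>.\<close>

theorem Obs_isomorphic: "mod_isomorphic R (Obs G C F) (Obs G C' F)"
  unfolding Obs_def
proof (rule quot_mod_isomorphic[where h = "\<lambda>s. restrict s C'"])
  let ?L = "lim_mod (sect_cat G C) F" and ?L' = "lim_mod (sect_cat G C') F"
  show L: "Module.module R ?L" and L': "Module.module R ?L'"
    by (rule R.lim_mod_module[OF F_sub[OF C_sections]], rule R.lim_mod_module[OF F_sub[OF C'_sections]])
  have top: "Module.module R (At F (top_sect G))"
    using contra_functorD(1)[OF F, of "top_sect G"] top_sect_sections by (simp add: sect_cat_sel(1))
  show "submodule (to_lim G C F ` carrier (At F (top_sect G))) R ?L"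
    by (rule R.lin_map_image_submodule[OF top L to_lim_lin_map[OF C_sections]])
  show B': "submodule (to_lim G C' F ` carrier (At F (top_sect G))) R ?L'"
    by (rule R.lin_map_image_submodule[OF top L' to_lim_lin_map[OF C'_sections]])
  show "lin_map R ?L ?L' (\<lambda>s. restrict s C')"
    by (rule lin_mapI[OF lim_restrict]) (use sub in \<open>auto simp: lim_mod_sel(3,4) sect_cat_sel(1) fun_eq_iff restrict_def\<close>)
  show "restrict s C' \<in> to_lim G C' F ` carrier (At F (top_sect G)) \<longleftrightarrow> s \<in> to_lim G C F ` carrier (At F (top_sect G))"
    if s: "s \<in> carrier ?L" for s
  proof
    assume "restrict s C' \<in> to_lim G C' F ` carrier (At F (top_sect G))"
    then obtain m where m: "m \<in> carrier (At F (top_sect G))" "restrict s C' = to_lim G C' F m" by blast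
    have "s = to_lim G C F m"
      by (rule lim_determined[OF s to_lim_in_lim[OF C_sections m(1)]]) (simp add: m(2) restrict_to_lim)
    then show "s \<in> to_lim G C F ` carrier (At F (top_sect G))" using m(1) by blast
  qed (use restrict_to_lim in auto)
  show "\<exists>t\<in>carrier ?L. s \<ominus>\<^bsub>?L'\<^esub> restrict t C' \<in> to_lim G C' F ` carrier (At F (top_sect G))" if s: "s \<in> carrier ?L'" for s
  proof -
    obtain t where t: "t \<in> carrier ?L" "restrict t C' = s" using lim_extend[OF s] by blast
    have "s \<ominus>\<^bsub>?L'\<^esub> s = \<zero>\<^bsub>?L'\<^esub>"
      using abelian_group.r_neg[OF Module.module.axioms(2)[OF L'] s] by (simp add: a_minus_def)
    then show ?thesis using t submodule_zero[OF L' B'] by (intro bexI[of _ t]) simp_all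
  qed
qed

text \<open>Since restriction of limits is injective, the two maps from \<open>F(G)\<close> even have the same kernel.\<close>

theorem red_cohom_neg1_isomorphic: "mod_isomorphic R (red_cohom_neg1 G C F) (red_cohom_neg1 G C' F)"
proof -
  have L: "Module.module R (lim_mod (sect_cat G C) F)" by (rule R.lim_mod_module[OF F_sub[OF C_sections]])
  have zero: "restrict \<zero>\<^bsub>lim_mod (sect_cat G C) F\<^esub> C' = \<zero>\<^bsub>lim_mod (sect_cat G C') F\<^esub>"
    using sub by (auto simp: lim_mod_sel(2) sect_cat_sel(1) fun_eq_iff restrict_def)
  have zin: "\<zero>\<^bsub>lim_mod (sect_cat G C) F\<^esub> \<in> carrier (lim_mod (sect_cat G C) F)"
    using Module.module.axioms(2)[OF L] by (simp add: abelian_group_def abelian_monoid.zero_closed)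
  have "to_lim G C F m = \<zero>\<^bsub>lim_mod (sect_cat G C) F\<^esub> \<longleftrightarrow> to_lim G C' F m = \<zero>\<^bsub>lim_mod (sect_cat G C') F\<^esub>"
    if m: "m \<in> carrier (At F (top_sect G))" for m
  proof
    assume "to_lim G C F m = \<zero>\<^bsub>lim_mod (sect_cat G C) F\<^esub>"
    then show "to_lim G C' F m = \<zero>\<^bsub>lim_mod (sect_cat G C') F\<^esub>" using restrict_to_lim[of m] zero by simp
  next
    assume "to_lim G C' F m = \<zero>\<^bsub>lim_mod (sect_cat G C') F\<^esub>"
    then show "to_lim G C F m = \<zero>\<^bsub>lim_mod (sect_cat G C) F\<^esub>"
      by (intro lim_determined[OF to_lim_in_lim[OF C_sections m] zin]) (simp add: restrict_to_lim zero)
  qed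
  then have "red_cohom_neg1 G C F = red_cohom_neg1 G C' F"
    unfolding red_cohom_neg1_def by (simp cong: conj_cong)
  moreover have "mod_isomorphic R M M" for M :: "('r, 'm) module"
    unfolding mod_isomorphic_def by (intro exI[of _ "\<lambda>x. x"]) (auto simp: lin_map_def bij_betw_def)
  ultimately show ?thesis by simp
qed

text \<open>\<open>Ext\<close> over \<open>C\<close>, then \<open>Q\<close> over \<open>C\<close>, then \<open>Q\<close> over \<open>C'\<close>, then \<open>Ext\<close> over \<open>C'\<close>.\<close>

theorem red_cohom_pos_isomorphic: "mod_isomorphic R (red_cohom_pos R G C (Suc k) F) (red_cohom_pos R G C' (Suc k) F)"
proof -
  interpret S: section_resolution G R C' C'
    by unfold_locales (use fin C' contr sub in auto)
  have "restrict (Qd n) C' = S.Qd n" for n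
    using sub by (auto simp: Qd_def S.Qd_def mk_nat_def sect_cat_sel(1) fun_eq_iff restrict_def)
  then have d: "(\<lambda>n. restrict (Qd n) C') = S.Qd" by auto
  show ?thesis
    using mod_isomorphic_trans[OF Ext_const(1)[OF F_sub[OF C_sections]]
        mod_isomorphic_trans[OF Q_restrict[OF F_sub[OF C_sections], unfolded d] S.Ext_const(2)[OF F_sub[OF C'_sections]]]] .
qed

end

end

section \<open>Bisets\<close>

lemma is_bisetD:
  assumes "is_biset K H X"
  shows "finite (pts X)"
    and "k \<in> carrier K \<Longrightarrow> x \<in> pts X \<Longrightarrow> lact X k x \<in> pts X"
    and "x \<in> pts X \<Longrightarrow> lact X \<one>\<^bsub>K\<^esub> x = x"
    and "k \<in> carrier K \<Longrightarrow> l \<in> carrier K \<Longrightarrow> x \<in> pts X \<Longrightarrow> lact X (k \<otimes>\<^bsub>K\<^esub> l) x = lact X k (lact X l x)"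
    and "h \<in> carrier H \<Longrightarrow> x \<in> pts X \<Longrightarrow> ract X x h \<in> pts X"
    and "x \<in> pts X \<Longrightarrow> ract X x \<one>\<^bsub>H\<^esub> = x"
    and "h \<in> carrier H \<Longrightarrow> h' \<in> carrier H \<Longrightarrow> x \<in> pts X \<Longrightarrow> ract X x (h \<otimes>\<^bsub>H\<^esub> h') = ract X (ract X x h) h'"
    and "k \<in> carrier K \<Longrightarrow> h \<in> carrier H \<Longrightarrow> x \<in> pts X \<Longrightarrow> ract X (lact X k x) h = lact X k (ract X x h)"
  using assms unfolding is_biset_def by blast+

lemma biset_isoI:
  assumes "bij_betw \<phi> (pts X) (pts Y)"
    "\<And>k x. k \<in> carrier K \<Longrightarrow> x \<in> pts X \<Longrightarrow> \<phi> (lact X k x) = lact Y k (\<phi> x)"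
    "\<And>h x. h \<in> carrier H \<Longrightarrow> x \<in> pts X \<Longrightarrow> \<phi> (ract X x h) = ract Y (\<phi> x) h"
  shows "biset_iso K H X Y"
  using assms unfolding biset_iso_def by blast

lemma biset_isoE:
  assumes "biset_iso K H X Y"
  obtains \<phi> where "bij_betw \<phi> (pts X) (pts Y)"
    "\<And>k x. k \<in> carrier K \<Longrightarrow> x \<in> pts X \<Longrightarrow> \<phi> (lact X k x) = lact Y k (\<phi> x)"
    "\<And>h x. h \<in> carrier H \<Longrightarrow> x \<in> pts X \<Longrightarrow> \<phi> (ract X x h) = ract Y (\<phi> x) h"
  using assms unfolding biset_iso_def by blast

lemma biset_iso_refl: "biset_iso K H X X"
  by (rule biset_isoI[of "\<lambda>x. x"]) (auto simp: bij_betw_def)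

lemma biset_iso_trans:
  assumes "biset_iso K H X Y" "biset_iso K H Y Z"
  shows "biset_iso K H X Z"
proof -
  obtain \<phi> where p: "bij_betw \<phi> (pts X) (pts Y)"
    "\<And>k x. k \<in> carrier K \<Longrightarrow> x \<in> pts X \<Longrightarrow> \<phi> (lact X k x) = lact Y k (\<phi> x)"
    "\<And>h x. h \<in> carrier H \<Longrightarrow> x \<in> pts X \<Longrightarrow> \<phi> (ract X x h) = ract Y (\<phi> x) h" using biset_isoE[OF assms(1)] by metis
  obtain \<psi> where q: "bij_betw \<psi> (pts Y) (pts Z)"
    "\<And>k x. k \<in> carrier K \<Longrightarrow> x \<in> pts Y \<Longrightarrow> \<psi> (lact Y k x) = lact Z k (\<psi> x)"
    "\<And>h x. h \<in> carrier H \<Longrightarrow> x \<in> pts Y \<Longrightarrow> \<psi> (ract Y x h) = ract Z (\<psi> x) h" using biset_isoE[OF assms(2)] by metis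
  show ?thesis
    by (rule biset_isoI[of "\<psi> \<circ> \<phi>"]) (use p q bij_betwE[OF p(1)] bij_betw_trans[OF p(1) q(1)] in auto)
qed

lemma biset_iso_sym:
  assumes X: "is_biset K H X" and "biset_iso K H X Y"
  shows "biset_iso K H Y X"
proof -
  obtain \<phi> where p: "bij_betw \<phi> (pts X) (pts Y)"
    "\<And>k x. k \<in> carrier K \<Longrightarrow> x \<in> pts X \<Longrightarrow> \<phi> (lact X k x) = lact Y k (\<phi> x)"
    "\<And>h x. h \<in> carrier H \<Longrightarrow> x \<in> pts X \<Longrightarrow> \<phi> (ract X x h) = ract Y (\<phi> x) h" using biset_isoE[OF assms(2)] by metis
  let ?\<psi> = "inv_into (pts X) \<phi>"
  have b: "bij_betw ?\<psi> (pts Y) (pts X)" by (rule bij_betw_inv_into[OF p(1)])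
  have r: "\<phi> (?\<psi> y) = y" "?\<psi> y \<in> pts X" if "y \<in> pts Y" for y
    using bij_betw_inv_into_right[OF p(1) that] bij_betwE[OF b] that by auto
  have l: "?\<psi> (\<phi> x) = x" if "x \<in> pts X" for x using bij_betw_inv_into_left[OF p(1) that] .
  show ?thesis
  proof (rule biset_isoI[OF b])
    show "?\<psi> (lact Y k y) = lact X k (?\<psi> y)" if "k \<in> carrier K" "y \<in> pts Y" for k y
      using l[OF is_bisetD(2)[OF X that(1) r(2)[OF that(2)]]] p(2)[OF that(1) r(2)[OF that(2)]] r(1)[OF that(2)] by simp
    show "?\<psi> (ract Y y h) = ract X (?\<psi> y) h" if "h \<in> carrier H" "y \<in> pts Y" for h y
      using l[OF is_bisetD(5)[OF X that(1) r(2)[OF that(2)]]] p(3)[OF that(1) r(2)[OF that(2)]] r(1)[OF that(2)] by simp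
  qed
qed

lemma nat_copy:
  assumes X: "is_biset K H X"
  shows "nat_copy K H X \<in> bisets K H" "biset_iso K H X (nat_copy K H X)"
proof -
  obtain f :: "'c \<Rightarrow> nat" and n where f: "bij_betw f (pts X) {..<n}"
    using finite_imp_inj_to_nat_seg[OF is_bisetD(1)[OF X]] by (auto simp: bij_betw_def lessThan_def)
  let ?g = "inv_into (pts X) f"
  let ?Y = "\<lparr>pts = {..<n}, lact = (\<lambda>k i. f (lact X k (?g i))), ract = (\<lambda>i h. f (ract X (?g i) h))\<rparr>"
  have g: "?g i \<in> pts X" "f (?g i) = i" if "i < n" for i
    using bij_betw_inv_into[OF f] bij_betw_inv_into_right[OF f] that by (auto dest: bij_betwE)
  have l: "?g (f x) = x" "f x < n" if "x \<in> pts X" for x using bij_betw_inv_into_left[OF f that] bij_betwE[OF f] that by auto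
  have "is_biset K H ?Y"
    unfolding is_biset_def using is_bisetD[OF X] by (auto simp: g l)
  moreover have "biset_iso K H X ?Y"
    by (rule biset_isoI[of f]) (use f l in auto)
  ultimately have "\<exists>Y. Y \<in> bisets K H \<and> biset_iso K H X Y" by (auto simp: bisets_def)
  then have "nat_copy K H X \<in> bisets K H \<and> biset_iso K H X (nat_copy K H X)"
    unfolding nat_copy_def by (rule someI_ex)
  then show "nat_copy K H X \<in> bisets K H" "biset_iso K H X (nat_copy K H X)" by auto
qed

lemma biset_sum_is_biset: "is_biset K H X \<Longrightarrow> is_biset K H Y \<Longrightarrow> is_biset K H (biset_sum X Y)"
  unfolding is_biset_def biset_sum_def by (auto simp: Plus_def)

lemma biset_sum_cong:
  assumes "biset_iso K H X X'" "biset_iso K H Y Y'"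
  shows "biset_iso K H (biset_sum X Y) (biset_sum X' Y')"
proof -
  obtain \<phi> where p: "bij_betw \<phi> (pts X) (pts X')"
    "\<And>k x. k \<in> carrier K \<Longrightarrow> x \<in> pts X \<Longrightarrow> \<phi> (lact X k x) = lact X' k (\<phi> x)"
    "\<And>h x. h \<in> carrier H \<Longrightarrow> x \<in> pts X \<Longrightarrow> \<phi> (ract X x h) = ract X' (\<phi> x) h" using biset_isoE[OF assms(1)] by metis
  obtain \<psi> where q: "bij_betw \<psi> (pts Y) (pts Y')"
    "\<And>k x. k \<in> carrier K \<Longrightarrow> x \<in> pts Y \<Longrightarrow> \<psi> (lact Y k x) = lact Y' k (\<psi> x)"
    "\<And>h x. h \<in> carrier H \<Longrightarrow> x \<in> pts Y \<Longrightarrow> \<psi> (ract Y x h) = ract Y' (\<psi> x) h" using biset_isoE[OF assms(2)] by metis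
  have "bij_betw (map_sum \<phi> \<psi>) (pts X <+> pts Y) (pts X' <+> pts Y')"
  proof (rule bij_betw_imageI)
    show "inj_on (map_sum \<phi> \<psi>) (pts X <+> pts Y)"
      using bij_betw_imp_inj_on[OF p(1)] bij_betw_imp_inj_on[OF q(1)]
      by (intro inj_onI) (auto elim!: PlusE dest: inj_onD)
    have "map_sum \<phi> \<psi> ` (pts X <+> pts Y) = \<phi> ` pts X <+> \<psi> ` pts Y"
      by (simp add: Plus_def image_Un image_image)
    then show "map_sum \<phi> \<psi> ` (pts X <+> pts Y) = pts X' <+> pts Y'"
      using bij_betw_imp_surj_on[OF p(1)] bij_betw_imp_surj_on[OF q(1)] by simp
  qed
  then show ?thesis
    by (intro biset_isoI[of "map_sum \<phi> \<psi>"]) (use p q in \<open>auto simp: biset_sum_def\<close>)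
qed

subsection \<open>Products\<close>

text \<open>The class of \<open>(x, y)\<close> in \<open>X \<times>\<^sub>H Y\<close>. The set that generates the relation in \<open>biset_prod\<close> is already an
equivalence relation because \<open>H\<close> is a group, so the class can be written down directly.\<close>

definition tensor :: "'h monoid \<Rightarrow> ('k, 'h, 'x) biset \<Rightarrow> ('h, 'l, 'y) biset \<Rightarrow> 'x \<Rightarrow> 'y \<Rightarrow> ('x \<times> 'y) set" where
  "tensor H X Y x y = {(x', y') \<in> pts X \<times> pts Y. \<exists>h\<in>carrier H. x = ract X x' h \<and> y' = lact Y h y}"

locale biset_pair = H: group H for K :: "'k monoid" and H :: "'h monoid" and L :: "'l monoid" +
  fixes X :: "('k, 'h, 'x) biset" and Y :: "('h, 'l, 'y) biset"
  assumes K: "group K" and L: "group L" and X: "is_biset K H X" and Y: "is_biset H L Y"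
begin

abbreviation "rel \<equiv> {((ract X x h, y), (x, lact Y h y)) | x y h. x \<in> pts X \<and> y \<in> pts Y \<and> h \<in> carrier H}"

lemma rel_iff:
  "((x, y), (x', y')) \<in> rel \<longleftrightarrow> x' \<in> pts X \<and> y \<in> pts Y \<and> (\<exists>h\<in>carrier H. x = ract X x' h \<and> y' = lact Y h y)"
  by blast

lemma H_cancel:
  assumes "h \<in> carrier H"
  shows "x \<in> pts X \<Longrightarrow> ract X (ract X x h) (inv\<^bsub>H\<^esub> h) = x" "x \<in> pts X \<Longrightarrow> ract X (ract X x (inv\<^bsub>H\<^esub> h)) h = x"
    "y \<in> pts Y \<Longrightarrow> lact Y h (lact Y (inv\<^bsub>H\<^esub> h) y) = y" "y \<in> pts Y \<Longrightarrow> lact Y (inv\<^bsub>H\<^esub> h) (lact Y h y) = y"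
  using assms is_bisetD(7)[OF X, symmetric] is_bisetD(4)[OF Y, symmetric] by (simp_all add: is_bisetD(6)[OF X] is_bisetD(3)[OF Y])

lemma rel_equiv: "equiv (pts X \<times> pts Y) rel"
proof (rule equivI)
  show "rel \<subseteq> (pts X \<times> pts Y) \<times> (pts X \<times> pts Y)" using is_bisetD(5)[OF X] is_bisetD(2)[OF Y] by blast
  show "refl_on (pts X \<times> pts Y) rel"
  proof (rule refl_onI)
    fix p assume p: "p \<in> pts X \<times> pts Y"
    then have "((fst p, snd p), (fst p, snd p)) \<in> rel"
      unfolding rel_iff by (intro conjI bexI[of _ "\<one>\<^bsub>H\<^esub>"]) (auto simp: is_bisetD(6)[OF X] is_bisetD(3)[OF Y])
    then show "(p, p) \<in> rel" by simp
  qed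
  show "sym rel"
  proof (rule symI)
    fix p q assume "(p, q) \<in> rel"
    then obtain x y h where *: "p = (ract X x h, y)" "q = (x, lact Y h y)" "x \<in> pts X" "y \<in> pts Y" "h \<in> carrier H" by blast
    show "(q, p) \<in> rel"
      unfolding *(1,2) rel_iff
      by (intro conjI bexI[of _ "inv\<^bsub>H\<^esub> h"]) (use * H_cancel is_bisetD(5)[OF X] is_bisetD(2)[OF Y] in auto)
  qed
  show "trans rel"
  proof (rule transI)
    fix p q r assume "(p, q) \<in> rel" "(q, r) \<in> rel"
    then obtain x y h x' h' where *: "p = (ract X x h, y)" "q = (x, lact Y h y)" "x \<in> pts X" "y \<in> pts Y" "h \<in> carrier H"
      "x = ract X x' h'" "r = (x', lact Y h' (lact Y h y))" "x' \<in> pts X" "h' \<in> carrier H" by blast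
    show "(p, r) \<in> rel"
      unfolding *(1,7) rel_iff
      by (intro conjI bexI[of _ "h' \<otimes>\<^bsub>H\<^esub> h"]) (use * is_bisetD(7)[OF X] is_bisetD(4)[OF Y] in auto)
  qed
qed

lemma tensor_class: "x \<in> pts X \<Longrightarrow> y \<in> pts Y \<Longrightarrow> tensor H X Y x y = rel `` {(x, y)}"
  by (auto simp: tensor_def is_bisetD(2)[OF Y])

lemma pts_prod: "pts (biset_prod H X Y) = {tensor H X Y x y | x y. x \<in> pts X \<and> y \<in> pts Y}"
proof -
  have "pts (biset_prod H X Y) = (\<Union>p\<in>pts X \<times> pts Y. {rel `` {p}})"
    by (simp only: biset_prod_def biset.simps quotient_def)
  also have "\<dots> = (\<Union>x\<in>pts X. \<Union>y\<in>pts Y. {tensor H X Y x y})"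
    using tensor_class by (fastforce simp del: mem_Collect_eq)
  finally show ?thesis by auto
qed

lemma tensor_eq_iff:
  assumes "x \<in> pts X" "y \<in> pts Y" "x' \<in> pts X" "y' \<in> pts Y"
  shows "tensor H X Y x y = tensor H X Y x' y' \<longleftrightarrow> (\<exists>h\<in>carrier H. x = ract X x' h \<and> y' = lact Y h y)"
  using eq_equiv_class_iff[OF rel_equiv, of "(x, y)" "(x', y')"] assms rel_iff[of x y x' y']
  by (simp only: tensor_class mem_Sigma_iff) simp

lemma tensor_self: "x \<in> pts X \<Longrightarrow> y \<in> pts Y \<Longrightarrow> (x, y) \<in> tensor H X Y x y"
  using equiv_class_self[OF rel_equiv] by (simp only: tensor_class mem_Sigma_iff)

lemma lact_tensor:
  assumes k: "k \<in> carrier K" and x: "x \<in> pts X" and y: "y \<in> pts Y"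
  shows "lact (biset_prod H X Y) k (tensor H X Y x y) = tensor H X Y (lact X k x) y"
proof -
  interpret K: group K by (rule K)
  have "(x', y') \<in> (\<lambda>(x, y). (lact X k x, y)) ` tensor H X Y x y" if t: "(x', y') \<in> tensor H X Y (lact X k x) y" for x' y'
  proof -
    obtain h where h: "x' \<in> pts X" "y' \<in> pts Y" "h \<in> carrier H" "lact X k x = ract X x' h" "y' = lact Y h y"
      using t by (auto simp: tensor_def)
    let ?x = "lact X (inv\<^bsub>K\<^esub> k) x'"
    have c1: "lact X k ?x = x'"
      using k h(1) is_bisetD(4)[OF X, of k "inv\<^bsub>K\<^esub> k" x'] by (simp add: is_bisetD(3)[OF X])
    have c2: "lact X (inv\<^bsub>K\<^esub> k) (lact X k x) = x"
      using k x is_bisetD(4)[OF X, of "inv\<^bsub>K\<^esub> k" k x] by (simp add: is_bisetD(3)[OF X])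
    note c = c1 c2
    have "x = ract X ?x h" using c(2) h k is_bisetD(8)[OF X, of "inv\<^bsub>K\<^esub> k" h x'] by simp
    then have "(?x, y') \<in> tensor H X Y x y" using h k is_bisetD(2)[OF X] by (auto simp: tensor_def)
    then show ?thesis using c(1) by force
  qed
  moreover have "(\<lambda>(x, y). (lact X k x, y)) ` tensor H X Y x y \<subseteq> tensor H X Y (lact X k x) y"
    using k is_bisetD(2,8)[OF X] by (auto simp: tensor_def)
  ultimately show ?thesis unfolding biset_prod_def biset.simps by auto
qed

lemma ract_tensor:
  assumes l: "l \<in> carrier L" and x: "x \<in> pts X" and y: "y \<in> pts Y"
  shows "ract (biset_prod H X Y) (tensor H X Y x y) l = tensor H X Y x (ract Y y l)"
proof -
  interpret L: group L by (rule L)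
  have "(x', y') \<in> (\<lambda>(x, y). (x, ract Y y l)) ` tensor H X Y x y" if t: "(x', y') \<in> tensor H X Y x (ract Y y l)" for x' y'
  proof -
    obtain h where h: "x' \<in> pts X" "y' \<in> pts Y" "h \<in> carrier H" "x = ract X x' h" "y' = lact Y h (ract Y y l)"
      using t by (auto simp: tensor_def)
    have "(x', lact Y h y) \<in> tensor H X Y x y" using h y is_bisetD(2)[OF Y] by (auto simp: tensor_def)
    moreover have "y' = ract Y (lact Y h y) l" using h y l is_bisetD(8)[OF Y] by simp
    ultimately show ?thesis by force
  qed
  moreover have "(\<lambda>(x, y). (x, ract Y y l)) ` tensor H X Y x y \<subseteq> tensor H X Y x (ract Y y l)"
    using l y is_bisetD(5,8)[OF Y] by (auto simp: tensor_def)
  ultimately show ?thesis unfolding biset_prod_def biset.simps by auto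
qed

lemma tensorE:
  assumes "c \<in> pts (biset_prod H X Y)"
  obtains x y where "x \<in> pts X" "y \<in> pts Y" "c = tensor H X Y x y"
  using assms unfolding pts_prod by blast

lemma tensor_in_prod: "x \<in> pts X \<Longrightarrow> y \<in> pts Y \<Longrightarrow> tensor H X Y x y \<in> pts (biset_prod H X Y)"
  unfolding pts_prod by blast

lemma prod_is_biset: "is_biset K L (biset_prod H X Y)"
proof -
  interpret K: group K by (rule K)
  interpret L: group L by (rule L)
  have "pts (biset_prod H X Y) = (\<lambda>(x, y). tensor H X Y x y) ` (pts X \<times> pts Y)" unfolding pts_prod by auto
  then have "finite (pts (biset_prod H X Y))" using is_bisetD(1)[OF X] is_bisetD(1)[OF Y] by simp
  then show ?thesis
    unfolding is_biset_def
    by (auto elim!: tensorE simp: lact_tensor ract_tensor is_bisetD[OF X] is_bisetD[OF Y] intro!: tensor_in_prod)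
qed

text \<open>A balanced map on \<open>X \<times> Y\<close> that is surjective, injective up to the action of \<open>H\<close>, and equivariant on both
sides induces an isomorphism from \<open>X \<times>\<^sub>H Y\<close>.\<close>

lemma prod_isoI:
  fixes W :: "('k, 'l, 'w) biset"
  assumes f: "\<And>x y. x \<in> pts X \<Longrightarrow> y \<in> pts Y \<Longrightarrow> f x y \<in> pts W"
    and surj: "\<And>w. w \<in> pts W \<Longrightarrow> \<exists>x\<in>pts X. \<exists>y\<in>pts Y. w = f x y"
    and bal: "\<And>x y h. x \<in> pts X \<Longrightarrow> y \<in> pts Y \<Longrightarrow> h \<in> carrier H \<Longrightarrow> f (ract X x h) y = f x (lact Y h y)"
    and inj: "\<And>x y x' y'. x \<in> pts X \<Longrightarrow> y \<in> pts Y \<Longrightarrow> x' \<in> pts X \<Longrightarrow> y' \<in> pts Y \<Longrightarrow> f x y = f x' y' \<Longrightarrow>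
        \<exists>h\<in>carrier H. x = ract X x' h \<and> y' = lact Y h y"
    and left: "\<And>k x y. k \<in> carrier K \<Longrightarrow> x \<in> pts X \<Longrightarrow> y \<in> pts Y \<Longrightarrow> f (lact X k x) y = lact W k (f x y)"
    and right: "\<And>l x y. l \<in> carrier L \<Longrightarrow> x \<in> pts X \<Longrightarrow> y \<in> pts Y \<Longrightarrow> f x (ract Y y l) = ract W (f x y) l"
  shows "biset_iso K L (biset_prod H X Y) W"
proof -
  define \<phi> where "\<phi> c = (case SOME p. p \<in> c of (x, y) \<Rightarrow> f x y)" for c
  have \<phi>: "\<phi> (tensor H X Y x y) = f x y" if xy: "x \<in> pts X" "y \<in> pts Y" for x y
  proof -
    have "(SOME p. p \<in> tensor H X Y x y) \<in> tensor H X Y x y" using tensor_self[OF xy] by (rule someI)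
    then obtain x' y' h where "(SOME p. p \<in> tensor H X Y x y) = (x', y')" "x' \<in> pts X" "h \<in> carrier H" "x = ract X x' h" "y' = lact Y h y"
      by (auto simp: tensor_def)
    then show ?thesis using bal[of x' y h] xy by (simp add: \<phi>_def)
  qed
  show ?thesis
  proof (rule biset_isoI[of \<phi>])
    show "bij_betw \<phi> (pts (biset_prod H X Y)) (pts W)"
    proof (rule bij_betw_imageI)
      show "inj_on \<phi> (pts (biset_prod H X Y))"
      proof (rule inj_onI)
        fix c c' assume "c \<in> pts (biset_prod H X Y)" "c' \<in> pts (biset_prod H X Y)" and eq: "\<phi> c = \<phi> c'"
        then obtain x y x' y' where c: "x \<in> pts X" "y \<in> pts Y" "c = tensor H X Y x y"
          "x' \<in> pts X" "y' \<in> pts Y" "c' = tensor H X Y x' y'" by (elim tensorE)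
        have "f x y = f x' y'" using eq \<phi> c by simp
        then show "c = c'" unfolding c(3,6) tensor_eq_iff[OF c(1,2,4,5)] by (rule inj[OF c(1,2,4,5)])
      qed
      show "\<phi> ` pts (biset_prod H X Y) = pts W"
      proof
        show "\<phi> ` pts (biset_prod H X Y) \<subseteq> pts W" by (auto elim!: tensorE simp: \<phi> f)
        show "pts W \<subseteq> \<phi> ` pts (biset_prod H X Y)"
        proof
          fix w assume "w \<in> pts W"
          then obtain x y where "x \<in> pts X" "y \<in> pts Y" "w = f x y" using surj by blast
          then show "w \<in> \<phi> ` pts (biset_prod H X Y)" using \<phi> tensor_in_prod by (metis imageI)
        qed
      qed
    qed
  qed (auto elim!: tensorE simp: lact_tensor ract_tensor \<phi> left right is_bisetD(2)[OF X] is_bisetD(5)[OF Y])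
qed

end

lemma biset_pairI: "group K \<Longrightarrow> group H \<Longrightarrow> group L \<Longrightarrow> is_biset K H X \<Longrightarrow> is_biset H L Y \<Longrightarrow> biset_pair K H L X Y"
  by (intro biset_pair.intro biset_pair_axioms.intro)

lemma biset_prod_cong:
  assumes "group K" "group H" "group L" and X: "is_biset K H X" and Y: "is_biset H L Y"
    and X': "is_biset K H X'" and Y': "is_biset H L Y'" and iso: "biset_iso K H X X'" "biset_iso H L Y Y'"
  shows "biset_iso K L (biset_prod H X Y) (biset_prod H X' Y')"
proof -
  interpret P: biset_pair K H L X Y by (intro biset_pairI assms)
  interpret P': biset_pair K H L X' Y' by (intro biset_pairI assms)
  obtain \<phi> where p: "bij_betw \<phi> (pts X) (pts X')"
    "\<And>k x. k \<in> carrier K \<Longrightarrow> x \<in> pts X \<Longrightarrow> \<phi> (lact X k x) = lact X' k (\<phi> x)"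
    "\<And>h x. h \<in> carrier H \<Longrightarrow> x \<in> pts X \<Longrightarrow> \<phi> (ract X x h) = ract X' (\<phi> x) h" using biset_isoE[OF iso(1)] by metis
  obtain \<psi> where q: "bij_betw \<psi> (pts Y) (pts Y')"
    "\<And>k x. k \<in> carrier H \<Longrightarrow> x \<in> pts Y \<Longrightarrow> \<psi> (lact Y k x) = lact Y' k (\<psi> x)"
    "\<And>h x. h \<in> carrier L \<Longrightarrow> x \<in> pts Y \<Longrightarrow> \<psi> (ract Y x h) = ract Y' (\<psi> x) h" using biset_isoE[OF iso(2)] by metis
  have pc: "\<phi> x \<in> pts X'" if "x \<in> pts X" for x using bij_betwE[OF p(1)] that by auto
  have qc: "\<psi> y \<in> pts Y'" if "y \<in> pts Y" for y using bij_betwE[OF q(1)] that by auto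
  show ?thesis
  proof (rule P.prod_isoI[of "\<lambda>x y. tensor H X' Y' (\<phi> x) (\<psi> y)"])
    fix w assume "w \<in> pts (biset_prod H X' Y')"
    then obtain x' y' where "x' \<in> pts X'" "y' \<in> pts Y'" "w = tensor H X' Y' x' y'" by (rule P'.tensorE)
    moreover obtain x y where "x \<in> pts X" "y \<in> pts Y" "x' = \<phi> x" "y' = \<psi> y"
      using \<open>x' \<in> pts X'\<close> \<open>y' \<in> pts Y'\<close> bij_betw_imp_surj_on[OF p(1)] bij_betw_imp_surj_on[OF q(1)] by blast
    ultimately show "\<exists>x\<in>pts X. \<exists>y\<in>pts Y. w = tensor H X' Y' (\<phi> x) (\<psi> y)" by blast
  next
    fix x y h assume "x \<in> pts X" "y \<in> pts Y" "h \<in> carrier H"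
    then show "tensor H X' Y' (\<phi> (ract X x h)) (\<psi> y) = tensor H X' Y' (\<phi> x) (\<psi> (lact Y h y))"
      using is_bisetD(5)[OF X'] is_bisetD(2)[OF Y'] by (subst P'.tensor_eq_iff) (auto simp: p(3) q(2) pc qc)
  next
    fix x y x' y' assume *: "x \<in> pts X" "y \<in> pts Y" "x' \<in> pts X" "y' \<in> pts Y"
      "tensor H X' Y' (\<phi> x) (\<psi> y) = tensor H X' Y' (\<phi> x') (\<psi> y')"
    then obtain h where h: "h \<in> carrier H" "\<phi> x = ract X' (\<phi> x') h" "\<psi> y' = lact Y' h (\<psi> y)"
      using P'.tensor_eq_iff[OF pc[OF *(1)] qc[OF *(2)] pc[OF *(3)] qc[OF *(4)]] by blast
    have "\<phi> x = \<phi> (ract X x' h)" "\<psi> y' = \<psi> (lact Y h y)" using h * by (simp_all add: p(3) q(2))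
    then have "x = ract X x' h" "y' = lact Y h y"
      using inj_onD[OF bij_betw_imp_inj_on[OF p(1)] _ *(1) is_bisetD(5)[OF X h(1) *(3)]]
        inj_onD[OF bij_betw_imp_inj_on[OF q(1)] _ *(4) is_bisetD(2)[OF Y h(1) *(2)]] by auto
    then show "\<exists>h\<in>carrier H. x = ract X x' h \<and> y' = lact Y h y" using h(1) by blast
  qed (auto simp: pc qc p q P'.tensor_in_prod P'.lact_tensor P'.ract_tensor)
qed

lemma biset_prod_sum_left:
  assumes "group K" "group H" "group L" and X: "is_biset K H X" and X': "is_biset K H X'" and Y: "is_biset H L Y"
  shows "biset_iso K L (biset_prod H (biset_sum X X') Y) (biset_sum (biset_prod H X Y) (biset_prod H X' Y))"
proof -
  interpret P: biset_pair K H L X Y by (intro biset_pairI assms)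
  interpret P': biset_pair K H L X' Y by (intro biset_pairI assms)
  interpret S: biset_pair K H L "biset_sum X X'" Y
    by (intro biset_pairI biset_sum_is_biset assms)
  let ?f = "\<lambda>s y. case s of Inl x \<Rightarrow> Inl (tensor H X Y x y) | Inr x \<Rightarrow> Inr (tensor H X' Y x y)"
  have sel: "pts (biset_sum A B) = pts A <+> pts B" "lact (biset_sum A B) k = map_sum (lact A k) (lact B k)"
    "ract (biset_sum A B) p h = map_sum (\<lambda>x. ract A x h) (\<lambda>y. ract B y h) p"
    for A :: "('u, 'v, 'aa) biset" and B :: "('u, 'v, 'bb) biset" and k p h by (simp_all add: biset_sum_def)
  show ?thesis
  proof (rule S.prod_isoI[of ?f])
    fix s y s' y' assume *: "s \<in> pts (biset_sum X X')" "y \<in> pts Y" "s' \<in> pts (biset_sum X X')" "y' \<in> pts Y" "?f s y = ?f s' y'"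
    then show "\<exists>h\<in>carrier H. s = ract (biset_sum X X') s' h \<and> y' = lact Y h y"
      by (auto simp: sel Plus_def P.tensor_eq_iff P'.tensor_eq_iff split: sum.splits)
  next
    fix w assume "w \<in> pts (biset_sum (biset_prod H X Y) (biset_prod H X' Y))"
    then show "\<exists>s\<in>pts (biset_sum X X'). \<exists>y\<in>pts Y. w = ?f s y"
      unfolding sel
    proof (elim PlusE)
      fix c assume 1: "c \<in> pts (biset_prod H X Y)" "w = Inl c"
      then obtain x y where "x \<in> pts X" "y \<in> pts Y" "c = tensor H X Y x y" by (elim P.tensorE)
      then show "\<exists>s\<in>pts X <+> pts X'. \<exists>y\<in>pts Y. w = ?f s y" using 1 by (intro bexI[of _ "Inl x"] bexI[of _ y]) auto
    next
      fix c assume 2: "c \<in> pts (biset_prod H X' Y)" "w = Inr c"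
      then obtain x y where "x \<in> pts X'" "y \<in> pts Y" "c = tensor H X' Y x y" by (elim P'.tensorE)
      then show "\<exists>s\<in>pts X <+> pts X'. \<exists>y\<in>pts Y. w = ?f s y" using 2 by (intro bexI[of _ "Inr x"] bexI[of _ y]) auto
    qed
  next
    fix s y h assume "s \<in> pts (biset_sum X X')" "y \<in> pts Y" "h \<in> carrier H"
    then show "?f (ract (biset_sum X X') s h) y = ?f s (lact Y h y)"
      by (auto simp: sel Plus_def P.tensor_eq_iff P'.tensor_eq_iff is_bisetD[OF X] is_bisetD[OF X'] is_bisetD[OF Y])
  qed (auto simp: sel Plus_def P.tensor_in_prod P'.tensor_in_prod P.lact_tensor P.ract_tensor P'.lact_tensor P'.ract_tensor)
qed

lemma biset_prod_sum_right:
  assumes "group K" "group H" "group L" and X: "is_biset K H X" and Y: "is_biset H L Y" and Y': "is_biset H L Y'"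
  shows "biset_iso K L (biset_prod H X (biset_sum Y Y')) (biset_sum (biset_prod H X Y) (biset_prod H X Y'))"
proof -
  interpret P: biset_pair K H L X Y by (intro biset_pairI assms)
  interpret P': biset_pair K H L X Y' by (intro biset_pairI assms)
  interpret S: biset_pair K H L X "biset_sum Y Y'"
    by (intro biset_pairI biset_sum_is_biset assms)
  let ?f = "\<lambda>x s. case s of Inl y \<Rightarrow> Inl (tensor H X Y x y) | Inr y \<Rightarrow> Inr (tensor H X Y' x y)"
  have sel: "pts (biset_sum A B) = pts A <+> pts B" "lact (biset_sum A B) k = map_sum (lact A k) (lact B k)"
    "ract (biset_sum A B) p h = map_sum (\<lambda>x. ract A x h) (\<lambda>y. ract B y h) p"
    for A :: "('u, 'v, 'aa) biset" and B :: "('u, 'v, 'bb) biset" and k p h by (simp_all add: biset_sum_def)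
  show ?thesis
  proof (rule S.prod_isoI[of ?f])
    fix x s x' s' assume *: "x \<in> pts X" "s \<in> pts (biset_sum Y Y')" "x' \<in> pts X" "s' \<in> pts (biset_sum Y Y')" "?f x s = ?f x' s'"
    then show "\<exists>h\<in>carrier H. x = ract X x' h \<and> s' = lact (biset_sum Y Y') h s"
      by (auto simp: sel Plus_def P.tensor_eq_iff P'.tensor_eq_iff split: sum.splits)
  next
    fix w assume "w \<in> pts (biset_sum (biset_prod H X Y) (biset_prod H X Y'))"
    then show "\<exists>x\<in>pts X. \<exists>s\<in>pts (biset_sum Y Y'). w = ?f x s"
      unfolding sel
    proof (elim PlusE)
      fix c assume 1: "c \<in> pts (biset_prod H X Y)" "w = Inl c"
      then obtain x y where "x \<in> pts X" "y \<in> pts Y" "c = tensor H X Y x y" by (elim P.tensorE)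
      then show "\<exists>x\<in>pts X. \<exists>s\<in>pts Y <+> pts Y'. w = ?f x s" using 1 by (intro bexI[of _ x] bexI[of _ "Inl y"]) auto
    next
      fix c assume 2: "c \<in> pts (biset_prod H X Y')" "w = Inr c"
      then obtain x y where "x \<in> pts X" "y \<in> pts Y'" "c = tensor H X Y' x y" by (elim P'.tensorE)
      then show "\<exists>x\<in>pts X. \<exists>s\<in>pts Y <+> pts Y'. w = ?f x s" using 2 by (intro bexI[of _ x] bexI[of _ "Inr y"]) auto
    qed
  next
    fix x s h assume "x \<in> pts X" "s \<in> pts (biset_sum Y Y')" "h \<in> carrier H"
    then show "?f (ract X x h) s = ?f x (lact (biset_sum Y Y') h s)"
      by (auto simp: sel Plus_def P.tensor_eq_iff P'.tensor_eq_iff is_bisetD[OF X] is_bisetD[OF Y] is_bisetD[OF Y'])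
  qed (auto simp: sel Plus_def P.tensor_in_prod P'.tensor_in_prod P.lact_tensor P.ract_tensor P'.lact_tensor P'.ract_tensor)
qed

section \<open>Composition in the biset category\<close>

lemma gen_submod_submodule:
  assumes M: "Module.module R M" and A: "A \<subseteq> carrier M"
  shows "submodule (gen_submod R M A) R M"
proof -
  interpret M: Module.module R M by fact
  have ex: "submodule (carrier M) R M \<and> A \<subseteq> carrier M" using A M.carrier_is_submodule by blast
  show ?thesis
    by (rule cring.submoduleI_smult[OF M.R.is_cring M])
       (use ex in \<open>auto simp: gen_submod_def submodule_zero[OF M] submodule_add[OF M] submodule_smult[OF M]\<close>)
qed

lemma gen_submod_least: "submodule N R M \<Longrightarrow> A \<subseteq> N \<Longrightarrow> gen_submod R M A \<subseteq> N"
  unfolding gen_submod_def by blast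

lemma gen_submod_incl: "a \<in> A \<Longrightarrow> a \<in> gen_submod R M A"
  unfolding gen_submod_def by blast

lemma (in cring) preimage_submodule:
  assumes M: "Module.module R M" and N: "Module.module R N" and f: "lin_map R M N f" and K: "submodule K R N"
  shows "submodule {x \<in> carrier M. f x \<in> K} R M"
proof -
  interpret M: Module.module R M by fact
  show ?thesis
    by (rule submoduleI_smult[OF M])
       (auto simp: lin_map_zero[OF M N f] lin_mapD[OF f] submodule_zero[OF N K] submodule_add[OF N K] submodule_smult[OF N K])
qed

context cring
begin

text \<open>The coefficients of \<open>a \<otimes> b\<close> in \<open>R[S] \<otimes> R[T] = R[S \<times> T]\<close>. The bilinear composition thus becomes the linear
extension of a map on pairs of bisets.\<close>

definition tensor_coeff :: "('s \<Rightarrow> 'a) \<Rightarrow> ('t \<Rightarrow> 'a) \<Rightarrow> 's \<times> 't \<Rightarrow> 'a" where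
  "tensor_coeff a b p = a (fst p) \<otimes> b (snd p)"

lemma tensor_coeff_closed:
  assumes a: "a \<in> carrier (free_mod R S)" and b: "b \<in> carrier (free_mod R T)"
  shows "tensor_coeff a b \<in> carrier (free_mod R (S \<times> T))"
proof (rule free_mod_memI[where A = "{s. a s \<noteq> \<zero>} \<times> {t. b t \<noteq> \<zero>}"])
  show "finite ({s. a s \<noteq> \<zero>} \<times> {t. b t \<noteq> \<zero>})" using free_mod_supp(1)[OF a] free_mod_supp(1)[OF b] by simp
  show "{s. a s \<noteq> \<zero>} \<times> {t. b t \<noteq> \<zero>} \<subseteq> S \<times> T" using free_mod_supp(2)[OF a] free_mod_supp(2)[OF b] by auto
qed (use free_mod_coeff[OF a] free_mod_coeff[OF b] in \<open>auto simp: tensor_coeff_def\<close>)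

lemma tensor_coeff_lin_left:
  assumes b: "b \<in> carrier (free_mod R T)"
  shows "lin_map R (free_mod R S) (free_mod R (S \<times> T)) (\<lambda>a. tensor_coeff a b)"
  by (rule lin_mapI[OF tensor_coeff_closed[OF _ b]])
     (use free_mod_coeff[OF b] free_mod_coeff[where S = S] in \<open>auto simp: tensor_coeff_def free_mod_sel(3,4) l_distr m_assoc fun_eq_iff\<close>)

lemma tensor_coeff_lin_right:
  assumes a: "a \<in> carrier (free_mod R S)"
  shows "lin_map R (free_mod R T) (free_mod R (S \<times> T)) (tensor_coeff a)"
  by (rule lin_mapI[OF tensor_coeff_closed[OF a]])
     (use free_mod_coeff[OF a] free_mod_coeff[where S = T] in \<open>auto simp: tensor_coeff_def free_mod_sel(3,4) r_distr m_lcomm fun_eq_iff\<close>)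

lemma tensor_coeff_delta: "tensor_coeff (delta R s) (delta R t) = delta R (s, t)"
  by (auto simp: tensor_coeff_def delta_def fun_eq_iff)

end

locale three_groups = cring R + K: group K + H: group H + L: group L
  for R :: "('r, 'q) ring_scheme" (structure) and K :: "'k monoid" and H :: "'h monoid" and L :: "'l monoid"

lemma (in cring)
  fixes K :: "'k monoid" and H :: "'h monoid"
  shows burnside_rels_submodule: "submodule (burnside_rels R K H) R (free_mod R (bisets K H))"
    and burnside_rels_iso: "X \<in> bisets K H \<Longrightarrow> Y \<in> bisets K H \<Longrightarrow> biset_iso K H X Y \<Longrightarrow>
       delta R X \<ominus>\<^bsub>free_mod R (bisets K H)\<^esub> delta R Y \<in> burnside_rels R K H"
    and burnside_rels_sum: "X \<in> bisets K H \<Longrightarrow> Y \<in> bisets K H \<Longrightarrow> Z \<in> bisets K H \<Longrightarrow> biset_iso K H Z (biset_sum X Y) \<Longrightarrow>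
       delta R Z \<ominus>\<^bsub>free_mod R (bisets K H)\<^esub> (delta R X \<oplus>\<^bsub>free_mod R (bisets K H)\<^esub> delta R Y) \<in> burnside_rels R K H"
    and burnside_rels_least: "submodule N R (free_mod R (bisets K H)) \<Longrightarrow>
       (\<And>X Y. X \<in> bisets K H \<Longrightarrow> Y \<in> bisets K H \<Longrightarrow> biset_iso K H X Y \<Longrightarrow> delta R X \<ominus>\<^bsub>free_mod R (bisets K H)\<^esub> delta R Y \<in> N) \<Longrightarrow>
       (\<And>X Y Z. X \<in> bisets K H \<Longrightarrow> Y \<in> bisets K H \<Longrightarrow> Z \<in> bisets K H \<Longrightarrow> biset_iso K H Z (biset_sum X Y) \<Longrightarrow>
         delta R Z \<ominus>\<^bsub>free_mod R (bisets K H)\<^esub> (delta R X \<oplus>\<^bsub>free_mod R (bisets K H)\<^esub> delta R Y) \<in> N) \<Longrightarrow>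
       burnside_rels R K H \<subseteq> N"
proof -
  let ?M = "free_mod R (bisets K H)"
  interpret M: Module.module R ?M by (rule free_mod_module)
  show "submodule (burnside_rels R K H) R ?M"
    unfolding burnside_rels_def Let_def
    by (rule gen_submod_submodule[OF free_mod_module]) (auto simp: delta_in_free_mod)
  show "delta R X \<ominus>\<^bsub>?M\<^esub> delta R Y \<in> burnside_rels R K H" if "X \<in> bisets K H" "Y \<in> bisets K H" "biset_iso K H X Y" for X Y
    unfolding burnside_rels_def Let_def by (rule gen_submod_incl) (use that in blast)
  show "delta R Z \<ominus>\<^bsub>?M\<^esub> (delta R X \<oplus>\<^bsub>?M\<^esub> delta R Y) \<in> burnside_rels R K H"
    if "X \<in> bisets K H" "Y \<in> bisets K H" "Z \<in> bisets K H" "biset_iso K H Z (biset_sum X Y)" for X Y Z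
    unfolding burnside_rels_def Let_def by (rule gen_submod_incl) (use that in blast)
  show "burnside_rels R K H \<subseteq> N" if "submodule N R ?M"
    "\<And>X Y. X \<in> bisets K H \<Longrightarrow> Y \<in> bisets K H \<Longrightarrow> biset_iso K H X Y \<Longrightarrow> delta R X \<ominus>\<^bsub>?M\<^esub> delta R Y \<in> N"
    "\<And>X Y Z. X \<in> bisets K H \<Longrightarrow> Y \<in> bisets K H \<Longrightarrow> Z \<in> bisets K H \<Longrightarrow> biset_iso K H Z (biset_sum X Y) \<Longrightarrow>
         delta R Z \<ominus>\<^bsub>?M\<^esub> (delta R X \<oplus>\<^bsub>?M\<^esub> delta R Y) \<in> N"
    unfolding burnside_rels_def Let_def by (rule gen_submod_least[OF that(1)]) (use that(2,3) in blast)
qed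

lemma (in cring) burnside_class_cong:
  assumes X: "is_biset K H X" and Y: "is_biset K H Y" and iso: "biset_iso K H X Y"
  shows "burnside_class R K H X = burnside_class R K H Y"
proof -
  note nX = nat_copy[OF X] and nY = nat_copy[OF Y]
  have "biset_iso K H (nat_copy K H X) (nat_copy K H Y)"
    using biset_iso_trans[OF biset_iso_sym[OF X nX(2)] biset_iso_trans[OF iso nY(2)]] .
  then show ?thesis
    unfolding burnside_class_def
    by (subst coset_eq_iff[OF free_mod_module burnside_rels_submodule]) (use nX nY in \<open>auto intro: delta_in_free_mod burnside_rels_iso\<close>)
qed

lemma (in cring) burnside_class_carrier:
  assumes X: "is_biset K H X"
  shows "burnside_class R K H X \<in> carrier (burnside_mod R K H)"
  unfolding burnside_class_def burnside_mod_def quot_mod_carrier_iff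
  using delta_in_free_mod[OF nat_copy(1)[OF X]] by blast

context three_groups
begin

abbreviation "prod_copy X Y \<equiv> nat_copy K L (biset_prod H X Y)"

abbreviation "comp_rep \<equiv> burnside_comp_rep R K H L"

lemma prod_biset: "X \<in> bisets K H \<Longrightarrow> Y \<in> bisets H L \<Longrightarrow> is_biset K L (biset_prod H X Y)"
  by (rule biset_pair.prod_is_biset, rule biset_pairI) (auto simp: bisets_def K.group_axioms H.group_axioms L.group_axioms)

lemma prod_copy: "X \<in> bisets K H \<Longrightarrow> Y \<in> bisets H L \<Longrightarrow> prod_copy X Y \<in> bisets K L"
  by (rule nat_copy(1)[OF prod_biset])

lemma comp_rep_eq:
  assumes a: "a \<in> carrier (free_mod R (bisets K H))" and b: "b \<in> carrier (free_mod R (bisets H L))"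
  shows "comp_rep a b = lin_ext R (free_mod R (bisets K L)) (\<lambda>p. delta R (prod_copy (fst p) (snd p))) (tensor_coeff a b)"
proof -
  have "lin_ext R (free_mod R (bisets K L)) (\<lambda>p. delta R (prod_copy (fst p) (snd p))) (tensor_coeff a b) =
    (\<Oplus>\<^bsub>free_mod R (bisets K L)\<^esub>p\<in>{X. a X \<noteq> \<zero>} \<times> {Y. b Y \<noteq> \<zero>}. tensor_coeff a b p \<odot>\<^bsub>free_mod R (bisets K L)\<^esub> delta R (prod_copy (fst p) (snd p)))"
    by (rule lin_ext_superset[OF free_mod_module tensor_coeff_closed[OF a b]])
       (use free_mod_supp[OF a] free_mod_supp[OF b] free_mod_coeff[OF a] free_mod_coeff[OF b] in
        \<open>auto simp: prod_copy delta_in_free_mod tensor_coeff_def\<close>)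
  then show ?thesis by (simp add: burnside_comp_rep_def tensor_coeff_def Let_def)
qed

lemma ext_lin: "lin_map R (free_mod R (bisets K H \<times> bisets H L)) (free_mod R (bisets K L))
    (lin_ext R (free_mod R (bisets K L)) (\<lambda>p. delta R (prod_copy (fst p) (snd p))))"
  by (rule lin_ext_lin_map[OF free_mod_module]) (auto simp: prod_copy delta_in_free_mod)

lemma comp_rep_left:
  assumes b: "b \<in> carrier (free_mod R (bisets H L))"
  shows "lin_map R (free_mod R (bisets K H)) (free_mod R (bisets K L)) (\<lambda>a. comp_rep a b)"
  using lin_map_compose[OF tensor_coeff_lin_left[OF b] ext_lin] lin_map_cong[OF free_mod_module] comp_rep_eq[OF _ b]
  by (smt (verit, best))

lemma comp_rep_right:
  assumes a: "a \<in> carrier (free_mod R (bisets K H))"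
  shows "lin_map R (free_mod R (bisets H L)) (free_mod R (bisets K L)) (comp_rep a)"
  using lin_map_compose[OF tensor_coeff_lin_right[OF a] ext_lin] lin_map_cong[OF free_mod_module] comp_rep_eq[OF a]
  by (smt (verit, best))

lemma comp_rep_delta:
  assumes "X \<in> bisets K H" "Y \<in> bisets H L"
  shows "comp_rep (delta R X) (delta R Y) = delta R (prod_copy X Y)"
  unfolding comp_rep_eq[OF delta_in_free_mod[OF assms(1)] delta_in_free_mod[OF assms(2)]] tensor_coeff_delta
  by (subst lin_ext_delta[OF free_mod_module]) (use assms in \<open>auto simp: prod_copy delta_in_free_mod\<close>)

lemma copies_iso:
  assumes "is_biset K L P" "is_biset K L P'" "biset_iso K L P P'"
  shows "biset_iso K L (nat_copy K L P) (nat_copy K L P')"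
  using biset_iso_trans[OF biset_iso_sym[OF assms(1) nat_copy(2)[OF assms(1)]] biset_iso_trans[OF assms(3) nat_copy(2)[OF assms(2)]]] .

lemma copies_sum:
  assumes "is_biset K L P" "is_biset K L P1" "is_biset K L P2" "biset_iso K L P (biset_sum P1 P2)"
  shows "biset_iso K L (nat_copy K L P) (biset_sum (nat_copy K L P1) (nat_copy K L P2))"
  using biset_iso_trans[OF biset_iso_sym[OF assms(1) nat_copy(2)[OF assms(1)]]
    biset_iso_trans[OF assms(4) biset_sum_cong[OF nat_copy(2)[OF assms(2)] nat_copy(2)[OF assms(3)]]]] .

lemma groups: "group K" "group H" "group L"
  by (rule K.group_axioms H.group_axioms L.group_axioms)+

text \<open>For a relation in the first argument it suffices, by linearity, to let the second argument be a biset.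
Then the product preserves isomorphisms and disjoint unions, so it maps relations to relations.\<close>

lemma comp_rep_rels_left:
  assumes a: "a \<in> burnside_rels R K H" and b: "b \<in> carrier (free_mod R (bisets H L))"
  shows "comp_rep a b \<in> burnside_rels R K L"
proof -
  let ?M = "free_mod R (bisets K H)" and ?N = "free_mod R (bisets K L)"
  note rK = burnside_rels_submodule[of K L]
  note d = delta_in_free_mod
  have red: "comp_rep c b \<in> burnside_rels R K L"
    if "c \<in> carrier ?M" "\<And>Y. Y \<in> bisets H L \<Longrightarrow> comp_rep c (delta R Y) \<in> burnside_rels R K L" for c
    by (rule lin_map_free_in_submodule[OF free_mod_module comp_rep_right[OF that(1)] rK that(2) b])
  interpret M: Module.module R ?M by (rule free_mod_module)
  have "burnside_rels R K H \<subseteq> {a \<in> carrier ?M. comp_rep a b \<in> burnside_rels R K L}"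
  proof (rule burnside_rels_least[OF preimage_submodule[OF free_mod_module free_mod_module comp_rep_left[OF b] rK]])
    fix X X' assume X: "X \<in> bisets K H" "X' \<in> bisets K H" "biset_iso K H X X'"
    have "comp_rep (delta R X \<ominus>\<^bsub>?M\<^esub> delta R X') (delta R Y) \<in> burnside_rels R K L" if Y: "Y \<in> bisets H L" for Y
      unfolding lin_map_minus(2)[OF free_mod_module free_mod_module comp_rep_left[OF d[OF Y]] d[OF X(1)] d[OF X(2)]]
        comp_rep_delta[OF X(1) Y] comp_rep_delta[OF X(2) Y]
      by (rule burnside_rels_iso[OF prod_copy prod_copy copies_iso[OF prod_biset prod_biset biset_prod_cong[OF groups]]])
         (use X Y biset_iso_refl in \<open>auto simp: bisets_def\<close>)
    moreover have "delta R X \<ominus>\<^bsub>?M\<^esub> delta R X' \<in> carrier ?M" by (rule M.M.minus_closed[OF d d]) (use X in auto)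
    ultimately show "delta R X \<ominus>\<^bsub>?M\<^esub> delta R X' \<in> {a \<in> carrier ?M. comp_rep a b \<in> burnside_rels R K L}"
      by (simp add: red)
  next
    fix X X' Z assume X: "X \<in> bisets K H" "X' \<in> bisets K H" "Z \<in> bisets K H" and iso: "biset_iso K H Z (biset_sum X X')"
    have "comp_rep (delta R Z \<ominus>\<^bsub>?M\<^esub> (delta R X \<oplus>\<^bsub>?M\<^esub> delta R X')) (delta R Y) \<in> burnside_rels R K L" if Y: "Y \<in> bisets H L" for Y
    proof -
      note l = comp_rep_left[OF d[OF Y]]
      have Bs: "is_biset K H X" "is_biset K H X'" "is_biset K H Z" "is_biset H L Y" using X Y by (auto simp: bisets_def)
      have "biset_iso K L (biset_prod H Z Y) (biset_sum (biset_prod H X Y) (biset_prod H X' Y))"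
        by (rule biset_iso_trans[OF biset_prod_cong[OF groups Bs(3,4) biset_sum_is_biset[OF Bs(1,2)] Bs(4) iso biset_iso_refl]
              biset_prod_sum_left[OF groups Bs(1,2,4)]])
      then have "delta R (prod_copy Z Y) \<ominus>\<^bsub>?N\<^esub> (delta R (prod_copy X Y) \<oplus>\<^bsub>?N\<^esub> delta R (prod_copy X' Y)) \<in> burnside_rels R K L"
        by (intro burnside_rels_sum copies_sum prod_copy prod_biset X Y)
      then show ?thesis
        using lin_map_minus(2)[OF free_mod_module free_mod_module l d[OF X(3)] M.M.a_closed[OF d[OF X(1)] d[OF X(2)]]]
          lin_mapD(2)[OF l d[OF X(1)] d[OF X(2)]] by (simp add: comp_rep_delta X Y)
    qed
    moreover have "delta R Z \<ominus>\<^bsub>?M\<^esub> (delta R X \<oplus>\<^bsub>?M\<^esub> delta R X') \<in> carrier ?M"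
      by (rule M.M.minus_closed[OF d M.M.a_closed[OF d d]]) (use X in auto)
    ultimately show "delta R Z \<ominus>\<^bsub>?M\<^esub> (delta R X \<oplus>\<^bsub>?M\<^esub> delta R X') \<in> {a \<in> carrier ?M. comp_rep a b \<in> burnside_rels R K L}"
      by (simp add: red)
  qed
  then show ?thesis using a by blast
qed

lemma comp_rep_rels_right:
  assumes a: "a \<in> carrier (free_mod R (bisets K H))" and b: "b \<in> burnside_rels R H L"
  shows "comp_rep a b \<in> burnside_rels R K L"
proof -
  let ?M = "free_mod R (bisets H L)" and ?N = "free_mod R (bisets K L)"
  note rK = burnside_rels_submodule[of K L]
  note d = delta_in_free_mod
  have red: "comp_rep a c \<in> burnside_rels R K L"
    if "c \<in> carrier ?M" "\<And>X. X \<in> bisets K H \<Longrightarrow> comp_rep (delta R X) c \<in> burnside_rels R K L" for c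
    by (rule lin_map_free_in_submodule[OF free_mod_module comp_rep_left[OF that(1)] rK that(2) a])
  interpret M: Module.module R ?M by (rule free_mod_module)
  have "burnside_rels R H L \<subseteq> {b \<in> carrier ?M. comp_rep a b \<in> burnside_rels R K L}"
  proof (rule burnside_rels_least[OF preimage_submodule[OF free_mod_module free_mod_module comp_rep_right[OF a] rK]])
    fix Y Y' assume Y: "Y \<in> bisets H L" "Y' \<in> bisets H L" "biset_iso H L Y Y'"
    have "comp_rep (delta R X) (delta R Y \<ominus>\<^bsub>?M\<^esub> delta R Y') \<in> burnside_rels R K L" if X: "X \<in> bisets K H" for X
      unfolding lin_map_minus(2)[OF free_mod_module free_mod_module comp_rep_right[OF d[OF X]] d[OF Y(1)] d[OF Y(2)]]
        comp_rep_delta[OF X Y(1)] comp_rep_delta[OF X Y(2)]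
      by (rule burnside_rels_iso[OF prod_copy prod_copy copies_iso[OF prod_biset prod_biset biset_prod_cong[OF groups]]])
         (use X Y biset_iso_refl in \<open>auto simp: bisets_def\<close>)
    moreover have "delta R Y \<ominus>\<^bsub>?M\<^esub> delta R Y' \<in> carrier ?M" by (rule M.M.minus_closed[OF d d]) (use Y in auto)
    ultimately show "delta R Y \<ominus>\<^bsub>?M\<^esub> delta R Y' \<in> {b \<in> carrier ?M. comp_rep a b \<in> burnside_rels R K L}"
      by (simp add: red)
  next
    fix Y Y' Z assume Y: "Y \<in> bisets H L" "Y' \<in> bisets H L" "Z \<in> bisets H L" and iso: "biset_iso H L Z (biset_sum Y Y')"
    have "comp_rep (delta R X) (delta R Z \<ominus>\<^bsub>?M\<^esub> (delta R Y \<oplus>\<^bsub>?M\<^esub> delta R Y')) \<in> burnside_rels R K L" if X: "X \<in> bisets K H" for X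
    proof -
      note l = comp_rep_right[OF d[OF X]]
      have Bs: "is_biset H L Y" "is_biset H L Y'" "is_biset H L Z" "is_biset K H X" using X Y by (auto simp: bisets_def)
      have "biset_iso K L (biset_prod H X Z) (biset_sum (biset_prod H X Y) (biset_prod H X Y'))"
        by (rule biset_iso_trans[OF biset_prod_cong[OF groups Bs(4,3) Bs(4) biset_sum_is_biset[OF Bs(1,2)] biset_iso_refl iso]
              biset_prod_sum_right[OF groups Bs(4,1,2)]])
      then have "delta R (prod_copy X Z) \<ominus>\<^bsub>?N\<^esub> (delta R (prod_copy X Y) \<oplus>\<^bsub>?N\<^esub> delta R (prod_copy X Y')) \<in> burnside_rels R K L"
        by (intro burnside_rels_sum copies_sum prod_copy prod_biset X Y)
      then show ?thesis
        using lin_map_minus(2)[OF free_mod_module free_mod_module l d[OF Y(3)] M.M.a_closed[OF d[OF Y(1)] d[OF Y(2)]]]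
          lin_mapD(2)[OF l d[OF Y(1)] d[OF Y(2)]] by (simp add: comp_rep_delta X Y)
    qed
    moreover have "delta R Z \<ominus>\<^bsub>?M\<^esub> (delta R Y \<oplus>\<^bsub>?M\<^esub> delta R Y') \<in> carrier ?M"
      by (rule M.M.minus_closed[OF d M.M.a_closed[OF d d]]) (use Y in auto)
    ultimately show "delta R Z \<ominus>\<^bsub>?M\<^esub> (delta R Y \<oplus>\<^bsub>?M\<^esub> delta R Y') \<in> {b \<in> carrier ?M. comp_rep a b \<in> burnside_rels R K L}"
      by (simp add: red)
  qed
  then show ?thesis using b by blast
qed

text \<open>Composition of cosets is defined as a union over all representatives. They all give the same coset because
the composition of representatives preserves relations in either argument.\<close>

theorem burnside_comp_class:
  assumes X: "is_biset K H X" and Y: "is_biset H L Y"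
  shows "burnside_comp R K H L (burnside_class R K H X) (burnside_class R H L Y) = burnside_class R K L (biset_prod H X Y)"
proof -
  let ?M = "free_mod R (bisets K H)" and ?M' = "free_mod R (bisets H L)" and ?N = "free_mod R (bisets K L)"
  let ?x = "nat_copy K H X" and ?y = "nat_copy H L Y"
  note nX = nat_copy[OF X] and nY = nat_copy[OF Y]
  note dx = delta_in_free_mod[OF nX(1)] and dy = delta_in_free_mod[OF nY(1)]
  note rM = burnside_rels_submodule[of K H] and rM' = burnside_rels_submodule[of H L] and rN = burnside_rels_submodule[of K L]
  interpret M: Module.module R ?M by (rule free_mod_module)
  interpret M': Module.module R ?M' by (rule free_mod_module)
  interpret N: Module.module R ?N by (rule free_mod_module)
  have P: "is_biset K L (biset_prod H X Y)" by (rule biset_pair.prod_is_biset[OF biset_pairI[OF groups X Y]])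
  have eq: "burnside_rels R K L +>\<^bsub>?N\<^esub> comp_rep a b = burnside_class R K L (biset_prod H X Y)"
    if a: "a \<in> burnside_class R K H X" and b: "b \<in> burnside_class R H L Y" for a b
  proof -
    have ac: "a \<in> carrier ?M" and bc: "b \<in> carrier ?M'"
      using coset_carrier[OF free_mod_module rM dx] coset_carrier[OF free_mod_module rM' dy] a b by (auto simp: burnside_class_def)
    have ar: "a \<ominus>\<^bsub>?M\<^esub> delta R ?x \<in> burnside_rels R K H"
      using coset_mem_eq[OF free_mod_module rM dx] coset_eq_iff[OF free_mod_module rM ac dx] a by (auto simp: burnside_class_def)
    have br: "b \<ominus>\<^bsub>?M'\<^esub> delta R ?y \<in> burnside_rels R H L"
      using coset_mem_eq[OF free_mod_module rM' dy] coset_eq_iff[OF free_mod_module rM' bc dy] b by (auto simp: burnside_class_def)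
    note cl = lin_mapD(1)[OF comp_rep_left]
    note c1 = cl[OF bc ac] and c2 = cl[OF bc dx] and c3 = cl[OF dy dx]
    have "comp_rep a b \<ominus>\<^bsub>?N\<^esub> comp_rep (delta R ?x) b \<in> burnside_rels R K L"
      using comp_rep_rels_left[OF ar bc] lin_map_minus(2)[OF free_mod_module free_mod_module comp_rep_left[OF bc] ac dx] by simp
    then have e1: "burnside_rels R K L +>\<^bsub>?N\<^esub> comp_rep a b = burnside_rels R K L +>\<^bsub>?N\<^esub> comp_rep (delta R ?x) b"
      using coset_eq_iff[OF free_mod_module rN c1 c2] by simp
    have "comp_rep (delta R ?x) b \<ominus>\<^bsub>?N\<^esub> comp_rep (delta R ?x) (delta R ?y) \<in> burnside_rels R K L"
      using comp_rep_rels_right[OF dx br] lin_map_minus(2)[OF free_mod_module free_mod_module comp_rep_right[OF dx] bc dy] by simp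
    then have e2: "burnside_rels R K L +>\<^bsub>?N\<^esub> comp_rep (delta R ?x) b = burnside_rels R K L +>\<^bsub>?N\<^esub> comp_rep (delta R ?x) (delta R ?y)"
      using coset_eq_iff[OF free_mod_module rN c2 c3] by simp
    have "burnside_class R K L (biset_prod H ?x ?y) = burnside_class R K L (biset_prod H X Y)"
      using nX nY biset_iso_sym[OF X nX(2)] biset_iso_sym[OF Y nY(2)]
      by (intro burnside_class_cong[OF prod_biset P biset_prod_cong[OF groups _ _ X Y]]) (auto simp: bisets_def)
    then show ?thesis unfolding e1 e2 comp_rep_delta[OF nX(1) nY(1)] by (simp add: burnside_class_def)
  qed
  have "delta R ?x \<in> burnside_class R K H X" "delta R ?y \<in> burnside_class R H L Y"
    unfolding burnside_class_def using coset_self[OF free_mod_module rM dx] coset_self[OF free_mod_module rM' dy] by auto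
  then show ?thesis unfolding burnside_comp_def using eq by blast
qed

end

section \<open>Biset functors as modules over the category of sections\<close>

context group
begin

lemma sect_quot_sel:
  "x \<in> carrier (sect_quot G s) \<longleftrightarrow> (\<exists>u\<in>fst s. x = snd s #> u)"
  "x \<otimes>\<^bsub>sect_quot G s\<^esub> y = x <#> y" "\<one>\<^bsub>sect_quot G s\<^esub> = snd s"
  by (auto simp: sect_quot_def FactGroup_def RCOSETS_def r_coset_def set_mult_def)

lemma sect_quot_group: "s \<in> sections G \<Longrightarrow> group (sect_quot G s)"
  unfolding sect_quot_def by (rule normal.factorgroup_is_group[OF sections_normal])

lemma conj_set_coset:
  assumes "g \<in> carrier G" "u \<in> carrier G" "A \<subseteq> carrier G"
  shows "conj_set G g (A #> u) = conj_set G g A #> (g \<otimes> u \<otimes> inv g)"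
proof -
  have "g \<otimes> (a \<otimes> u) \<otimes> inv g = (g \<otimes> a \<otimes> inv g) \<otimes> (g \<otimes> u \<otimes> inv g)" if "a \<in> A" for a
  proof -
    have k: "inv g \<otimes> (g \<otimes> z) = z" if "z \<in> carrier G" for z using that assms(1) by (simp add: m_assoc[symmetric])
    have "a \<in> carrier G" using that assms(3) by blast
    then show ?thesis using assms(1,2) by (simp add: m_assoc k)
  qed
  then show ?thesis unfolding conj_set_def r_coset_def by (auto simp: image_iff)
qed

lemma coset_eqD:
  assumes "subgroup N G" "a \<in> carrier G" "N #> a = N #> b"
  obtains v where "v \<in> N" "a = v \<otimes> b"
proof -
  have "a \<in> N #> a" using subgroup.one_closed[OF assms(1)] assms(2) by (force simp: r_coset_def)
  then show ?thesis using that assms(3) by (auto simp: r_coset_def)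
qed

lemma coset_absorb: "subgroup N G \<Longrightarrow> v \<in> N \<Longrightarrow> a \<in> carrier G \<Longrightarrow> N #> (v \<otimes> a) = N #> a"
  by (metis coset_join2 coset_mult_assoc subgroup.mem_carrier subgroup.subset)

text \<open>For \<open>s = (U,V)\<close> and \<open>t = (M,L)\<close> this is the \<open>(U/V, M/L)\<close>-biset \<open>gVg\<inverse> \ M\<close>, on which \<open>U/V\<close> acts through
conjugation by \<open>g\<close>. Restriction, deflation and conjugation are special cases, and so is their composite
along \<open>Mg\<close>.\<close>

definition morphism_biset :: "'a sect \<Rightarrow> 'a sect \<Rightarrow> 'a \<Rightarrow> ('a set, 'a set, 'a set) biset" where
  "morphism_biset s t g =
     \<lparr>pts = {conj_set G g (snd s) #> m | m. m \<in> fst t}, lact = (\<lambda>k x. conj_set G g k <#> x), ract = (\<lambda>x h. x <#> h)\<rparr>"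

end

locale section_morphism = group G for G :: "('g, 'h) monoid_scheme" (structure) +
  fixes s t :: "'g sect" and g :: 'g
  assumes s: "s \<in> sections G" and t: "t \<in> sections G" and g: "g \<in> carrier G" and le: "sect_le (conj_sect G g s) t"
begin

abbreviation "V' \<equiv> conj_set G g (snd s)"

lemma V'_subgroup: "subgroup V' G"
  by (rule conj_set_subgroup[OF sections_snd_subgroup[OF s] g])

lemma carriers: "u \<in> fst s \<Longrightarrow> u \<in> carrier G" "m \<in> fst t \<Longrightarrow> m \<in> carrier G"
  using sections_fst_carrier[OF s] sections_fst_carrier[OF t] by auto

lemma conj_in: "u \<in> fst s \<Longrightarrow> g \<otimes> u \<otimes> inv g \<in> fst t"
  using le by (auto simp: sect_le_def conj_sect_def conj_set_def)

lemma fst_t: "m \<in> fst t \<Longrightarrow> q \<in> fst t \<Longrightarrow> m \<otimes> q \<in> fst t" "m \<in> fst t \<Longrightarrow> inv m \<in> fst t"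
  by (rule subgroup.m_closed[OF sections_subgroup[OF t]], assumption+) (rule subgroup.m_inv_closed[OF sections_subgroup[OF t]])

lemma V'_fst_t: "v \<in> V' \<Longrightarrow> v \<in> fst t"
  using le by (auto simp: sect_le_def conj_sect_def)

lemma ract_coset: "m \<in> fst t \<Longrightarrow> q \<in> fst t \<Longrightarrow> (V' #> m) <#> (snd t #> q) = V' #> (m \<otimes> q)"
proof (rule coset_mult_morphism[OF V'_subgroup sections_snd_carrier[OF t] sections_one(2)[OF t]])
  assume m: "m \<in> fst t"
  have "conj_set G m (snd t) \<subseteq> snd t" using sections_conj_closed[OF t m] by (auto simp: conj_set_def)
  then show "conj_set G m (snd t) \<subseteq> V'" using le by (auto simp: sect_le_def conj_sect_def)
qed (auto simp: carriers)

lemma lact_coset: "u \<in> fst s \<Longrightarrow> m \<in> fst t \<Longrightarrow> conj_set G g (snd s #> u) <#> (V' #> m) = V' #> (g \<otimes> u \<otimes> inv g \<otimes> m)"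
proof -
  assume u: "u \<in> fst s" and m: "m \<in> fst t"
  have "conj_set G (g \<otimes> u \<otimes> inv g) V' = conj_set G (g \<otimes> u) (snd s)"
    using u g sections_snd_carrier[OF s] by (simp add: conj_set_mult[symmetric] carriers m_assoc)
  also have "\<dots> = conj_set G g (conj_set G u (snd s))"
    using u g sections_snd_carrier[OF s] by (simp add: conj_set_mult carriers)
  also have "\<dots> \<subseteq> V'"
    by (rule conj_set_mono) (use sections_conj_closed[OF s u] in \<open>auto simp: conj_set_def\<close>)
  finally have c: "conj_set G (g \<otimes> u \<otimes> inv g) V' \<subseteq> V'" .
  show ?thesis
    unfolding conj_set_coset[OF g carriers(1)[OF u] sections_snd_carrier[OF s]]
    by (rule coset_mult_morphism[OF V'_subgroup subgroup.subset[OF V'_subgroup] subgroup.one_closed[OF V'_subgroup] _ _ c])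
       (use u m g in \<open>auto simp: carriers\<close>)
qed

abbreviation "B \<equiv> morphism_biset s t g"

lemma pts_B: "x \<in> pts B \<longleftrightarrow> (\<exists>m\<in>fst t. x = V' #> m)"
  by (auto simp: morphism_biset_def)

lemma lact_B: "u \<in> fst s \<Longrightarrow> m \<in> fst t \<Longrightarrow> lact B (snd s #> u) (V' #> m) = V' #> (g \<otimes> u \<otimes> inv g \<otimes> m)"
  by (simp add: morphism_biset_def lact_coset)

lemma ract_B: "m \<in> fst t \<Longrightarrow> q \<in> fst t \<Longrightarrow> ract B (V' #> m) (snd t #> q) = V' #> (m \<otimes> q)"
  by (simp add: morphism_biset_def ract_coset)

lemma coset_prod_s: "u \<in> fst s \<Longrightarrow> u' \<in> fst s \<Longrightarrow> (snd s #> u) <#> (snd s #> u') = snd s #> (u \<otimes> u')"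
  by (rule coset_mult_morphism[OF sections_snd_subgroup[OF s] sections_snd_carrier[OF s] sections_one(2)[OF s]])
     (use sections_conj_closed[OF s] in \<open>auto simp: carriers conj_set_def\<close>)

lemma coset_prod_t: "u \<in> fst t \<Longrightarrow> u' \<in> fst t \<Longrightarrow> (snd t #> u) <#> (snd t #> u') = snd t #> (u \<otimes> u')"
  by (rule coset_mult_morphism[OF sections_snd_subgroup[OF t] sections_snd_carrier[OF t] sections_one(2)[OF t]])
     (use sections_conj_closed[OF t] in \<open>auto simp: carriers conj_set_def\<close>)

lemma conj_mult: "u \<in> fst s \<Longrightarrow> u' \<in> fst s \<Longrightarrow> m \<in> carrier G \<Longrightarrow> g \<otimes> (u \<otimes> u') \<otimes> inv g \<otimes> m = g \<otimes> u \<otimes> inv g \<otimes> (g \<otimes> u' \<otimes> inv g \<otimes> m)"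
proof -
  assume *: "u \<in> fst s" "u' \<in> fst s" "m \<in> carrier G"
  have k: "inv g \<otimes> (g \<otimes> z) = z" if "z \<in> carrier G" for z using that g by (simp add: m_assoc[symmetric])
  show ?thesis using * g by (simp add: m_assoc k carriers)
qed

lemma B_is_biset:
  assumes fin: "finite (carrier G)"
  shows "is_biset (sect_quot G s) (sect_quot G t) B"
  unfolding is_biset_def
proof (intro conjI ballI)
  have "pts B = (\<lambda>m. V' #> m) ` fst t" by (auto simp: morphism_biset_def)
  then show "finite (pts B)" using finite_subset[OF sections_fst_carrier[OF t] fin] by simp
  have us: "snd s #> \<one> = snd s" "snd t #> \<one> = snd t"
    using sections_snd_carrier[OF s] sections_snd_carrier[OF t] by (auto simp: coset_mult_one)
  note sm = subgroup.m_closed[OF sections_subgroup[OF s]]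
  fix x assume "x \<in> pts B"
  then obtain m where m: "m \<in> fst t" "x = V' #> m" unfolding pts_B by blast
  note mc = carriers(2)[OF m(1)]
  show "lact B \<one>\<^bsub>sect_quot G s\<^esub> x = x" using lact_B[OF sections_one(1)[OF s] m(1)] mc g by (simp add: m(2) sect_quot_sel(3) us)
  show "ract B x \<one>\<^bsub>sect_quot G t\<^esub> = x" using ract_B[OF m(1) sections_one(1)[OF t]] mc by (simp add: m(2) sect_quot_sel(3) us)
  {
    fix k assume "k \<in> carrier (sect_quot G s)"
    then obtain u where u: "u \<in> fst s" "k = snd s #> u" unfolding sect_quot_sel by blast
    show "lact B k x \<in> pts B" unfolding u(2) m(2) lact_B[OF u(1) m(1)] pts_B using conj_in[OF u(1)] m(1) fst_t(1) by blast
    {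
      fix l assume "l \<in> carrier (sect_quot G s)"
      then obtain v where v: "v \<in> fst s" "l = snd s #> v" unfolding sect_quot_sel by blast
      show "lact B (k \<otimes>\<^bsub>sect_quot G s\<^esub> l) x = lact B k (lact B l x)"
        unfolding u(2) v(2) m(2) sect_quot_sel(2) coset_prod_s[OF u(1) v(1)] lact_B[OF v(1) m(1)]
          lact_B[OF sm[OF u(1) v(1)] m(1)] lact_B[OF u(1) fst_t(1)[OF conj_in[OF v(1)] m(1)]] conj_mult[OF u(1) v(1) mc] ..
    next
      fix h assume "h \<in> carrier (sect_quot G t)"
      then obtain q where q: "q \<in> fst t" "h = snd t #> q" unfolding sect_quot_sel by blast
      have "g \<otimes> u \<otimes> inv g \<otimes> m \<otimes> q = g \<otimes> u \<otimes> inv g \<otimes> (m \<otimes> q)" using u q g mc by (simp add: m_assoc carriers)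
      then show "ract B (lact B k x) h = lact B k (ract B x h)"
        unfolding u(2) q(2) m(2) lact_B[OF u(1) m(1)] ract_B[OF m(1) q(1)] ract_B[OF fst_t(1)[OF conj_in[OF u(1)] m(1)] q(1)]
          lact_B[OF u(1) fst_t(1)[OF m(1) q(1)]] by simp
    }
  }
  fix h assume "h \<in> carrier (sect_quot G t)"
  then obtain q where q: "q \<in> fst t" "h = snd t #> q" unfolding sect_quot_sel by blast
  show "ract B x h \<in> pts B" unfolding q(2) m(2) ract_B[OF m(1) q(1)] pts_B using fst_t(1)[OF m(1) q(1)] by blast
  fix l assume "l \<in> carrier (sect_quot G t)"
  then obtain r where r: "r \<in> fst t" "l = snd t #> r" unfolding sect_quot_sel by blast
  show "ract B x (h \<otimes>\<^bsub>sect_quot G t\<^esub> l) = ract B (ract B x h) l"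
    unfolding q(2) r(2) m(2) sect_quot_sel(2) coset_prod_t[OF q(1) r(1)] ract_B[OF m(1) q(1)] ract_B[OF m(1) fst_t(1)[OF q(1) r(1)]]
      ract_B[OF fst_t(1)[OF m(1) q(1)] r(1)]
    using q r mc by (simp add: m_assoc carriers)
qed

end

context group
begin

lemma section_morphismI:
  "s \<in> sections G \<Longrightarrow> t \<in> sections G \<Longrightarrow> g \<in> carrier G \<Longrightarrow> sect_le (conj_sect G g s) t \<Longrightarrow> section_morphism G s t g"
  by (intro section_morphism.intro section_morphism_axioms.intro) (rule group_axioms)

text \<open>With \<open>u = (N,K)\<close>, the isomorphism from \<open>gVg\<inverse> \ M \<times>\<^bsub>M/L\<^esub> hLh\<inverse> \ N\<close> to \<open>(hg)V(hg)\<inverse> \ N\<close> sends the pair of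
\<open>m\<close> and \<open>n\<close> to \<open>hmh\<inverse>n\<close>.\<close>

lemma morphism_biset_prod:
  assumes fin: "finite (carrier G)" and st: "section_morphism G s t g" and tu: "section_morphism G t u h"
  shows "biset_iso (sect_quot G s) (sect_quot G u)
     (biset_prod (sect_quot G t) (morphism_biset s t g) (morphism_biset t u h)) (morphism_biset s u (h \<otimes> g))"
proof -
  interpret A: section_morphism G s t g by fact
  interpret C: section_morphism G t u h by fact
  note s = A.s and t = A.t and u = C.t and g = A.g and h = C.g
  have su: "section_morphism G s u (h \<otimes> g)"
    by (rule section_morphismI[OF s u _ sect_le_comp[OF s t g h A.le C.le]]) (use g h in simp)
  interpret E: section_morphism G s u "h \<otimes> g" by fact
  interpret P: biset_pair "sect_quot G s" "sect_quot G t" "sect_quot G u" A.B C.B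
    by (rule biset_pairI[OF sect_quot_group[OF s] sect_quot_group[OF t] sect_quot_group[OF u] A.B_is_biset[OF fin] C.B_is_biset[OF fin]])
  have V'': "E.V' = conj_set G h A.V'" using g h sections_snd_carrier[OF s] by (simp add: conj_set_mult)
  let ?f = "\<lambda>x y. conj_set G h x <#> y"
  have kh: "inv h \<otimes> (h \<otimes> z) = z" "h \<otimes> (inv h \<otimes> z) = z" if "z \<in> carrier G" for z using that h by (simp_all add: m_assoc[symmetric])
  have hm: "h \<otimes> m \<otimes> inv h \<otimes> n \<in> fst u" if "m \<in> fst t" "n \<in> fst u" for m n
    by (rule C.fst_t(1)[OF C.conj_in[OF that(1)] that(2)])
  have f: "?f (A.V' #> m) (C.V' #> n) = E.V' #> (h \<otimes> m \<otimes> inv h \<otimes> n)" if m: "m \<in> fst t" and n: "n \<in> fst u" for m n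
    unfolding conj_set_coset[OF h A.carriers(2)[OF m] subgroup.subset[OF A.V'_subgroup]] V''[symmetric]
  proof (rule coset_mult_morphism[OF E.V'_subgroup subgroup.subset[OF C.V'_subgroup] subgroup.one_closed[OF C.V'_subgroup]])
    have "conj_set G (h \<otimes> m \<otimes> inv h) C.V' = conj_set G (h \<otimes> m) (snd t)"
      using m h sections_snd_carrier[OF t] by (simp add: conj_set_mult[symmetric] A.carriers m_assoc)
    also have "\<dots> = conj_set G h (conj_set G m (snd t))"
      using m h sections_snd_carrier[OF t] by (simp add: conj_set_mult A.carriers)
    also have "\<dots> \<subseteq> conj_set G h (snd t)"
      by (rule conj_set_mono) (use sections_conj_closed[OF t m] in \<open>auto simp: conj_set_def\<close>)
    also have "\<dots> \<subseteq> E.V'" unfolding V'' by (rule conj_set_mono) (use A.le in \<open>auto simp: sect_le_def conj_sect_def\<close>)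
    finally show "conj_set G (h \<otimes> m \<otimes> inv h) C.V' \<subseteq> E.V'" .
  qed (use m n h A.carriers C.carriers in auto)
  show ?thesis
  proof (rule P.prod_isoI[of ?f])
    fix x y assume "x \<in> pts A.B" "y \<in> pts C.B"
    then obtain m n where mn: "m \<in> fst t" "n \<in> fst u" "x = A.V' #> m" "y = C.V' #> n" unfolding A.pts_B C.pts_B by blast
    note mc = A.carriers(2)[OF mn(1)] and nc = C.carriers(2)[OF mn(2)]
    show "?f x y \<in> pts E.B" unfolding mn(3,4) f[OF mn(1,2)] E.pts_B using hm[OF mn(1,2)] by blast
    {
      fix k assume "k \<in> carrier (sect_quot G t)"
      then obtain q where q: "q \<in> fst t" "k = snd t #> q" unfolding sect_quot_sel by blast
      note qc = A.carriers(2)[OF q(1)]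
      show "?f (ract A.B x k) y = ?f x (lact C.B k y)"
        unfolding mn(3,4) q(2) A.ract_B[OF mn(1) q(1)] C.lact_B[OF q(1) mn(2)] f[OF A.fst_t(1)[OF mn(1) q(1)] mn(2)]
          f[OF mn(1) hm[OF q(1) mn(2)]]
        using mc nc qc h by (simp add: m_assoc kh)
    next
      fix k assume "k \<in> carrier (sect_quot G s)"
      then obtain v where v: "v \<in> fst s" "k = snd s #> v" unfolding sect_quot_sel by blast
      note vc = A.carriers(1)[OF v(1)]
      have "h \<otimes> (g \<otimes> v \<otimes> inv g \<otimes> m) \<otimes> inv h \<otimes> n = h \<otimes> g \<otimes> v \<otimes> inv (h \<otimes> g) \<otimes> (h \<otimes> m \<otimes> inv h \<otimes> n)"
        using mc nc vc h g by (simp add: m_assoc kh inv_mult_group)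
      then show "?f (lact A.B k x) y = lact E.B k (?f x y)"
        unfolding mn(3,4) v(2) A.lact_B[OF v(1) mn(1)] f[OF mn(1,2)] f[OF A.fst_t(1)[OF A.conj_in[OF v(1)] mn(1)] mn(2)]
          E.lact_B[OF v(1) hm[OF mn(1,2)]] by simp
    next
      fix l assume "l \<in> carrier (sect_quot G u)"
      then obtain q where q: "q \<in> fst u" "l = snd u #> q" unfolding sect_quot_sel by blast
      note qc = C.carriers(2)[OF q(1)]
      show "?f x (ract C.B y l) = ract E.B (?f x y) l"
        unfolding mn(3,4) q(2) C.ract_B[OF mn(2) q(1)] f[OF mn(1,2)] f[OF mn(1) C.fst_t(1)[OF mn(2) q(1)]] E.ract_B[OF hm[OF mn(1,2)] q(1)]
        using mc nc qc h by (simp add: m_assoc)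
    }
    fix x' y' assume "x' \<in> pts A.B" "y' \<in> pts C.B" and eq: "?f x y = ?f x' y'"
    then obtain m' n' where mn': "m' \<in> fst t" "n' \<in> fst u" "x' = A.V' #> m'" "y' = C.V' #> n'" unfolding A.pts_B C.pts_B by blast
    note mc' = A.carriers(2)[OF mn'(1)] and nc' = C.carriers(2)[OF mn'(2)]
    have "E.V' #> (h \<otimes> m \<otimes> inv h \<otimes> n) = E.V' #> (h \<otimes> m' \<otimes> inv h \<otimes> n')"
      using eq unfolding mn(3,4) mn'(3,4) f[OF mn(1,2)] f[OF mn'(1,2)] .
    then obtain w where w: "w \<in> E.V'" "h \<otimes> m \<otimes> inv h \<otimes> n = w \<otimes> (h \<otimes> m' \<otimes> inv h \<otimes> n')"
      by (rule coset_eqD[OF E.V'_subgroup E.carriers(2)[OF hm[OF mn(1,2)]]])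
    obtain v where v: "v \<in> A.V'" "w = h \<otimes> v \<otimes> inv h" using w(1) unfolding V'' by (auto simp: conj_set_def[of G h])
    have vt: "v \<in> fst t" "v \<in> carrier G" "inv v \<in> A.V'"
      using A.V'_fst_t[OF v(1)] A.carriers(2) subgroup.m_inv_closed[OF A.V'_subgroup v(1)] by auto
    \<comment> \<open>the element of \<open>M\<close> that carries \<open>(m', n')\<close> to \<open>(m, n)\<close>, up to \<open>v \<in> gVg\<inverse>\<close>\<close>
    define q where "q = inv m' \<otimes> inv v \<otimes> m"
    have q: "q \<in> fst t" unfolding q_def using A.fst_t mn(1) mn'(1) vt(1) by auto
    have k': "inv a \<otimes> (a \<otimes> z) = z" "a \<otimes> (inv a \<otimes> z) = z" if "z \<in> carrier G" "a \<in> carrier G" for a z using that by (simp_all add: m_assoc[symmetric])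
    have "x = ract A.B x' (snd t #> q)"
    proof -
      have "m' \<otimes> q = inv v \<otimes> m" using mc mc' vt by (simp add: q_def m_assoc k')
      then show ?thesis unfolding mn(3) mn'(3) A.ract_B[OF mn'(1) q] using coset_absorb[OF A.V'_subgroup vt(3) mc] by simp
    qed
    moreover have "y' = lact C.B (snd t #> q) y"
    proof -
      have "h \<otimes> q \<otimes> inv h \<otimes> n = h \<otimes> inv m' \<otimes> inv v \<otimes> inv h \<otimes> (h \<otimes> m \<otimes> inv h \<otimes> n)"
        using mc mc' nc vt h by (simp add: q_def m_assoc kh)
      also have "\<dots> = n'"
        unfolding w(2) v(2) using mc' nc' vt h by (simp add: m_assoc k')
      finally show ?thesis unfolding mn(4) mn'(4) C.lact_B[OF q mn(2)] by simp
    qed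
    moreover have "snd t #> q \<in> carrier (sect_quot G t)" unfolding sect_quot_sel(1) using q by auto
    ultimately show "\<exists>k\<in>carrier (sect_quot G t). x = ract A.B x' k \<and> y' = lact C.B k y"
      by (intro bexI conjI)
  next
    fix w assume "w \<in> pts E.B"
    then obtain n where n: "n \<in> fst u" "w = E.V' #> n" unfolding E.pts_B by blast
    have "w = ?f (A.V' #> \<one>) (C.V' #> n)"
      unfolding f[OF sections_one(1)[OF t] n(1)] n(2) using h C.carriers(2)[OF n(1)] by simp
    moreover have "A.V' #> \<one> \<in> pts A.B" "C.V' #> n \<in> pts C.B"
      unfolding A.pts_B C.pts_B using n(1) sections_one(1)[OF t] by auto
    ultimately show "\<exists>x\<in>pts A.B. \<exists>y\<in>pts C.B. w = ?f x y" by (intro bexI)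
  qed
qed

text \<open>Left multiplication by \<open>m\<close> maps \<open>gVg\<inverse> \ M\<close> to \<open>(mg)V(mg)\<inverse> \ M\<close>.\<close>

lemma morphism_biset_representative:
  assumes st: "section_morphism G s t g" and m: "m \<in> fst t"
  shows "biset_iso (sect_quot G s) (sect_quot G t) (morphism_biset s t g) (morphism_biset s t (m \<otimes> g))"
proof -
  interpret A: section_morphism G s t g by fact
  note s = A.s and t = A.t and g = A.g and mc = A.carriers(2)[OF m]
  have "conj_sect G m t = t" by (rule conj_sect_self[OF t m])
  then have "sect_le (conj_sect G (m \<otimes> g) s) t"
    using sect_le_conj_iff[OF mc conj_sect_sections[OF s g] t] A.le g mc s by (simp add: conj_sect_mult)
  then have "section_morphism G s t (m \<otimes> g)" by (intro section_morphismI s t) (use mc g in simp)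
  then interpret E: section_morphism G s t "m \<otimes> g" .
  have V'': "E.V' = conj_set G m A.V'" using g mc sections_snd_carrier[OF s] by (simp add: conj_set_mult)
  have k: "inv a \<otimes> (a \<otimes> z) = z" "a \<otimes> (inv a \<otimes> z) = z" if "z \<in> carrier G" "a \<in> carrier G" for a z using that by (simp_all add: m_assoc[symmetric])
  let ?\<phi> = "\<lambda>x. m <# x"
  have \<phi>: "?\<phi> (A.V' #> q) = E.V' #> (m \<otimes> q)" if q: "q \<in> fst t" for q
  proof -
    have "m \<otimes> (v \<otimes> q) = (m \<otimes> v \<otimes> inv m) \<otimes> (m \<otimes> q)" if "v \<in> A.V'" for v
      using subgroup.mem_carrier[OF A.V'_subgroup that] mc A.carriers(2)[OF q] by (simp add: m_assoc k)
    then show ?thesis unfolding V'' by (auto simp: l_coset_def r_coset_def conj_set_def[of G m])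
  qed
  show ?thesis
  proof (rule biset_isoI[of ?\<phi>])
    show "bij_betw ?\<phi> (pts A.B) (pts E.B)"
    proof (rule bij_betw_imageI)
      show "inj_on ?\<phi> (pts A.B)"
      proof (rule inj_onI)
        fix x y assume "x \<in> pts A.B" "y \<in> pts A.B" and eq: "m <# x = m <# y"
        then obtain p q where p: "p \<in> fst t" "x = A.V' #> p" "q \<in> fst t" "y = A.V' #> q" unfolding A.pts_B by blast
        have "E.V' #> (m \<otimes> p) = E.V' #> (m \<otimes> q)" using eq unfolding p(2,4) \<phi>[OF p(1)] \<phi>[OF p(3)] .
        then obtain w where w: "w \<in> E.V'" "m \<otimes> p = w \<otimes> (m \<otimes> q)"
          by (rule coset_eqD[OF E.V'_subgroup m_closed[OF mc A.carriers(2)[OF p(1)]]])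
        obtain v where v: "v \<in> A.V'" "w = m \<otimes> v \<otimes> inv m" using w(1) unfolding V'' by (auto simp: conj_set_def[of G m])
        have vc: "v \<in> carrier G" by (rule subgroup.mem_carrier[OF A.V'_subgroup v(1)])
        have "inv m \<otimes> (m \<otimes> p) = inv m \<otimes> (w \<otimes> (m \<otimes> q))" using w(2) by simp
        then have "p = v \<otimes> q" using mc vc A.carriers(2)[OF p(1)] A.carriers(2)[OF p(3)] by (simp add: v(2) m_assoc k)
        then show "x = y" using coset_absorb[OF A.V'_subgroup v(1) A.carriers(2)[OF p(3)]] by (simp add: p(2,4))
      qed
      show "?\<phi> ` pts A.B = pts E.B"
      proof (intro equalityI subsetI)
        fix w assume "w \<in> ?\<phi> ` pts A.B"
        then obtain x where x: "x \<in> pts A.B" "w = m <# x" by blast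
        then obtain q where "q \<in> fst t" "w = E.V' #> (m \<otimes> q)" unfolding A.pts_B using \<phi> by blast
        then show "w \<in> pts E.B" unfolding E.pts_B using A.fst_t(1)[OF m] by blast
      next
        fix w assume "w \<in> pts E.B"
        then obtain n where n: "n \<in> fst t" "w = E.V' #> n" unfolding E.pts_B by blast
        have q: "inv m \<otimes> n \<in> fst t" using A.fst_t m n(1) by blast
        have "w = ?\<phi> (A.V' #> (inv m \<otimes> n))" unfolding \<phi>[OF q] n(2) using mc A.carriers(2)[OF n(1)] by (simp add: k)
        moreover have "A.V' #> (inv m \<otimes> n) \<in> pts A.B" unfolding A.pts_B using q by auto
        ultimately show "w \<in> ?\<phi> ` pts A.B" by (rule image_eqI)
      qed
    qed
    fix x assume "x \<in> pts A.B"
    then obtain q where q: "q \<in> fst t" "x = A.V' #> q" unfolding A.pts_B by blast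
    note qc = A.carriers(2)[OF q(1)]
    {
      fix l assume "l \<in> carrier (sect_quot G s)"
      then obtain v where v: "v \<in> fst s" "l = snd s #> v" unfolding sect_quot_sel by blast
      have "m \<otimes> (g \<otimes> v \<otimes> inv g \<otimes> q) = m \<otimes> g \<otimes> v \<otimes> inv (m \<otimes> g) \<otimes> (m \<otimes> q)"
        using mc g qc A.carriers(1)[OF v(1)] by (simp add: m_assoc k inv_mult_group)
      then show "?\<phi> (lact A.B l x) = lact E.B l (?\<phi> x)"
        unfolding v(2) q(2) A.lact_B[OF v(1) q(1)] \<phi>[OF q(1)] \<phi>[OF A.fst_t(1)[OF A.conj_in[OF v(1)] q(1)]] E.lact_B[OF v(1) A.fst_t(1)[OF m q(1)]] by simp
    next
      fix l assume "l \<in> carrier (sect_quot G t)"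
      then obtain p where p: "p \<in> fst t" "l = snd t #> p" unfolding sect_quot_sel by blast
      show "?\<phi> (ract A.B x l) = ract E.B (?\<phi> x) l"
        unfolding p(2) q(2) A.ract_B[OF q(1) p(1)] \<phi>[OF q(1)] \<phi>[OF A.fst_t(1)[OF q(1) p(1)]] E.ract_B[OF A.fst_t(1)[OF m q(1)] p(1)]
        using mc qc A.carriers(2)[OF p(1)] by (simp add: m_assoc)
    }
  qed
qed

lemma biset_iso_ident:
  assumes "pts X = pts Y" "\<And>k x. k \<in> carrier K \<Longrightarrow> x \<in> pts X \<Longrightarrow> lact X k x = lact Y k x"
    "\<And>h x. h \<in> carrier H \<Longrightarrow> x \<in> pts X \<Longrightarrow> ract X x h = ract Y x h"
  shows "biset_iso K H X Y"
  by (rule biset_isoI[of "\<lambda>x. x"]) (use assms in \<open>auto simp: bij_betw_def\<close>)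

text \<open>The reason why the sets in the definitions of restriction, deflation and conjugation are closed under
their actions.\<close>

lemma is_biset_transport:
  assumes Y: "is_biset K H Y" and iso: "biset_iso K H Y X" and K: "group K" and H: "group H"
  shows "is_biset K H X"
proof -
  interpret K: group K by fact
  interpret H: group H by fact
  obtain \<phi> where \<phi>: "bij_betw \<phi> (pts Y) (pts X)" "\<And>k x. k \<in> carrier K \<Longrightarrow> x \<in> pts Y \<Longrightarrow> \<phi> (lact Y k x) = lact X k (\<phi> x)"
    "\<And>h x. h \<in> carrier H \<Longrightarrow> x \<in> pts Y \<Longrightarrow> \<phi> (ract Y x h) = ract X (\<phi> x) h"
    by (rule biset_isoE[OF iso]) (rule that)
  have e: "pts X = \<phi> ` pts Y" using \<phi>(1) by (simp add: bij_betw_def)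
  show ?thesis
    unfolding is_biset_def e using is_bisetD[OF Y] by (auto simp: \<phi>(2,3)[symmetric])
qed

lemma carrier_sect_quot_eq: "carrier (sect_quot G s) = {snd s #> u | u. u \<in> fst s}"
  using sect_quot_sel(1)[of _ s] by blast

lemma sect_quot_subset: "s \<in> sections G \<Longrightarrow> x \<in> carrier (sect_quot G s) \<Longrightarrow> x \<subseteq> carrier G"
  unfolding sect_quot_sel(1) using r_coset_subset_G[OF sections_snd_carrier] subsetD[OF sections_fst_carrier] by blast

lemma conj_set_one_quot: "s \<in> sections G \<Longrightarrow> k \<in> carrier (sect_quot G s) \<Longrightarrow> conj_set G \<one> k = k"
  by (rule conj_set_one[OF sect_quot_subset])

lemma regular_is_morphism_biset:
  assumes s: "s \<in> sections G"
  shows "biset_iso (sect_quot G s) (sect_quot G s) (morphism_biset s s \<one>) (regular_biset (sect_quot G s))"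
proof (rule biset_iso_ident)
  show "pts (morphism_biset s s \<one>) = pts (regular_biset (sect_quot G s))"
    using conj_set_one[OF sections_snd_carrier[OF s]] by (simp add: regular_biset_def morphism_biset_def carrier_sect_quot_eq)
qed (simp_all add: regular_biset_def morphism_biset_def sect_quot_sel(2) conj_set_one_quot[OF s])

lemma res_is_morphism_biset:
  assumes r: "r \<in> sections G" and L: "snd r = snd t"
  shows "biset_iso (sect_quot G r) (sect_quot G t) (morphism_biset r t \<one>) (res_biset G t)"
proof (rule biset_iso_ident)
  show "pts (morphism_biset r t \<one>) = pts (res_biset G t)"
    using conj_set_one[OF sections_snd_carrier[OF r]] by (simp add: res_biset_def regular_biset_def morphism_biset_def carrier_sect_quot_eq L)
qed (simp_all add: res_biset_def regular_biset_def morphism_biset_def sect_quot_sel(2) conj_set_one_quot[OF r])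

lemma def_is_morphism_biset:
  assumes s: "s \<in> sections G" and U: "fst s = fst r"
  shows "biset_iso (sect_quot G s) (sect_quot G r) (morphism_biset s r \<one>) (def_biset G s)"
proof (rule biset_iso_ident)
  show "pts (morphism_biset s r \<one>) = pts (def_biset G s)"
    using conj_set_one[OF sections_snd_carrier[OF s]] by (simp add: def_biset_def morphism_biset_def carrier_sect_quot_eq U)
qed (simp_all add: def_biset_def morphism_biset_def sect_quot_sel(2) conj_set_one_quot[OF s])

lemma conj_set_set_mult:
  assumes "g \<in> carrier G" "A \<subseteq> carrier G" "D \<subseteq> carrier G"
  shows "conj_set G g (A <#> D) = conj_set G g A <#> conj_set G g D"
proof -
  have k: "inv g \<otimes> (g \<otimes> z) = z" if "z \<in> carrier G" for z using that assms(1) by (simp add: m_assoc[symmetric])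
  have e: "g \<otimes> (a \<otimes> d) \<otimes> inv g = (g \<otimes> a \<otimes> inv g) \<otimes> (g \<otimes> d \<otimes> inv g)" if "a \<in> A" "d \<in> D" for a d
  proof -
    have "a \<in> carrier G" "d \<in> carrier G" using that assms by auto
    then show ?thesis using assms(1) by (simp add: m_assoc k)
  qed
  show ?thesis unfolding conj_set_def set_mult_def
  proof (intro equalityI subsetI)
    fix z assume "z \<in> (\<lambda>x. g \<otimes> x \<otimes> inv g) ` (\<Union>h\<in>A. \<Union>k\<in>D. {h \<otimes> k})"
    then obtain a d where "a \<in> A" "d \<in> D" "z = g \<otimes> (a \<otimes> d) \<otimes> inv g" by blast
    then show "z \<in> (\<Union>h\<in>(\<lambda>x. g \<otimes> x \<otimes> inv g) ` A. \<Union>k\<in>(\<lambda>x. g \<otimes> x \<otimes> inv g) ` D. {h \<otimes> k})" using e by auto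
  next
    fix z assume "z \<in> (\<Union>h\<in>(\<lambda>x. g \<otimes> x \<otimes> inv g) ` A. \<Union>k\<in>(\<lambda>x. g \<otimes> x \<otimes> inv g) ` D. {h \<otimes> k})"
    then obtain a d where "a \<in> A" "d \<in> D" "z = (g \<otimes> a \<otimes> inv g) \<otimes> (g \<otimes> d \<otimes> inv g)" by blast
    then show "z \<in> (\<lambda>x. g \<otimes> x \<otimes> inv g) ` (\<Union>h\<in>A. \<Union>k\<in>D. {h \<otimes> k})" using e[of a d] by (intro image_eqI[of _ _ "a \<otimes> d"]) auto
  qed
qed

text \<open>Conjugation by \<open>g\<close> identifies \<open>U/V\<close> with the quotient of the conjugate section, which is the underlying
set of the biset of the morphism.\<close>

lemma conj_is_morphism_biset:
  assumes s: "s \<in> sections G" and g: "g \<in> carrier G"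
  shows "biset_iso (sect_quot G s) (sect_quot G (conj_sect G g s)) (morphism_biset s (conj_sect G g s) g) (conj_biset G g s)"
proof (rule biset_isoI[of "conj_set G (inv g)"])
  let ?t = "conj_sect G g s" and ?c = "conj_set G (inv g)"
  note Vc = sections_snd_carrier[OF s] and qs = sect_quot_subset[OF s]
  note ig = inv_closed[OF g]
  have cc: "?c (conj_set G g x) = x" if "x \<subseteq> carrier G" for x
    using g that by (simp add: conj_set_mult[symmetric] conj_set_one)
  have pts: "pts (morphism_biset s ?t g) = conj_set G g ` carrier (sect_quot G s)"
  proof -
    have c: "conj_set G g (snd s #> u) = conj_set G g (snd s) #> (g \<otimes> u \<otimes> inv g)" if "u \<in> fst s" for u
      by (rule conj_set_coset[OF g _ Vc]) (use that sections_fst_carrier[OF s] in auto)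
    have f: "fst ?t = (\<lambda>u. g \<otimes> u \<otimes> inv g) ` fst s" by (simp add: conj_sect_def conj_set_def)
    have "pts (morphism_biset s ?t g) = (\<lambda>u. conj_set G g (snd s) #> (g \<otimes> u \<otimes> inv g)) ` fst s"
      unfolding morphism_biset_def f by auto
    also have "\<dots> = (\<lambda>u. conj_set G g (snd s #> u)) ` fst s" by (rule image_cong) (simp_all add: c)
    finally show ?thesis unfolding carrier_sect_quot_eq by auto
  qed
  show "bij_betw ?c (pts (morphism_biset s ?t g)) (pts (conj_biset G g s))"
    unfolding pts by (rule bij_betw_byWitness[where f' = "conj_set G g"]) (auto simp: conj_biset_def cc qs)
  fix x assume "x \<in> pts (morphism_biset s ?t g)"
  then obtain y where y: "y \<in> carrier (sect_quot G s)" "x = conj_set G g y" unfolding pts by blast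
  have xc: "x \<subseteq> carrier G" unfolding y(2) by (rule conj_set_closed[OF g qs[OF y(1)]])
  show "?c (lact (morphism_biset s ?t g) k x) = lact (conj_biset G g s) k (?c x)" if k: "k \<in> carrier (sect_quot G s)" for k
    using conj_set_set_mult[OF ig conj_set_closed[OF g qs[OF k]] xc] cc[OF qs[OF k]]
    by (simp add: conj_biset_def morphism_biset_def sect_quot_sel(2))
  show "?c (ract (morphism_biset s ?t g) x h) = ract (conj_biset G g s) (?c x) h" if h: "h \<in> carrier (sect_quot G ?t)" for h
    using conj_set_set_mult[OF ig xc sect_quot_subset[OF conj_sect_sections[OF s g] h]]
    by (simp add: conj_biset_def morphism_biset_def sect_quot_sel(2))
qed

end

locale biset_functor_setting = group G + R: cring R for G :: "('g, 'h) monoid_scheme" (structure) and R :: "('r, 'q) ring_scheme" +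
  fixes F :: "('g sect, ('g, 'r) burnside_elt, 'r, 'n) mfunctor"
  assumes fin: "finite (carrier G)" and F: "co_functor R (biset_cat R G) F"
begin

abbreviation "q \<equiv> sect_quot G"

definition morphism_action :: "'g sect \<Rightarrow> 'g sect \<Rightarrow> 'g \<Rightarrow> 'n \<Rightarrow> 'n" where
  "morphism_action s t g = act_biset R G F t s (morphism_biset s t g)"

lemma co_functorD:
  shows "x \<in> sections G \<Longrightarrow> Module.module R (At F x)"
    and "x \<in> sections G \<Longrightarrow> y \<in> sections G \<Longrightarrow> f \<in> carrier (burnside_mod R (q y) (q x)) \<Longrightarrow> lin_map R (At F x) (At F y) (Act F x y f)"
    and "x \<in> sections G \<Longrightarrow> m \<in> carrier (At F x) \<Longrightarrow> Act F x x (burnside_class R (q x) (q x) (regular_biset (q x))) m = m"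
    and "x \<in> sections G \<Longrightarrow> y \<in> sections G \<Longrightarrow> z \<in> sections G \<Longrightarrow> f \<in> carrier (burnside_mod R (q y) (q x)) \<Longrightarrow>
       g \<in> carrier (burnside_mod R (q z) (q y)) \<Longrightarrow> m \<in> carrier (At F x) \<Longrightarrow>
        Act F x z (burnside_comp R (q z) (q y) (q x) g f) m = Act F y z g (Act F x y f m)"
  using F unfolding co_functor_def biset_cat_def cat.simps by blast+

lemma morphism_action_lin:
  assumes "section_morphism G s t g"
  shows "lin_map R (At F t) (At F s) (morphism_action s t g)"
proof -
  interpret A: section_morphism G s t g by fact
  show ?thesis unfolding morphism_action_def act_biset_def
    by (rule co_functorD(2)[OF A.t A.s R.burnside_class_carrier[OF A.B_is_biset[OF fin]]])
qed

lemma morphism_action_comp: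
  assumes st: "section_morphism G s t g" and tu: "section_morphism G t u h" and m: "m \<in> carrier (At F u)"
  shows "morphism_action s t g (morphism_action t u h m) = morphism_action s u (h \<otimes> g) m"
proof -
  interpret A: section_morphism G s t g by fact
  interpret C: section_morphism G t u h by fact
  have su: "section_morphism G s u (h \<otimes> g)"
    by (rule section_morphismI[OF A.s C.t _ sect_le_comp[OF A.s A.t A.g C.g A.le C.le]]) (use A.g C.g in simp)
  interpret E: section_morphism G s u "h \<otimes> g" by fact
  note qg = sect_quot_group[OF A.s] sect_quot_group[OF A.t] sect_quot_group[OF C.t]
  interpret T: three_groups R "q s" "q t" "q u"
    by (intro three_groups.intro R.is_cring qg)
  have "burnside_comp R (q s) (q t) (q u) (burnside_class R (q s) (q t) A.B) (burnside_class R (q t) (q u) C.B) = burnside_class R (q s) (q u) E.B"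
    unfolding T.burnside_comp_class[OF A.B_is_biset[OF fin] C.B_is_biset[OF fin]]
    by (rule R.burnside_class_cong[OF biset_pair.prod_is_biset[OF biset_pairI[OF qg A.B_is_biset[OF fin] C.B_is_biset[OF fin]]] E.B_is_biset[OF fin]
          morphism_biset_prod[OF fin st tu]])
  then show ?thesis
    unfolding morphism_action_def act_biset_def
    using co_functorD(4)[OF C.t A.t A.s R.burnside_class_carrier[OF C.B_is_biset[OF fin]] R.burnside_class_carrier[OF A.B_is_biset[OF fin]] m] by simp
qed

lemma act_biset_cong:
  assumes st: "section_morphism G s t g" and iso: "biset_iso (q s) (q t) (morphism_biset s t g) X"
  shows "act_biset R G F t s X = morphism_action s t g"
proof -
  interpret A: section_morphism G s t g by fact
  have "is_biset (q s) (q t) X"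
    by (rule is_biset_transport[OF A.B_is_biset[OF fin] iso sect_quot_group[OF A.s] sect_quot_group[OF A.t]])
  from R.burnside_class_cong[OF A.B_is_biset[OF fin] this iso] show ?thesis unfolding morphism_action_def act_biset_def by simp
qed

lemma morphism_action_representative:
  assumes st: "section_morphism G s t g" and m: "m \<in> fst t"
  shows "morphism_action s t (m \<otimes> g) = morphism_action s t g"
  unfolding morphism_action_def[of s t "m \<otimes> g"] by (rule act_biset_cong[OF st morphism_biset_representative[OF st m]])

text \<open>The definition of the action factors a morphism as \<open>s \<rightarrow> s' \<rightarrow> r \<rightarrow> t\<close>, where \<open>s'\<close> is the conjugate of \<open>s\<close> by
some \<open>g'\<close> in the coset and \<open>r\<close> is the part of \<open>t\<close> over the upper group of \<open>s'\<close>. Each factor acts by the biset of its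
morphism, so the composite does, and the choice of \<open>g'\<close> does not matter.\<close>

lemma biset_action:
  assumes st: "section_morphism G s t g" and m: "m \<in> carrier (At F t)"
  shows "Act (biset_to_DG R G F) s t (fst t #> g) m = morphism_action s t g m"
proof -
  interpret A: section_morphism G s t g by fact
  have "g \<in> fst t #> g"
    using rcos_self[OF A.g sections_subgroup[OF A.t]] .
  then have "(SOME g'. g' \<in> fst t #> g) \<in> fst t #> g" by (rule someI)
  then obtain u where u: "u \<in> fst t" "(SOME g'. g' \<in> fst t #> g) = u \<otimes> g" by (auto simp: r_coset_def)
  define g' where "g' = u \<otimes> g"
  have uc: "u \<in> carrier G" by (rule A.carriers(2)[OF u(1)])
  have g': "g' \<in> carrier G" unfolding g'_def using A.g uc by simp
  have "conj_sect G u t = t" by (rule conj_sect_self[OF A.t u(1)])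
  then have le: "sect_le (conj_sect G g' s) t"
    unfolding g'_def
    using sect_le_conj_iff[OF uc conj_sect_sections[OF A.s A.g] A.t] A.le A.g uc A.s by (simp add: conj_sect_mult)
  define s' where "s' = conj_sect G g' s"
  define r where "r = (fst s', snd t)"
  have s': "s' \<in> sections G" unfolding s'_def by (rule conj_sect_sections[OF A.s g'])
  have le': "snd t \<subseteq> snd s'" "snd s' \<subseteq> fst s'" "fst s' \<subseteq> fst t"
    using le unfolding s'_def sect_le_def by auto
  have r: "r \<in> sections G"
    unfolding r_def
  proof (rule sectionsI[OF sections_subgroup[OF s'] sections_snd_subgroup[OF A.t]])
    show "\<And>x v. x \<in> fst s' \<Longrightarrow> v \<in> snd t \<Longrightarrow> x \<otimes> v \<otimes> inv x \<in> snd t"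
      by (rule sections_conj_closed[OF A.t]) (use le' in auto)
  qed (use le' in auto)
  have one: "conj_sect G \<one> s' = s'" "conj_sect G \<one> r = r" by (rule conj_sect_one[OF s'], rule conj_sect_one[OF r])
  have m1: "section_morphism G s s' g'" by (rule section_morphismI[OF A.s s' g']) (use le' in \<open>auto simp: s'_def[symmetric] sect_le_def\<close>)
  have m2: "section_morphism G s' r \<one>" by (rule section_morphismI[OF s' r one_closed]) (use le' in \<open>auto simp: one r_def sect_le_def\<close>)
  have m3: "section_morphism G r t \<one>"
    by (rule section_morphismI[OF r A.t one_closed]) (use le' in \<open>auto simp: one[unfolded r_def] one sect_le_def r_def\<close>)
  have m23: "section_morphism G s' t \<one>" by (rule section_morphismI[OF s' A.t one_closed]) (use le' in \<open>auto simp: one sect_le_def\<close>)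
  have "Act (biset_to_DG R G F) s t (fst t #> g) m =
      act_biset R G F s' s (conj_biset G g' s) (act_biset R G F r s' (def_biset G s') (act_biset R G F t r (res_biset G t) m))"
    by (simp add: biset_to_DG_def Let_def u(2) g'_def[symmetric] s'_def[symmetric] r_def[symmetric])
  also have "\<dots> = morphism_action s s' g' (morphism_action s' r \<one> (morphism_action r t \<one> m))"
    using act_biset_cong[OF m1] conj_is_morphism_biset[OF A.s g'] act_biset_cong[OF m2 def_is_morphism_biset[OF s']]
      act_biset_cong[OF m3 res_is_morphism_biset[OF r]] by (simp add: r_def s'_def)
  also have "\<dots> = morphism_action s t g' m"
    using morphism_action_comp[OF m2 m3 m] morphism_action_comp[OF m1 m23 m] g' by simp
  also have "\<dots> = morphism_action s t g m" unfolding g'_def by (rule fun_cong[OF morphism_action_representative[OF st u(1)]])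
  finally show ?thesis .
qed

lemma biset_to_DG_functor: "contra_functor R (sect_cat G (sections G)) (biset_to_DG R G F)"
  unfolding contra_functor_def sect_cat_sel(1)
proof (intro conjI ballI)
  have At: "At (biset_to_DG R G F) = At F" by (simp add: biset_to_DG_def)
  let ?A = "Act (biset_to_DG R G F)"
  {
    fix s assume s: "s \<in> sections G"
    show "Module.module R (At (biset_to_DG R G F) s)" unfolding At by (rule co_functorD(1)[OF s])
    fix m assume m: "m \<in> carrier (At (biset_to_DG R G F) s)"
    have i: "section_morphism G s s \<one>"
      by (rule section_morphismI[OF s s one_closed]) (simp add: conj_sect_one[OF s] sect_le_refl[OF s])
    have "?A s s (fst s #> \<one>) m = act_biset R G F s s (regular_biset (q s)) m"
      unfolding act_biset_cong[OF i regular_is_morphism_biset[OF s]] by (rule biset_action[OF i m[unfolded At]])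
    also have "\<dots> = m" unfolding act_biset_def by (rule co_functorD(3)[OF s m[unfolded At]])
    finally show "?A s s (Idt (sect_cat G (sections G)) s) m = m"
      using sections_fst_carrier[OF s] by (simp add: sect_cat_sel coset_mult_one)
  }
  fix s t c assume s: "s \<in> sections G" and t: "t \<in> sections G" and c: "c \<in> Hom (sect_cat G (sections G)) s t"
  obtain g where g: "g \<in> carrier G" "c = fst t #> g" "sect_le (conj_sect G g s) t"
    using c unfolding sect_cat_sel(4) by blast
  note st = section_morphismI[OF s t g(1,3)]
  have l: "lin_map R (At F t) (At F s) (morphism_action s t g)" by (rule morphism_action_lin[OF st])
  then show "lin_map R (At (biset_to_DG R G F) t) (At (biset_to_DG R G F) s) (?A s t c)"
    unfolding At g(2) using lin_map_cong[OF co_functorD(1)[OF t], of "morphism_action s t g" "?A s t (fst t #> g)"] biset_action[OF st] by simp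
  fix u d m assume u: "u \<in> sections G" and d: "d \<in> Hom (sect_cat G (sections G)) t u"
    and m: "m \<in> carrier (At (biset_to_DG R G F) u)"
  obtain h where h: "h \<in> carrier G" "d = fst u #> h" "sect_le (conj_sect G h t) u"
    using d unfolding sect_cat_sel(4) by blast
  note tu = section_morphismI[OF t u h(1,3)]
  have su: "section_morphism G s u (h \<otimes> g)"
    by (rule section_morphismI[OF s u _ sect_le_comp[OF s t g(1) h(1) g(3) h(3)]]) (use g h in simp)
  note m' = m[unfolded At]
  have "morphism_action t u h m \<in> carrier (At F t)" using morphism_action_lin[OF tu] m' by (simp add: lin_map_def Pi_iff)
  then show "?A s u (Comp (sect_cat G (sections G)) s t u d c) m = ?A s t c (?A t u d m)"
    unfolding sect_cat_sel g(2) h(2) sect_comp[OF s t u g(1) h(1,3)]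
    by (simp add: biset_action[OF su m'] biset_action[OF tu m'] biset_action[OF st] morphism_action_comp[OF st tu m'])
qed

end

section \<open>Invariance of reduced cohomology\<close>

theorem proposition4p7:
  fixes R :: "('r, 'q) ring_scheme"
    and G :: "('g, 'h) monoid_scheme"
    and C C' :: "'g sect set"
    and F :: "('g sect, 'g set, 'r, 'm) mfunctor"
    and B :: "('g sect, ('g, 'r) burnside_elt, 'r, 'n) mfunctor"
  assumes "cring R" and "group G" and "finite (carrier G)"
    and "collection G C" and "collection G C'" and "C' \<subseteq> C"
    and "\<forall>w\<in>C. contractible_realization {w' \<in> C'. sect_le w w'} sect_le"
  shows "(contra_functor R (sect_cat G (sections G)) F \<longrightarrow>
            mod_isomorphic R (red_cohom_neg1 G C F) (red_cohom_neg1 G C' F) \<and>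
            mod_isomorphic R (red_cohom_0 G C F) (red_cohom_0 G C' F) \<and>
            (\<forall>n\<ge>1. mod_isomorphic R (red_cohom_pos R G C n F) (red_cohom_pos R G C' n F))) \<and>
         (biset_functor R G B \<longrightarrow>
            mod_isomorphic R (Obs G C (biset_to_DG R G B)) (Obs G C' (biset_to_DG R G B)))"
proof -
  interpret group G by fact
  interpret R: cring R by fact
  interpret section_resolution G R C C'
    by (intro section_resolution.intro section_resolution_axioms.intro group_axioms R.is_cring) (use assms in auto)
  have degrees: "mod_isomorphic R (red_cohom_neg1 G C F) (red_cohom_neg1 G C' F) \<and>
            mod_isomorphic R (red_cohom_0 G C F) (red_cohom_0 G C' F) \<and>
            (\<forall>n\<ge>1. mod_isomorphic R (red_cohom_pos R G C n F) (red_cohom_pos R G C' n F))"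
    if F: "contra_functor R (sect_cat G (sections G)) F"
  proof (intro conjI allI impI)
    fix n :: nat assume "1 \<le> n"
    then obtain k where "n = Suc k" by (cases n) auto
    then show "mod_isomorphic R (red_cohom_pos R G C n F) (red_cohom_pos R G C' n F)"
      using red_cohom_pos_isomorphic[OF F] by simp
  qed (rule red_cohom_neg1_isomorphic[OF F] Obs_isomorphic[OF F])+
  have "contra_functor R (sect_cat G (sections G)) (biset_to_DG R G B)" if "biset_functor R G B"
  proof (rule biset_functor_setting.biset_to_DG_functor)
    show "biset_functor_setting G R B"
      by (intro biset_functor_setting.intro biset_functor_setting_axioms.intro group_axioms R.is_cring fin)
         (use that in \<open>simp add: biset_functor_def\<close>)
  qed
  then show ?thesis using degrees Obs_isomorphic[of "biset_to_DG R G B"] by blast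
qed

end
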